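(* Let $N\ge 3$ and $p\in[\frac12,2)$. There exists $\epsilon>0$ such that for every sufficiently small $\delta>0$ there exists $V\in H^1_\Gamma$ with $\|V\|_{H^1(\Gamma)}\le\delta$ such that the unique global solution $\Psi\in C(\mathbb{R},H^1_\Gamma)\cap C^1(\mathbb{R},H^{-1}_\Gamma)$ of the NLS equation $$i\partial_t\Psi=-\Delta\Psi-(p+1)|\Psi|^{2p}\Psi$$ with initial datum $\Psi(0)=\Phi+V$ satisfies $$\inf_{\theta\in\mathbb{R}}\|e^{-i\theta}\Psi(t_0)-\Phi\|_{H^1(\Gamma)}>\epsilon\quad\text{for some } t_0>0.$$ Consequently, the orbit $\{e^{i\theta}\Phi\}_{\theta\in\mathbb{R}}$ is unstable in the time evolution of this NLS equation in $H^1_\Gamma$.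
   Context: Let $N\ge 3$ and let $\Gamma$ be the star graph of $N$ half-lines joined at a single vertex; each edge is parametrized by $x\in[0,\infty)$ with the vertex at $x=0$. Functions on $\Gamma$ are vectors $\Psi=(\psi_1,\dots,\psi_N)^T$ of complex-valued functions on $\mathbb{R}^+$; $H^1(\Gamma)=\oplus_{j=1}^N H^1(\mathbb{R}^+)$, $H^1_\Gamma=\{\Psi\in H^1(\Gamma):\psi_1(0)=\dots=\psi_N(0)\}$, and $H^{-1}_\Gamma=H^{-1}(\Gamma)$ is its dual. The Laplacian acts componentwise, $\Delta\Psi=(\psi_1'',\dots,\psi_N'')^T$, with Kirchhoff vertex conditions (continuity at $0$ and $\sum_j\psi_j'(0)=0$), understood weakly in $H^1_\Gamma$; $|\Psi|^{2p}\Psi=(|\psi_1|^{2p}\psi_1,\dots,|\psi_N|^{2p}\psi_N)^T$. For $p\in(0,2)$ this NLS is globally well-posed in $H^1_\Gamma$. The half-soliton state is $\Phi=\phi\,(1,\dots,1)^T$ with $\phi(x)=\operatorname{sech}^{1/p}(px)$. *)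

theory Defs
  imports "HOL-Analysis.Analysis"
begin

text \<open>Functions on the star graph with N half-lines: the j-th component (j < N) is
  the function on the half-line [0,inf). Values for j >= N or x < 0 are irrelevant.\<close>
type_synonym gfun = "nat \<Rightarrow> real \<Rightarrow> complex"

definition L2_hl :: "(real \<Rightarrow> complex) \<Rightarrow> bool" where
  "L2_hl f \<longleftrightarrow> set_borel_measurable lborel {0..} f \<and>
      set_integrable lborel {0..} (\<lambda>x. (cmod (f x))\<^sup>2)"

text \<open>H^1 on the half-line (continuous representative): f is in L^2 and is the
  primitive of an L^2 function g (its weak derivative).\<close>
definition is_hl_deriv :: "(real \<Rightarrow> complex) \<Rightarrow> (real \<Rightarrow> complex) \<Rightarrow> bool" where
  "is_hl_deriv f g \<longleftrightarrow> L2_hl g \<and>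
      (\<forall>x\<ge>0. f x = f 0 + (LINT s:{0..x}|lborel. g s))"

definition H1_hl :: "(real \<Rightarrow> complex) \<Rightarrow> bool" where
  "H1_hl f \<longleftrightarrow> L2_hl f \<and> (\<exists>g. is_hl_deriv f g)"

definition hl_deriv :: "(real \<Rightarrow> complex) \<Rightarrow> real \<Rightarrow> complex" where
  "hl_deriv f = (SOME g. is_hl_deriv f g)"

definition H1G :: "nat \<Rightarrow> gfun \<Rightarrow> bool" where
  "H1G N \<Psi> \<longleftrightarrow> (\<forall>j<N. H1_hl (\<Psi> j)) \<and> (\<forall>j<N. \<Psi> j 0 = \<Psi> 0 0)"

definition H1norm :: "nat \<Rightarrow> gfun \<Rightarrow> real" where
  "H1norm N \<Psi> = sqrt (\<Sum>j<N. (LINT x:{0..}|lborel. (cmod (\<Psi> j x))\<^sup>2)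
                             + (LINT x:{0..}|lborel. (cmod (hl_deriv (\<Psi> j) x))\<^sup>2))"

text \<open>L^2(Gamma) pairing (antilinear in the second argument); it also realises the
  H^{-1}/H^1 duality for L^2 elements.\<close>
definition ipG :: "nat \<Rightarrow> gfun \<Rightarrow> gfun \<Rightarrow> complex" where
  "ipG N u v = (\<Sum>j<N. LINT x:{0..}|lborel. u j x * cnj (v j x))"

text \<open>Weak Kirchhoff Laplacian form: <-Delta u, v> = sum_j int u_j' conj(v_j').\<close>
definition gradG :: "nat \<Rightarrow> gfun \<Rightarrow> gfun \<Rightarrow> complex" where
  "gradG N u v = (\<Sum>j<N. LINT x:{0..}|lborel. hl_deriv (u j) x * cnj (hl_deriv (v j) x))"

definition nonlin :: "real \<Rightarrow> gfun \<Rightarrow> gfun" where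
  "nonlin p u = (\<lambda>j x. complex_of_real (cmod (u j x) powr (2 * p)) * u j x)"

definition dual_le :: "nat \<Rightarrow> (gfun \<Rightarrow> complex) \<Rightarrow> real \<Rightarrow> bool" where
  "dual_le N F e \<longleftrightarrow> (\<forall>\<Theta>. H1G N \<Theta> \<and> H1norm N \<Theta> \<le> 1 \<longrightarrow> cmod (F \<Theta>) \<le> e)"

text \<open>Psi : R -> H^1_Gamma is a global solution of
  i Psi_t = - Delta Psi - (p+1) |Psi|^{2p} Psi in C(R,H^1_Gamma) \<inter> C^1(R,H^{-1}_Gamma):
  Psi(t) in H^1_Gamma for all t, continuous in H^1 norm, and t |-> Psi(t) is
  continuously differentiable as an H^{-1}-valued map with derivative D t,
  where D t is given (as a functional on H^1_Gamma) by the weak form of the equation.\<close>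
definition nls_sol :: "nat \<Rightarrow> real \<Rightarrow> (real \<Rightarrow> gfun) \<Rightarrow> bool" where
  "nls_sol N p \<Psi> \<longleftrightarrow>
     (\<forall>t. H1G N (\<Psi> t)) \<and>
     (\<forall>t. ((\<lambda>s. H1norm N (\<lambda>j x. \<Psi> s j x - \<Psi> t j x)) \<longlongrightarrow> 0) (at t)) \<and>
     (\<exists>D :: real \<Rightarrow> gfun \<Rightarrow> complex.
        (\<forall>t. \<forall>e>0. \<exists>d>0. \<forall>h. h \<noteq> 0 \<and> \<bar>h\<bar> < d \<longrightarrow>
            dual_le N (\<lambda>\<Theta>. ipG N (\<lambda>j x. (\<Psi> (t + h) j x - \<Psi> t j x) / complex_of_real h) \<Theta>
                              - D t \<Theta>) e) \<and>
        (\<forall>t. \<forall>e>0. \<exists>d>0. \<forall>s. \<bar>s - t\<bar> < d \<longrightarrow> dual_le N (\<lambda>\<Theta>. D s \<Theta> - D t \<Theta>) e) \<and>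
        (\<forall>t \<Theta>. H1G N \<Theta> \<longrightarrow>
            \<i> * D t \<Theta> = gradG N (\<Psi> t) \<Theta> - complex_of_real (p + 1) * ipG N (nonlin p (\<Psi> t)) \<Theta>))"

definition phi :: "real \<Rightarrow> real \<Rightarrow> real" where
  "phi p x = (1 / cosh (p * x)) powr (1 / p)"

definition halfsol :: "real \<Rightarrow> gfun" where
  "halfsol p = (\<lambda>j x. complex_of_real (phi p x))"

end

theory Submission
  imports Defs
begin

text \<open>
  Let \<open>U\<^sub>j = c\<^sub>j \<phi>'\<close> with \<open>c\<^sub>0 = - (N - 1)\<close> and \<open>c\<^sub>j = 1\<close> otherwise. It lies in
  the kernel of the second variation of the energy at \<open>\<Phi>\<close>, and on the remaining directions, those of the
  phase and of the mass excepted, the second variation is coercive. For \<open>N \<ge> 3\<close> the cubic term of the energy along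
  \<open>U\<close> does not vanish, since \<open>\<Sum> c\<^sub>j\<^sup>3 \<noteq> 0\<close>; hence arbitrarily close to \<open>\<Phi>\<close> there are data \<open>\<lambda> (\<Phi> + c U)\<close>
  with the mass of \<open>\<Phi>\<close> and with strictly smaller energy, say by \<open>\<eta> > 0\<close>.

  Let \<open>\<Psi>\<close> be the solution and suppose that it stays near the orbit. On the energy and mass level of the data the
  functional \<open>A = Im (\<langle>\<Psi>, U\<rangle> cnj \<langle>\<Psi>, \<Phi>\<rangle>)\<close>, which is invariant under phase rotations, satisfies \<open>A' \<ge> k \<eta>\<close> with a constant
  \<open>k > 0\<close>: the component of \<open>\<Psi>\<close> along \<open>U\<close> is bounded away from \<open>0\<close>, it controls all other components, and \<open>A'\<close>
  is to leading order a positive multiple of its square. But \<open>A\<close> is bounded by conservation of mass, a contradiction.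
\<close>

section \<open>Real functions on the half-line\<close>

text \<open>All fields c_j \<phi>' with c_j summing to zero lie in the kernel, so its dimension is
  at least N - 1. The data are therefore taken equal on all edges but edge 0. The flow preserves
  this, and only two profiles, the second with weight n = N - 1, and one kernel coordinate remain.
  Orthogonality conditions are replaced by point values: the phase is fixed by a real value at the
  vertex, and the kernel coordinate and the component along \<open>chi\<close> are read off at
  \<open>x0\<close>. Coercivity then rests on explicit Riccati functions instead of spectral theory.
  Since \<phi> tends to 0, a perturbation small in H^1 may still dominate \<phi> far out. The Taylor
  remainders stay cubic uniformly in x because \<phi>^(2p) \<le> \<phi>, which uses 1/2 \<le> p; so
  do the Lipschitz bound for |z|^(2p) and the sign of the fourth Taylor coefficient in the choice of
  the data. A solution is differentiable in time only with values in H^{-1}, so mass, energy and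
  symmetry are shown to be conserved from the definition alone.\<close>

abbreviation hl :: "real measure" where "hl \<equiv> restrict_space lborel {0..}"

text \<open>The derivative is carried along as a second argument, so that no weak derivative has to
  be selected; the selected one, \<open>hl_deriv\<close>, is compared with it almost everywhere
  later. Integrability is stated explicitly because the integral of a non-integrable function is 0
  by convention.\<close>

definition prim :: "(real \<Rightarrow> real) \<Rightarrow> (real \<Rightarrow> real) \<Rightarrow> bool" where
  "prim f g \<longleftrightarrow> (\<forall>x\<ge>0. set_integrable lborel {0..x} g \<and> f x = f 0 + (LINT s:{0..x}|lborel. g s))"

definition L2r :: "(real \<Rightarrow> real) \<Rightarrow> bool" where
  "L2r u \<longleftrightarrow> u \<in> borel_measurable hl \<and> integrable hl (\<lambda>x. (u x)\<^sup>2)"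

definition H1r :: "(real \<Rightarrow> real) \<Rightarrow> (real \<Rightarrow> real) \<Rightarrow> bool" where
  "H1r u u' \<longleftrightarrow> L2r u \<and> L2r u' \<and> prim u u'"

lemma space_hl [simp]: "space hl = {0..}"
  by (simp add: space_restrict_space)

lemma hl_integrable_iff: "integrable hl f \<longleftrightarrow> set_integrable lborel {0..} f"
  for f :: "real \<Rightarrow> 'a::{banach, second_countable_topology}"
  unfolding set_integrable_def by (subst integrable_restrict_space) auto

lemma hl_integral_eq: "(LINT x:{0..}|lborel. f x) = integral\<^sup>L hl f"
  for f :: "real \<Rightarrow> 'a::{banach, second_countable_topology}"
  unfolding set_lebesgue_integral_def by (subst integral_restrict_space) auto

lemma borel_measurable_hl_iff: "f \<in> borel_measurable hl \<longleftrightarrow> set_borel_measurable lborel {0..} f"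
  for f :: "real \<Rightarrow> 'a::real_normed_vector"
  unfolding set_borel_measurable_def by (subst borel_measurable_restrict_space_iff) auto

lemma AE_hl_I: "(\<And>x. x \<ge> 0 \<Longrightarrow> P x) \<Longrightarrow> AE x in hl. P x"
  by (rule AE_I2) simp

lemma hl_integral_mono:
  fixes f g :: "real \<Rightarrow> real"
  assumes "integrable hl f" "integrable hl g" "\<And>x. x \<ge> 0 \<Longrightarrow> f x \<le> g x"
  shows "integral\<^sup>L hl f \<le> integral\<^sup>L hl g"
  using assms by (intro integral_mono) auto

lemma hl_continuous_measurable:
  fixes f :: "real \<Rightarrow> 'a::real_normed_vector"
  assumes "continuous_on {0..} f" shows "f \<in> borel_measurable hl"
proof -
  have "f \<in> borel_measurable (restrict_space borel {0..})"
    by (rule borel_measurable_continuous_on_restrict[OF assms])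
  moreover have "sets (restrict_space borel {0..}) = sets (restrict_space lborel {0::real..})"
    by (rule sets_restrict_space_cong) simp
  ultimately show ?thesis by (metis measurable_cong_sets)
qed

lemma integrable_hl_bound:
  fixes f :: "real \<Rightarrow> 'a::{banach, second_countable_topology}"
  assumes "integrable hl g" "f \<in> borel_measurable hl" "\<And>x. x \<ge> 0 \<Longrightarrow> norm (f x) \<le> g x"
  shows "integrable hl f"
proof (rule Bochner_Integration.integrable_bound[OF assms(1,2)])
  have "norm (f x) \<le> norm (g x)" if "x \<ge> 0" for x using assms(3)[OF that] by simp
  then show "AE x in hl. norm (f x) \<le> norm (g x)" by (rule AE_hl_I)
qed

lemma prim_int: "prim f g \<Longrightarrow> x \<ge> 0 \<Longrightarrow> set_integrable lborel {0..x} g"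
  unfolding prim_def by blast

lemma prim_eq:
  assumes "prim f g" "x \<ge> 0" shows "(LINT s:{0..x}|lborel. g s) = f x - f 0"
proof -
  have "f x = f 0 + (LINT s:{0..x}|lborel. g s)" using assms unfolding prim_def by blast
  then show ?thesis by linarith
qed

lemma prim_diff:
  assumes "prim f g" "0 \<le> a" "a \<le> b"
  shows "set_integrable lborel {a..b} g" "f b - f a = (LINT s:{a..b}|lborel. g s)"
proof -
  have i: "set_integrable lborel {0..b} g" using assms by (auto intro: prim_int)
  show ib: "set_integrable lborel {a..b} g"
    by (rule set_integrable_subset[OF i]) (use assms in auto)
  have ia: "set_integrable lborel {0..a} g"
    by (rule set_integrable_subset[OF i]) (use assms in auto)
  have "(LINT s:{0..a} \<union> {a..b}|lborel. g s) = (LINT s:{0..a}|lborel. g s) + (LINT s:{a..b}|lborel. g s)"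
  proof (rule set_integral_Un_AE[OF _ _ _ ia ib])
    have "AE x in lborel. x \<noteq> a" by (rule AE_lborel_singleton)
    then show "AE x in lborel. \<not> (x \<in> {0..a} \<and> x \<in> {a..b})" by eventually_elim auto
  qed auto
  moreover have "{0..a} \<union> {a..b} = {0..b}" using assms by auto
  ultimately show "f b - f a = (LINT s:{a..b}|lborel. g s)"
    using prim_eq[OF assms(1), of a] prim_eq[OF assms(1), of b] assms by simp
qed

lemma prim_continuous:
  assumes "prim f g" shows "continuous_on {0..} f"
proof -
  have "continuous_on {0..b} f" if "b \<ge> 0" for b
  proof -
    have "set_integrable lborel {0..b} g" using assms that by (auto intro: prim_int)
    then have "continuous_on {0..b} (\<lambda>x. integral {0..x} g)"
      by (intro indefinite_integral_continuous_1 set_borel_integral_eq_integral)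
    then have "continuous_on {0..b} (\<lambda>x. f 0 + integral {0..x} g)"
      by (intro continuous_intros)
    then show ?thesis
      by (rule continuous_on_eq)
         (use prim_eq[OF assms] set_borel_integral_eq_integral(2)[OF prim_int[OF assms]] in auto)
  qed
  \<comment> \<open>\<open>{0..<b}\<close> is relatively open in \<open>{0..}\<close>, so continuity
    on it passes to the half-line.\<close>
  then have "continuous_on {0..<b} f" if "b > 0" for b
    using continuous_on_subset[of "{0..b}" f "{0..<b}"] that by force
  then show ?thesis
    unfolding continuous_on_def
  proof (intro ballI)
    fix x :: real assume x: "x \<in> {0..}"
    assume *: "\<And>b. 0 < b \<Longrightarrow> \<forall>x\<in>{0..<b}. (f \<longlongrightarrow> f x) (at x within {0..<b})"
    have "(f \<longlongrightarrow> f x) (at x within {0..<x+1})" using *[of "x+1"] x by auto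
    moreover have "at x within {0..<x+1} = at x within {0..}"
      by (rule at_within_nhd[of x "{x-1<..<x+1}"]) auto
    ultimately show "(f \<longlongrightarrow> f x) (at x within {0..})" by simp
  qed
qed

lemma prim_C1:
  assumes "\<And>x. x \<ge> 0 \<Longrightarrow> (f has_real_derivative g x) (at x)" "continuous_on {0..} g"
  shows "prim f g"
  unfolding prim_def
proof (intro allI impI)
  fix x :: real assume x: "0 \<le> x"
  have c: "continuous_on {0..x} g" by (rule continuous_on_subset[OF assms(2)]) auto
  have "has_bochner_integral lborel (\<lambda>s. indicator {0..x} s *\<^sub>R g s) (f x - f 0)"
    by (rule has_bochner_integral_FTC_Icc[OF x _ c])
       (use assms(1) in \<open>auto simp: has_real_derivative_iff_has_vector_derivative[symmetric] intro: has_field_derivative_at_within\<close>)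
  then show "set_integrable lborel {0..x} g \<and> f x = f 0 + (LINT s:{0..x}|lborel. g s)"
    by (auto simp: set_integrable_def set_lebesgue_integral_def has_bochner_integral_iff)
qed

lemma set_integrable_mult_cont:
  fixes f g :: "real \<Rightarrow> real"
  assumes "set_integrable lborel {a..b} g" "continuous_on {a..b} f"
  shows "set_integrable lborel {a..b} (\<lambda>x. f x * g x)"
proof -
  have "compact (f ` {a..b})" by (rule compact_continuous_image[OF assms(2)]) simp
  then obtain B where B: "\<And>x. x \<in> {a..b} \<Longrightarrow> \<bar>f x\<bar> \<le> B"
    using compact_imp_bounded by (metis bounded_iff image_eqI real_norm_def)
  have m: "(\<lambda>x. indicator {a..b} x *\<^sub>R f x) \<in> borel_measurable lborel"
    using borel_measurable_continuous_on_indicator[OF _ assms(2)] by simp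
  have "integrable lborel (\<lambda>x. (indicator {a..b} x *\<^sub>R f x) * (indicator {a..b} x *\<^sub>R g x))"
  proof (rule Bochner_Integration.integrable_bound)
    show "integrable lborel (\<lambda>x. B * norm (indicator {a..b} x *\<^sub>R g x))"
      using assms(1) unfolding set_integrable_def by (intro integrable_mult_right integrable_norm)
    show "(\<lambda>x. indicat_real {a..b} x *\<^sub>R f x * (indicat_real {a..b} x *\<^sub>R g x)) \<in> borel_measurable lborel"
      using m borel_measurable_integrable[OF assms(1)[unfolded set_integrable_def]] by (rule borel_measurable_times)
    show "AE x in lborel. norm (indicat_real {a..b} x *\<^sub>R f x * (indicat_real {a..b} x *\<^sub>R g x)) \<le> norm (B * norm (indicat_real {a..b} x *\<^sub>R g x))"
      by (rule AE_I2) (auto simp: indicator_def abs_mult intro!: mult_right_mono order_trans[OF B])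
  qed
  then show ?thesis unfolding set_integrable_def
    by (rule Bochner_Integration.integrable_cong[THEN iffD1, rotated -1]) (auto simp: indicator_def)
qed

text \<open>Fubini for F t * G s, cut along the diagonal, which is a null set. This is the
  measure-theoretic content of the product rule for absolutely continuous functions.\<close>

lemma integral_triangle_split:
  fixes F G :: "real \<Rightarrow> real"
  assumes F: "integrable lborel F" and G: "integrable lborel G"
  shows "(LINT t|lborel. F t * (LINT s|lborel. indicator {..t} s * G s))
       + (LINT t|lborel. G t * (LINT s|lborel. indicator {..t} s * F s))
       = integral\<^sup>L lborel F * integral\<^sup>L lborel G"
proof -
  note [measurable] = borel_measurable_integrable[OF F] borel_measurable_integrable[OF G]
  have "integrable (lborel \<Otimes>\<^sub>M lborel) (\<lambda>(t, s). F t * G s)"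
  proof (rule lborel_pair.Fubini_integrable)
    show "integrable lborel (\<lambda>t. LINT s|lborel. norm (case (t, s) of (t, s) \<Rightarrow> F t * G s))"
      using F G by (simp add: abs_mult)
  qed (use G in auto)
  have K: "integrable (lborel \<Otimes>\<^sub>M lborel) (\<lambda>(s, t). G s * (indicator {..s} t * F t))"
  proof -
    have FG': "integrable (lborel \<Otimes>\<^sub>M lborel) (\<lambda>(t, s). G t * F s)"
    proof (rule lborel_pair.Fubini_integrable)
      show "integrable lborel (\<lambda>t. LINT s|lborel. norm (case (t, s) of (t, s) \<Rightarrow> G t * F s))"
        using F G by (simp add: abs_mult)
    qed (use F in auto)
    have [measurable]: "Measurable.pred (lborel \<Otimes>\<^sub>M lborel) (\<lambda>x. snd x \<le> (fst x :: real))"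
      by measurable
    show ?thesis
    proof (rule Bochner_Integration.integrable_bound[OF FG'])
      show "(\<lambda>(s, t). G s * (indicator {..s} t * F t)) \<in> borel_measurable (lborel \<Otimes>\<^sub>M lborel)"
        unfolding indicator_def of_bool_def by (simp add: case_prod_beta) measurable
    qed (auto simp: indicator_def)
  qed
  have "(LINT t|lborel. G t * (LINT s|lborel. indicator {..t} s * F s))
      = (LINT t|lborel. LINT s|lborel. G t * (indicator {..t} s * F s))" by simp
  also have "\<dots> = (LINT s|lborel. LINT t|lborel. G t * (indicator {..t} s * F s))"
    by (rule lborel_pair.Fubini_integral[OF K, symmetric])
  also have "\<dots> = (LINT t|lborel. F t * (LINT s|lborel. indicator {t..} s * G s))"
    by (auto intro!: Bochner_Integration.integral_cong simp flip: integral_mult_right_zero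
             simp: indicator_def)
  finally have 2: "(LINT t|lborel. G t * (LINT s|lborel. indicator {..t} s * F s))
     = (LINT t|lborel. F t * (LINT s|lborel. indicator {t..} s * G s))" .
  have ii: "integrable lborel (\<lambda>s. indicator {..t} s * G s)" "integrable lborel (\<lambda>s. indicator {t..} s * G s)" for t
    using integrable_mult_indicator[OF _ G] by auto
  have inner: "(LINT s|lborel. indicator {..t} s * G s) + (LINT s|lborel. indicator {t..} s * G s) = integral\<^sup>L lborel G" for t
  proof -
    have "(LINT s|lborel. indicator {..t} s * G s) + (LINT s|lborel. indicator {t..} s * G s)
        = (LINT s|lborel. indicator {..t} s * G s + indicator {t..} s * G s)"
      using ii by simp
    also have "\<dots> = integral\<^sup>L lborel G"
    proof (rule integral_cong_AE)
      have "AE x in lborel. x \<noteq> t" by (rule AE_lborel_singleton)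
      then show "AE x in lborel. indicat_real {..t} x * G x + indicat_real {t..} x * G x = G x"
        by eventually_elim (auto simp: indicator_def)
    qed auto
    finally show ?thesis .
  qed
  have J: "integrable lborel (\<lambda>t. F t * (LINT s|lborel. indicator {t..} s * G s))"
  proof -
    have "integrable lborel (\<lambda>s. LINT t|lborel. G t * (indicator {..t} s * F s))"
      using lborel_pair.integrable_snd[OF K] .
    then show ?thesis
      by (rule Bochner_Integration.integrable_cong[THEN iffD1, rotated -1])
         (auto intro!: Bochner_Integration.integral_cong simp flip: integral_mult_right_zero
             simp: indicator_def)
  qed
  have FGi: "integrable lborel (\<lambda>t. F t * integral\<^sup>L lborel G)" using F by simp
  have J': "integrable lborel (\<lambda>t. F t * (LINT s|lborel. indicator {..t} s * G s))"
  proof -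
    have "F t * (LINT s|lborel. indicator {..t} s * G s) = F t * integral\<^sup>L lborel G - F t * (LINT s|lborel. indicator {t..} s * G s)" for t
      unfolding inner[of t, symmetric] by (simp only: distrib_left add_diff_cancel_right')
    then show ?thesis using Bochner_Integration.integrable_diff[OF FGi J] by simp
  qed
  show ?thesis unfolding 2
    by (subst Bochner_Integration.integral_add[OF J' J, symmetric])
       (simp add: inner flip: distrib_left)
qed

text \<open>For F and G the derivatives cut off to \<open>{0..x}\<close>, the inner integrals of the
  triangle identity are the increments f t - f 0 and g t - g 0. Rearranged, it is integration by
  parts with both factors merely absolutely continuous.\<close>

lemma prim_mult:
  assumes f: "prim f f'" and g: "prim g g'"
  shows "prim (\<lambda>x. f x * g x) (\<lambda>x. f' x * g x + f x * g' x)"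
  unfolding prim_def
proof (intro allI impI)
  fix x :: real assume x: "0 \<le> x"
  have if': "set_integrable lborel {0..x} f'" and ig': "set_integrable lborel {0..x} g'"
    using f g x by (auto intro: prim_int)
  have cf: "continuous_on {0..x} f" and cg: "continuous_on {0..x} g"
    using prim_continuous[OF f] prim_continuous[OF g] by (auto intro: continuous_on_subset)
  have i1: "set_integrable lborel {0..x} (\<lambda>x. f' x * g x)"
    using set_integrable_mult_cont[OF if' cg] by (simp add: mult.commute)
  have i2: "set_integrable lborel {0..x} (\<lambda>x. f x * g' x)"
    using set_integrable_mult_cont[OF ig' cf] .
  define F where "F t = indicator {0..x} t * f' t" for t
  define G where "G t = indicator {0..x} t * g' t" for t
  have iF: "integrable lborel F" and iG: "integrable lborel G"
    using if' ig' by (auto simp: F_def[abs_def] G_def[abs_def] set_integrable_def)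
  have Ft: "(LINT s|lborel. indicator {..t} s * F s) = f t - f 0" and
       Gt: "(LINT s|lborel. indicator {..t} s * G s) = g t - g 0" if "0 \<le> t" "t \<le> x" for t
  proof -
    have "(LINT s|lborel. indicator {..t} s * F s) = (LINT s:{0..t}|lborel. f' s)"
         "(LINT s|lborel. indicator {..t} s * G s) = (LINT s:{0..t}|lborel. g' s)"
      unfolding F_def G_def set_lebesgue_integral_def using that
      by (auto intro!: Bochner_Integration.integral_cong simp: indicator_def)
    then show "(LINT s|lborel. indicator {..t} s * F s) = f t - f 0"
       "(LINT s|lborel. indicator {..t} s * G s) = g t - g 0"
      using prim_eq[OF f, of t] prim_eq[OF g, of t] that by simp_all
  qed
  have sF: "integral\<^sup>L lborel F = f x - f 0" and sG: "integral\<^sup>L lborel G = g x - g 0"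
    using prim_eq[OF f x] prim_eq[OF g x] by (simp_all add: F_def[abs_def] G_def[abs_def] set_lebesgue_integral_def)
  have e1: "(LINT t|lborel. F t * (LINT s|lborel. indicator {..t} s * G s))
      = (LINT t:{0..x}|lborel. f' t * g t - f' t * g 0)"
    unfolding set_lebesgue_integral_def
  proof (rule Bochner_Integration.integral_cong)
    fix t show "F t * (LINT s|lborel. indicator {..t} s * G s) = indicat_real {0..x} t *\<^sub>R (f' t * g t - f' t * g 0)"
      by (cases "t \<in> {0..x}") (simp_all add: F_def Gt right_diff_distrib)
  qed simp
  have e2: "(LINT t|lborel. G t * (LINT s|lborel. indicator {..t} s * F s))
      = (LINT t:{0..x}|lborel. f t * g' t - f 0 * g' t)"
    unfolding set_lebesgue_integral_def
  proof (rule Bochner_Integration.integral_cong)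
    fix t show "G t * (LINT s|lborel. indicator {..t} s * F s) = indicat_real {0..x} t *\<^sub>R (f t * g' t - f 0 * g' t)"
    proof (cases "t \<in> {0..x}")
      case True
      then have "(LINT s|lborel. indicator {..t} s * F s) = f t - f 0" by (intro Ft) auto
      with True show ?thesis by (simp only: G_def) (simp add: algebra_simps)
    qed (simp add: G_def)
  qed simp
  have j1: "set_integrable lborel {0..x} (\<lambda>t. f' t * g 0)" and j2: "set_integrable lborel {0..x} (\<lambda>t. f 0 * g' t)"
    by (intro set_integrable_mult_left set_integrable_mult_right if' ig')+
  have h1: "(LINT t:{0..x}|lborel. f' t * g t - f' t * g 0) = (LINT t:{0..x}|lborel. f' t * g t) - (f x - f 0) * g 0"
    using set_integral_diff(2)[OF i1 j1] prim_eq[OF f x] by simp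
  have h2: "(LINT t:{0..x}|lborel. f t * g' t - f 0 * g' t) = (LINT t:{0..x}|lborel. f t * g' t) - f 0 * (g x - g 0)"
    using set_integral_diff(2)[OF i2 j2] prim_eq[OF g x] by simp
  have "(LINT t:{0..x}|lborel. f' t * g t) + (LINT t:{0..x}|lborel. f t * g' t) - (f x - f 0) * g 0 - f 0 * (g x - g 0)
      = (f x - f 0) * (g x - g 0)"
    using integral_triangle_split[OF iF iG] unfolding e1 e2 h1 h2 sF sG by (simp add: algebra_simps)
  moreover have "(LINT t:{0..x}|lborel. f' t * g t + f t * g' t) = (LINT t:{0..x}|lborel. f' t * g t) + (LINT t:{0..x}|lborel. f t * g' t)"
    by (rule set_integral_add(2)[OF i1 i2])
  ultimately show "set_integrable lborel {0..x} (\<lambda>x. f' x * g x + f x * g' x) \<and>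
     f x * g x = f 0 * g 0 + (LINT s:{0..x}|lborel. f' s * g s + f s * g' s)"
    using set_integral_add(1)[OF i1 i2] by (simp add: algebra_simps)
qed

lemma two_abs_mult_le: "2 * \<bar>a * b\<bar> \<le> a\<^sup>2 + b\<^sup>2" for a b :: real
  using sum_squares_bound[of "\<bar>a\<bar>" "\<bar>b\<bar>"] by (simp add: abs_mult)

lemma quadratic_nonneg_discriminant:
  fixes A B C :: real
  assumes "\<And>t. 0 \<le> A + 2 * t * B + t\<^sup>2 * C" and C: "C \<ge> 0"
  shows "B\<^sup>2 \<le> A * C"
proof (cases "C = 0")
  case True
  have "B = 0"
  proof (rule ccontr)
    assume "B \<noteq> 0"
    \<comment> \<open>With C = 0 the expression is affine in t, and this t gives it the value -
      1.\<close>
    then show False using assms(1)[of "- (A + 1) / (2 * B)"] True by (simp add: field_simps)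
  qed
  then show ?thesis using True by simp
next
  case False
  with C have C: "C > 0" by simp
  have "0 \<le> A + 2 * (-B/C) * B + (-B/C)\<^sup>2 * C" by (rule assms)
  also have "\<dots> = A - B\<^sup>2 / C" using C by (simp add: field_simps power2_eq_square)
  finally show ?thesis using C by (simp add: field_simps)
qed

lemma L2r_sq: "L2r u \<Longrightarrow> integrable hl (\<lambda>x. (u x)\<^sup>2)"
  by (auto simp: L2r_def)

lemma L2r_mult_integrable:
  assumes "L2r u" "L2r v" shows "integrable hl (\<lambda>x. u x * v x)"
proof (rule integrable_hl_bound)
  show "integrable hl (\<lambda>x. (u x)\<^sup>2 + (v x)\<^sup>2)" using assms by (auto simp: L2r_def)
  show "(\<lambda>x. u x * v x) \<in> borel_measurable hl" using assms by (auto simp: L2r_def)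
  fix x
  show "norm (u x * v x) \<le> (u x)\<^sup>2 + (v x)\<^sup>2"
    unfolding real_norm_def using two_abs_mult_le[of "u x" "v x"] abs_ge_zero[of "u x * v x"] by linarith
qed

lemma L2r_add: assumes "L2r u" "L2r v" shows "L2r (\<lambda>x. u x + v x)"
proof -
  have "integrable hl (\<lambda>x. (u x)\<^sup>2 + (v x)\<^sup>2 + 2 * (u x * v x))"
    using assms L2r_mult_integrable[OF assms] by (auto simp: L2r_def)
  moreover have "(\<lambda>x. (u x)\<^sup>2 + (v x)\<^sup>2 + 2 * (u x * v x)) = (\<lambda>x. (u x + v x)\<^sup>2)"
    by (auto simp: power2_eq_square algebra_simps)
  ultimately show ?thesis using assms by (auto simp: L2r_def)
qed

lemma L2r_bounded_mult:
  assumes "L2r u" "b \<in> borel_measurable hl" "\<And>x. x \<ge> 0 \<Longrightarrow> \<bar>b x\<bar> \<le> B"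
  shows "L2r (\<lambda>x. b x * u x)"
  unfolding L2r_def
proof
  show "(\<lambda>x. b x * u x) \<in> borel_measurable hl" using assms by (auto simp: L2r_def)
  show "integrable hl (\<lambda>x. (b x * u x)\<^sup>2)"
  proof (rule integrable_hl_bound)
    show "integrable hl (\<lambda>x. B\<^sup>2 * (u x)\<^sup>2)" using assms by (auto simp: L2r_def)
    show "(\<lambda>x. (b x * u x)\<^sup>2) \<in> borel_measurable hl" using assms by (auto simp: L2r_def)
    fix x :: real assume "x \<ge> 0"
    then have "\<bar>b x\<bar>\<^sup>2 \<le> B\<^sup>2" by (intro power_mono assms) auto
    then show "norm ((b x * u x)\<^sup>2) \<le> B\<^sup>2 * (u x)\<^sup>2" by (simp add: power_mult_distrib mult_right_mono)
  qed
qed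

lemma L2r_cmult: "L2r u \<Longrightarrow> L2r (\<lambda>x. c * u x)"
  by (rule L2r_bounded_mult[where B="\<bar>c\<bar>"]) auto

lemma L2r_diff: assumes "L2r u" "L2r v" shows "L2r (\<lambda>x. u x - v x)"
  using L2r_add[OF assms(1) L2r_cmult[OF assms(2), of "-1"]] by simp

lemma L2r_bound:
  assumes "L2r v" "u \<in> borel_measurable hl" "\<And>x. x \<ge> 0 \<Longrightarrow> \<bar>u x\<bar> \<le> \<bar>v x\<bar>"
  shows "L2r u"
  unfolding L2r_def
proof
  show "integrable hl (\<lambda>x. (u x)\<^sup>2)"
  proof (rule integrable_hl_bound[OF L2r_sq[OF assms(1)]])
    fix x :: real assume "x \<ge> 0"
    then show "norm ((u x)\<^sup>2) \<le> (v x)\<^sup>2" using assms(3)[of x] by (simp add: abs_le_square_iff)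
  qed (use assms in auto)
qed fact

lemma L2r_Cauchy_Schwarz:
  assumes "L2r u" "L2r v"
  shows "(\<integral>x. u x * v x \<partial>hl)\<^sup>2 \<le> (\<integral>x. (u x)\<^sup>2 \<partial>hl) * (\<integral>x. (v x)\<^sup>2 \<partial>hl)"
proof (rule quadratic_nonneg_discriminant)
  fix t
  have i: "integrable hl (\<lambda>x. (u x)\<^sup>2)" "integrable hl (\<lambda>x. u x * v x)" "integrable hl (\<lambda>x. (v x)\<^sup>2)"
    using assms L2r_mult_integrable[OF assms] by (auto simp: L2r_def)
  have "0 \<le> (\<integral>x. (u x + t * v x)\<^sup>2 \<partial>hl)" by simp
  also have "\<dots> = (\<integral>x. (u x)\<^sup>2 + 2 * t * (u x * v x) + t\<^sup>2 * (v x)\<^sup>2 \<partial>hl)"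
    by (intro Bochner_Integration.integral_cong) (auto simp: power2_eq_square algebra_simps)
  also have "\<dots> = (\<integral>x. (u x)\<^sup>2 \<partial>hl) + 2 * t * (\<integral>x. u x * v x \<partial>hl) + t\<^sup>2 * (\<integral>x. (v x)\<^sup>2 \<partial>hl)"
    using i by simp
  finally show "0 \<le> (\<integral>x. (u x)\<^sup>2 \<partial>hl) + 2 * t * (\<integral>x. u x * v x \<partial>hl) + t\<^sup>2 * (\<integral>x. (v x)\<^sup>2 \<partial>hl)" .
qed simp

lemma prim_add: assumes "prim f f'" "prim g g'" shows "prim (\<lambda>x. f x + g x) (\<lambda>x. f' x + g' x)"
  unfolding prim_def
proof (intro allI impI conjI)
  fix x :: real assume x: "0 \<le> x"
  note i = prim_int[OF assms(1) x] prim_int[OF assms(2) x]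
  show "set_integrable lborel {0..x} (\<lambda>x. f' x + g' x)" using set_integral_add(1)[OF i] .
  show "f x + g x = f 0 + g 0 + (LINT s:{0..x}|lborel. f' s + g' s)"
    using set_integral_add(2)[OF i] prim_eq[OF assms(1) x] prim_eq[OF assms(2) x] by simp
qed

lemma prim_cmult: assumes "prim f f'" shows "prim (\<lambda>x. c * f x) (\<lambda>x. c * f' x)"
  unfolding prim_def
proof (intro allI impI conjI)
  fix x :: real assume x: "0 \<le> x"
  show "set_integrable lborel {0..x} (\<lambda>x. c * f' x)"
    by (intro set_integrable_mult_right prim_int[OF assms x])
  show "c * f x = c * f 0 + (LINT s:{0..x}|lborel. c * f' s)"
    using arg_cong[OF prim_eq[OF assms x], of "(*) c"] by (simp add: right_diff_distrib)
qed

lemma H1r_add: "H1r f f' \<Longrightarrow> H1r g g' \<Longrightarrow> H1r (\<lambda>x. f x + g x) (\<lambda>x. f' x + g' x)"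
  by (simp add: H1r_def L2r_add prim_add)

lemma H1r_cmult: "H1r f f' \<Longrightarrow> H1r (\<lambda>x. c * f x) (\<lambda>x. c * f' x)"
  by (simp add: H1r_def L2r_cmult prim_cmult)

lemma H1r_diff: "H1r f f' \<Longrightarrow> H1r g g' \<Longrightarrow> H1r (\<lambda>x. f x - g x) (\<lambda>x. f' x - g' x)"
  using H1r_add[of f f' "\<lambda>x. -1 * g x" "\<lambda>x. -1 * g' x"] H1r_cmult[of g g' "-1"] by simp

lemma prim_tendsto:
  assumes "prim F F'" "integrable hl F'"
  shows "(F \<longlongrightarrow> F 0 + integral\<^sup>L hl F') at_top"
proof -
  have "((\<lambda>b. LINT s:{0..b}|lborel. F' s) \<longlongrightarrow> (LINT s:{0..}|lborel. F' s)) at_top"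
    by (rule tendsto_set_lebesgue_integral_at_top) (use assms in \<open>auto simp: hl_integrable_iff\<close>)
  then have "((\<lambda>b. F 0 + (LINT s:{0..b}|lborel. F' s)) \<longlongrightarrow> F 0 + integral\<^sup>L hl F') at_top"
    unfolding hl_integral_eq by (intro tendsto_intros)
  moreover have "eventually (\<lambda>b. F 0 + (LINT s:{0..b}|lborel. F' s) = F b) at_top"
    using eventually_ge_at_top[of 0] by eventually_elim (simp add: prim_eq[OF assms(1)])
  ultimately show ?thesis by (rule Lim_transform_eventually)
qed

text \<open>F has a limit by \<open>prim_tendsto\<close>; a nonzero limit would keep |F| away from 0
  on a half-line of infinite measure, against integrability. Applied to products, this removes the
  boundary term at infinity from integration by parts.\<close>

lemma prim_vanish:
  assumes "prim F F'" "integrable hl F'" "integrable hl F"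
  shows "(F \<longlongrightarrow> 0) at_top" "integral\<^sup>L hl F' = - F 0"
proof -
  define L where "L = F 0 + integral\<^sup>L hl F'"
  have lim: "(F \<longlongrightarrow> L) at_top" using prim_tendsto[OF assms(1,2)] by (simp add: L_def)
  have "L = 0"
  proof (rule ccontr)
    assume L: "L \<noteq> 0"
    have "eventually (\<lambda>x. dist (F x) L < \<bar>L\<bar>/2) at_top"
      using lim L by (intro tendstoD) auto
    then obtain B where B: "\<And>x. x \<ge> B \<Longrightarrow> dist (F x) L < \<bar>L\<bar>/2"
      unfolding eventually_at_top_linorder by blast
    define b where "b = max 0 B"
    have "integrable lborel (\<lambda>x. indicator {0..} x *\<^sub>R F x)"
      using assms(3) by (simp add: hl_integrable_iff set_integrable_def)
    then have "integrable lborel (\<lambda>x. \<bar>indicator {0..} x *\<^sub>R F x\<bar>)" by simp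
    then have "integrable lborel (\<lambda>x. indicator {b..} x * (\<bar>L\<bar>/2))"
    proof (rule Bochner_Integration.integrable_bound)
      show "AE x in lborel. norm (indicat_real {b..} x * (\<bar>L\<bar> / 2)) \<le> norm \<bar>indicat_real {0..} x *\<^sub>R F x\<bar>"
      proof (rule AE_I2)
        fix x show "norm (indicat_real {b..} x * (\<bar>L\<bar> / 2)) \<le> norm \<bar>indicat_real {0..} x *\<^sub>R F x\<bar>"
        proof (cases "x \<ge> b")
          case True
          then have "dist (F x) L < \<bar>L\<bar>/2" by (intro B) (simp add: b_def)
          then have "\<bar>L\<bar>/2 \<le> \<bar>F x\<bar>" 
            using abs_triangle_ineq2[of L "L - F x"] by (simp add: dist_real_def abs_minus_commute)
          then show ?thesis using True by (simp add: b_def)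
        qed simp
      qed
    qed auto
    then have "integrable lborel (\<lambda>x. (2/\<bar>L\<bar>) * (indicator {b..} x * (\<bar>L\<bar>/2)))" by (rule integrable_mult_right)
    moreover have "(\<lambda>x. (2/\<bar>L\<bar>) * (indicator {b..} x * (\<bar>L\<bar>/2))) = indicat_real {b..}" using L by auto
    ultimately have "integrable lborel (indicat_real {b..})" by simp
    then have "emeasure lborel {b..} < \<infinity>" by (subst (asm) integrable_indicator_iff) auto
    then obtain m where m: "m \<ge> 0" "emeasure lborel {b..} = ennreal m"
      by (cases "emeasure lborel {b..}") auto
    have "emeasure lborel {b..b + (m + 1)} \<le> emeasure lborel {b..}" by (rule emeasure_mono) auto
    then show False using m by simp
  qed
  then show "(F \<longlongrightarrow> 0) at_top" "integral\<^sup>L hl F' = - F 0" using lim by (auto simp: L_def)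
qed

lemma H1r_prim_mult:
  assumes "H1r u u'" "H1r v v'"
  shows "prim (\<lambda>x. u x * v x) (\<lambda>x. u' x * v x + u x * v' x)"
    "integrable hl (\<lambda>x. u' x * v x + u x * v' x)" "integrable hl (\<lambda>x. u x * v x)"
  using assms by (auto simp: H1r_def intro!: prim_mult L2r_mult_integrable)

lemma H1r_by_parts:
  assumes "H1r u u'" "H1r v v'"
  shows "(\<integral>x. u' x * v x \<partial>hl) + (\<integral>x. u x * v' x \<partial>hl) = - u 0 * v 0"
  using prim_vanish(2)[OF H1r_prim_mult[OF assms]] assms
  by (subst (asm) Bochner_Integration.integral_add) (auto simp: H1r_def intro!: L2r_mult_integrable)

lemma H1r_tendsto_zero:
  assumes "H1r u u'" shows "(u \<longlongrightarrow> 0) at_top"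
proof -
  have "((\<lambda>x. u x * u x) \<longlongrightarrow> 0) at_top" by (rule prim_vanish(1)[OF H1r_prim_mult[OF assms assms]])
  then have "((\<lambda>x. sqrt (u x * u x)) \<longlongrightarrow> sqrt 0) at_top" by (intro tendsto_intros)
  then show ?thesis by (simp add: tendsto_rabs_zero_iff)
qed

text \<open>Integrate (u^2)' from x to b, use |2 u u'| \<le> u^2 + u'^2, and let b tend to infinity,
  where u vanishes. The embedding constant is 1, so pointwise bounds cost nothing.\<close>

lemma H1r_sup:
  assumes "H1r u u'" "x \<ge> 0"
  shows "(u x)\<^sup>2 \<le> (\<integral>x. (u x)\<^sup>2 \<partial>hl) + (\<integral>x. (u' x)\<^sup>2 \<partial>hl)"
proof -
  let ?I = "\<integral>x. (u x)\<^sup>2 + (u' x)\<^sup>2 \<partial>hl"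
  have iI: "integrable hl (\<lambda>x. (u x)\<^sup>2 + (u' x)\<^sup>2)" using assms by (auto simp: H1r_def L2r_def)
  have p: "prim (\<lambda>x. u x * u x) (\<lambda>x. u' x * u x + u x * u' x)" by (rule H1r_prim_mult[OF assms(1,1)])
  have "(u x)\<^sup>2 \<le> ?I + (u b)\<^sup>2" if "b \<ge> x" for b
  proof -
    have "(u x)\<^sup>2 - (u b)\<^sup>2 = - (LINT s:{x..b}|lborel. u' s * u s + u s * u' s)"
      using prim_diff(2)[OF p assms(2) that] by (simp add: power2_eq_square)
    also have "\<dots> \<le> norm (LINT s:{x..b}|lborel. u' s * u s + u s * u' s)" by simp
    also have "\<dots> \<le> (LINT s:{x..b}|lborel. norm (u' s * u s + u s * u' s))"
      by (rule set_integral_norm_bound[OF prim_diff(1)[OF p assms(2) that]])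
    also have "\<dots> \<le> (LINT s:{x..b}|lborel. (u s)\<^sup>2 + (u' s)\<^sup>2)"
    proof (rule set_integral_mono)
      show "set_integrable lborel {x..b} (\<lambda>s. norm (u' s * u s + u s * u' s))"
        by (rule set_integrable_norm[OF prim_diff(1)[OF p assms(2) that]])
      show "set_integrable lborel {x..b} (\<lambda>s. (u s)\<^sup>2 + (u' s)\<^sup>2)"
        by (rule set_integrable_subset[of _ "{0..}"]) (use iI assms in \<open>auto simp: hl_integrable_iff\<close>)
      fix s
      show "norm (u' s * u s + u s * u' s) \<le> (u s)\<^sup>2 + (u' s)\<^sup>2"
        using two_abs_mult_le[of "u s" "u' s"] by (simp add: mult.commute[of "u' s"])
    qed
    also have "\<dots> \<le> (LINT s:{0..}|lborel. (u s)\<^sup>2 + (u' s)\<^sup>2)"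
      unfolding set_lebesgue_integral_def
    proof (rule integral_mono)
      show "integrable lborel (\<lambda>s. indicat_real {0..} s *\<^sub>R ((u s)\<^sup>2 + (u' s)\<^sup>2))"
        using iI by (simp add: hl_integrable_iff set_integrable_def)
      have "set_integrable lborel {x..b} (\<lambda>s. (u s)\<^sup>2 + (u' s)\<^sup>2)"
        by (rule set_integrable_subset[of _ "{0..}"]) (use iI assms in \<open>auto simp: hl_integrable_iff\<close>)
      then show "integrable lborel (\<lambda>s. indicat_real {x..b} s *\<^sub>R ((u s)\<^sup>2 + (u' s)\<^sup>2))"
        by (simp add: set_integrable_def)
    qed (use assms in \<open>auto simp: indicator_def\<close>)
    also have "\<dots> = ?I" by (rule hl_integral_eq)
    finally show ?thesis by simp
  qed
  then have "eventually (\<lambda>b. (u x)\<^sup>2 \<le> ?I + (u b)\<^sup>2) at_top"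
    unfolding eventually_at_top_linorder by blast
  moreover have "((\<lambda>b. ?I + (u b)\<^sup>2) \<longlongrightarrow> ?I + 0\<^sup>2) at_top"
    by (intro tendsto_intros H1r_tendsto_zero[OF assms(1)])
  ultimately have "(u x)\<^sup>2 \<le> ?I + 0\<^sup>2" by (intro tendsto_lowerbound[where F=at_top]) auto
  then show ?thesis using assms by (simp add: H1r_def L2r_def)
qed

section \<open>Riccati inequalities and uniqueness of weak derivatives\<close>

lemma set_integral_shift:
  fixes g :: "real \<Rightarrow> real"
  shows "(LINT s:{0..b}|lborel. g (s + a)) = (LINT s:{a..a+b}|lborel. g s)"
    "set_integrable lborel {0..b} (\<lambda>s. g (s + a)) \<longleftrightarrow> set_integrable lborel {a..a+b} g"
proof -
  have e: "(\<lambda>s. indicat_real {a..a + b} (a + 1 * s) *\<^sub>R g (a + 1 * s)) = (\<lambda>s. indicat_real {0..b} s *\<^sub>R g (s + a))"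
    by (auto simp: indicator_def add.commute)
  show "(LINT s:{0..b}|lborel. g (s + a)) = (LINT s:{a..a+b}|lborel. g s)"
    using lborel_integral_real_affine[of 1 "\<lambda>s. indicat_real {a..a + b} s *\<^sub>R g s" a]
    unfolding set_lebesgue_integral_def e by simp
  show "set_integrable lborel {0..b} (\<lambda>s. g (s + a)) \<longleftrightarrow> set_integrable lborel {a..a+b} g"
    unfolding set_integrable_def
    using lborel_integrable_real_affine_iff[of 1 "\<lambda>s. indicat_real {a..a + b} s *\<^sub>R g s" a] by (simp only: e)
qed

lemma prim_shift:
  assumes "prim f g" "a \<ge> 0" shows "prim (\<lambda>x. f (x + a)) (\<lambda>x. g (x + a))"
  unfolding prim_def
proof (intro allI impI conjI)
  fix x :: real assume x: "0 \<le> x"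
  show "set_integrable lborel {0..x} (\<lambda>x. g (x + a))"
    unfolding set_integral_shift by (rule prim_diff(1)[OF assms(1)]) (use assms x in auto)
  show "f (x + a) = f (0 + a) + (LINT s:{0..x}|lborel. g (s + a))"
    unfolding set_integral_shift using prim_diff(2)[OF assms, of "a+x"] x by (simp add: add.commute)
qed

text \<open>Completing the square: (\<tau> w^2)' = \<tau>' w^2 + 2 \<tau> w w' is at most w'^2 +
  (\<tau>' + \<tau>^2) w^2, because (w' - \<tau> w)^2 is nonnegative. Integration leaves the two
  boundary terms.\<close>

lemma riccati_interval:
  fixes V :: "real \<Rightarrow> real"
  assumes w: "prim w w'" and b: "0 \<le> b" and w2: "set_integrable lborel {0..b} (\<lambda>x. (w' x)\<^sup>2)"
    and V: "continuous_on {0..} V"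
    and \<tau>: "\<And>x. x \<ge> 0 \<Longrightarrow> (\<tau> has_real_derivative \<tau>' x) (at x)" and \<tau>': "continuous_on {0..} \<tau>'"
    and R: "\<And>x. 0 \<le> x \<Longrightarrow> x \<le> b \<Longrightarrow> \<tau>' x + (\<tau> x)\<^sup>2 \<le> V x"
  shows "(LINT x:{0..b}|lborel. (w' x)\<^sup>2 + V x * (w x)\<^sup>2) \<ge> \<tau> b * (w b)\<^sup>2 - \<tau> 0 * (w 0)\<^sup>2"
proof -
  have cw: "continuous_on {0..} w" by (rule prim_continuous[OF w])
  have p: "prim (\<lambda>x. \<tau> x * (w x * w x)) (\<lambda>x. \<tau>' x * (w x * w x) + \<tau> x * (w' x * w x + w x * w' x))"
    by (intro prim_mult prim_C1 \<tau> \<tau>' w)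
  have "set_integrable lborel {0..b} (\<lambda>x. V x * (w x)\<^sup>2)"
    by (intro borel_integrable_atLeastAtMost' continuous_intros continuous_on_subset[OF V] continuous_on_subset[OF cw]) auto
  then have i: "set_integrable lborel {0..b} (\<lambda>x. (w' x)\<^sup>2 + V x * (w x)\<^sup>2)" using w2 by simp
  have "\<tau> b * (w b)\<^sup>2 - \<tau> 0 * (w 0)\<^sup>2 = (LINT x:{0..b}|lborel. \<tau>' x * (w x * w x) + \<tau> x * (w' x * w x + w x * w' x))"
    using prim_eq[OF p b] by (simp add: power2_eq_square)
  also have "\<dots> \<le> (LINT x:{0..b}|lborel. (w' x)\<^sup>2 + V x * (w x)\<^sup>2)"
  proof (rule set_integral_mono[OF prim_int[OF p b] i])
    fix x assume "x \<in> {0..b}"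
    then have "(\<tau>' x + (\<tau> x)\<^sup>2) * (w x)\<^sup>2 \<le> V x * (w x)\<^sup>2" using R by (intro mult_right_mono) auto
    moreover have "0 \<le> (w' x - \<tau> x * w x)\<^sup>2" by simp
    ultimately show "\<tau>' x * (w x * w x) + \<tau> x * (w' x * w x + w x * w' x) \<le> (w' x)\<^sup>2 + V x * (w x)\<^sup>2"
      by (simp add: power2_eq_square algebra_simps)
  qed
  finally show ?thesis .
qed

text \<open>Induction over the Borel sets generated by intervals; the vanishing total integral
  serves the complement step.\<close>

lemma borel_set_integral_zero:
  fixes w :: "real \<Rightarrow> real"
  assumes w: "integrable lborel w" and z: "\<And>a b. a \<le> b \<Longrightarrow> (LINT x:{a..b}|lborel. w x) = 0" and A: "A \<in> sets borel"
    and t: "integral\<^sup>L lborel w = 0"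
  shows "(LINT x:A|lborel. w x) = 0"
  using A
proof (induction rule: borel_set_induct)
  case empty then show ?case by (simp add: set_lebesgue_integral_def)
next
  case (interval a b) then show ?case using z by simp
next
  case (compl A)
  have s: "set_integrable lborel B w" if "B \<in> sets borel" for B
    using integrable_mult_indicator[OF _ w, of B] that by (simp add: set_integrable_def)
  have "(LINT x:A \<union> -A|lborel. w x) = (LINT x:A|lborel. w x) + (LINT x:-A|lborel. w x)"
    by (rule set_integral_Un) (use compl s in auto)
  then show ?case using compl t by (simp add: set_lebesgue_integral_def)
next
  case (union f)
  have "set_integrable lborel (\<Union>i. f i) w"
    using integrable_mult_indicator[OF _ w, of "\<Union>i. f i"] union by (simp add: set_integrable_def)
  then have "(LINT x:(\<Union>i. f i)|lborel. w x) = (\<Sum>i. (LINT x:(f i)|lborel. w x))"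
    using union by (intro lebesgue_integral_countable_add) (auto simp: disjoint_family_on_def)
  then show ?case using union by simp
qed

text \<open>\<open>hl_deriv\<close> is an arbitrary choice among weak derivatives, and this makes
  integrals of it independent of the choice. On \<open>{0..n}\<close> the difference of two
  derivatives has integral zero over every interval, hence over every Borel set, hence it vanishes
  almost everywhere.\<close>

lemma prim_unique_AE:
  assumes g: "prim f g" and h: "prim f h"
  shows "AE x in hl. g x = h x"
proof -
  have "AE x in lborel. indicator {0..real n} x * (g x - h x) = 0" for n :: nat
  proof -
    let ?w = "\<lambda>x. indicator {0..real n} x * (g x - h x)"
    have "set_integrable lborel {0..real n} (\<lambda>x. g x - h x)"
      using prim_int[OF g, of "real n"] prim_int[OF h, of "real n"] by simp
    then have w: "integrable lborel ?w" by (simp add: set_integrable_def)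
    have z: "(LINT x:{a..b}|lborel. ?w x) = 0" if ab: "a \<le> b" for a b
    proof -
      let ?a = "max 0 a" and ?b = "min b (real n)"
      have e: "(LINT x:{a..b}|lborel. ?w x) = (LINT x:{?a..?b}|lborel. g x - h x)"
        unfolding set_lebesgue_integral_def by (rule Bochner_Integration.integral_cong) (auto simp: indicator_def)
      show ?thesis
      proof (cases "?a \<le> ?b")
        case True
        have "(LINT x:{?a..?b}|lborel. g x - h x) = (LINT x:{?a..?b}|lborel. g x) - (LINT x:{?a..?b}|lborel. h x)"
          by (rule set_integral_diff(2)) (use True in \<open>auto intro!: prim_diff(1)[OF g] prim_diff(1)[OF h]\<close>)
        also have "\<dots> = 0" using prim_diff(2)[OF g _ True] prim_diff(2)[OF h _ True] by simp
        finally show ?thesis using e by simp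
      next
        case False
        then have "{?a..?b} = {}" by simp
        then show ?thesis using e by (simp only: set_lebesgue_integral_def) simp
      qed
    qed
    have t: "integral\<^sup>L lborel ?w = 0"
    proof -
      have "integral\<^sup>L lborel ?w = (LINT x:{0..real n}|lborel. ?w x)"
        unfolding set_lebesgue_integral_def by (rule Bochner_Integration.integral_cong) (auto simp: indicator_def)
      then show ?thesis using z[of 0 "real n"] by simp
    qed
    have "AE x in lborel. ?w x = 0"
      by (rule density_unique_real[OF w, of "\<lambda>x. 0"])
        (use borel_set_integral_zero[OF w z _ t] in \<open>simp_all add: set_lebesgue_integral_def\<close>)
    then show ?thesis .
  qed
  then have "AE x in lborel. \<forall>n. indicator {0..real n} x * (g x - h x) = 0"
    unfolding AE_all_countable by blast
  then have "AE x in lborel. x \<in> {0..} \<longrightarrow> g x = h x"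
  proof eventually_elim
    case (elim x)
    obtain n where n: "x \<le> real n" using real_arch_simple by blast
    have "indicator {0..real n} x * (g x - h x) = 0" using elim by blast
    then show ?case using n by (auto simp: indicator_def)
  qed
  then show ?thesis by (subst AE_restrict_space_iff) auto
qed

section \<open>The half-soliton\<close>

definition h2 :: "(real \<Rightarrow> real) \<Rightarrow> (real \<Rightarrow> real) \<Rightarrow> real" where
  "h2 u u' = (\<integral>x. (u x)\<^sup>2 \<partial>hl) + (\<integral>x. (u' x)\<^sup>2 \<partial>hl)"

lemma integrable_exp_minus_hl: "k > 0 \<Longrightarrow> integrable hl (\<lambda>x. exp (- k * x))"
proof -
  assume k: "k > 0"
  have "(\<integral>\<^sup>+x. ennreal (exp (- k * x)) * indicator {0..} x \<partial>lborel) = 0 - (- exp (- k * 0) / k)"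
  proof (rule nn_integral_FTC_atLeast)
    show "((\<lambda>x. - exp (- k * x) / k) \<longlongrightarrow> 0) at_top"
      using k by real_asymp
    show "((\<lambda>x. - exp (- k * x) / k) has_real_derivative exp (- k * x)) (at x)" for x
      using k by (auto intro!: derivative_eq_intros)
  qed auto
  then have e: "(\<integral>\<^sup>+x. ennreal (exp (- k * x)) * indicator {0..} x \<partial>lborel) = ennreal (1 / k)" by simp
  have "integrable lborel (\<lambda>x. indicator {0..} x *\<^sub>R exp (- k * x))"
  proof (rule integrableI_nn_integral_finite)
    show "(\<integral>\<^sup>+x. ennreal (indicat_real {0..} x *\<^sub>R exp (- k * x)) \<partial>lborel) = ennreal (1/k)"
      unfolding e[symmetric] by (intro nn_integral_cong) (auto simp: indicator_def)
  qed auto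
  then show ?thesis by (simp add: hl_integrable_iff set_integrable_def)
qed

lemma h2_nonneg: "h2 u u' \<ge> 0"
  by (simp add: h2_def)

lemma h2_cmult: "h2 (\<lambda>x. c * u x) (\<lambda>x. c * u' x) = c\<^sup>2 * h2 u u'"
  by (simp add: h2_def power_mult_distrib distrib_left)

lemma L2r_sq_add_le:
  assumes "L2r u" "L2r v"
  shows "(\<integral>x. (u x + v x)\<^sup>2 \<partial>hl) \<le> 2 * (\<integral>x. (u x)\<^sup>2 \<partial>hl) + 2 * (\<integral>x. (v x)\<^sup>2 \<partial>hl)"
proof -
  have "(\<integral>x. (u x + v x)\<^sup>2 \<partial>hl) \<le> (\<integral>x. 2 * (u x)\<^sup>2 + 2 * (v x)\<^sup>2 \<partial>hl)"
  proof (rule hl_integral_mono)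
    show "integrable hl (\<lambda>x. (u x + v x)\<^sup>2)" using L2r_add[OF assms] by (rule L2r_sq)
    fix x have "0 \<le> (u x - v x)\<^sup>2" by simp
    then show "(u x + v x)\<^sup>2 \<le> 2 * (u x)\<^sup>2 + 2 * (v x)\<^sup>2" by (simp add: power2_eq_square algebra_simps)
  qed (use assms in \<open>auto simp: L2r_def\<close>)
  also have "\<dots> = 2 * (\<integral>x. (u x)\<^sup>2 \<partial>hl) + 2 * (\<integral>x. (v x)\<^sup>2 \<partial>hl)"
    using assms by (simp add: L2r_def)
  finally show ?thesis .
qed

lemma h2_add_le:
  assumes "H1r u u'" "H1r v v'"
  shows "h2 (\<lambda>x. u x + v x) (\<lambda>x. u' x + v' x) \<le> 2 * h2 u u' + 2 * h2 v v'"
  using L2r_sq_add_le[of u v] L2r_sq_add_le[of u' v'] assms by (simp add: h2_def H1r_def)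

lemma H1r_sup_h2: "H1r u u' \<Longrightarrow> x \<ge> 0 \<Longrightarrow> (u x)\<^sup>2 \<le> h2 u u'"
  unfolding h2_def by (rule H1r_sup)

text \<open>In the limit b \<rightarrow> \<infinity> the boundary term vanishes with w b, which
  leaves \<kappa> times the L^2 norm. The derivative is then recovered from the crude lower bound V
  \<ge> - 15, a value that fits both potentials below.\<close>

lemma riccati_half_line:
  fixes V :: "real \<Rightarrow> real"
  assumes w: "H1r w w'" and V: "continuous_on {0..} V" and VM: "\<And>x. x \<ge> 0 \<Longrightarrow> \<bar>V x\<bar> \<le> 15"
    and \<kappa>: "0 < \<kappa>" "\<kappa> \<le> 1"
    and R: "\<And>b. b \<ge> b0 \<Longrightarrow> (LINT x:{0..b}|lborel. (w' x)\<^sup>2 + (V x - \<kappa>) * (w x)\<^sup>2) \<ge> \<tau> b * (w b)\<^sup>2"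
    and B: "\<And>b. b \<ge> b0 \<Longrightarrow> \<bar>\<tau> b\<bar> \<le> B"
  shows "(\<integral>x. (w' x)\<^sup>2 + V x * (w x)\<^sup>2 \<partial>hl) \<ge> \<kappa> / 32 * h2 w w'"
proof -
  have mV: "V \<in> borel_measurable hl" by (rule hl_continuous_measurable[OF V])
  have L: "L2r w" "L2r w'" using w by (auto simp: H1r_def)
  have iw: "integrable hl (\<lambda>x. (w x)\<^sup>2)" "integrable hl (\<lambda>x. (w' x)\<^sup>2)" using L by (auto simp: L2r_def)
  have "integrable hl (\<lambda>x. (V x * w x) * w x)"
    by (intro L2r_mult_integrable L2r_bounded_mult[OF _ mV VM] L)
  then have iV: "integrable hl (\<lambda>x. V x * (w x)\<^sup>2)" by (simp add: power2_eq_square mult.assoc)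
  let ?q = "\<lambda>x. (w' x)\<^sup>2 + (V x - \<kappa>) * (w x)\<^sup>2"
  have eq: "?q = (\<lambda>x. ((w' x)\<^sup>2 + V x * (w x)\<^sup>2) - \<kappa> * (w x)\<^sup>2)" by (auto simp: algebra_simps)
  have iq: "integrable hl ?q" unfolding eq using iw iV by simp
  have "((\<lambda>b. LINT x:{0..b}|lborel. ?q x) \<longlongrightarrow> (LINT x:{0..}|lborel. ?q x)) at_top"
    by (rule tendsto_set_lebesgue_integral_at_top) (use iq in \<open>auto simp: hl_integrable_iff\<close>)
  then have l1: "((\<lambda>b. LINT x:{0..b}|lborel. ?q x) \<longlongrightarrow> integral\<^sup>L hl ?q) at_top"
    unfolding hl_integral_eq .
  have l2: "((\<lambda>b. - B * (w b)\<^sup>2) \<longlongrightarrow> - B * 0\<^sup>2) at_top"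
    by (intro tendsto_intros H1r_tendsto_zero[OF w])
  have "eventually (\<lambda>b. (LINT x:{0..b}|lborel. ?q x) \<ge> - B * (w b)\<^sup>2) at_top"
    using eventually_ge_at_top[of b0]
  proof eventually_elim
    case (elim b)
    have "- B * (w b)\<^sup>2 \<le> \<tau> b * (w b)\<^sup>2" using B[OF elim] by (intro mult_right_mono) auto
    then show ?case using R[OF elim] by linarith
  qed
  then have "- B * 0\<^sup>2 \<le> integral\<^sup>L hl ?q" by (intro tendsto_le[OF _ l1 l2]) auto
  then have 1: "(\<integral>x. (w' x)\<^sup>2 + V x * (w x)\<^sup>2 \<partial>hl) \<ge> \<kappa> * (\<integral>x. (w x)\<^sup>2 \<partial>hl)"
    unfolding eq using iw iV by simp
  have "(\<integral>x. V x * (w x)\<^sup>2 \<partial>hl) \<ge> (\<integral>x. - 15 * (w x)\<^sup>2 \<partial>hl)"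
  proof (rule hl_integral_mono)
    fix x :: real assume "x \<ge> 0"
    then have "- 15 \<le> V x" using VM[of x] by auto
    then show "- 15 * (w x)\<^sup>2 \<le> V x * (w x)\<^sup>2" by (rule mult_right_mono) simp
  qed (use iw iV in auto)
  then have 2: "(\<integral>x. (w' x)\<^sup>2 + V x * (w x)\<^sup>2 \<partial>hl) \<ge> (\<integral>x. (w' x)\<^sup>2 \<partial>hl) - 15 * (\<integral>x. (w x)\<^sup>2 \<partial>hl)"
    using iw iV by simp
  define Q where "Q = (\<integral>x. (w' x)\<^sup>2 + V x * (w x)\<^sup>2 \<partial>hl)"
  define a where "a = (\<integral>x. (w x)\<^sup>2 \<partial>hl)"
  define b where "b = (\<integral>x. (w' x)\<^sup>2 \<partial>hl)"
  have a: "a \<ge> 0" by (simp add: a_def)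
  \<comment> \<open>The weight \<kappa>/32 on the crude bound costs 15 \<kappa>/32 of the L^2 norm,
    while the other part supplies at least 16 \<kappa>/32; the difference \<kappa>/32 is the final
    constant.\<close>
  have "Q = (1 - \<kappa>/32) * Q + \<kappa>/32 * Q" by (simp add: algebra_simps)
  moreover have "(1 - \<kappa>/32) * Q \<ge> (1 - \<kappa>/32) * (\<kappa> * a)" using 1 \<kappa> by (intro mult_left_mono) (auto simp: Q_def a_def)
  moreover have "\<kappa>/32 * Q \<ge> \<kappa>/32 * (b - 15 * a)" using 2 \<kappa> by (intro mult_left_mono) (auto simp: Q_def a_def b_def)
  moreover have "(1 - \<kappa>/32) * (\<kappa> * a) \<ge> (1/2) * (\<kappa> * a)" using \<kappa> a by (intro mult_right_mono) auto
  ultimately have "Q \<ge> (1/2) * (\<kappa> * a) + \<kappa>/32 * (b - 15 * a)" by linarith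
  also have "(1/2) * (\<kappa> * a) + \<kappa>/32 * (b - 15 * a) = \<kappa>/32 * (b + a)" by (simp add: field_simps)
  finally show ?thesis by (simp add: Q_def a_def b_def h2_def algebra_simps)
qed

section \<open>The profile, the linearised potentials and their decay\<close>

locale half_soliton =
  fixes p :: real
  assumes p_ge: "1/2 \<le> p" and p_lt: "p < 2"
begin

definition T :: "real \<Rightarrow> real" where "T x = tanh (p * x)"
text \<open>This is sech^2(p x), which equals \<phi>^(2p); see \<open>S_cosh\<close> and
  \<open>phi_powr\<close>. In terms of tanh, the derivatives of \<phi> are polynomials in T times
  \<phi>.\<close>

definition S :: "real \<Rightarrow> real" where "S x = 1 - (T x)\<^sup>2"
definition ph1 :: "real \<Rightarrow> real" where "ph1 x = - (phi p x * T x)"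
definition ph2 :: "real \<Rightarrow> real" where "ph2 x = phi p x * (1 - (p + 1) * S x)"
text \<open>\<open>Vm\<close> and \<open>Vp\<close> are the potentials of the second variation at
  \<phi> on imaginary and on real parts, that is of L_- = - d^2/dx^2 + \<open>Vm\<close> and L_+ = -
  d^2/dx^2 + \<open>Vp\<close>. The formulas for \<open>ph2\<close> and \<open>ph3\<close> say that
  L_- \<phi> = 0 and L_+ \<phi>' = 0.\<close>

definition Vm :: "real \<Rightarrow> real" where "Vm x = 1 - (p + 1) * S x"
definition Vp :: "real \<Rightarrow> real" where "Vp x = 1 - (p + 1) * (2 * p + 1) * S x"
definition ph3 :: "real \<Rightarrow> real" where "ph3 x = Vp x * ph1 x"
text \<open>\<open>chi\<close> is the derivative of the scaled standing waves in the frequency, so that \<open>L\<^sub>+ chi = - \<phi>\<close>;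
  the subcritical bound \<open>p < 2\<close> enters through \<open>\<langle>\<phi>, chi\<rangle> > 0\<close>.\<close>

definition chi :: "real \<Rightarrow> real" where "chi x = phi p x / (2 * p) + x * ph1 x / 2"
definition chi1 :: "real \<Rightarrow> real" where "chi1 x = ph1 x / (2 * p) + ph1 x / 2 + x * ph2 x / 2"
definition chi2 :: "real \<Rightarrow> real" where "chi2 x = ph2 x / (2 * p) + ph2 x + x * ph3 x / 2"

lemma p_pos [simp]: "p > 0" "p \<noteq> 0" "p \<ge> 0" using p_ge by auto

lemma T_bounds: "- 1 < T x" "T x < 1" "x \<ge> 0 \<Longrightarrow> 0 \<le> T x" "x > 0 \<Longrightarrow> 0 < T x"
  using tanh_real_bounds[of "p * x"] by (auto simp: T_def)

lemma S_bounds: "0 < S x" "S x \<le> 1"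
  using tanh_real_bounds[of "p * x"] by (auto simp: S_def T_def abs_square_less_1 abs_if)

lemma T_deriv: "(T has_real_derivative p * S x) (at x)"
  unfolding T_def[abs_def] S_def T_def
  by (rule derivative_eq_intros refl | simp)+

lemma S_cosh: "S x = (1 / cosh (p * x))\<^sup>2"
proof -
  have "cosh (p * x) \<noteq> 0" using cosh_real_pos[of "p * x"] by linarith
  then have "S x = ((cosh (p * x))\<^sup>2 - (sinh (p * x))\<^sup>2) / (cosh (p * x))\<^sup>2"
    by (simp add: S_def T_def tanh_def power_divide diff_divide_distrib)
  then show ?thesis unfolding hyperbolic_pythagoras by (simp add: power_divide)
qed

lemma phi_pos: "phi p x > 0"
  by (simp add: phi_def)

lemma phi_le_1: "phi p x \<le> 1"
  unfolding phi_def using cosh_real_ge_1[of "p * x"]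
  by (intro powr_le1) (auto simp: divide_simps)

lemma phi_0 [simp]: "phi p 0 = 1" by (simp add: phi_def)

lemma phi_powr: "phi p x powr (2 * p) = S x"
proof -
  have "phi p x powr (2 * p) = (1 / cosh (p * x)) powr (1 / p * (2 * p))" unfolding phi_def powr_powr ..
  also have "1 / p * (2 * p) = 2" by simp
  also have "(1 / cosh (p * x)) powr 2 = (1 / cosh (p * x))\<^sup>2"
    using powr_realpow[of "1 / cosh (p * x)" 2] by simp
  finally show ?thesis by (simp add: S_cosh)
qed

lemma phi_deriv: "(phi p has_real_derivative ph1 x) (at x)"
proof -
  have c: "cosh (p * x) > 0" by simp
  have "((\<lambda>x. (1 / cosh (p * x)) powr (1 / p)) has_real_derivative
      (1/p) * (1 / cosh (p * x)) powr (1/p - 1) * (- (p * sinh (p * x)) / (cosh (p * x))\<^sup>2)) (at x)"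
    using c by (auto intro!: derivative_eq_intros simp: power2_eq_square)
  moreover have "(1 / cosh (p * x)) powr (1/p - 1) = (1 / cosh (p * x)) powr (1/p) * cosh (p * x)"
    using c by (simp add: powr_diff)
  ultimately show ?thesis
    using c by (simp add: phi_def[abs_def] ph1_def T_def tanh_def power2_eq_square)
qed

lemma S_deriv: "(S has_real_derivative - 2 * p * T x * S x) (at x)"
  unfolding S_def[abs_def] by (rule derivative_eq_intros T_deriv refl | simp add: S_def)+

lemma ph1_deriv: "(ph1 has_real_derivative ph2 x) (at x)"
  unfolding ph1_def[abs_def]
  by (rule derivative_eq_intros T_deriv phi_deriv refl)+ (simp add: ph1_def ph2_def S_def power2_eq_square algebra_simps)

lemma ph2_deriv: "(ph2 has_real_derivative ph3 x) (at x)"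
  unfolding ph2_def[abs_def]
  by (rule derivative_eq_intros S_deriv phi_deriv refl)+ (simp add: ph1_def ph3_def Vp_def algebra_simps)

lemma chi_deriv: "(chi has_real_derivative chi1 x) (at x)"
proof -
  have "((\<lambda>x. (1 / (2 * p)) * phi p x + (1/2) * (x * ph1 x)) has_real_derivative
      (1 / (2 * p)) * ph1 x + (1/2) * (1 * ph1 x + ph2 x * x)) (at x)"
    by (intro DERIV_add DERIV_cmult DERIV_mult DERIV_ident phi_deriv ph1_deriv)
  then show ?thesis by (simp add: chi_def[abs_def] chi1_def algebra_simps add_divide_distrib)
qed

lemma chi1_deriv: "(chi1 has_real_derivative chi2 x) (at x)"
proof -
  have "((\<lambda>x. (1 / (2 * p)) * ph1 x + (1/2) * ph1 x + (1/2) * (x * ph2 x)) has_real_derivative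
      (1 / (2 * p)) * ph2 x + (1/2) * ph2 x + (1/2) * (1 * ph2 x + ph3 x * x)) (at x)"
    by (intro DERIV_add DERIV_cmult DERIV_mult DERIV_ident ph1_deriv ph2_deriv)
  then show ?thesis by (simp add: chi1_def[abs_def] chi2_def algebra_simps add_divide_distrib)
qed

lemma cont:
  "continuous_on A T" "continuous_on A S" "continuous_on A (phi p)" "continuous_on A ph1" "continuous_on A ph2"
  "continuous_on A Vm" "continuous_on A Vp" "continuous_on A ph3" "continuous_on A chi" "continuous_on A chi1" "continuous_on A chi2"
proof -
  show 1: "continuous_on A T" "continuous_on A S" "continuous_on A (phi p)" "continuous_on A ph1" "continuous_on A ph2"
    "continuous_on A chi" "continuous_on A chi1"
    using T_deriv S_deriv phi_deriv ph1_deriv ph2_deriv chi_deriv chi1_deriv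
    by (auto intro!: DERIV_isCont continuous_at_imp_continuous_on)
  show 2: "continuous_on A Vm" "continuous_on A Vp" unfolding Vm_def[abs_def] Vp_def[abs_def] by (intro continuous_intros 1)+
  show 3: "continuous_on A ph3" unfolding ph3_def[abs_def] by (intro continuous_intros 1 2)
  show "continuous_on A chi2" unfolding chi2_def[abs_def] by (intro continuous_intros 1 2 3) auto
qed

lemma Vp_bound: "\<bar>Vp x\<bar> \<le> 15"
proof -
  have "(p + 1) * (2 * p + 1) \<le> 3 * 5" using p_ge p_lt by (intro mult_mono) auto
  moreover have "(p + 1) * (2 * p + 1) * S x \<le> (p + 1) * (2 * p + 1) * 1"
    using S_bounds[of x] p_ge by (intro mult_left_mono) auto
  moreover have "0 \<le> (p + 1) * (2 * p + 1) * S x" using S_bounds[of x] p_ge by (intro mult_nonneg_nonneg) auto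
  ultimately show ?thesis unfolding Vp_def by linarith
qed

lemma Vp_ge: "Vp x \<ge> - 14"
proof -
  have "(p + 1) * (2 * p + 1) \<le> 3 * 5" using p_ge p_lt by (intro mult_mono) auto
  moreover have "(p + 1) * (2 * p + 1) * S x \<le> (p + 1) * (2 * p + 1) * 1"
    using S_bounds[of x] p_ge by (intro mult_left_mono) auto
  ultimately show ?thesis unfolding Vp_def by linarith
qed

lemma Vm_bound: "\<bar>Vm x\<bar> \<le> 4"
proof -
  have "(p + 1) * S x \<le> 3 * 1" using S_bounds[of x] p_ge p_lt by (intro mult_mono) auto
  moreover have "0 \<le> (p + 1) * S x" using S_bounds[of x] p_ge by (intro mult_nonneg_nonneg) auto
  ultimately show ?thesis unfolding Vm_def by linarith
qed

lemma phi_exp: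
  assumes "x \<ge> 0" shows "phi p x \<le> 2 powr (1/p) * exp (- x)"
proof -
  have "1 / cosh (p * x) \<le> 2 * exp (- (p * x))"
  proof -
    have "exp (p * x) \<le> 2 * cosh (p * x)" by (simp add: cosh_field_def)
    then show ?thesis by (simp add: exp_minus field_simps)
  qed
  then have "phi p x \<le> (2 * exp (- (p * x))) powr (1/p)" unfolding phi_def by (intro powr_mono2) auto
  also have "\<dots> = 2 powr (1/p) * exp (- (p * x)) powr (1/p)" by (simp add: powr_mult)
  also have "exp (- (p * x)) powr (1/p) = exp (- x)" by (simp add: powr_def)
  finally show ?thesis .
qed

text \<open>The factor 1 + x is there for \<open>chi\<close>, which contains x \<phi>'; by 1 + x
  \<le> 2 exp(x/2) half of the exponential decay of \<phi> absorbs it.\<close>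

lemma L2r_decay:
  assumes c: "continuous_on {0..} f" and K: "\<And>x. x \<ge> 0 \<Longrightarrow> \<bar>f x\<bar> \<le> K * ((1 + x) * phi p x)"
  shows "L2r f"
proof (rule L2r_bound)
  define C where "C = \<bar>K\<bar> * (2 * 2 powr (1/p))"
  show "L2r (\<lambda>x. C * exp (- (1/2) * x))"
    unfolding L2r_def
  proof
    have "integrable hl (\<lambda>x. C\<^sup>2 * exp (- 1 * x))" by (intro integrable_mult_right integrable_exp_minus_hl) simp
    moreover have "(\<lambda>x. (C * exp (- (1/2) * x))\<^sup>2) = (\<lambda>x. C\<^sup>2 * exp (- 1 * x))"
      by (simp add: power_mult_distrib flip: exp_double)
    ultimately show "integrable hl (\<lambda>x. (C * exp (- (1/2) * x))\<^sup>2)" by simp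
  qed (intro hl_continuous_measurable continuous_intros)
  show "f \<in> borel_measurable hl" by (rule hl_continuous_measurable[OF c])
  fix x :: real assume x: "x \<ge> 0"
  have e: "1 + x \<le> 2 * exp (x / 2)" using exp_ge_add_one_self[of "x/2"] x by linarith
  have "\<bar>f x\<bar> \<le> K * ((1 + x) * phi p x)" by (rule K[OF x])
  also have "\<dots> \<le> \<bar>K\<bar> * ((1 + x) * phi p x)" using x phi_pos[of x] by (intro mult_right_mono) auto
  also have "\<dots> \<le> \<bar>K\<bar> * ((2 * exp (x / 2)) * (2 powr (1/p) * exp (- x)))"
    using x e phi_exp[OF x] phi_pos[of x] by (intro mult_left_mono mult_mono) auto
  also have "\<dots> = C * (exp (x / 2) * exp (- x))" by (simp add: C_def)
  also have "exp (x / 2) * exp (- x) = exp (- (1/2) * x)" by (simp add: exp_add[symmetric])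
  also have "C * \<dots> \<le> \<bar>C * exp (- (1/2) * x)\<bar>" by (rule abs_ge_self)
  finally show "\<bar>f x\<bar> \<le> \<bar>C * exp (- (1/2) * x)\<bar>" .
qed

lemma ph_abs: "\<bar>ph1 x\<bar> \<le> phi p x" "\<bar>ph2 x\<bar> \<le> 4 * phi p x" "\<bar>ph3 x\<bar> \<le> 15 * phi p x"
proof -
  show 1: "\<bar>ph1 x\<bar> \<le> phi p x" 
  proof -
    have "phi p x * \<bar>T x\<bar> \<le> phi p x * 1" using T_bounds[of x] phi_pos[of x] by (intro mult_left_mono) auto
    then show ?thesis using phi_pos[of x] by (simp add: ph1_def abs_mult)
  qed
  have "\<bar>ph2 x\<bar> = \<bar>Vm x\<bar> * phi p x" using phi_pos[of x] by (simp add: ph2_def Vm_def abs_mult)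
  then show "\<bar>ph2 x\<bar> \<le> 4 * phi p x" using Vm_bound[of x] phi_pos[of x] by (simp add: mult_right_mono)
  have "\<bar>ph3 x\<bar> = \<bar>Vp x\<bar> * \<bar>ph1 x\<bar>" by (simp add: ph3_def abs_mult)
  also have "\<dots> \<le> 15 * phi p x" using 1 Vp_bound[of x] by (intro mult_mono) auto
  finally show "\<bar>ph3 x\<bar> \<le> 15 * phi p x" .
qed

lemma phi_le_decay: "x \<ge> 0 \<Longrightarrow> phi p x \<le> (1 + x) * phi p x" "x \<ge> 0 \<Longrightarrow> x * phi p x \<le> (1 + x) * phi p x" "x \<ge> 0 \<Longrightarrow> 0 \<le> x * phi p x"
  using phi_pos[of x] by (auto simp: algebra_simps)

lemma L2r_phis: "L2r (phi p)" "L2r ph1" "L2r ph2" "L2r ph3" "L2r chi" "L2r chi1" "L2r chi2" "L2r (\<lambda>x. x * phi p x)"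
   "L2r (\<lambda>x. phi p x + x * ph1 x)"
proof -
  have h: "\<bar>y / (2 * p)\<bar> \<le> \<bar>y\<bar>" for y using p_ge by (auto simp: divide_simps abs_mult mult_le_cancel_left1)
  show "L2r (phi p)"
  proof (rule L2r_decay[where K=1, OF cont(3)])
    fix x :: real assume "x \<ge> 0"
    then show "\<bar>phi p x\<bar> \<le> 1 * ((1 + x) * phi p x)" using phi_pos[of x] phi_le_decay(1)[of x] by linarith
  qed
  show "L2r ph1"
  proof (rule L2r_decay[where K=1, OF cont(4)])
    fix x :: real assume "x \<ge> 0"
    then show "\<bar>ph1 x\<bar> \<le> 1 * ((1 + x) * phi p x)" using ph_abs(1)[of x] phi_le_decay(1)[of x] by linarith
  qed
  show "L2r ph2"
  proof (rule L2r_decay[where K=4, OF cont(5)])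
    fix x :: real assume "x \<ge> 0"
    then show "\<bar>ph2 x\<bar> \<le> 4 * ((1 + x) * phi p x)" using ph_abs(2)[of x] phi_le_decay(1)[of x] by linarith
  qed
  show "L2r ph3"
  proof (rule L2r_decay[where K=15, OF cont(8)])
    fix x :: real assume "x \<ge> 0"
    then show "\<bar>ph3 x\<bar> \<le> 15 * ((1 + x) * phi p x)" using ph_abs(3)[of x] phi_le_decay(1)[of x] by linarith
  qed
  have b2: "\<bar>x * ph1 x / 2\<bar> \<le> x * phi p x / 2" "\<bar>x * ph2 x / 2\<bar> \<le> 2 * (x * phi p x)" "\<bar>x * ph3 x / 2\<bar> \<le> 8 * (x * phi p x)" if x: "x \<ge> 0" for x
  proof -
    have "x * \<bar>ph1 x\<bar> \<le> x * phi p x" "x * \<bar>ph2 x\<bar> \<le> x * (4 * phi p x)" "x * \<bar>ph3 x\<bar> \<le> x * (15 * phi p x)"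
      using ph_abs[of x] x by (auto intro!: mult_left_mono)
    then show "\<bar>x * ph1 x / 2\<bar> \<le> x * phi p x / 2" "\<bar>x * ph2 x / 2\<bar> \<le> 2 * (x * phi p x)" "\<bar>x * ph3 x / 2\<bar> \<le> 8 * (x * phi p x)"
      using x phi_le_decay(3)[OF x] by (auto simp: abs_mult)
  qed
  show "L2r chi"
  proof (rule L2r_decay[where K=2, OF cont(9)])
    fix x :: real assume x: "x \<ge> 0"
    have "\<bar>phi p x / (2 * p)\<bar> \<le> phi p x" using h[of "phi p x"] phi_pos[of x] by simp
    then show "\<bar>chi x\<bar> \<le> 2 * ((1 + x) * phi p x)" unfolding chi_def
      using b2(1)[OF x] phi_le_decay[OF x] by linarith
  qed
  show "L2r chi1"
  proof (rule L2r_decay[where K=4, OF cont(10)])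
    fix x :: real assume x: "x \<ge> 0"
    show "\<bar>chi1 x\<bar> \<le> 4 * ((1 + x) * phi p x)" unfolding chi1_def
      using h[of "ph1 x"] ph_abs(1)[of x] b2(2)[OF x] phi_le_decay[OF x] by linarith
  qed
  show "L2r chi2"
  proof (rule L2r_decay[where K=16, OF cont(11)])
    fix x :: real assume x: "x \<ge> 0"
    show "\<bar>chi2 x\<bar> \<le> 16 * ((1 + x) * phi p x)" unfolding chi2_def
      using h[of "ph2 x"] ph_abs(2)[of x] b2(3)[OF x] phi_le_decay[OF x] by linarith
  qed
  show "L2r (\<lambda>x. x * phi p x)"
  proof (rule L2r_decay[where K=1])
    fix x :: real assume x: "x \<ge> 0"
    then show "\<bar>x * phi p x\<bar> \<le> 1 * ((1 + x) * phi p x)" using phi_le_decay[OF x] by linarith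
  qed (intro continuous_intros cont)
  show "L2r (\<lambda>x. phi p x + x * ph1 x)"
  proof (rule L2r_decay[where K=2])
    fix x :: real assume x: "x \<ge> 0"
    then show "\<bar>phi p x + x * ph1 x\<bar> \<le> 2 * ((1 + x) * phi p x)" using phi_le_decay[OF x] b2(1)[OF x] phi_pos[of x] by linarith
  qed (intro continuous_intros cont)
qed

lemma H1r_phis: "H1r (phi p) ph1" "H1r ph1 ph2" "H1r ph2 ph3" "H1r chi chi1" "H1r chi1 chi2"
    "H1r (\<lambda>x. x * phi p x) (\<lambda>x. phi p x + x * ph1 x)"
proof -
  have "((\<lambda>x. x * phi p x) has_real_derivative phi p x + x * ph1 x) (at x)" for x
    using DERIV_mult[OF DERIV_ident phi_deriv, of x] by (simp add: mult.commute)
  then have "prim (\<lambda>x. x * phi p x) (\<lambda>x. phi p x + x * ph1 x)"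
    by (intro prim_C1 continuous_intros cont)
  then show "H1r (\<lambda>x. x * phi p x) (\<lambda>x. phi p x + x * ph1 x)" by (simp add: H1r_def L2r_phis)
qed (simp_all add: H1r_def L2r_phis prim_C1 phi_deriv ph1_deriv ph2_deriv chi_deriv chi1_deriv cont)

section \<open>The quadratic forms on one edge and their coercivity\<close>

definition qp :: "(real \<Rightarrow> real) \<Rightarrow> (real \<Rightarrow> real) \<Rightarrow> real" where
  "qp u u' = (\<integral>x. (u' x)\<^sup>2 + Vp x * (u x)\<^sup>2 \<partial>hl)"

definition qm :: "(real \<Rightarrow> real) \<Rightarrow> (real \<Rightarrow> real) \<Rightarrow> real" where
  "qm u u' = (\<integral>x. (u' x)\<^sup>2 + Vm x * (u x)\<^sup>2 \<partial>hl)"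

text \<open>The logarithmic derivative - T of the zero mode \<phi> solves \<tau>' + \<tau>^2 =
  \<open>Vm\<close> exactly. Since v vanishes at the vertex, \<tau> may be positive there, and this
  leaves room for the added term \<epsilon> (2 - T), which makes the inequality strict. The vertex
  condition thus excludes the phase direction \<phi>.\<close>

lemma qm_coercive:
  assumes v: "H1r v v'" and v0: "v 0 = 0"
  shows "qm v v' \<ge> p\<^sup>2/16 / 32 * h2 v v'"
  unfolding qm_def
proof (rule riccati_half_line[OF v cont(6)])
  \<comment> \<open>Minimises - p \<epsilon> + 4 \<epsilon>^2, the gain minus the quadratic loss,
    with value - p^2/16.\<close>
  define \<epsilon> where "\<epsilon> = p / 8"
  define \<tau> where "\<tau> x = - T x + \<epsilon> * (2 - T x)" for x
  define \<tau>' where "\<tau>' x = - (1 + \<epsilon>) * (p * S x)" for x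
  have \<epsilon>: "0 < \<epsilon>" using p_ge by (simp add: \<epsilon>_def)
  show "\<bar>Vm x\<bar> \<le> 15" for x using Vm_bound[of x] by linarith
  show "p\<^sup>2 / 16 > 0" by simp
  have "p\<^sup>2 \<le> 2\<^sup>2" using p_ge p_lt by (intro power_mono) auto
  then show "p\<^sup>2 / 16 \<le> 1" by simp
  have d: "(\<tau> has_real_derivative \<tau>' x) (at x)" for x
    unfolding \<tau>_def[abs_def] \<tau>'_def by (rule derivative_eq_intros T_deriv refl)+ (simp add: algebra_simps)
  have R: "\<tau>' x + (\<tau> x)\<^sup>2 \<le> Vm x - p\<^sup>2 / 16" if x: "x \<ge> 0" for x
  proof -
    have t: "0 \<le> T x" "T x \<le> 1" using T_bounds[of x] x by auto
    have sq: "(2 - T x)\<^sup>2 \<le> 2\<^sup>2" using t by (intro power_mono) auto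
    have "\<tau>' x + (\<tau> x)\<^sup>2 = Vm x + \<epsilon> * (- p * (1 - (T x)\<^sup>2) - 4 * T x + 2 * (T x)\<^sup>2) + \<epsilon>\<^sup>2 * (2 - T x)\<^sup>2"
      unfolding \<tau>'_def \<tau>_def Vm_def S_def by (simp add: power2_eq_square algebra_simps)
    moreover have "- p * (1 - (T x)\<^sup>2) - 4 * T x + 2 * (T x)\<^sup>2 \<le> - p"
    proof -
      have "(T x)\<^sup>2 \<le> T x" using t by (simp add: power2_eq_square mult_left_le)
      then have "(p + 2) * (T x)\<^sup>2 \<le> (p + 2) * T x" using p_ge by (intro mult_left_mono) auto
      moreover have "(p + 2) * T x \<le> 4 * T x" using p_lt t by (intro mult_right_mono) auto
      ultimately show ?thesis by (simp add: algebra_simps)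
    qed
    then have "\<epsilon> * (- p * (1 - (T x)\<^sup>2) - 4 * T x + 2 * (T x)\<^sup>2) \<le> \<epsilon> * (- p)"
      using \<epsilon> by (intro mult_left_mono) auto
    moreover have "\<epsilon>\<^sup>2 * (2 - T x)\<^sup>2 \<le> \<epsilon>\<^sup>2 * 4" using sq by (intro mult_left_mono) auto
    moreover have "\<epsilon> * (- p) + \<epsilon>\<^sup>2 * 4 = - p\<^sup>2 / 16" by (simp add: \<epsilon>_def power2_eq_square)
    ultimately show ?thesis by linarith
  qed
  show "\<tau> b * (v b)\<^sup>2 \<le> (LBINT x:{0..b}. (v' x)\<^sup>2 + (Vm x - p\<^sup>2 / 16) * (v x)\<^sup>2)" if b: "b \<ge> 0" for b
  proof -
    have "\<tau> b * (v b)\<^sup>2 - \<tau> 0 * (v 0)\<^sup>2 \<le> (LBINT x:{0..b}. (v' x)\<^sup>2 + (Vm x - p\<^sup>2 / 16) * (v x)\<^sup>2)"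
    proof (rule riccati_interval[OF _ b _ _ d _ R])
      show "prim v v'" using v by (simp add: H1r_def)
      show "set_integrable lborel {0..b} (\<lambda>x. (v' x)\<^sup>2)"
        by (rule set_integrable_subset[of _ "{0..}"]) (use v in \<open>auto simp: H1r_def L2r_def hl_integrable_iff\<close>)
      show "continuous_on {0..} (\<lambda>x. Vm x - p\<^sup>2 / 16)" by (intro continuous_intros cont)
      show "continuous_on {0..} \<tau>'" unfolding \<tau>'_def[abs_def] by (intro continuous_intros cont)
    qed
    then show ?thesis using v0 by simp
  qed
  show "\<bar>\<tau> b\<bar> \<le> 1 + \<epsilon> * 2" if "b \<ge> 0" for b
  proof -
    have t: "0 \<le> T b" "T b \<le> 1" using T_bounds[of b] that by auto
    have "\<epsilon> * (2 - T b) \<le> \<epsilon> * 2" "0 \<le> \<epsilon> * (2 - T b)" using t \<epsilon> by auto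
    then show ?thesis using t unfolding \<tau>_def by linarith
  qed
qed

text \<open>Coercivity modulo the kernel is obtained by point evaluation: functions vanishing at \<open>x0\<close> are treated on
  \<open>[0, x0]\<close> and on \<open>[x0, \<infinity>)\<close> separately, with an explicit solution \<open>\<tau>\<close> of \<open>\<tau>' + \<tau>\<^sup>2 \<le> Vp - \<kappa>\<close> on each piece.\<close>

definition x0 :: real where "x0 = 1/16"
definition T0 :: real where "T0 = T x0"
definition \<kappa>0 :: real where "\<kappa>0 = T0 ^ 4"

lemma T0_bounds: "0 < T0" "T0 < 1" using T_bounds[of x0] by (auto simp: T0_def x0_def)

lemma \<kappa>0_bounds: "0 < \<kappa>0" "\<kappa>0 \<le> 1"
  using T0_bounds by (auto simp: \<kappa>0_def power_le_one)

lemma T_ge_T0: "x \<ge> x0 \<Longrightarrow> T0 \<le> T x"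
  unfolding T0_def T_def by (simp add: x0_def)

lemma qp_coercive:
  assumes w: "H1r w w'" and w0: "w x0 = 0"
  shows "qp w w' \<ge> \<kappa>0 / 32 * h2 w w'"
  unfolding qp_def
proof (rule riccati_half_line[OF w cont(7) _ \<kappa>0_bounds])
  show "\<bar>Vp x\<bar> \<le> 15" for x by (rule Vp_bound)
  define \<epsilon> where "\<epsilon> = \<kappa>0"
  have \<epsilon>: "0 < \<epsilon>" "\<epsilon> = T0^4" using \<kappa>0_bounds by (auto simp: \<epsilon>_def \<kappa>0_def)
  \<comment> \<open>- T + p (1/T - T) is the logarithmic derivative of the zero mode \<phi>',
    singular at the vertex where \<phi>' vanishes; hence the start at \<open>x0\<close>. The
    correction \<epsilon>/T^2 changes \<tau>' + \<tau>^2 by - 2 \<epsilon>/T + \<epsilon>^2/T^4, and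
    \<epsilon> = T0^4 makes this at most - \<epsilon>.\<close>
  define \<tau> where "\<tau> x = - T x + p * (1 / T x - T x) + \<epsilon> * (1 / T x)\<^sup>2" for x
  define \<tau>' where "\<tau>' x = - (p * S x) + p * (- (p * S x) / (T x)\<^sup>2 - p * S x) + \<epsilon> * (- 2 * (p * S x) / T x ^ 3)" for x
  have Tp: "T x > 0" "T0 \<le> T x" "T x < 1" if "x \<ge> x0" for x using T_ge_T0[OF that] T0_bounds T_bounds[of x] by auto
  have d: "(\<tau> has_real_derivative \<tau>' x) (at x)" if "x \<ge> x0" for x
  proof -
    have nz: "T x \<noteq> 0" using Tp[OF that] by simp
    have i: "((\<lambda>x. 1 / T x) has_real_derivative - (p * S x) / (T x)\<^sup>2) (at x)"
      using nz by (auto intro!: derivative_eq_intros T_deriv simp: power2_eq_square)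
    show ?thesis unfolding \<tau>_def[abs_def] \<tau>'_def
      by (rule derivative_eq_intros T_deriv i refl)+ (use nz in \<open>simp add: field_simps power2_eq_square power3_eq_cube\<close>)
  qed
  have R: "\<tau>' x + (\<tau> x)\<^sup>2 \<le> Vp x - \<kappa>0" if x: "x \<ge> x0" for x
  proof -
    have t: "0 < T x" "T0 \<le> T x" "T x < 1" by (rule Tp[OF x])+
    define r where "r = 1 / T x"
    have r: "r \<ge> 1" "r * T x = 1" using t by (auto simp: r_def divide_simps)
    have "\<tau>' x + (\<tau> x)\<^sup>2 = Vp x - 2 * \<epsilon> * r + \<epsilon>\<^sup>2 * r^4"
    proof -
      have e1: "S x / (T x)\<^sup>2 = r\<^sup>2 - 1" "S x / T x ^ 3 = r^3 - r"
        using t by (auto simp: S_def r_def field_simps power2_eq_square power3_eq_cube)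
      have "\<tau>' x = - (p * S x) + p * (- p * (S x / (T x)\<^sup>2) - p * S x) + \<epsilon> * (- 2 * p * (S x / T x ^ 3))"
        by (simp add: \<tau>'_def)
      then have \<tau>'r: "\<tau>' x = - (p * S x) + p * (- p * (r\<^sup>2 - 1) - p * S x) + \<epsilon> * (- 2 * p * (r^3 - r))" unfolding e1 .
      have \<tau>r: "\<tau> x = - T x + p * (r - T x) + \<epsilon> * r\<^sup>2" by (simp add: \<tau>_def r_def)
      have rr: "T x * r = 1" "T x * (r * z) = z" "T x * r^2 = r" "T x * r^3 = r^2" for z
        using r(2) by (simp_all add: mult.commute power2_eq_square power3_eq_cube)
      have "(\<tau> x)\<^sup>2 = (T x)\<^sup>2 + p\<^sup>2 * (r\<^sup>2 - 2 * (T x * r) + (T x)\<^sup>2) + \<epsilon>\<^sup>2 * r^4 - 2 * p * (T x * r - (T x)\<^sup>2)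
          - 2 * \<epsilon> * (T x * r^2) + 2 * p * \<epsilon> * (r^3 - T x * r^2)"
        unfolding \<tau>r by (simp add: power2_eq_square power3_eq_cube power4_eq_xxxx algebra_simps)
      also have "\<dots> = (T x)\<^sup>2 + p\<^sup>2 * (r\<^sup>2 - 2 + (T x)\<^sup>2) + \<epsilon>\<^sup>2 * r^4 - 2 * p * (1 - (T x)\<^sup>2)
          - 2 * \<epsilon> * r + 2 * p * \<epsilon> * (r^3 - r)" unfolding rr by simp
      finally show ?thesis unfolding \<tau>'r Vp_def S_def by (simp add: power2_eq_square algebra_simps)
    qed
    moreover have "\<epsilon>\<^sup>2 * r^4 \<le> \<epsilon>"
    proof -
      have "T0^4 \<le> T x^4" using t T0_bounds by (intro power_mono) auto
      then have "\<epsilon> * r^4 \<le> T x^4 * r^4" unfolding \<epsilon>(2) using r by (intro mult_right_mono) auto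
      also have "\<dots> = 1" using r by (simp add: power_mult_distrib[symmetric] mult.commute)
      finally have "\<epsilon> * (\<epsilon> * r^4) \<le> \<epsilon> * 1" using \<epsilon> by (intro mult_left_mono) auto
      then show ?thesis by (simp add: power2_eq_square mult.assoc)
    qed
    moreover have "\<epsilon> * 1 \<le> \<epsilon> * r" using r \<epsilon> by (intro mult_left_mono) auto
    ultimately show ?thesis unfolding \<epsilon>_def by linarith
  qed
  have pw: "prim w w'" using w by (simp add: H1r_def)
  have w2: "set_integrable lborel {a..b} (\<lambda>x. (w' x)\<^sup>2)" if "a \<ge> 0" for a b
    by (rule set_integrable_subset[of _ "{0..}"]) (use w that in \<open>auto simp: H1r_def L2r_def hl_integrable_iff\<close>)
  have cV: "continuous_on {0..} (\<lambda>x. Vp x - \<kappa>0)" by (intro continuous_intros cont)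
  let ?q = "\<lambda>x. (w' x)\<^sup>2 + (Vp x - \<kappa>0) * (w x)\<^sup>2"
  have x0: "x0 > 0" by (simp add: x0_def)
  have qi: "set_integrable lborel {a..b} ?q" if "a \<ge> 0" for a b
  proof -
    have "set_integrable lborel {a..b} (\<lambda>x. (Vp x - \<kappa>0) * (w x)\<^sup>2)"
      by (intro borel_integrable_atLeastAtMost' continuous_intros cont continuous_on_subset[OF prim_continuous[OF pw]])
         (use that in auto)
    then show ?thesis using w2[OF that] by simp
  qed
  have inner: "0 \<le> (LBINT x:{0..x0}. ?q x)"
  proof -
    \<comment> \<open>On the inner piece the function - 16 x is used. It vanishes at 0, so the free
      vertex value of w drops out. Its slope beats the potential, - 16 + 1 \<le> - 14 - \<kappa>0,
      because 16 x \<le> 1 up to \<open>x0\<close>.\<close>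
    have "(- 16 * x0) * (w x0)\<^sup>2 - (- 16 * 0) * (w 0)\<^sup>2 \<le> (LBINT x:{0..x0}. ?q x)"
    proof (rule riccati_interval[OF pw _ w2 cV])
      show "((\<lambda>x. - 16 * x) has_real_derivative - 16) (at x)" for x :: real
        by (auto intro!: derivative_eq_intros)
      fix x assume x: "0 \<le> x" "x \<le> x0"
      have "(- 16 * x)\<^sup>2 \<le> 1\<^sup>2"
        using x power_mono[of "16 * x" 1 2] by (simp add: x0_def)
      then show "- 16 + (- 16 * x)\<^sup>2 \<le> Vp x - \<kappa>0" using Vp_ge[of x] \<kappa>0_bounds by simp
    qed (use x0 in auto)
    then show ?thesis using w0 by simp
  qed
  show "\<tau> b * (w b)\<^sup>2 \<le> (LBINT x:{0..b}. ?q x)" if b: "b \<ge> x0" for b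
  proof -
    have "\<tau> ((b - x0) + x0) * (w ((b - x0) + x0))\<^sup>2 - \<tau> (0 + x0) * (w (0 + x0))\<^sup>2
        \<le> (LBINT x:{0..b - x0}. (w' (x + x0))\<^sup>2 + (Vp (x + x0) - \<kappa>0) * (w (x + x0))\<^sup>2)"
    proof (rule riccati_interval[where \<tau>="\<lambda>x. \<tau> (x + x0)" and \<tau>'="\<lambda>x. \<tau>' (x + x0)"])
      show "prim (\<lambda>x. w (x + x0)) (\<lambda>x. w' (x + x0))" by (rule prim_shift[OF pw]) (use x0 in simp)
      show "set_integrable lborel {0..b - x0} (\<lambda>x. (w' (x + x0))\<^sup>2)"
        using set_integral_shift(2)[of "b - x0" "\<lambda>x. (w' x)\<^sup>2" x0] w2[of x0 "x0 + (b - x0)"] x0 by simp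
      show "continuous_on {0..} (\<lambda>x. Vp (x + x0) - \<kappa>0)"
        by (intro continuous_intros continuous_on_compose2[OF cont(7)[of UNIV]]) auto
      show "((\<lambda>x. \<tau> (x + x0)) has_real_derivative \<tau>' (x + x0)) (at x)" if "x \<ge> 0" for x
        using DERIV_shift[THEN iffD1, OF d[of "x + x0"]] that x0 by simp
      have "continuous_on {x0..} \<tau>'" unfolding \<tau>'_def[abs_def]
        by (intro continuous_intros cont) (use Tp in force)+
      then show "continuous_on {0..} (\<lambda>x. \<tau>' (x + x0))"
        by (rule continuous_on_compose2) (use x0 in \<open>auto intro!: continuous_intros\<close>)
      show "\<tau>' (x + x0) + (\<tau> (x + x0))\<^sup>2 \<le> Vp (x + x0) - \<kappa>0" if "0 \<le> x" for x using R[of "x + x0"] that by simp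
    qed (use b in auto)
    also have "\<dots> = (LBINT x:{x0..b}. ?q x)"
      using set_integral_shift(1)[of "b - x0" ?q x0] by simp
    finally have 1: "\<tau> b * (w b)\<^sup>2 \<le> (LBINT x:{x0..b}. ?q x)" using w0 by simp
    have "(LBINT x:{0..x0} \<union> {x0..b}. ?q x) = (LBINT x:{0..x0}. ?q x) + (LBINT x:{x0..b}. ?q x)"
    proof (rule set_integral_Un_AE)
      have "AE x in lborel. x \<noteq> x0" by (rule AE_lborel_singleton)
      then show "AE x in lborel. \<not> (x \<in> {0..x0} \<and> x \<in> {x0..b})" by eventually_elim auto
    qed (use qi[of 0 x0] qi[of x0 b] x0 in auto)
    moreover have "{0..x0} \<union> {x0..b} = {0..b}" using b x0 by auto
    ultimately show ?thesis using 1 inner by simp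
  qed
  show "\<bar>\<tau> b\<bar> \<le> 1 + p * (1 / T0 + 1) + \<epsilon> * (1 / T0)\<^sup>2" if "b \<ge> x0" for b
  proof -
    note t = Tp[OF that]
    have r: "0 \<le> 1 / T b" "1 / T b \<le> 1 / T0" using t T0_bounds by (auto intro!: divide_left_mono)
    have "\<epsilon> * (1 / T b)\<^sup>2 \<le> \<epsilon> * (1 / T0)\<^sup>2" using r \<epsilon> by (intro mult_left_mono power_mono) auto
    moreover have "0 \<le> \<epsilon> * (1 / T b)\<^sup>2" using \<epsilon> by simp
    moreover have "p * (1 / T b - T b) \<le> p * (1 / T0 + 1)" using r t by (intro mult_left_mono) auto
    moreover have "- (p * (1 / T0 + 1)) \<le> p * (1 / T b - T b)"
    proof -
      have "- (1 / T0 + 1) \<le> 1 / T b - T b" using r t by linarith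
      then have "p * (- (1 / T0 + 1)) \<le> p * (1 / T b - T b)" by (rule mult_left_mono) simp
      then show ?thesis by (simp only: mult_minus_right)
    qed
    ultimately show ?thesis using t unfolding \<tau>_def by linarith
  qed
qed

lemma L2r_Vp: "L2r u \<Longrightarrow> L2r (\<lambda>x. Vp x * u x)"
  by (rule L2r_bounded_mult[OF _ hl_continuous_measurable[OF cont(7)] Vp_bound])

text \<open>chi'' = Vp chi + \<phi>, and chi' vanishes at the vertex, so testing needs no vertex
  condition on u.\<close>

lemma chi_form:
  assumes u: "H1r u u'"
  shows "(\<integral>x. chi1 x * u' x + Vp x * chi x * u x \<partial>hl) = - (\<integral>x. phi p x * u x \<partial>hl)"
proof -
  have L: "L2r u" "L2r u'" using u by (auto simp: H1r_def)
  have e: "chi1 x * u' x + Vp x * chi x * u x = (chi2 x * u x + chi1 x * u' x) - phi p x * u x" for x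
  proof -
    have "chi2 x = Vp x * chi x + phi p x"
      unfolding chi2_def chi_def ph3_def ph2_def Vp_def by (simp add: field_simps)
    then show ?thesis by (simp add: algebra_simps)
  qed
  have i: "integrable hl (\<lambda>x. chi2 x * u x)" "integrable hl (\<lambda>x. chi1 x * u' x)" "integrable hl (\<lambda>x. phi p x * u x)"
    using L by (auto intro!: L2r_mult_integrable L2r_phis)
  have "(\<integral>x. chi2 x * u x \<partial>hl) + (\<integral>x. chi1 x * u' x \<partial>hl) = - chi1 0 * u 0"
    by (rule H1r_by_parts[OF H1r_phis(5) u])
  moreover have "chi1 0 = 0" by (simp add: chi1_def ph1_def T_def)
  ultimately show ?thesis unfolding e using i by simp
qed

text \<open>In contrast to \<open>chi_form\<close> there is a boundary term: \<open>ph2\<close>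
  takes the value - p at the vertex, so u has to vanish there. For two edges this is met by the
  difference of the profiles.\<close>

lemma ph1_form:
  assumes u: "H1r u u'" "u 0 = 0"
  shows "(\<integral>x. ph2 x * u' x + Vp x * ph1 x * u x \<partial>hl) = 0"
proof -
  have L: "L2r u" "L2r u'" using u by (auto simp: H1r_def)
  have i: "integrable hl (\<lambda>x. ph3 x * u x)" "integrable hl (\<lambda>x. ph2 x * u' x)"
    using L by (auto intro!: L2r_mult_integrable L2r_phis)
  have "(\<integral>x. ph3 x * u x \<partial>hl) + (\<integral>x. ph2 x * u' x \<partial>hl) = - ph2 0 * u 0"
    by (rule H1r_by_parts[OF H1r_phis(3) u(1)])
  then show ?thesis using i u(2) by (simp add: ph3_def add.commute)
qed

lemma phi_form:
  assumes u: "H1r u u'"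
  shows "(\<integral>x. ph1 x * u' x + Vm x * phi p x * u x \<partial>hl) = 0"
proof -
  have L: "L2r u" "L2r u'" using u by (auto simp: H1r_def)
  have i: "integrable hl (\<lambda>x. ph2 x * u x)" "integrable hl (\<lambda>x. ph1 x * u' x)"
    using L by (auto intro!: L2r_mult_integrable L2r_phis)
  have e: "Vm x * phi p x = ph2 x" for x by (simp add: ph2_def Vm_def)
  have "(\<integral>x. ph2 x * u x \<partial>hl) + (\<integral>x. ph1 x * u' x \<partial>hl) = - ph1 0 * u 0"
    by (rule H1r_by_parts[OF H1r_phis(2) u(1)])
  moreover have "ph1 0 = 0" by (simp add: ph1_def T_def)
  ultimately show ?thesis unfolding e using i by (simp add: add.commute)
qed

lemma qp_add_cmult:
  assumes u: "H1r u u'" and v: "H1r v v'"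
  shows "qp (\<lambda>x. c * u x + v x) (\<lambda>x. c * u' x + v' x) = c\<^sup>2 * qp u u' + 2 * c * (\<integral>x. u' x * v' x + Vp x * u x * v x \<partial>hl) + qp v v'"
proof -
  have L: "L2r u" "L2r u'" "L2r v" "L2r v'" using u v by (auto simp: H1r_def)
  have i: "integrable hl (\<lambda>x. (u' x)\<^sup>2)" "integrable hl (\<lambda>x. (v' x)\<^sup>2)" "integrable hl (\<lambda>x. u' x * v' x)"
    using L by (auto intro!: L2r_mult_integrable simp: L2r_def)
  have j: "integrable hl (\<lambda>x. Vp x * (u x)\<^sup>2)" "integrable hl (\<lambda>x. Vp x * (v x)\<^sup>2)" "integrable hl (\<lambda>x. Vp x * u x * v x)"
    using L2r_mult_integrable[OF L2r_Vp[OF L(1)] L(1)] L2r_mult_integrable[OF L2r_Vp[OF L(3)] L(3)] L2r_mult_integrable[OF L2r_Vp[OF L(1)] L(3)]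
    by (simp_all add: power2_eq_square mult.assoc)
  have "qp (\<lambda>x. c * u x + v x) (\<lambda>x. c * u' x + v' x) =
     (\<integral>x. c\<^sup>2 * ((u' x)\<^sup>2 + Vp x * (u x)\<^sup>2) + 2 * c * (u' x * v' x + Vp x * u x * v x) + ((v' x)\<^sup>2 + Vp x * (v x)\<^sup>2) \<partial>hl)"
    unfolding qp_def by (rule Bochner_Integration.integral_cong) (auto simp: power2_eq_square algebra_simps)
  also have "\<dots> = c\<^sup>2 * qp u u' + 2 * c * (\<integral>x. u' x * v' x + Vp x * u x * v x \<partial>hl) + qp v v'"
    unfolding qp_def using i j by simp
  finally show ?thesis .
qed

definition m0 :: real where "m0 = (\<integral>x. (phi p x)\<^sup>2 \<partial>hl)"
definition mchi :: real where "mchi = (\<integral>x. phi p x * chi x \<partial>hl)"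

lemma integral_pos_hl:
  fixes f :: "real \<Rightarrow> real"
  assumes "integrable hl f" "\<And>x. x \<ge> 0 \<Longrightarrow> f x \<ge> 0" "\<And>x. x > 0 \<Longrightarrow> f x > 0"
  shows "integral\<^sup>L hl f > 0"
proof -
  have "integral\<^sup>L hl f \<ge> 0" using assms(2) by (intro integral_nonneg_AE AE_hl_I) auto
  moreover have "integral\<^sup>L hl f \<noteq> 0"
  proof
    assume "integral\<^sup>L hl f = 0"
    then have "AE x in hl. f x = 0"
      using integral_nonneg_eq_0_iff_AE[OF assms(1)] assms(2) AE_hl_I[of "\<lambda>x. 0 \<le> f x"] by blast
    then have "AE x in lborel. x \<in> {0..} \<longrightarrow> f x = 0" by (subst (asm) AE_restrict_space_iff) auto
    then have "AE x in lborel. x \<notin> {0<..<1::real}"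
    proof eventually_elim
      case (elim x) then show ?case using assms(3)[of x] by auto
    qed
    then have "emeasure lborel {0<..<1::real} = 0" by (subst (asm) AE_iff_measurable[where N="{0<..<1}"]) auto
    then show False by simp
  qed
  ultimately show ?thesis by simp
qed

lemma m0_pos: "m0 > 0"
  unfolding m0_def using L2r_phis(1) by (intro integral_pos_hl zero_less_power phi_pos) (auto simp: L2r_def)

text \<open>Integration by parts gives - m0/2 for the integral of x \<phi> \<phi>'. The resulting
  factor is positive exactly for p < 2.\<close>

lemma mchi_eq: "mchi = (1 / (2 * p) - 1 / 4) * m0"
proof -
  have i: "integrable hl (\<lambda>x. (phi p x)\<^sup>2)" "integrable hl (\<lambda>x. x * phi p x * ph1 x)"
    using L2r_mult_integrable[OF L2r_phis(8) L2r_phis(2)] L2r_phis(1) by (auto simp: L2r_def)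
  have "(\<integral>x. (phi p x + x * ph1 x) * phi p x \<partial>hl) + (\<integral>x. x * phi p x * ph1 x \<partial>hl) = 0"
    using H1r_by_parts[OF H1r_phis(6) H1r_phis(1)] by simp
  moreover have "(\<integral>x. (phi p x + x * ph1 x) * phi p x \<partial>hl) = (\<integral>x. (phi p x)\<^sup>2 + x * phi p x * ph1 x \<partial>hl)"
    by (rule Bochner_Integration.integral_cong) (auto simp: power2_eq_square algebra_simps)
  ultimately have e: "m0 + 2 * (\<integral>x. x * phi p x * ph1 x \<partial>hl) = 0" using i by (simp add: m0_def)
  have "mchi = (\<integral>x. 1 / (2 * p) * (phi p x)\<^sup>2 + 1/2 * (x * phi p x * ph1 x) \<partial>hl)"
    unfolding mchi_def chi_def by (rule Bochner_Integration.integral_cong) (auto simp: power2_eq_square field_simps)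
  also have "\<dots> = 1 / (2 * p) * m0 + 1/2 * (\<integral>x. x * phi p x * ph1 x \<partial>hl)" using i by (simp add: m0_def)
  also have "\<dots> = (1 / (2 * p) - 1 / 4) * m0" using e by (simp add: algebra_simps) 
  finally show ?thesis .
qed

lemma mchi_pos: "mchi > 0"
  unfolding mchi_eq using p_lt p_ge m0_pos by (intro mult_pos_pos) (auto simp: divide_simps)

lemma chi_x0_pos: "chi x0 > 0"
proof -
  have "chi x0 = phi p x0 * (1 / (2 * p) - x0 * T x0 / 2)" by (simp add: chi_def ph1_def algebra_simps)
  moreover have "x0 * T x0 / 2 < 1 / (2 * p)"
  proof -
    have "x0 * T x0 \<le> 1/16 * 1" using T_bounds[of x0] by (intro mult_mono) (auto simp: x0_def)
    moreover have "1/2 < 1 / p" using p_lt by (simp add: divide_simps)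
    moreover have "1 / (2 * p) = (1 / p) / 2" by simp
    ultimately show ?thesis by linarith
  qed
  ultimately show ?thesis using phi_pos by simp
qed

lemma ph1_x0: "ph1 x0 \<noteq> 0"
  using phi_pos[of x0] T0_bounds by (auto simp: ph1_def T0_def)

text \<open>The form has the value - mchi on \<open>chi\<close>, but when a chi is split off the
  cross term contributes 2 mchi a^2, because L_+ chi = - \<phi> turns it into a pairing with \<phi>.
  So the form is positive up to the square of the pairing of s with \<phi>, which the mass
  constraint will make small.\<close>

lemma qp_shift_chi:
  assumes s: "H1r s s'"
  defines "a \<equiv> s x0 / chi x0"
  defines "w \<equiv> \<lambda>x. s x - a * chi x" and "w' \<equiv> \<lambda>x. s' x - a * chi1 x"
  shows "\<kappa>0 / 32 * h2 w w' + mchi / 2 * a\<^sup>2 \<le> qp s s' + 2 / mchi * (\<integral>x. phi p x * s x \<partial>hl)\<^sup>2"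
proof -
  have Hw: "H1r w w'" unfolding w_def w'_def by (intro H1r_diff s H1r_cmult H1r_phis)
  have w0: "w x0 = 0" using chi_x0_pos by (simp add: w_def a_def)
  let ?m = "\<integral>x. phi p x * s x \<partial>hl"
  have qc: "qp chi chi1 = - mchi"
    using chi_form[OF H1r_phis(4)] by (simp add: qp_def mchi_def power2_eq_square mult.assoc)
  have Lw: "L2r s" using s by (simp add: H1r_def)
  have "(\<integral>x. phi p x * w x \<partial>hl) = (\<integral>x. phi p x * s x - a * (phi p x * chi x) \<partial>hl)"
    by (rule Bochner_Integration.integral_cong) (auto simp: w_def algebra_simps)
  also have "\<dots> = ?m - a * mchi"
    using L2r_mult_integrable[OF L2r_phis(1) Lw] L2r_mult_integrable[OF L2r_phis(1) L2r_phis(5)] by (simp add: mchi_def)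
  finally have pw: "(\<integral>x. phi p x * w x \<partial>hl) = ?m - a * mchi" .
  have "qp s s' = qp (\<lambda>x. a * chi x + w x) (\<lambda>x. a * chi1 x + w' x)" by (simp add: w_def w'_def)
  also have "\<dots> = a\<^sup>2 * (- mchi) + 2 * a * (- (?m - a * mchi)) + qp w w'"
    unfolding qp_add_cmult[OF H1r_phis(4) Hw] qc chi_form[OF Hw] pw ..
  also have "\<dots> = qp w w' + mchi * a\<^sup>2 - 2 * a * ?m" by (simp add: power2_eq_square algebra_simps)
  finally have e: "qp s s' = qp w w' + mchi * a\<^sup>2 - 2 * a * ?m" .
  have "0 \<le> mchi / 2 * (a - 2 / mchi * ?m)\<^sup>2" using mchi_pos by simp
  also have "\<dots> = mchi / 2 * a\<^sup>2 - 2 * a * ?m + 2 / mchi * ?m\<^sup>2"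
    using mchi_pos by (simp add: power2_eq_square field_simps)
  finally show ?thesis using e qp_coercive[OF Hw w0] by simp
qed

text \<open>\<open>ph1\<close> is a zero mode and vanishes at the vertex, as d does, so subtracting
  a multiple of it leaves the form unchanged. The multiple c, fixed by the value at
  \<open>x0\<close>, will be the kernel coordinate.\<close>

lemma qp_shift_ph1:
  assumes d: "H1r d d'" and d0: "d 0 = 0"
  defines "c \<equiv> d x0 / ph1 x0"
  shows "\<kappa>0 / 32 * h2 (\<lambda>x. d x - c * ph1 x) (\<lambda>x. d' x - c * ph2 x) \<le> qp d d'"
proof -
  define w where "w = (\<lambda>x. d x - c * ph1 x)"
  define w' where "w' = (\<lambda>x. d' x - c * ph2 x)"
  have Hw: "H1r w w'" unfolding w_def w'_def by (intro H1r_diff d H1r_cmult H1r_phis)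
  have w0: "w x0 = 0" using ph1_x0 by (simp add: w_def c_def)
  have p0: "ph1 0 = 0" by (simp add: ph1_def T_def)
  have wz: "w 0 = 0" using d0 p0 by (simp add: w_def)
  have "qp d d' = qp (\<lambda>x. c * ph1 x + w x) (\<lambda>x. c * ph2 x + w' x)" by (simp add: w_def w'_def)
  also have "\<dots> = c\<^sup>2 * qp ph1 ph2 + 2 * c * 0 + qp w w'"
    unfolding qp_add_cmult[OF H1r_phis(2) Hw] ph1_form[OF Hw wz] ..
  also have "qp ph1 ph2 = 0" using ph1_form[OF H1r_phis(2) p0] by (simp add: qp_def power2_eq_square mult.assoc)
  finally show ?thesis using qp_coercive[OF Hw w0] unfolding w_def w'_def by simp
qed

end

section \<open>Taylor estimates for powers of the modulus\<close>

text \<open>The range of q covers the two exponents p and p + 1. On [1/2, 3/2] the third derivative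
  is at most 6 * 8 = 48, and 48/3! = 8.\<close>

lemma powr_taylor3:
  fixes q y :: real
  assumes q: "1/2 \<le> q" "q \<le> 3" and y: "\<bar>y\<bar> \<le> 1/2"
  shows "\<bar>(1 + y) powr q - 1 - q * y - q * (q - 1) / 2 * y\<^sup>2\<bar> \<le> 8 * \<bar>y\<bar> ^ 3"
proof (cases "y = 0")
  case False
  define D where "D m t = (\<Prod>i<m. (q - real i)) * t powr (q - real m)" for m :: nat and t :: real
  have "\<exists>t. (if 1 + y < 1 then 1 + y < t \<and> t < 1 else 1 < t \<and> t < 1 + y) \<and>
     (1 + y) powr q = (\<Sum>m<3. D m 1 / fact m * (1 + y - 1) ^ m) + D 3 t / fact 3 * (1 + y - 1) ^ 3"
  proof (rule Taylor[where a="1/2" and b="3/2"])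
    show "D 0 = (\<lambda>x. x powr q)" by (auto simp: D_def)
    show "\<forall>m t. m < 3 \<and> 1/2 \<le> t \<and> t \<le> 3/2 \<longrightarrow> (D m has_real_derivative D (Suc m) t) (at t)"
    proof (intro allI impI)
      fix m :: nat and t :: real assume "m < 3 \<and> 1/2 \<le> t \<and> t \<le> 3/2"
      then have t: "t > 0" by simp
      have "((\<lambda>t. (\<Prod>i<m. (q - real i)) * t powr (q - real m)) has_real_derivative
         (\<Prod>i<m. (q - real i)) * ((q - real m) * t powr (q - real m - 1))) (at t)"
        by (intro DERIV_cmult has_real_derivative_powr t)
      then show "(D m has_real_derivative D (Suc m) t) (at t)"
        by (simp add: D_def[abs_def] algebra_simps)
    qed
  qed (use y False in auto)
  then obtain t where tt: "if 1 + y < 1 then 1 + y < t \<and> t < 1 else 1 < t \<and> t < 1 + y"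
    and e0: "(1 + y) powr q = (\<Sum>m<3. D m 1 / fact m * (1 + y - 1) ^ m) + D 3 t / fact 3 * (1 + y - 1) ^ 3"
    by blast
  have t: "1/2 \<le> t" "t \<le> 3/2" using tt y by (auto split: if_splits)
  have e: "(1 + y) powr q = (\<Sum>m<3. D m 1 / fact m * y ^ m) + D 3 t / fact 3 * y ^ 3" using e0 by simp
  have "(\<Sum>m<3. D m 1 / fact m * y ^ m) = 1 + q * y + q * (q - 1) / 2 * y\<^sup>2"
    by (simp add: D_def eval_nat_numeral)
  then have "\<bar>(1 + y) powr q - 1 - q * y - q * (q - 1) / 2 * y\<^sup>2\<bar> = \<bar>D 3 t\<bar> / 6 * \<bar>y\<bar>^3"
    using e by (simp add: abs_mult power_abs fact_numeral)
  also have "\<bar>D 3 t\<bar> \<le> 48"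
  proof -
    have 1: "\<bar>q\<bar> \<le> 3" "\<bar>q - 1\<bar> \<le> 2" "\<bar>q - 2\<bar> \<le> 2 - 1/2" using q unfolding abs_le_iff by linarith+
    have "t powr (q - 3) \<le> (1/2) powr (q - 3)" using t q by (intro powr_mono2') auto
    also have "\<dots> \<le> (1/2) powr (- 5/2)" using q by (intro powr_mono') auto
    also have "(1/2::real) powr (- 5/2) = 2 powr (5/2)" by (simp add: powr_divide powr_minus_divide)
    also have "\<dots> \<le> 2 powr 3" by (rule powr_mono) auto
    finally have 2: "t powr (q - 3) \<le> 8" by simp
    have "D 3 t = q * (q - 1) * (q - 2) * t powr (q - 3)" by (simp add: D_def eval_nat_numeral)
    then have "\<bar>D 3 t\<bar> = \<bar>q\<bar> * \<bar>q - 1\<bar> * \<bar>q - 2\<bar> * t powr (q - 3)" by (simp add: abs_mult)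
    also have "\<dots> \<le> 3 * 2 * (2 - 1/2) * 8" using 1 2 by (intro mult_mono) auto
    finally have "\<bar>D 3 t\<bar> \<le> 72" by simp
    moreover have "\<bar>q * (q - 1) * (q - 2)\<bar> \<le> 6"
    proof -
      have a: "\<bar>q * (q - 2)\<bar> \<le> 3"
      proof -
        have "q * (q - 2) = (q - 1)\<^sup>2 - 1" by (simp add: power2_eq_square algebra_simps)
        moreover have "(q - 1)\<^sup>2 \<le> 4" using 1 power_mono[of "\<bar>q - 1\<bar>" 2 2] by simp
        moreover have "0 \<le> (q - 1)\<^sup>2" by simp
        ultimately have "q * (q - 2) \<le> 3" "- (q * (q - 2)) \<le> 3" by linarith+
        then show ?thesis by (simp only: abs_le_iff)
      qed
      have "\<bar>q * (q - 2)\<bar> * \<bar>q - 1\<bar> \<le> 3 * 2" using a 1 by (intro mult_mono) auto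
      then show ?thesis by (simp add: abs_mult mult.commute mult.left_commute)
    qed
    then have "\<bar>q * (q - 1) * (q - 2)\<bar> * t powr (q - 3) \<le> 6 * 8" using 2 by (intro mult_mono) auto
    ultimately show ?thesis by (simp add: \<open>D 3 t = q * (q - 1) * (q - 2) * t powr (q - 3)\<close> abs_mult)
  qed
  finally show ?thesis by (simp add: mult_right_mono)
qed simp

text \<open>\<open>powr_taylor3\<close> with 1 + y = (1 + a)^2 + b^2, so that |y| \<le> 3 \<rho>.
  The remainder collects 8 * 27 from the cube of y and 15 from the cubic and quartic terms in the
  expansion of y^2.\<close>

lemma unit_taylor:
  fixes a b q \<rho> :: real
  assumes q: "1/2 \<le> q" "q \<le> 3" and \<rho>: "0 \<le> \<rho>" "\<rho> \<le> 1/8" "\<rho>\<^sup>2 = a\<^sup>2 + b\<^sup>2"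
  shows "\<bar>((1 + a)\<^sup>2 + b\<^sup>2) powr q - 1 - 2 * q * a - q * (2 * q - 1) * a\<^sup>2 - q * b\<^sup>2\<bar> \<le> 300 * \<rho> ^ 3"
proof -
  define y where "y = 2 * a + \<rho>\<^sup>2"
  have y: "(1 + a)\<^sup>2 + b\<^sup>2 = 1 + y" unfolding y_def \<rho>(3) by (simp add: power2_eq_square algebra_simps)
  have a: "\<bar>a\<bar> \<le> \<rho>" 
  proof -
    have "a\<^sup>2 \<le> \<rho>\<^sup>2" unfolding \<rho>(3) by simp
    then show ?thesis using \<rho>(1) by (simp add: abs_le_square_iff[symmetric])
  qed
  have r2: "\<rho>\<^sup>2 \<le> \<rho>" using mult_left_mono[of \<rho> 1 \<rho>] \<rho>(1,2) by (simp add: power2_eq_square)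
  have ya: "\<bar>y\<bar> \<le> 3 * \<rho>" unfolding y_def using a r2 zero_le_power2[of \<rho>] by linarith
  have y3: "\<bar>y\<bar> ^ 3 \<le> 27 * \<rho> ^ 3" using power_mono[OF ya, of 3] by (simp add: power_mult_distrib)
  have t: "\<bar>(1 + y) powr q - 1 - q * y - q * (q - 1) / 2 * y\<^sup>2\<bar> \<le> 8 * \<bar>y\<bar> ^ 3"
    by (rule powr_taylor3) (use q ya \<rho> in auto)
  have qq: "\<bar>q * (q - 1) / 2\<bar> \<le> 3"
  proof -
    have "\<bar>q\<bar> * \<bar>q - 1\<bar> \<le> 3 * 2" using q by (intro mult_mono) auto
    then show ?thesis by (simp add: abs_mult)
  qed
  have e: "q * y + q * (q - 1) / 2 * y\<^sup>2 - (2 * q * a + q * (2 * q - 1) * a\<^sup>2 + q * b\<^sup>2)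
      = q * (q - 1) / 2 * (4 * a * \<rho>\<^sup>2 + \<rho>\<^sup>2 * \<rho>\<^sup>2)"
  proof -
    have b: "b\<^sup>2 = \<rho>\<^sup>2 - a\<^sup>2" using \<rho>(3) by simp
    show ?thesis unfolding b y_def by (simp add: power2_eq_square field_simps)
  qed
  have "\<bar>4 * a * \<rho>\<^sup>2 + \<rho>\<^sup>2 * \<rho>\<^sup>2\<bar> \<le> 5 * \<rho> ^ 3"
  proof -
    have "\<bar>a\<bar> * \<rho>\<^sup>2 \<le> \<rho> * \<rho>\<^sup>2" using a by (intro mult_right_mono) auto
    moreover have "\<rho>\<^sup>2 * \<rho>\<^sup>2 \<le> \<rho> * \<rho>\<^sup>2" using r2 by (intro mult_right_mono) auto
    moreover have "\<bar>4 * a * \<rho>\<^sup>2 + \<rho>\<^sup>2 * \<rho>\<^sup>2\<bar> \<le> 4 * (\<bar>a\<bar> * \<rho>\<^sup>2) + \<rho>\<^sup>2 * \<rho>\<^sup>2"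
      by (rule order_trans[OF abs_triangle_ineq]) (simp add: abs_mult)
    moreover have "\<rho> * \<rho>\<^sup>2 = \<rho>^3" by (simp add: power2_eq_square power3_eq_cube)
    ultimately show ?thesis by linarith
  qed
  then have "\<bar>q * (q - 1) / 2 * (4 * a * \<rho>\<^sup>2 + \<rho>\<^sup>2 * \<rho>\<^sup>2)\<bar> \<le> 3 * (5 * \<rho>^3)"
    unfolding abs_mult[of "q * (q - 1) / 2"] using qq \<rho> by (intro mult_mono) auto
  then show ?thesis unfolding y using t y3 e by linarith
qed

context half_soliton begin

lemma powr_scale:
  fixes f u v q :: real
  assumes f: "f > 0"
  shows "((f + u)\<^sup>2 + v\<^sup>2) powr q = f powr (2 * q) * ((1 + u / f)\<^sup>2 + (v / f)\<^sup>2) powr q"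
proof -
  have "(f + f * a)\<^sup>2 + (f * b)\<^sup>2 = f\<^sup>2 * ((1 + a)\<^sup>2 + b\<^sup>2)" for a b
    by algebra
  from this[of "u / f" "v / f"] have "(f + u)\<^sup>2 + v\<^sup>2 = f\<^sup>2 * ((1 + u / f)\<^sup>2 + (v / f)\<^sup>2)"
    using f by simp
  moreover have "(f\<^sup>2) powr q = f powr (2 * q)" using f by (simp add: powr_powr flip: powr_numeral)
  ultimately show ?thesis using f by (simp add: powr_mult)
qed

text \<open>Both sides are homogeneous in \<open>(f, u, v)\<close>; where \<open>(u, v)\<close> dominates \<open>f\<close>, every single term is
  already of the size of the remainder.\<close>

context
  fixes f u v Z s :: real
  assumes f: "0 < f" "f \<le> 1" and Z: "0 \<le> Z" "Z \<le> 1" "Z\<^sup>2 = u\<^sup>2 + v\<^sup>2"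
  defines "s \<equiv> f powr (2 * p)"
begin

text \<open>The bound s \<le> f is where 1/2 \<le> p enters: rescaling by f turns the cubic
  remainder into (s/f) Z^3, and this quotient is at most 1 although f may be arbitrarily
  small.\<close>

lemma s_bounds: "0 < s" "s \<le> 1" "s \<le> f"
proof -
  show "0 < s" "s \<le> 1" using f by (auto simp: s_def powr_le1)
  have "f powr (2 * p) \<le> f powr 1" using f p_ge by (intro powr_mono') auto
  then show "s \<le> f" using f by (simp add: s_def)
qed

lemma uv_le: "\<bar>u\<bar> \<le> Z" "\<bar>v\<bar> \<le> Z" "u\<^sup>2 \<le> Z\<^sup>2" "v\<^sup>2 \<le> Z\<^sup>2" "0 \<le> u\<^sup>2" "0 \<le> v\<^sup>2"
proof -
  show 1: "u\<^sup>2 \<le> Z\<^sup>2" "v\<^sup>2 \<le> Z\<^sup>2" unfolding Z(3) by auto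
  show "\<bar>u\<bar> \<le> Z" "\<bar>v\<bar> \<le> Z" using 1 Z(1) by (simp_all add: abs_le_square_iff[symmetric])
qed auto

lemma p_uv_le: "p * (2 * p + 1) * u\<^sup>2 \<le> 10 * Z\<^sup>2" "p * v\<^sup>2 \<le> 2 * Z\<^sup>2"
  "0 \<le> p * (2 * p + 1) * u\<^sup>2 + p * v\<^sup>2"
proof -
  have "p * (2 * p + 1) \<le> 2 * 5" using p_ge p_lt by (intro mult_mono) auto
  then show "p * (2 * p + 1) * u\<^sup>2 \<le> 10 * Z\<^sup>2" using uv_le(3) by (intro mult_mono) auto
  show "p * v\<^sup>2 \<le> 2 * Z\<^sup>2" using uv_le(4) p_lt by (intro mult_mono) auto
  show "0 \<le> p * (2 * p + 1) * u\<^sup>2 + p * v\<^sup>2" using p_ge by (intro add_nonneg_nonneg mult_nonneg_nonneg) auto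
qed

lemma fsu_large:
  assumes "f < 8 * Z"
  shows "\<bar>f * s * u\<bar> \<le> 64 * Z ^ 3"
proof -
  have 1: "\<bar>f\<bar> \<le> 8 * Z" "\<bar>s\<bar> \<le> 8 * Z" "0 \<le> 8 * Z" using assms f s_bounds by linarith+
  have "\<bar>f\<bar> * \<bar>s\<bar> * \<bar>u\<bar> \<le> (8 * Z) * (8 * Z) * Z"
    by (intro mult_mono 1 uv_le(1) mult_nonneg_nonneg abs_ge_zero)
  then show ?thesis by (simp add: abs_mult power3_eq_cube)
qed

text \<open>Here |f + u + iv| \<le> f + Z \<le> 9 Z, and Z^(2p) \<le> Z because Z \<le> 1 and 1
  \<le> 2p; the factor 9^4 = 81^2 bounds 81^p.\<close>

lemma taylor_large:
  assumes "f < 8 * Z"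
  shows "((f + u)\<^sup>2 + v\<^sup>2) powr p \<le> 9^4 * Z"  "s \<le> 8 * Z" "\<bar>f + u\<bar> \<le> 9 * Z" "(f + u)\<^sup>2 + v\<^sup>2 \<le> 81 * Z\<^sup>2"
proof -
  have Zp: "Z > 0" using assms f by linarith
  show s: "s \<le> 8 * Z" using s_bounds assms by linarith
  show fu: "\<bar>f + u\<bar> \<le> 9 * Z" using assms uv_le f by linarith
  have "(f + u)\<^sup>2 + v\<^sup>2 = f\<^sup>2 + 2 * f * u + Z\<^sup>2" using Z(3) by (simp add: power2_eq_square algebra_simps)
  also have "\<dots> \<le> f\<^sup>2 + 2 * f * Z + Z\<^sup>2" using uv_le f by (simp add: mult_left_mono abs_le_iff)
  also have "\<dots> = (f + Z)\<^sup>2" by (simp add: power2_eq_square algebra_simps)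
  also have "\<dots> \<le> (9 * Z)\<^sup>2" using assms f Z by (intro power_mono) auto
  finally show sq: "(f + u)\<^sup>2 + v\<^sup>2 \<le> 81 * Z\<^sup>2" by (simp add: power_mult_distrib)
  have "((f + u)\<^sup>2 + v\<^sup>2) powr p \<le> (81 * Z\<^sup>2) powr p" using sq by (intro powr_mono2) auto
  also have "\<dots> = 81 powr p * (Z powr (2 * p))"
    using Zp by (simp add: powr_mult powr_powr flip: powr_numeral)
  also have "\<dots> \<le> 81 powr 2 * Z powr 1" using p_ge p_lt Zp Z by (intro mult_mono powr_mono powr_mono') auto
  also have "\<dots> = 9^4 * Z" using Zp by simp
  finally show "((f + u)\<^sup>2 + v\<^sup>2) powr p \<le> 9^4 * Z" .
qed

lemma small_scale:
  assumes "8 * Z \<le> f" and q: "1/2 \<le> q" "q \<le> 3"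
  shows "\<bar>((f + u)\<^sup>2 + v\<^sup>2) powr q - f powr (2 * q) * (1 + 2 * q * (u / f) + q * (2 * q - 1) * (u / f)\<^sup>2 + q * (v / f)\<^sup>2)\<bar>
      \<le> f powr (2 * q) * (300 * (Z / f) ^ 3)"
proof -
  have "\<bar>((1 + u/f)\<^sup>2 + (v/f)\<^sup>2) powr q - 1 - 2 * q * (u/f) - q * (2 * q - 1) * (u/f)\<^sup>2 - q * (v/f)\<^sup>2\<bar> \<le> 300 * (Z/f) ^ 3"
  proof (rule unit_taylor[OF q])
    show "Z / f \<le> 1/8" using assms f by (simp add: divide_simps)
    show "(Z / f)\<^sup>2 = (u / f)\<^sup>2 + (v / f)\<^sup>2" by (simp add: power_divide Z(3) add_divide_distrib)
  qed (use f Z in simp)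
  then have "f powr (2 * q) * \<bar>((1 + u/f)\<^sup>2 + (v/f)\<^sup>2) powr q - 1 - 2 * q * (u/f) - q * (2 * q - 1) * (u/f)\<^sup>2 - q * (v/f)\<^sup>2\<bar> \<le> f powr (2 * q) * (300 * (Z/f) ^ 3)"
    by (intro mult_left_mono) auto
  moreover have "((f + u)\<^sup>2 + v\<^sup>2) powr q - f powr (2 * q) * (1 + 2 * q * (u / f) + q * (2 * q - 1) * (u / f)\<^sup>2 + q * (v / f)\<^sup>2)
     = f powr (2 * q) * (((1 + u/f)\<^sup>2 + (v/f)\<^sup>2) powr q - 1 - 2 * q * (u/f) - q * (2 * q - 1) * (u/f)\<^sup>2 - q * (v/f)\<^sup>2)"
    unfolding powr_scale[OF f(1), of u v q] by (simp add: algebra_simps)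
  ultimately show ?thesis by (simp add: abs_mult)
qed

text \<open>An upper bound suffices: the power enters the energy with a minus sign, and the energy
  is to be bounded below.\<close>

lemma energy_taylor:
  "((f + u)\<^sup>2 + v\<^sup>2) powr (p + 1) \<le> f\<^sup>2 * s + (2 * p + 2) * (f * s * u) + (p + 1) * (s * ((2 * p + 1) * u\<^sup>2 + v\<^sup>2)) + 10^6 * Z ^ 3"
proof (cases "8 * Z \<le> f")
  case True
  have fs: "f powr (2 * (p + 1)) = f\<^sup>2 * s"
    using f by (simp add: s_def powr_add algebra_simps)
  have "\<bar>((f + u)\<^sup>2 + v\<^sup>2) powr (p + 1) - f\<^sup>2 * s * (1 + 2 * (p + 1) * (u / f) + (p + 1) * (2 * (p + 1) - 1) * (u / f)\<^sup>2 + (p + 1) * (v / f)\<^sup>2)\<bar>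
      \<le> f\<^sup>2 * s * (300 * (Z / f) ^ 3)"
    using small_scale[OF True, of "p + 1"] p_ge p_lt unfolding fs by simp
  moreover have "f\<^sup>2 * s * (1 + 2 * (p + 1) * (u / f) + (p + 1) * (2 * (p + 1) - 1) * (u / f)\<^sup>2 + (p + 1) * (v / f)\<^sup>2)
     = f\<^sup>2 * s + (2 * p + 2) * (f * s * u) + (p + 1) * (s * ((2 * p + 1) * u\<^sup>2 + v\<^sup>2))"
    using f by (simp add: power2_eq_square field_simps)
  moreover have "f\<^sup>2 * s * (300 * (Z / f) ^ 3) \<le> 10^6 * Z^3"
  proof -
    have "f\<^sup>2 * s * (300 * (Z / f) ^ 3) = (s / f) * (300 * Z^3)"
      using f by (simp add: power2_eq_square power3_eq_cube field_simps)
    also have "\<dots> \<le> 1 * (300 * Z^3)" using s_bounds f Z by (intro mult_right_mono) auto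
    also have "\<dots> \<le> 10^6 * Z^3" using Z by simp
    finally show ?thesis .
  qed
  ultimately show ?thesis by linarith
next
  case False
  then have l: "f < 8 * Z" by simp
  note L = taylor_large[OF l]
  have sq: "(f + u)\<^sup>2 + v\<^sup>2 \<ge> 0" by simp
  have "((f + u)\<^sup>2 + v\<^sup>2) powr (p + 1) = ((f + u)\<^sup>2 + v\<^sup>2) powr p * ((f + u)\<^sup>2 + v\<^sup>2)"
    using powr_add[of "(f + u)\<^sup>2 + v\<^sup>2" p 1] sq by simp
  also have "\<dots> \<le> (9^4 * Z) * (81 * Z\<^sup>2)" using L Z by (intro mult_mono) auto
  also have "\<dots> = 9^6 * Z^3" by (simp add: power2_eq_square power3_eq_cube)
  finally have 1: "((f + u)\<^sup>2 + v\<^sup>2) powr (p + 1) \<le> 9^6 * Z^3" .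
  have 2: "\<bar>f * s * u\<bar> \<le> 64 * Z^3" by (rule fsu_large[OF l])
  have "\<bar>2 * p + 2\<bar> * \<bar>f * s * u\<bar> \<le> 6 * (64 * Z^3)" using 2 p_ge p_lt by (intro mult_mono) auto
  then have "\<bar>(2 * p + 2) * (f * s * u)\<bar> \<le> 6 * (64 * Z^3)" by (simp add: abs_mult)
  then have 3: "- (6 * (64 * Z^3)) \<le> (2 * p + 2) * (f * s * u)" by linarith
  have 4: "0 \<le> f\<^sup>2 * s" "0 \<le> (p + 1) * (s * ((2 * p + 1) * u\<^sup>2 + v\<^sup>2))"
    using s_bounds p_ge by (auto intro!: mult_nonneg_nonneg add_nonneg_nonneg)
  have "9^6 * Z^3 + 6 * (64 * Z^3) \<le> 10^6 * Z^3" using Z by simp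
  then show ?thesis using 1 3 4 by linarith
qed

abbreviation (input) "A \<equiv> ((f + u)\<^sup>2 + v\<^sup>2) powr p"

lemma A_small:
  assumes "8 * Z \<le> f"
  obtains E where "A = s * (1 + 2 * p * (u / f) + p * (2 * p - 1) * (u / f)\<^sup>2 + p * (v / f)\<^sup>2 + E)" "\<bar>E\<bar> \<le> 300 * (Z / f)^3"
proof
  let ?X = "1 + 2 * p * (u / f) + p * (2 * p - 1) * (u / f)\<^sup>2 + p * (v / f)\<^sup>2"
  show "A = s * (?X + (A / s - ?X))" using s_bounds by simp
  have "\<bar>A - s * ?X\<bar> \<le> s * (300 * (Z / f)^3)"
    using small_scale[OF assms, of p] p_ge p_lt by (simp add: s_def)
  moreover have "A - s * ?X = s * (A / s - ?X)" using s_bounds by (simp add: right_diff_distrib)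
  ultimately show "\<bar>A / s - ?X\<bar> \<le> 300 * (Z / f)^3" using s_bounds by (simp add: abs_mult)
qed

text \<open>The outer factor f comes from the pairing with \<open>ph1\<close> = - \<phi> T. It makes
  the cubic remainder uniform: without it the rescaled error would be s/f^2 times Z^3, which is
  unbounded for p < 1.\<close>

lemma nonlin_taylor2:
  "\<bar>f * (A * (f + u)) - f\<^sup>2 * s - (2 * p + 1) * (f * s * u) - s * (p * (2 * p + 1) * u\<^sup>2 + p * v\<^sup>2)\<bar> \<le> 10^6 * Z^3"
proof (cases "8 * Z \<le> f")
  case True
  obtain E where E: "A = s * (1 + 2 * p * (u / f) + p * (2 * p - 1) * (u / f)\<^sup>2 + p * (v / f)\<^sup>2 + E)" "\<bar>E\<bar> \<le> 300 * (Z / f)^3"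
    by (rule A_small[OF True])
  define r where "r = Z / f"
  define a where "a = u / f"
  define b where "b = v / f"
  have r: "0 \<le> r" "r \<le> 1/8" using True f Z by (auto simp: r_def divide_simps)
  have ab: "\<bar>a\<bar> \<le> r" "a\<^sup>2 \<le> r\<^sup>2" "b\<^sup>2 \<le> r\<^sup>2" using uv_le f by (auto simp: a_def b_def r_def divide_right_mono power_divide)
  have u: "u = f * a" "v = f * b" "Z = f * r" using f by (auto simp: a_def b_def r_def)
  have alg: "f * (B * (f + f * a)) - f\<^sup>2 * s - (2 * p + 1) * (f * s * (f * a)) - s * (p * (2 * p + 1) * (f * a)\<^sup>2 + p * (f * b)\<^sup>2)
     = f\<^sup>2 * s * (a * (p * (2 * p - 1) * a\<^sup>2 + p * b\<^sup>2) + (1 + a) * E)"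
    if "B = s * (1 + 2 * p * a + p * (2 * p - 1) * a\<^sup>2 + p * b\<^sup>2 + E)" for B
    unfolding that by (simp add: power2_eq_square algebra_simps)
  have "f * (A * (f + u)) - f\<^sup>2 * s - (2 * p + 1) * (f * s * u) - s * (p * (2 * p + 1) * u\<^sup>2 + p * v\<^sup>2)
     = f\<^sup>2 * s * (a * (p * (2 * p - 1) * a\<^sup>2 + p * b\<^sup>2) + (1 + a) * E)"
    using alg[OF E(1)[folded a_def b_def]] by (simp only: u(1,2)[symmetric])
  then have "\<bar>f * (A * (f + u)) - f\<^sup>2 * s - (2 * p + 1) * (f * s * u) - s * (p * (2 * p + 1) * u\<^sup>2 + p * v\<^sup>2)\<bar>
     = f\<^sup>2 * s * \<bar>a * (p * (2 * p - 1) * a\<^sup>2 + p * b\<^sup>2) + (1 + a) * E\<bar>"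
    using s_bounds by (simp add: abs_mult)
  also have "\<bar>a * (p * (2 * p - 1) * a\<^sup>2 + p * b\<^sup>2) + (1 + a) * E\<bar> \<le> 1000 * r^3"
  proof -
    have "p * (2 * p - 1) * a\<^sup>2 \<le> 2 * 3 * r\<^sup>2" using ab p_ge p_lt by (intro mult_mono) auto
    moreover have "p * b\<^sup>2 \<le> 2 * r\<^sup>2" using ab p_ge p_lt by (intro mult_mono) auto
    moreover have "0 \<le> p * (2 * p - 1) * a\<^sup>2 + p * b\<^sup>2" using p_ge by (intro add_nonneg_nonneg mult_nonneg_nonneg) auto
    ultimately have "\<bar>p * (2 * p - 1) * a\<^sup>2 + p * b\<^sup>2\<bar> \<le> 8 * r\<^sup>2" by linarith
    then have "\<bar>a\<bar> * \<bar>p * (2 * p - 1) * a\<^sup>2 + p * b\<^sup>2\<bar> \<le> r * (8 * r\<^sup>2)" using ab r by (intro mult_mono) auto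
    moreover have "\<bar>1 + a\<bar> * \<bar>E\<bar> \<le> 2 * (300 * r^3)"
    proof (rule mult_mono)
      show "\<bar>1 + a\<bar> \<le> 2" using ab(1) r by linarith
      show "\<bar>E\<bar> \<le> 300 * r^3" using E(2) by (simp add: r_def)
    qed auto
    moreover have "\<bar>a * (p * (2 * p - 1) * a\<^sup>2 + p * b\<^sup>2) + (1 + a) * E\<bar> \<le> \<bar>a\<bar> * \<bar>p * (2 * p - 1) * a\<^sup>2 + p * b\<^sup>2\<bar> + \<bar>1 + a\<bar> * \<bar>E\<bar>"
      by (metis abs_mult abs_triangle_ineq)
    moreover have "r * (8 * r\<^sup>2) = 8 * r^3" "0 \<le> r^3" using r by (auto simp: power2_eq_square power3_eq_cube)
    ultimately show ?thesis by linarith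
  qed
  also have "f\<^sup>2 * s * (1000 * r^3) = (s / f) * (1000 * Z^3)"
    unfolding u(3) using f by (simp add: power2_eq_square power3_eq_cube field_simps)
  also have "\<dots> \<le> 1 * (1000 * Z^3)" using s_bounds f Z by (intro mult_right_mono) auto
  also have "\<dots> \<le> 10^6 * Z^3" using Z by simp
  finally show ?thesis using s_bounds by (simp add: mult_left_mono)
next
  case False
  then have l: "f < 8 * Z" by simp
  note L = taylor_large[OF l]
  have "\<bar>f * (A * (f + u))\<bar> \<le> (8 * Z) * ((9^4 * Z) * (9 * Z))"
    unfolding abs_mult using L l f Z by (intro mult_mono) auto
  then have 1: "\<bar>f * (A * (f + u))\<bar> \<le> 8 * 9^5 * Z^3" by (simp add: power3_eq_cube)
  have "f\<^sup>2 * s \<le> (8 * Z)\<^sup>2 * (8 * Z)" using L l f Z s_bounds by (intro mult_mono power_mono) auto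
  then have 2: "f\<^sup>2 * s \<le> 512 * Z^3" "0 \<le> f\<^sup>2 * s" using s_bounds by (auto simp: power3_eq_cube power2_eq_square)
  have "\<bar>f * s * u\<bar> \<le> 64 * Z^3" by (rule fsu_large[OF l])
  then have "\<bar>2 * p + 1\<bar> * \<bar>f * s * u\<bar> \<le> 5 * (64 * Z^3)" using p_ge p_lt by (intro mult_mono) auto
  then have 3: "\<bar>(2 * p + 1) * (f * s * u)\<bar> \<le> 320 * Z^3" by (simp add: abs_mult)
  have "p * (2 * p + 1) * u\<^sup>2 + p * v\<^sup>2 \<le> 12 * Z\<^sup>2" using p_uv_le by linarith
  then have "s * (p * (2 * p + 1) * u\<^sup>2 + p * v\<^sup>2) \<le> (8 * Z) * (12 * Z\<^sup>2)"
    using L(2) Z(1) by (intro mult_mono p_uv_le(3)) auto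
  then have 4: "s * (p * (2 * p + 1) * u\<^sup>2 + p * v\<^sup>2) \<le> 96 * Z^3" by (simp add: power3_eq_cube power2_eq_square)
  have 5: "0 \<le> s * (p * (2 * p + 1) * u\<^sup>2 + p * v\<^sup>2)" using s_bounds(1) p_uv_le(3) by (intro mult_nonneg_nonneg) auto
  have "(8 * 9^5 + 512 + 320 + 96) * Z^3 \<le> 10^6 * Z^3" using Z by (intro mult_right_mono) auto
  then have 6: "8 * 9^5 * Z^3 + 512 * Z^3 + 320 * Z^3 + 96 * Z^3 \<le> 10^6 * Z^3" by (simp add: algebra_simps)
  show ?thesis using 1 2 3 4 5 6 by linarith
qed

text \<open>Where 8 Z \<le> f, the first bound is \<open>nonlin_taylor2\<close> divided by f: one
  factor Z \<le> f/8 of the cubic remainder pays for the division, and s \<le> f pays for it in the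
  quadratic term.\<close>

lemma nonlin_taylor1:
  "\<bar>A * (f + u) - f * s - (2 * p + 1) * (s * u)\<bar> \<le> 10^6 * Z\<^sup>2" "\<bar>A * v - s * v\<bar> \<le> 10^6 * Z\<^sup>2"
proof -
  show "\<bar>A * (f + u) - f * s - (2 * p + 1) * (s * u)\<bar> \<le> 10^6 * Z\<^sup>2"
  proof -
    let ?R = "A * (f + u) - f * s - (2 * p + 1) * (s * u)"
    show ?thesis
    proof (cases "8 * Z \<le> f")
      case True
      have "f * ?R = (f * (A * (f + u)) - f\<^sup>2 * s - (2 * p + 1) * (f * s * u) - s * (p * (2 * p + 1) * u\<^sup>2 + p * v\<^sup>2)) + s * (p * (2 * p + 1) * u\<^sup>2 + p * v\<^sup>2)"
        by (simp add: power2_eq_square algebra_simps)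
      moreover have "s * (p * (2 * p + 1) * u\<^sup>2 + p * v\<^sup>2) \<le> f * (12 * Z\<^sup>2)"
      proof -
        have "p * (2 * p + 1) * u\<^sup>2 + p * v\<^sup>2 \<le> 12 * Z\<^sup>2" using p_uv_le by linarith
        then show ?thesis using s_bounds(3) f by (intro mult_mono p_uv_le(3)) auto
      qed
      moreover have "0 \<le> s * (p * (2 * p + 1) * u\<^sup>2 + p * v\<^sup>2)" using s_bounds(1) p_uv_le(3) by (intro mult_nonneg_nonneg) auto
      moreover have "10^6 * Z^3 \<le> f * (10^6 / 8 * Z\<^sup>2)"
      proof -
        have "Z^3 = Z * Z\<^sup>2" by (simp add: power2_eq_square power3_eq_cube)
        also have "\<dots> \<le> (f / 8) * Z\<^sup>2" using True by (intro mult_right_mono) auto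
        finally show ?thesis by simp
      qed
      ultimately have "\<bar>f * ?R\<bar> \<le> f * (12 * Z\<^sup>2) + f * (10^6 / 8 * Z\<^sup>2)" using nonlin_taylor2 by linarith
      moreover have "f * \<bar>?R\<bar> = \<bar>f * ?R\<bar>" using f(1) by (simp only: abs_mult abs_of_pos)
      ultimately have "f * \<bar>?R\<bar> \<le> f * (12 * Z\<^sup>2 + 10^6 / 8 * Z\<^sup>2)" by (simp only: distrib_left)
      then have "\<bar>?R\<bar> \<le> 12 * Z\<^sup>2 + 10^6 / 8 * Z\<^sup>2" using mult_le_cancel_left_pos[OF f(1)] by blast
      also have "\<dots> \<le> 10^6 * Z\<^sup>2" by simp
      finally show ?thesis .
    next
      case False
      then have l: "f < 8 * Z" by simp
      note L = taylor_large[OF l]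
      have "\<bar>A * (f + u)\<bar> \<le> (9^4 * Z) * (9 * Z)" unfolding abs_mult using L Z by (intro mult_mono) auto
      moreover have "f * s \<le> (8 * Z) * (8 * Z)" using L(2) l f Z(1) s_bounds(1) by (intro mult_mono) auto
      moreover have "0 \<le> f * s" using f s_bounds(1) by simp
      moreover have "\<bar>2 * p + 1\<bar> * (\<bar>s\<bar> * \<bar>u\<bar>) \<le> 5 * ((8 * Z) * Z)" using L(2) p_ge p_lt s_bounds(1) uv_le(1) Z(1) by (intro mult_mono) auto
      then have "\<bar>(2 * p + 1) * (s * u)\<bar> \<le> 5 * ((8 * Z) * Z)" by (simp add: abs_mult)
      ultimately have "\<bar>?R\<bar> \<le> (9^4 * Z) * (9 * Z) + (8 * Z) * (8 * Z) + 5 * ((8 * Z) * Z)" by linarith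
      also have "\<dots> \<le> 10^6 * Z\<^sup>2" by (simp add: power2_eq_square)
      finally show ?thesis .
    qed
  qed
  show "\<bar>A * v - s * v\<bar> \<le> 10^6 * Z\<^sup>2"
  proof (cases "8 * Z \<le> f")
    case True
    obtain E where E: "A = s * (1 + 2 * p * (u / f) + p * (2 * p - 1) * (u / f)\<^sup>2 + p * (v / f)\<^sup>2 + E)" "\<bar>E\<bar> \<le> 300 * (Z / f)^3"
      by (rule A_small[OF True])
    define r where "r = Z / f"
    define a where "a = u / f"
    define b where "b = v / f"
    have r: "0 \<le> r" "r \<le> 1/8" using True f Z by (auto simp: r_def divide_simps)
    have r2: "r\<^sup>2 \<le> r" "r^3 \<le> r" using r power_decreasing[of 1 2 r] power_decreasing[of 1 3 r] by auto
    have ab: "\<bar>a\<bar> \<le> r" "a\<^sup>2 \<le> r\<^sup>2" "b\<^sup>2 \<le> r\<^sup>2" using uv_le f by (auto simp: a_def b_def r_def divide_right_mono power_divide)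
    have "\<bar>2 * p\<bar> * \<bar>a\<bar> \<le> 4 * r" using ab p_ge p_lt by (intro mult_mono) auto
    then have "\<bar>2 * p * a\<bar> \<le> 4 * r" by (simp add: abs_mult)
    moreover have "p * (2 * p - 1) \<le> 2 * 3" using p_ge p_lt by (intro mult_mono) auto
    then have "p * (2 * p - 1) * a\<^sup>2 \<le> 6 * r\<^sup>2" using ab by (intro mult_mono) auto
    moreover have "p * b\<^sup>2 \<le> 2 * r\<^sup>2" using ab p_lt by (intro mult_mono) auto
    moreover have "0 \<le> p * (2 * p - 1) * a\<^sup>2" "0 \<le> p * b\<^sup>2" using p_ge by (auto intro!: mult_nonneg_nonneg)
    moreover have "\<bar>E\<bar> \<le> 300 * r^3" using E(2) by (simp add: r_def)
    ultimately have "\<bar>2 * p * a + p * (2 * p - 1) * a\<^sup>2 + p * b\<^sup>2 + E\<bar> \<le> 1000 * r" using r2 r by linarith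
    then have "\<bar>s\<bar> * \<bar>2 * p * a + p * (2 * p - 1) * a\<^sup>2 + p * b\<^sup>2 + E\<bar> * \<bar>v\<bar> \<le> f * (1000 * r) * Z"
      using s_bounds uv_le f r by (intro mult_mono) auto
    moreover have "A * v - s * v = s * (2 * p * a + p * (2 * p - 1) * a\<^sup>2 + p * b\<^sup>2 + E) * v"
      unfolding E(1) a_def[symmetric] b_def[symmetric] by (simp add: algebra_simps)
    moreover have "f * (1000 * r) * Z = 1000 * Z\<^sup>2" using f by (simp add: r_def power2_eq_square)
    ultimately have "\<bar>A * v - s * v\<bar> \<le> 1000 * Z\<^sup>2" by (simp add: abs_mult)
    also have "\<dots> \<le> 10^6 * Z\<^sup>2" by simp
    finally show ?thesis .
  next
    case False
    then have l: "f < 8 * Z" by simp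
    note L = taylor_large[OF l]
    have "\<bar>A * v\<bar> \<le> (9^4 * Z) * Z" unfolding abs_mult using L Z uv_le by (intro mult_mono) auto
    moreover have "\<bar>s * v\<bar> \<le> (8 * Z) * Z" unfolding abs_mult using L Z uv_le s_bounds by (intro mult_mono) auto
    ultimately have "\<bar>A * v - s * v\<bar> \<le> (9^4 * Z) * Z + (8 * Z) * Z" by linarith
    also have "\<dots> \<le> 10^6 * Z\<^sup>2" by (simp add: power2_eq_square)
    finally show ?thesis .
  qed
qed

end

section \<open>Coercivity on two weighted edges\<close>

text \<open>With the weighted mean s and the scaled difference d = (u1 - u0)/(n + 1) one has u0 = s
  - n d and u1 = s + d, and the weighted form becomes (n + 1) (qp s + n qp d). Continuity at the
  vertex gives d 0 = 0. The mean carries the mass direction and is treated by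
  \<open>qp_shift_chi\<close>; the difference carries the kernel and is treated by
  \<open>qp_shift_ph1\<close>.\<close>

lemma two_edge_coercive:
  fixes n :: real
  assumes n: "n \<ge> 1"
  obtains \<kappa> where "\<kappa> > 0"
    "\<And>u0 u0' u1 u1'. H1r u0 u0' \<Longrightarrow> H1r u1 u1' \<Longrightarrow> u0 0 = u1 0 \<Longrightarrow>
      (let c = ((u1 x0 - u0 x0) / (n + 1)) / ph1 x0 in
      \<kappa> * (h2 (\<lambda>x. u0 x + n * c * ph1 x) (\<lambda>x. u0' x + n * c * ph2 x) + n * h2 (\<lambda>x. u1 x - c * ph1 x) (\<lambda>x. u1' x - c * ph2 x))
       \<le> qp u0 u0' + n * qp u1 u1' + 2 / mchi * ((\<integral>x. phi p x * u0 x \<partial>hl) + n * (\<integral>x. phi p x * u1 x \<partial>hl))\<^sup>2)"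
proof
  define Hc where "Hc = h2 chi chi1"
  have Hc: "Hc \<ge> 0" by (simp add: Hc_def h2_nonneg)
  \<comment> \<open>128 = 4 * 32 pays for two uses of \<open>h2_add_le\<close>, each with a factor
    2; the second entry pays for the norm of a chi out of mchi/2 * a^2.\<close>
  define \<kappa> where "\<kappa> = min (\<kappa>0 / 128) (mchi / (8 * (Hc + 1)))"
  show \<kappa>: "\<kappa> > 0" using \<kappa>0_bounds mchi_pos Hc by (simp add: \<kappa>_def)
  have \<kappa>1: "4 * \<kappa> \<le> \<kappa>0 / 32" "4 * \<kappa> * Hc \<le> mchi / 2"
  proof -
    show "4 * \<kappa> \<le> \<kappa>0 / 32" by (simp add: \<kappa>_def)
    have "\<kappa> \<le> mchi / (8 * (Hc + 1))" by (simp add: \<kappa>_def)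
    then have "\<kappa> * (Hc + 1) \<le> mchi / 8" using Hc by (simp add: field_simps)
    then show "4 * \<kappa> * Hc \<le> mchi / 2" using \<kappa> by (simp add: algebra_simps)
  qed
  fix u0 u0' u1 u1' assume u0: "H1r u0 u0'" and u1: "H1r u1 u1'" and eq0: "u0 0 = u1 0"
  define s where "s = (\<lambda>x. 1 / (n + 1) * (u0 x + n * u1 x))"
  define s' where "s' = (\<lambda>x. 1 / (n + 1) * (u0' x + n * u1' x))"
  define d where "d = (\<lambda>x. 1 / (n + 1) * (u1 x - u0 x))"
  define d' where "d' = (\<lambda>x. 1 / (n + 1) * (u1' x - u0' x))"
  have hs: "H1r s s'" unfolding s_def s'_def by (intro H1r_cmult H1r_add u0 u1)
  have hd: "H1r d d'" unfolding d_def d'_def by (intro H1r_cmult H1r_diff u0 u1)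
  have d0: "d 0 = 0" by (simp add: d_def eq0)
  define a where "a = s x0 / chi x0"
  define c where "c = d x0 / ph1 x0"
  have nn: "n + 1 \<noteq> 0" using n by simp
  have cc: "((u1 x0 - u0 x0) / (n + 1)) / ph1 x0 = c" by (simp add: c_def d_def)
  define ws where "ws = (\<lambda>x. s x - a * chi x)"
  define ws' where "ws' = (\<lambda>x. s' x - a * chi1 x)"
  define wd where "wd = (\<lambda>x. d x - c * ph1 x)"
  define wd' where "wd' = (\<lambda>x. d' x - c * ph2 x)"
  have hws: "H1r ws ws'" unfolding ws_def ws'_def by (intro H1r_cmult H1r_diff hs H1r_phis)
  have hwd: "H1r wd wd'" unfolding wd_def wd'_def by (intro H1r_cmult H1r_diff hd H1r_phis)
  let ?m = "(\<integral>x. phi p x * u0 x \<partial>hl) + n * (\<integral>x. phi p x * u1 x \<partial>hl)"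
  have m: "(\<integral>x. phi p x * s x \<partial>hl) = ?m / (n + 1)"
  proof -
    have i: "integrable hl (\<lambda>x. phi p x * u0 x)" "integrable hl (\<lambda>x. phi p x * u1 x)"
      using u0 u1 by (auto intro!: L2r_mult_integrable L2r_phis simp: H1r_def)
    have "(\<integral>x. phi p x * s x \<partial>hl) = (\<integral>x. 1 / (n + 1) * (phi p x * u0 x + n * (phi p x * u1 x)) \<partial>hl)"
      unfolding s_def by (rule Bochner_Integration.integral_cong) (auto simp: algebra_simps)
    also have "\<dots> = 1 / (n + 1) * ?m" using i by simp
    finally show ?thesis by simp
  qed
  have q1: "\<kappa>0 / 32 * h2 ws ws' + mchi / 2 * a\<^sup>2 \<le> qp s s' + 2 / mchi * (?m / (n + 1))\<^sup>2"
    using qp_shift_chi[OF hs] unfolding m ws_def ws'_def a_def .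
  have q2: "\<kappa>0 / 32 * h2 wd wd' \<le> qp d d'"
    using qp_shift_ph1[OF hd d0] unfolding wd_def wd'_def c_def .
  have e0: "u0 = (\<lambda>x. - n * d x + s x)" "u0' = (\<lambda>x. - n * d' x + s' x)" and e1: "u1 = (\<lambda>x. 1 * d x + s x)" "u1' = (\<lambda>x. 1 * d' x + s' x)"
    unfolding s_def s'_def d_def d'_def using nn by (auto simp: fun_eq_iff divide_simps) (auto simp: algebra_simps)
  have Q: "qp u0 u0' + n * qp u1 u1' = (n + 1) * (qp s s' + n * qp d d')"
    unfolding e0 e1 qp_add_cmult[OF hd hs] by (simp add: power2_eq_square algebra_simps)
  have r0: "(\<lambda>x. u0 x + n * c * ph1 x) = (\<lambda>x. s x + (- n) * wd x)" "(\<lambda>x. u0' x + n * c * ph2 x) = (\<lambda>x. s' x + (- n) * wd' x)"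
    unfolding e0 wd_def wd'_def by (auto simp: fun_eq_iff algebra_simps)
  have r1: "(\<lambda>x. u1 x - c * ph1 x) = (\<lambda>x. s x + wd x)" "(\<lambda>x. u1' x - c * ph2 x) = (\<lambda>x. s' x + wd' x)"
    unfolding e1 wd_def wd'_def by (auto simp: fun_eq_iff algebra_simps)
  have es: "s = (\<lambda>x. a * chi x + ws x)" "s' = (\<lambda>x. a * chi1 x + ws' x)" by (auto simp: ws_def ws'_def)
  have hh: "h2 s s' \<le> 2 * (a\<^sup>2 * Hc) + 2 * h2 ws ws'"
    using h2_add_le[OF H1r_cmult[OF H1r_phis(4)] hws, of a] unfolding h2_cmult Hc_def es[symmetric] .
  have h0: "h2 (\<lambda>x. s x + (- n) * wd x) (\<lambda>x. s' x + (- n) * wd' x) \<le> 2 * h2 s s' + 2 * (n\<^sup>2 * h2 wd wd')"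
    using h2_add_le[OF hs H1r_cmult[OF hwd], of "-n"] unfolding h2_cmult by simp
  have h1: "h2 (\<lambda>x. s x + wd x) (\<lambda>x. s' x + wd' x) \<le> 2 * h2 s s' + 2 * h2 wd wd'"
    by (rule h2_add_le[OF hs hwd])
  have n1: "n * h2 (\<lambda>x. s x + wd x) (\<lambda>x. s' x + wd' x) \<le> n * (2 * h2 s s' + 2 * h2 wd wd')"
    using h1 n by (intro mult_left_mono) auto
  define hw where "hw = h2 ws ws'"
  define hd2 where "hd2 = h2 wd wd'"
  have nonneg: "hw \<ge> 0" "hd2 \<ge> 0" by (simp_all add: hw_def hd2_def h2_nonneg)
  have "h2 (\<lambda>x. u0 x + n * c * ph1 x) (\<lambda>x. u0' x + n * c * ph2 x) + n * h2 (\<lambda>x. u1 x - c * ph1 x) (\<lambda>x. u1' x - c * ph2 x)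
      \<le> 2 * h2 s s' + 2 * (n\<^sup>2 * hd2) + n * (2 * h2 s s' + 2 * hd2)"
    unfolding r0 r1 hd2_def using h0 n1 by linarith
  also have "\<dots> = (n + 1) * (2 * h2 s s' + 2 * n * hd2)" by (simp add: power2_eq_square algebra_simps)
  also have "\<dots> \<le> (n + 1) * (2 * (2 * (a\<^sup>2 * Hc) + 2 * hw) + 2 * n * hd2)"
    using hh n unfolding hw_def by (intro mult_left_mono) auto
  finally have X: "h2 (\<lambda>x. u0 x + n * c * ph1 x) (\<lambda>x. u0' x + n * c * ph2 x) + n * h2 (\<lambda>x. u1 x - c * ph1 x) (\<lambda>x. u1' x - c * ph2 x)
     \<le> (n + 1) * (2 * (2 * (a\<^sup>2 * Hc) + 2 * hw) + 2 * n * hd2)" .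
  have "\<kappa> * (h2 (\<lambda>x. u0 x + n * c * ph1 x) (\<lambda>x. u0' x + n * c * ph2 x) + n * h2 (\<lambda>x. u1 x - c * ph1 x) (\<lambda>x. u1' x - c * ph2 x))
     \<le> \<kappa> * ((n + 1) * (2 * (2 * (a\<^sup>2 * Hc) + 2 * hw) + 2 * n * hd2))"
    using \<kappa> by (intro mult_left_mono[OF X]) auto
  also have "\<dots> = (n + 1) * ((4 * \<kappa> * Hc) * a\<^sup>2 + (4 * \<kappa>) * hw + n * ((2 * \<kappa>) * hd2))"
    by (simp add: algebra_simps)
  also have "\<dots> \<le> (n + 1) * (mchi / 2 * a\<^sup>2 + \<kappa>0 / 32 * hw + n * (\<kappa>0 / 32 * hd2))"
  proof -
    have "(4 * \<kappa> * Hc) * a\<^sup>2 \<le> mchi / 2 * a\<^sup>2" "(4 * \<kappa>) * hw \<le> \<kappa>0 / 32 * hw" 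
      using \<kappa>1 nonneg by (intro mult_right_mono; simp)+
    moreover have "(2 * \<kappa>) * hd2 \<le> \<kappa>0 / 32 * hd2" using \<kappa>1 \<kappa> nonneg by (intro mult_right_mono) linarith+
    then have "n * ((2 * \<kappa>) * hd2) \<le> n * (\<kappa>0 / 32 * hd2)" using n by (intro mult_left_mono) auto
    ultimately show ?thesis using n by (intro mult_left_mono) linarith+
  qed
  also have "\<dots> \<le> (n + 1) * (qp s s' + 2 / mchi * (?m / (n + 1))\<^sup>2 + n * qp d d')"
  proof -
    have "n * (\<kappa>0 / 32 * hd2) \<le> n * qp d d'" using q2 n unfolding hd2_def by (intro mult_left_mono) auto
    then show ?thesis using q1 n unfolding hw_def by (intro mult_left_mono) linarith+
  qed
  also have "\<dots> = qp u0 u0' + n * qp u1 u1' + 2 / mchi * ((n + 1) * (?m / (n + 1))\<^sup>2)"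
    unfolding Q by (simp add: algebra_simps add_divide_distrib)
  also have "(n + 1) * (?m / (n + 1))\<^sup>2 \<le> ?m\<^sup>2"
  proof -
    have "(n + 1) * (?m / (n + 1))\<^sup>2 = ?m\<^sup>2 / (n + 1)" using nn by (simp add: power2_eq_square)
    also have "\<dots> \<le> ?m\<^sup>2 / 1" using n by (intro divide_left_mono) auto
    finally show ?thesis by simp
  qed
  then have "2 / mchi * ((n + 1) * (?m / (n + 1))\<^sup>2) \<le> 2 / mchi * ?m\<^sup>2" using mchi_pos by (intro mult_left_mono) auto
  finally show "let c = ((u1 x0 - u0 x0) / (n + 1)) / ph1 x0 in
      \<kappa> * (h2 (\<lambda>x. u0 x + n * c * ph1 x) (\<lambda>x. u0' x + n * c * ph2 x) + n * h2 (\<lambda>x. u1 x - c * ph1 x) (\<lambda>x. u1' x - c * ph2 x))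
       \<le> qp u0 u0' + n * qp u1 u1' + 2 / mchi * ?m\<^sup>2"
    unfolding cc Let_def by linarith
qed

text \<open>Cauchy-Schwarz against any weight dominated by \<phi>, so that the single constant sqrt
  m0 serves all pairings below.\<close>

lemma integral_phi_bound:
  assumes u: "L2r u" and f: "f \<in> borel_measurable hl" "\<And>x. x \<ge> 0 \<Longrightarrow> \<bar>f x\<bar> \<le> phi p x"
  shows "\<bar>\<integral>x. u x * f x \<partial>hl\<bar> \<le> sqrt m0 * sqrt (\<integral>x. (u x)\<^sup>2 \<partial>hl)" "integrable hl (\<lambda>x. u x * f x)"
proof -
  have Lf: "L2r f" by (rule L2r_bound[OF L2r_phis(1) f(1)]) (use f(2) phi_pos in \<open>auto simp: abs_of_pos\<close>)
  show "integrable hl (\<lambda>x. u x * f x)" by (rule L2r_mult_integrable[OF u Lf])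
  have "(\<integral>x. (f x)\<^sup>2 \<partial>hl) \<le> m0" unfolding m0_def
  proof (rule hl_integral_mono)
    fix x :: real assume "x \<ge> 0"
    then show "(f x)\<^sup>2 \<le> (phi p x)\<^sup>2" using f(2)[of x] phi_pos[of x] by (simp add: abs_le_square_iff[symmetric])
  qed (use Lf L2r_phis(1) in \<open>auto simp: L2r_def\<close>)
  then have "(\<integral>x. (u x)\<^sup>2 \<partial>hl) * (\<integral>x. (f x)\<^sup>2 \<partial>hl) \<le> (\<integral>x. (u x)\<^sup>2 \<partial>hl) * m0"
    by (intro mult_left_mono) auto
  then have "(\<integral>x. u x * f x \<partial>hl)\<^sup>2 \<le> (\<integral>x. (u x)\<^sup>2 \<partial>hl) * m0" using L2r_Cauchy_Schwarz[OF u Lf] by linarith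
  then have "sqrt ((\<integral>x. u x * f x \<partial>hl)\<^sup>2) \<le> sqrt ((\<integral>x. (u x)\<^sup>2 \<partial>hl) * m0)" by (rule real_sqrt_le_mono)
  then show "\<bar>\<integral>x. u x * f x \<partial>hl\<bar> \<le> sqrt m0 * sqrt (\<integral>x. (u x)\<^sup>2 \<partial>hl)" by (simp add: real_sqrt_mult mult.commute)
qed

lemma Su_bound: "\<bar>S x * phi p x\<bar> \<le> phi p x" "\<bar>S x * ph1 x\<bar> \<le> phi p x" "\<bar>T x * S x * ph1 x\<bar> \<le> phi p x"
proof -
  have s: "\<bar>S x\<bar> \<le> 1" "\<bar>T x\<bar> \<le> 1" using S_bounds[of x] T_bounds[of x] by auto
  show "\<bar>S x * phi p x\<bar> \<le> phi p x" using s(1) phi_pos[of x] mult_right_mono[of "\<bar>S x\<bar>" 1 "phi p x"] by (simp add: abs_mult)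
  have a: "\<bar>S x\<bar> * \<bar>ph1 x\<bar> \<le> 1 * phi p x" using s(1) ph_abs(1)[of x] by (intro mult_mono) auto
  then show "\<bar>S x * ph1 x\<bar> \<le> phi p x" by (simp add: abs_mult)
  have "\<bar>T x\<bar> * (\<bar>S x\<bar> * \<bar>ph1 x\<bar>) \<le> 1 * phi p x" using s(2) a phi_pos[of x] by (intro mult_mono) auto
  then show "\<bar>T x * S x * ph1 x\<bar> \<le> phi p x" by (simp add: abs_mult mult.assoc)
qed

lemma abs_integral_le:
  fixes f g :: "real \<Rightarrow> real"
  assumes "integrable hl f" "integrable hl g" "\<And>x. x \<ge> 0 \<Longrightarrow> \<bar>f x\<bar> \<le> g x"
  shows "\<bar>integral\<^sup>L hl f\<bar> \<le> integral\<^sup>L hl g"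
proof -
  have "\<bar>integral\<^sup>L hl f\<bar> \<le> (\<integral>x. \<bar>f x\<bar> \<partial>hl)" using integral_norm_bound[of hl f] by simp
  also have "\<dots> \<le> integral\<^sup>L hl g" by (rule hl_integral_mono) (use assms in auto)
  finally show ?thesis .
qed

section \<open>Expansion of the energy and of the virial rate on one edge\<close>

definition A_of :: "(real \<Rightarrow> real) \<Rightarrow> (real \<Rightarrow> real) \<Rightarrow> real \<Rightarrow> real" where
  "A_of u v x = ((phi p x + u x)\<^sup>2 + (v x)\<^sup>2) powr p"

text \<open>The edge contributions to the derivative of the functional A of the overview.
  \<open>I_e\<close> and \<open>J_e\<close> are the real and imaginary parts of a nonlinear
  remainder paired with \<phi>', \<open>R_e\<close> and \<open>W_e\<close> those of another one
  paired with \<phi>. The subtracted multiples of S cancel the linear terms in u in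
  \<open>I_e\<close> and in v in \<open>W_e\<close>.\<close>

definition I_e :: "(real \<Rightarrow> real) \<Rightarrow> (real \<Rightarrow> real) \<Rightarrow> real" where
  "I_e u v = (\<integral>x. (A_of u v x * (phi p x + u x) - (2 * p + 1) * (S x * (phi p x + u x))) * ph1 x \<partial>hl)"
definition J_e :: "(real \<Rightarrow> real) \<Rightarrow> (real \<Rightarrow> real) \<Rightarrow> real" where
  "J_e u v = (\<integral>x. (A_of u v x * v x - (2 * p + 1) * (S x * v x)) * ph1 x \<partial>hl)"
definition R_e :: "(real \<Rightarrow> real) \<Rightarrow> (real \<Rightarrow> real) \<Rightarrow> real" where
  "R_e u v = (\<integral>x. (S x * (phi p x + u x) - A_of u v x * (phi p x + u x)) * phi p x \<partial>hl)"
definition W_e :: "(real \<Rightarrow> real) \<Rightarrow> (real \<Rightarrow> real) \<Rightarrow> real" where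
  "W_e u v = (\<integral>x. (S x * v x - A_of u v x * v x) * phi p x \<partial>hl)"

context
  fixes u u' v v' :: "real \<Rightarrow> real"
  assumes u: "H1r u u'" and v: "H1r v v'" and small: "h2 u u' + h2 v v' \<le> 1"
begin

abbreviation "hh \<equiv> h2 u u' + h2 v v'"
abbreviation "ZZ x \<equiv> sqrt ((u x)\<^sup>2 + (v x)\<^sup>2)"

lemma L2uv: "L2r u" "L2r v" "L2r u'" "L2r v'"
  using u v by (auto simp: H1r_def)

lemma meas_uv: "u \<in> borel_measurable hl" "v \<in> borel_measurable hl" "u' \<in> borel_measurable hl" "v' \<in> borel_measurable hl"
    "phi p \<in> borel_measurable hl" "ph1 \<in> borel_measurable hl" "S \<in> borel_measurable hl" "T \<in> borel_measurable hl"
    "A_of u v \<in> borel_measurable hl"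
proof -
  show 1: "u \<in> borel_measurable hl" "v \<in> borel_measurable hl" "u' \<in> borel_measurable hl" "v' \<in> borel_measurable hl"
    using L2uv by (auto simp: L2r_def)
  show 2: "phi p \<in> borel_measurable hl" "ph1 \<in> borel_measurable hl" "S \<in> borel_measurable hl" "T \<in> borel_measurable hl"
    by (auto intro!: hl_continuous_measurable cont)
  show "A_of u v \<in> borel_measurable hl" unfolding A_of_def[abs_def]
    by (intro powr_real_measurable borel_measurable_add borel_measurable_power 1 2 borel_measurable_const)
qed

lemma ZZ_sq_le: "x \<ge> 0 \<Longrightarrow> (u x)\<^sup>2 + (v x)\<^sup>2 \<le> hh"
  using H1r_sup_h2[OF u] H1r_sup_h2[OF v] by (rule add_mono)

lemma ZZ_bounds: "x \<ge> 0 \<Longrightarrow> 0 \<le> ZZ x" "x \<ge> 0 \<Longrightarrow> ZZ x \<le> 1" "x \<ge> 0 \<Longrightarrow> (ZZ x)\<^sup>2 = (u x)\<^sup>2 + (v x)\<^sup>2"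
  "x \<ge> 0 \<Longrightarrow> ZZ x ^ 3 \<le> sqrt hh * ((u x)\<^sup>2 + (v x)\<^sup>2)"
proof -
  assume x: "x \<ge> 0"
  show "0 \<le> ZZ x" "(ZZ x)\<^sup>2 = (u x)\<^sup>2 + (v x)\<^sup>2" by simp_all
  show "ZZ x \<le> 1" using ZZ_sq_le[OF x] small by simp
  have "ZZ x ^ 3 = ZZ x * (ZZ x)\<^sup>2" by (simp add: power2_eq_square power3_eq_cube)
  also have "\<dots> \<le> sqrt hh * (ZZ x)\<^sup>2" using ZZ_sq_le[OF x] by (intro mult_right_mono) auto
  finally show "ZZ x ^ 3 \<le> sqrt hh * ((u x)\<^sup>2 + (v x)\<^sup>2)" by simp
qed

lemma int_Z2: "integrable hl (\<lambda>x. (u x)\<^sup>2 + (v x)\<^sup>2)" "(\<integral>x. (u x)\<^sup>2 + (v x)\<^sup>2 \<partial>hl) \<le> hh"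
  using L2uv by (auto simp: L2r_def h2_def)

lemma int_Z3: "integrable hl (\<lambda>x. ZZ x ^ 3)" "(\<integral>x. ZZ x ^ 3 \<partial>hl) \<le> sqrt hh * hh"
proof -
  have i: "integrable hl (\<lambda>x. sqrt hh * ((u x)\<^sup>2 + (v x)\<^sup>2))" using int_Z2(1) by simp
  show j: "integrable hl (\<lambda>x. ZZ x ^ 3)"
  proof (rule integrable_hl_bound[OF i])
    show "(\<lambda>x. ZZ x ^ 3) \<in> borel_measurable hl" using meas_uv by measurable
    show "norm (ZZ x ^ 3) \<le> sqrt hh * ((u x)\<^sup>2 + (v x)\<^sup>2)" if "x \<ge> 0" for x
      using ZZ_bounds(4)[OF that] by simp
  qed
  have "(\<integral>x. ZZ x ^ 3 \<partial>hl) \<le> (\<integral>x. sqrt hh * ((u x)\<^sup>2 + (v x)\<^sup>2) \<partial>hl)"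
    by (rule hl_integral_mono[OF j i ZZ_bounds(4)])
  also have "\<dots> = sqrt hh * (\<integral>x. (u x)\<^sup>2 + (v x)\<^sup>2 \<partial>hl)" by (rule integral_mult_right_zero)
  also have "\<dots> \<le> sqrt hh * hh" using int_Z2(2) by (intro mult_left_mono) (auto simp: h2_nonneg)
  finally show "(\<integral>x. ZZ x ^ 3 \<partial>hl) \<le> sqrt hh * hh" .
qed

text \<open>The mass is added to the energy because \<phi> is a critical point of their sum: the
  linear term vanishes by \<open>phi_form\<close>, separately on each edge. The quadratic terms are
  \<open>qp\<close> and \<open>qm\<close>, and the integrated cubic remainder is the supremum of
  |(u, v)| times the squared norm.\<close>

lemma edge_energy:
  "integrable hl (\<lambda>x. ((phi p x + u x)\<^sup>2 + (v x)\<^sup>2) powr (p + 1))"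
  "(\<integral>x. (ph1 x + u' x)\<^sup>2 + (v' x)\<^sup>2 + ((phi p x + u x)\<^sup>2 + (v x)\<^sup>2) - ((phi p x + u x)\<^sup>2 + (v x)\<^sup>2) powr (p + 1) \<partial>hl)
   \<ge> (\<integral>x. (ph1 x)\<^sup>2 + (phi p x)\<^sup>2 - (phi p x)\<^sup>2 * S x \<partial>hl) + qp u u' + qm v v' - 10^6 * (sqrt hh * hh)"
proof -
  have Lf: "L2r (\<lambda>x. phi p x + u x)" by (intro L2r_add L2r_phis L2uv)
  have i0: "integrable hl (\<lambda>x. (phi p x + u x)\<^sup>2 + (v x)\<^sup>2)" using Lf L2uv by (auto simp: L2r_def)
  have b: "((phi p x + u x)\<^sup>2 + (v x)\<^sup>2) powr (p + 1) \<le> 5 powr p * ((phi p x + u x)\<^sup>2 + (v x)\<^sup>2)" if x: "x \<ge> 0" for x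
  proof -
    have "(phi p x + u x)\<^sup>2 \<le> 2 * (phi p x)\<^sup>2 + 2 * (u x)\<^sup>2"
    proof -
      have "0 \<le> (phi p x - u x)\<^sup>2" by simp
      then show ?thesis by (simp add: power2_eq_square algebra_simps)
    qed
    moreover have "(phi p x)\<^sup>2 \<le> 1" using phi_le_1[of x] phi_pos[of x] by (simp add: power_le_one)
    ultimately have le: "(phi p x + u x)\<^sup>2 + (v x)\<^sup>2 \<le> 5" using ZZ_sq_le[OF x] small by (smt (verit) zero_le_power2)
    have "((phi p x + u x)\<^sup>2 + (v x)\<^sup>2) powr (p + 1) = ((phi p x + u x)\<^sup>2 + (v x)\<^sup>2) powr p * ((phi p x + u x)\<^sup>2 + (v x)\<^sup>2)"
      by (simp add: powr_add)
    also have "\<dots> \<le> 5 powr p * ((phi p x + u x)\<^sup>2 + (v x)\<^sup>2)"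
      using le by (intro mult_right_mono powr_mono2) auto
    finally show ?thesis .
  qed
  show i1: "integrable hl (\<lambda>x. ((phi p x + u x)\<^sup>2 + (v x)\<^sup>2) powr (p + 1))"
  proof (rule integrable_hl_bound)
    show "integrable hl (\<lambda>x. 5 powr p * ((phi p x + u x)\<^sup>2 + (v x)\<^sup>2))" using i0 by simp
    show "(\<lambda>x. ((phi p x + u x)\<^sup>2 + (v x)\<^sup>2) powr (p + 1)) \<in> borel_measurable hl" 
      by (intro powr_real_measurable borel_measurable_add borel_measurable_power meas_uv borel_measurable_const)
  qed (use b in simp)
  let ?R = "\<lambda>x. ((ph1 x)\<^sup>2 + (phi p x)\<^sup>2 - (phi p x)\<^sup>2 * S x) + 2 * (ph1 x * u' x + Vm x * phi p x * u x)
      + ((u' x)\<^sup>2 + Vp x * (u x)\<^sup>2) + ((v' x)\<^sup>2 + Vm x * (v x)\<^sup>2) - 10^6 * ZZ x ^ 3"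
  let ?L = "\<lambda>x. (ph1 x + u' x)\<^sup>2 + (v' x)\<^sup>2 + ((phi p x + u x)\<^sup>2 + (v x)\<^sup>2) - ((phi p x + u x)\<^sup>2 + (v x)\<^sup>2) powr (p + 1)"
  have LV: "L2r (\<lambda>x. Vm x * w x)" if "L2r w" for w
    by (rule L2r_bounded_mult[OF that hl_continuous_measurable[OF cont(6)] Vm_bound])
  have LS: "L2r (\<lambda>x. S x * phi p x)"
    by (rule L2r_bound[OF L2r_phis(1)]) (use Su_bound(1) phi_pos meas_uv in \<open>auto simp: abs_of_pos\<close>)
  have j1: "integrable hl (\<lambda>x. (ph1 x)\<^sup>2 + (phi p x)\<^sup>2 - (phi p x)\<^sup>2 * S x)"
  proof -
    have "integrable hl (\<lambda>x. phi p x * (S x * phi p x))" by (rule L2r_mult_integrable[OF L2r_phis(1) LS])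
    then have "integrable hl (\<lambda>x. (phi p x)\<^sup>2 * S x)" by (simp add: power2_eq_square mult_ac)
    then show ?thesis using L2r_phis(1,2) by (auto simp: L2r_def)
  qed
  have j2: "integrable hl (\<lambda>x. ph1 x * u' x + Vm x * phi p x * u x)"
    using L2r_mult_integrable[OF LV[OF L2r_phis(1)] L2uv(1)] L2r_mult_integrable[OF L2r_phis(2) L2uv(3)]
    by auto
  have j3: "integrable hl (\<lambda>x. (u' x)\<^sup>2 + Vp x * (u x)\<^sup>2)" 
    using L2r_mult_integrable[OF L2r_Vp[OF L2uv(1)] L2uv(1)] L2uv(3) by (simp add: L2r_def power2_eq_square mult.assoc)
  have j4: "integrable hl (\<lambda>x. (v' x)\<^sup>2 + Vm x * (v x)\<^sup>2)" 
    using L2r_mult_integrable[OF LV[OF L2uv(2)] L2uv(2)] L2uv(4) by (simp add: L2r_def power2_eq_square mult.assoc)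
  have "integral\<^sup>L hl ?L \<ge> integral\<^sup>L hl ?R"
  proof (rule hl_integral_mono)
    show "integrable hl ?R"
      by (intro Bochner_Integration.integrable_add Bochner_Integration.integrable_diff integrable_mult_right j1 j2 j3 j4 int_Z3(1))
    show "integrable hl ?L" using i0 i1 L2r_add[OF L2r_phis(2) L2uv(3)] L2uv(4) by (auto simp: L2r_def)
    fix x :: real assume x: "x \<ge> 0"
    have "((phi p x + u x)\<^sup>2 + (v x)\<^sup>2) powr (p + 1) \<le> (phi p x)\<^sup>2 * S x + (2 * p + 2) * (phi p x * S x * u x)
        + (p + 1) * (S x * ((2 * p + 1) * (u x)\<^sup>2 + (v x)\<^sup>2)) + 10^6 * ZZ x ^ 3"
      using energy_taylor[OF phi_pos phi_le_1 ZZ_bounds(1-3)[OF x]] unfolding phi_powr .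
    then show "?R x \<le> ?L x" unfolding Vm_def Vp_def by (simp add: power2_eq_square algebra_simps)
  qed
  also have "integral\<^sup>L hl ?R = (\<integral>x. (ph1 x)\<^sup>2 + (phi p x)\<^sup>2 - (phi p x)\<^sup>2 * S x \<partial>hl) + 2 * (\<integral>x. ph1 x * u' x + Vm x * phi p x * u x \<partial>hl)
      + qp u u' + qm v v' - 10^6 * (\<integral>x. ZZ x ^ 3 \<partial>hl)"
    unfolding qp_def qm_def using j1 j2 j3 j4 int_Z3(1) by (simp del: distrib_left_numeral)
  finally show "integral\<^sup>L hl ?L \<ge> (\<integral>x. (ph1 x)\<^sup>2 + (phi p x)\<^sup>2 - (phi p x)\<^sup>2 * S x \<partial>hl) + qp u u' + qm v v' - 10^6 * (sqrt hh * hh)"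
    using int_Z3(2) phi_form[OF u] by simp
qed

lemma A_le: "x \<ge> 0 \<Longrightarrow> \<bar>A_of u v x\<bar> \<le> 25"
proof -
  assume x: "x \<ge> 0"
  have "(phi p x + u x)\<^sup>2 \<le> 2 * (phi p x)\<^sup>2 + 2 * (u x)\<^sup>2"
  proof -
    have "0 \<le> (phi p x - u x)\<^sup>2" by simp
    then show ?thesis by (simp add: power2_eq_square algebra_simps)
  qed
  moreover have "(phi p x)\<^sup>2 \<le> 1" using phi_le_1[of x] phi_pos[of x] by (simp add: power_le_one)
  ultimately have le: "(phi p x + u x)\<^sup>2 + (v x)\<^sup>2 \<le> 5" using ZZ_sq_le[OF x] small by (smt (verit) zero_le_power2)
  have "A_of u v x \<le> 5 powr p" unfolding A_of_def using le by (intro powr_mono2) auto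
  also have "\<dots> \<le> 5 powr 2" using p_lt by (intro powr_mono) auto
  finally show ?thesis by (simp add: A_of_def)
qed

lemma nl_L2: "L2r (\<lambda>x. A_of u v x * (phi p x + u x))" "L2r (\<lambda>x. A_of u v x * v x)"
    "L2r (\<lambda>x. S x * (phi p x + u x))" "L2r (\<lambda>x. S x * v x)"
proof -
  have S1: "\<bar>S x\<bar> \<le> 1" for x using S_bounds[of x] by auto
  show "L2r (\<lambda>x. A_of u v x * (phi p x + u x))" "L2r (\<lambda>x. A_of u v x * v x)"
    by (intro L2r_bounded_mult[OF _ meas_uv(9) A_le] L2r_add L2r_phis L2uv; assumption)+
  show "L2r (\<lambda>x. S x * (phi p x + u x))" "L2r (\<lambda>x. S x * v x)"
    by (intro L2r_bounded_mult[OF _ meas_uv(7) S1] L2r_add L2r_phis L2uv)+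
qed

text \<open>Multiplying \<open>nonlin_taylor2\<close> by - T produces the pairing with
  \<open>ph1\<close>. The choice of the factor 2p + 1 in \<open>I_e\<close> removes the term linear
  in u; the remaining quadratic term in u is the source of the growth.\<close>

lemma I_e_bound:
  "\<bar>I_e u v + 2 * p * (\<integral>x. S x * phi p x * ph1 x \<partial>hl) + p * (2 * p + 1) * (\<integral>x. T x * S x * (u x)\<^sup>2 \<partial>hl)\<bar>
     \<le> 2 * (\<integral>x. (v x)\<^sup>2 \<partial>hl) + 10^6 * (sqrt hh * hh)"
proof -
  have TS: "\<bar>T x * S x\<bar> \<le> 1" for x using S_bounds[of x] T_bounds[of x] by (auto simp: abs_mult intro!: mult_le_one)
  have mTS: "(\<lambda>x. T x * S x) \<in> borel_measurable hl" using meas_uv by measurable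
  have i1: "integrable hl (\<lambda>x. (A_of u v x * (phi p x + u x) - (2 * p + 1) * (S x * (phi p x + u x))) * ph1 x)"
    by (intro L2r_mult_integrable L2r_diff L2r_cmult nl_L2 L2r_phis)
  have i2: "integrable hl (\<lambda>x. S x * phi p x * ph1 x)"
    using integral_phi_bound(2)[OF L2r_phis(2), of "\<lambda>x. S x * phi p x"] Su_bound meas_uv by (auto simp: mult.commute)
  have i3: "integrable hl (\<lambda>x. T x * S x * (u x)\<^sup>2)"
    using L2r_mult_integrable[OF L2r_bounded_mult[OF L2uv(1) mTS TS] L2uv(1)] by (simp add: power2_eq_square mult.assoc)
  have "\<bar>\<integral>x. (A_of u v x * (phi p x + u x) - (2 * p + 1) * (S x * (phi p x + u x))) * ph1 x + 2 * p * (S x * phi p x * ph1 x)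
      + p * (2 * p + 1) * (T x * S x * (u x)\<^sup>2) \<partial>hl\<bar> \<le> (\<integral>x. 2 * (v x)\<^sup>2 + 10^6 * ZZ x ^ 3 \<partial>hl)"
  proof (rule abs_integral_le)
    show "integrable hl (\<lambda>x. 2 * (v x)\<^sup>2 + 10^6 * ZZ x ^ 3)" using L2uv(2) int_Z3(1) by (auto simp: L2r_def)
    show "integrable hl (\<lambda>x. (A_of u v x * (phi p x + u x) - (2 * p + 1) * (S x * (phi p x + u x))) * ph1 x + 2 * p * (S x * phi p x * ph1 x)
      + p * (2 * p + 1) * (T x * S x * (u x)\<^sup>2))" using i1 i2 i3 by simp
    fix x :: real assume x: "x \<ge> 0"
    let ?E = "phi p x * (A_of u v x * (phi p x + u x)) - (phi p x)\<^sup>2 * S x - (2 * p + 1) * (phi p x * S x * u x) - S x * (p * (2 * p + 1) * (u x)\<^sup>2 + p * (v x)\<^sup>2)"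
    have E: "\<bar>?E\<bar> \<le> 10^6 * ZZ x ^ 3"
      using nonlin_taylor2[OF phi_pos phi_le_1 ZZ_bounds(1-3)[OF x]] unfolding phi_powr A_of_def .
    have "(A_of u v x * (phi p x + u x) - (2 * p + 1) * (S x * (phi p x + u x))) * ph1 x + 2 * p * (S x * phi p x * ph1 x)
      + p * (2 * p + 1) * (T x * S x * (u x)\<^sup>2) = - (T x * ?E) - p * (T x * S x * (v x)\<^sup>2)"
      unfolding ph1_def by (simp add: power2_eq_square algebra_simps)
    moreover have "\<bar>T x * ?E\<bar> \<le> 1 * (10^6 * ZZ x ^ 3)"
      unfolding abs_mult[of "T x"] using E T_bounds[of x] by (intro mult_mono) auto
    moreover have "\<bar>p * (T x * S x * (v x)\<^sup>2)\<bar> \<le> 2 * (1 * (v x)\<^sup>2)"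
      unfolding abs_mult[of p] abs_mult[of "T x * S x"] using TS[of x] p_lt by (intro mult_mono) auto
    ultimately show "\<bar>(A_of u v x * (phi p x + u x) - (2 * p + 1) * (S x * (phi p x + u x))) * ph1 x + 2 * p * (S x * phi p x * ph1 x)
      + p * (2 * p + 1) * (T x * S x * (u x)\<^sup>2)\<bar> \<le> 2 * (v x)\<^sup>2 + 10^6 * ZZ x ^ 3" by linarith
  qed
  also have "\<dots> \<le> 2 * (\<integral>x. (v x)\<^sup>2 \<partial>hl) + 10^6 * (sqrt hh * hh)"
    using L2uv(2) int_Z3 by (simp add: L2r_def)
  finally show ?thesis unfolding I_e_def using i1 i2 i3 by simp
qed

lemma int_Z2_const: "integrable hl (\<lambda>x. 10^6 * ((u x)\<^sup>2 + (v x)\<^sup>2))" "(\<integral>x. 10^6 * ((u x)\<^sup>2 + (v x)\<^sup>2) \<partial>hl) \<le> 10^6 * hh"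
  using int_Z2 by (simp_all only: integral_mult_right_zero integrable_mult_right) simp

lemma nl1: "x \<ge> 0 \<Longrightarrow> \<bar>A_of u v x * (phi p x + u x) - phi p x * S x - (2 * p + 1) * (S x * u x)\<bar> \<le> 10^6 * ((u x)\<^sup>2 + (v x)\<^sup>2)"
  "x \<ge> 0 \<Longrightarrow> \<bar>A_of u v x * v x - S x * v x\<bar> \<le> 10^6 * ((u x)\<^sup>2 + (v x)\<^sup>2)"
  using nonlin_taylor1[OF phi_pos phi_le_1 ZZ_bounds(1-3)] ZZ_bounds(3) unfolding phi_powr A_of_def by metis+

text \<open>A term linear in v survives here. It is harmless because in \<open>Bfun\<close> its
  partner is a pairing of v with \<phi>, which supplies a second small factor.\<close>

lemma J_e_bound: "\<bar>J_e u v\<bar> \<le> 4 * (sqrt m0 * sqrt (\<integral>x. (v x)\<^sup>2 \<partial>hl)) + 10^6 * hh"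
proof -
  have i1: "integrable hl (\<lambda>x. (A_of u v x * v x - S x * v x) * ph1 x)"
    by (intro L2r_mult_integrable L2r_diff nl_L2 L2r_phis)
  note i2 = integral_phi_bound[OF L2uv(2), of "\<lambda>x. S x * ph1 x"]
  have i2': "integrable hl (\<lambda>x. v x * (S x * ph1 x))" "\<bar>\<integral>x. v x * (S x * ph1 x) \<partial>hl\<bar> \<le> sqrt m0 * sqrt (\<integral>x. (v x)\<^sup>2 \<partial>hl)"
    using i2 Su_bound meas_uv by auto
  have "J_e u v = (\<integral>x. (A_of u v x * v x - S x * v x) * ph1 x - 2 * p * (v x * (S x * ph1 x)) \<partial>hl)"
    unfolding J_e_def by (rule Bochner_Integration.integral_cong) (auto simp: algebra_simps)
  also have "\<dots> = (\<integral>x. (A_of u v x * v x - S x * v x) * ph1 x \<partial>hl) - 2 * p * (\<integral>x. v x * (S x * ph1 x) \<partial>hl)"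
    using i1 i2'(1) by simp
  finally have e: "J_e u v = (\<integral>x. (A_of u v x * v x - S x * v x) * ph1 x \<partial>hl) - 2 * p * (\<integral>x. v x * (S x * ph1 x) \<partial>hl)" .
  have "\<bar>\<integral>x. (A_of u v x * v x - S x * v x) * ph1 x \<partial>hl\<bar> \<le> (\<integral>x. 10^6 * ((u x)\<^sup>2 + (v x)\<^sup>2) \<partial>hl)"
  proof (rule abs_integral_le[OF i1])
    fix x :: real assume x: "x \<ge> 0"
    have "\<bar>A_of u v x * v x - S x * v x\<bar> * \<bar>ph1 x\<bar> \<le> (10^6 * ((u x)\<^sup>2 + (v x)\<^sup>2)) * 1"
      using nl1(2)[OF x] ph_abs(1)[of x] phi_le_1[of x] by (intro mult_mono) auto
    then show "\<bar>(A_of u v x * v x - S x * v x) * ph1 x\<bar> \<le> 10^6 * ((u x)\<^sup>2 + (v x)\<^sup>2)" by (simp add: abs_mult)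
  qed (rule int_Z2_const(1))
  moreover have "\<bar>2 * p * (\<integral>x. v x * (S x * ph1 x) \<partial>hl)\<bar> \<le> 4 * (sqrt m0 * sqrt (\<integral>x. (v x)\<^sup>2 \<partial>hl))"
    unfolding abs_mult[of "2 * p"] using i2'(2) p_lt by (intro mult_mono) auto
  ultimately show ?thesis using e int_Z2_const by linarith
qed

text \<open>The linear term is kept exactly and not estimated, because its kernel part cancels only
  after summation over the edges.\<close>

lemma R_e_bound: "\<bar>R_e u v + 2 * p * (\<integral>x. u x * (S x * phi p x) \<partial>hl)\<bar> \<le> 10^6 * hh"
proof -
  have i1: "integrable hl (\<lambda>x. (S x * (phi p x + u x) - A_of u v x * (phi p x + u x)) * phi p x)"
    by (intro L2r_mult_integrable L2r_diff nl_L2 L2r_phis)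
  have i2: "integrable hl (\<lambda>x. u x * (S x * phi p x))"
    using integral_phi_bound(2)[OF L2uv(1), of "\<lambda>x. S x * phi p x"] Su_bound meas_uv by auto
  have "\<bar>\<integral>x. (S x * (phi p x + u x) - A_of u v x * (phi p x + u x)) * phi p x + 2 * p * (u x * (S x * phi p x)) \<partial>hl\<bar>
      \<le> (\<integral>x. 10^6 * ((u x)\<^sup>2 + (v x)\<^sup>2) \<partial>hl)"
  proof (rule abs_integral_le)
    fix x :: real assume x: "x \<ge> 0"
    let ?E = "A_of u v x * (phi p x + u x) - phi p x * S x - (2 * p + 1) * (S x * u x)"
    have "\<bar>?E\<bar> * \<bar>phi p x\<bar> \<le> (10^6 * ((u x)\<^sup>2 + (v x)\<^sup>2)) * 1"
      using nl1(1)[OF x] phi_pos[of x] phi_le_1[of x] by (intro mult_mono) auto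
    moreover have "(S x * (phi p x + u x) - A_of u v x * (phi p x + u x)) * phi p x + 2 * p * (u x * (S x * phi p x)) = - (?E * phi p x)"
      by (simp add: algebra_simps)
    ultimately show "\<bar>(S x * (phi p x + u x) - A_of u v x * (phi p x + u x)) * phi p x + 2 * p * (u x * (S x * phi p x))\<bar> \<le> 10^6 * ((u x)\<^sup>2 + (v x)\<^sup>2)"
      by (simp add: abs_mult)
  qed (use int_Z2_const(1) i1 i2 in \<open>simp_all del: power_numeral distrib_left_numeral\<close>)
  then show ?thesis unfolding R_e_def using i1 i2 int_Z2_const by simp
qed

lemma W_e_bound: "\<bar>W_e u v\<bar> \<le> 10^6 * hh"
proof -
  have i1: "integrable hl (\<lambda>x. (S x * v x - A_of u v x * v x) * phi p x)"
    by (intro L2r_mult_integrable L2r_diff nl_L2 L2r_phis)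
  have "\<bar>W_e u v\<bar> \<le> (\<integral>x. 10^6 * ((u x)\<^sup>2 + (v x)\<^sup>2) \<partial>hl)"
    unfolding W_e_def
  proof (rule abs_integral_le[OF i1])
    fix x :: real assume x: "x \<ge> 0"
    have "\<bar>S x * v x - A_of u v x * v x\<bar> * \<bar>phi p x\<bar> \<le> (10^6 * ((u x)\<^sup>2 + (v x)\<^sup>2)) * 1"
      using nl1(2)[OF x] phi_pos[of x] phi_le_1[of x] by (intro mult_mono) auto
    then show "\<bar>(S x * v x - A_of u v x * v x) * phi p x\<bar> \<le> 10^6 * ((u x)\<^sup>2 + (v x)\<^sup>2)" by (simp add: abs_mult)
  qed (rule int_Z2_const(1))
  then show ?thesis using int_Z2_const by linarith
qed

end

end

text \<open>The algebra of the trapping argument: \<open>c\<close> is the coordinate along the kernel of the second variation,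
  \<open>y\<close> the size of the remaining components, \<open>z\<close> the total size, \<open>\<eta>\<close> the energy defect.\<close>

lemma trapping_inequality:
  fixes \<kappa> C K :: real
  assumes "\<kappa> > 0" "C \<ge> 1" "K > 0"
  obtains \<epsilon> k where "\<epsilon> > 0" "k > 0"
    "\<And>c y z \<eta> B. \<lbrakk>0 \<le> y; 0 \<le> z; z \<le> \<epsilon>; z \<le> C * (\<bar>c\<bar> + y); 0 \<le> \<eta>; \<kappa> * y\<^sup>2 + \<eta> \<le> C * z^3;
       B \<ge> K * c\<^sup>2 - C * (z * y + z^3)\<rbrakk> \<Longrightarrow> B \<ge> k * \<eta>"
proof
  define D where "D = 4 * C^3 / \<kappa>"
  define \<mu> where "\<mu> = min 1 (K / (8 * C\<^sup>2))"
  define \<epsilon> where "\<epsilon> = min (\<kappa> / (4 * C^3)) (min (\<mu>\<^sup>2 / D) (K / (16 * C^3)))"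
  have C: "C > 0" using assms by simp
  have D: "D > 0" using assms C by (simp add: D_def)
  have \<mu>: "0 < \<mu>" "\<mu> \<le> 1" "\<mu> * (8 * C\<^sup>2) \<le> K"
  proof -
    show "0 < \<mu>" "\<mu> \<le> 1" using assms C by (auto simp: \<mu>_def)
    have "\<mu> \<le> K / (8 * C\<^sup>2)" by (simp add: \<mu>_def)
    then show "\<mu> * (8 * C\<^sup>2) \<le> K" using C by (simp add: pos_le_divide_eq)
  qed
  show "\<epsilon> > 0" using assms C D \<mu> by (simp add: \<epsilon>_def)
  show "K / \<kappa> > 0" using assms by simp
  have e1: "\<epsilon> * (4 * C^3) \<le> \<kappa>" and e2: "\<epsilon> * D \<le> \<mu>\<^sup>2" and e3: "\<epsilon> * (16 * C^3) \<le> K"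
  proof -
    have "\<epsilon> \<le> \<kappa> / (4 * C^3)" "\<epsilon> \<le> \<mu>\<^sup>2 / D" "\<epsilon> \<le> K / (16 * C^3)" by (auto simp: \<epsilon>_def)
    then show "\<epsilon> * (4 * C^3) \<le> \<kappa>" "\<epsilon> * D \<le> \<mu>\<^sup>2" "\<epsilon> * (16 * C^3) \<le> K"
      using C D by (simp_all add: pos_le_divide_eq)
  qed
  fix c y z \<eta> B :: real
  assume y: "0 \<le> y" and z: "0 \<le> z" "z \<le> \<epsilon>" and zc: "z \<le> C * (\<bar>c\<bar> + y)"
    and \<eta>: "0 \<le> \<eta>" and en: "\<kappa> * y\<^sup>2 + \<eta> \<le> C * z^3" and B: "B \<ge> K * c\<^sup>2 - C * (z * y + z^3)"
  have z2: "z\<^sup>2 \<le> 2 * C\<^sup>2 * (c\<^sup>2 + y\<^sup>2)"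
  proof -
    have "z\<^sup>2 \<le> (C * (\<bar>c\<bar> + y))\<^sup>2" using zc z by (intro power_mono) auto
    also have "\<dots> = C\<^sup>2 * (\<bar>c\<bar> + y)\<^sup>2" by (simp add: power_mult_distrib)
    also have "(\<bar>c\<bar> + y)\<^sup>2 \<le> 2 * (c\<^sup>2 + y\<^sup>2)"
    proof -
      have "0 \<le> (\<bar>c\<bar> - y)\<^sup>2" by simp
      then show ?thesis by (simp add: power2_eq_square algebra_simps)
    qed
    then have "C\<^sup>2 * (\<bar>c\<bar> + y)\<^sup>2 \<le> C\<^sup>2 * (2 * (c\<^sup>2 + y\<^sup>2))" by (rule mult_left_mono) simp
    finally show ?thesis by (simp add: algebra_simps)
  qed
  have z3: "z^3 \<le> \<epsilon> * (2 * C\<^sup>2 * (c\<^sup>2 + y\<^sup>2))"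
  proof -
    have "z^3 = z * z\<^sup>2" by (simp add: power2_eq_square power3_eq_cube)
    also have "\<dots> \<le> \<epsilon> * (2 * C\<^sup>2 * (c\<^sup>2 + y\<^sup>2))" using z z2 by (intro mult_mono) auto
    finally show ?thesis .
  qed
  have "C * z^3 \<le> C * (\<epsilon> * (2 * C\<^sup>2 * (c\<^sup>2 + y\<^sup>2)))" using z3 C by (intro mult_left_mono) auto
  also have "\<dots> = \<epsilon> * (4 * C^3) / 2 * c\<^sup>2 + \<epsilon> * (4 * C^3) / 2 * y\<^sup>2"
    by (simp add: power2_eq_square power3_eq_cube algebra_simps)
  finally have Cz3: "C * z^3 \<le> \<epsilon> * (4 * C^3) / 2 * c\<^sup>2 + \<epsilon> * (4 * C^3) / 2 * y\<^sup>2" .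
  have "\<epsilon> * (4 * C^3) / 2 * y\<^sup>2 \<le> \<kappa> / 2 * y\<^sup>2" using e1 by (intro mult_right_mono) auto
  then have key: "\<kappa> / 2 * y\<^sup>2 + \<eta> \<le> \<epsilon> * (4 * C^3) / 2 * c\<^sup>2" using en Cz3 by linarith
    have "\<kappa> / 2 * y\<^sup>2 \<le> \<epsilon> * (4 * C^3) / 2 * c\<^sup>2" using key \<eta> by linarith
    then have "y\<^sup>2 \<le> (\<epsilon> * D) * c\<^sup>2" using assms by (simp add: D_def field_simps)
    also have "\<dots> \<le> \<mu>\<^sup>2 * c\<^sup>2" using e2 by (intro mult_right_mono) auto
    finally have "y\<^sup>2 \<le> \<mu>\<^sup>2 * c\<^sup>2" .
    then have "y\<^sup>2 \<le> (\<mu> * \<bar>c\<bar>)\<^sup>2" by (simp add: power_mult_distrib)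
    then have ym: "y \<le> \<mu> * \<bar>c\<bar>" using \<mu> by (intro power2_le_imp_le[of y]) auto
    have y1: "y \<le> \<bar>c\<bar>" using ym \<mu> mult_right_mono[of \<mu> 1 "\<bar>c\<bar>"] by simp
    have "z * y \<le> (C * (\<bar>c\<bar> + y)) * y" using zc y by (intro mult_right_mono)
    also have "\<dots> \<le> (C * (\<bar>c\<bar> + \<bar>c\<bar>)) * (\<mu> * \<bar>c\<bar>)" using y y1 ym C by (intro mult_mono mult_nonneg_nonneg) auto
    also have "\<dots> = 2 * C * \<mu> * c\<^sup>2" by (simp add: power2_eq_square)
    finally have zy: "z * y \<le> 2 * C * \<mu> * c\<^sup>2" .
    have "y\<^sup>2 \<le> c\<^sup>2" using power_mono[OF y1 y, of 2] by simp
    then have "\<epsilon> * (2 * C\<^sup>2 * (c\<^sup>2 + y\<^sup>2)) \<le> \<epsilon> * (2 * C\<^sup>2 * (c\<^sup>2 + c\<^sup>2))"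
      using \<open>\<epsilon> > 0\<close> by (intro mult_left_mono) auto
    then have z3': "z^3 \<le> 4 * C\<^sup>2 * \<epsilon> * c\<^sup>2" using z3 by (simp add: algebra_simps)
    have "C * (z * y + z^3) \<le> C * (2 * C * \<mu> * c\<^sup>2 + 4 * C\<^sup>2 * \<epsilon> * c\<^sup>2)"
      using zy z3' C by (intro mult_left_mono) auto
    also have "\<dots> = (\<mu> * (8 * C\<^sup>2)) / 4 * c\<^sup>2 + (\<epsilon> * (16 * C^3)) / 4 * c\<^sup>2"
      by (simp add: power2_eq_square power3_eq_cube algebra_simps)
    also have "\<dots> \<le> K / 4 * c\<^sup>2 + K / 4 * c\<^sup>2"
      using \<mu>(3) e3 by (intro add_mono mult_right_mono) auto
    finally have B2: "B \<ge> K / 2 * c\<^sup>2" using B by linarith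
    have "\<epsilon> * (4 * C^3) / 2 * c\<^sup>2 \<le> \<kappa> / 2 * c\<^sup>2" using e1 by (intro mult_right_mono) auto
    moreover have "0 \<le> \<kappa> / 2 * y\<^sup>2" using assms by simp
    ultimately have "\<eta> \<le> \<kappa> / 2 * c\<^sup>2" using key by linarith
    then have "K / \<kappa> * \<eta> \<le> K / \<kappa> * (\<kappa> / 2 * c\<^sup>2)" using assms by (intro mult_left_mono) auto
    also have "\<dots> = K / 2 * c\<^sup>2" using assms by simp
    finally show "B \<ge> K / \<kappa> * \<eta>" using B2 by linarith
qed

section \<open>The trapping estimate for two profiles\<close>

context half_soliton begin

text \<open>The quadratic integral of \<open>I_e_bound\<close> evaluated on \<phi>' itself; its
  positivity makes the kernel coordinate drive the growth.\<close>

definition tau3 :: real where "tau3 = (\<integral>x. T x * S x * (ph1 x)\<^sup>2 \<partial>hl)"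

lemma phi_bounded_facts:
  "(\<lambda>x. S x * phi p x) \<in> borel_measurable hl" "(\<lambda>x. T x * S x * ph1 x) \<in> borel_measurable hl"
  "phi p \<in> borel_measurable hl" "ph1 \<in> borel_measurable hl"
  "\<bar>phi p x\<bar> \<le> phi p x"
  by (auto intro!: hl_continuous_measurable continuous_intros cont simp: phi_pos less_imp_le)

lemma tau3_pos: "tau3 > 0" and tau3_int: "integrable hl (\<lambda>x. T x * S x * (ph1 x)\<^sup>2)"
proof -
  have "integrable hl (\<lambda>x. ph1 x * (T x * S x * ph1 x))"
    by (rule integral_phi_bound(2)[OF L2r_phis(2) phi_bounded_facts(2) Su_bound(3)])
  then show i: "integrable hl (\<lambda>x. T x * S x * (ph1 x)\<^sup>2)" by (simp add: power2_eq_square mult_ac)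
  show "tau3 > 0" unfolding tau3_def
  proof (rule integral_pos_hl[OF i])
    fix x :: real
    show "0 \<le> T x * S x * (ph1 x)\<^sup>2" if "0 \<le> x" using that T_bounds(3)[of x] S_bounds[of x] by simp
    show "0 < T x * S x * (ph1 x)\<^sup>2" if "0 < x"
      using that T_bounds(4)[of x] S_bounds[of x] phi_pos[of x] by (simp add: ph1_def)
  qed
qed

text \<open>The time derivative of the functional A of the overview divided by p + 1, in terms of
  the two profiles; see \<open>Rate_Bfun\<close> and \<open>virial_deriv\<close>. Of the four
  products only the first contributes at order c^2; the others are of order z y + z^3 in the
  notation of \<open>trap\<close>.\<close>

definition Bfun :: "real \<Rightarrow> (real \<Rightarrow> real) \<Rightarrow> (real \<Rightarrow> real) \<Rightarrow> (real \<Rightarrow> real) \<Rightarrow> (real \<Rightarrow> real) \<Rightarrow> real" where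
  "Bfun n u0 v0 u1 v1 =
     (n * (I_e u1 v1 - I_e u0 v0)) * ((\<integral>x. (phi p x + u0 x) * phi p x \<partial>hl) + n * (\<integral>x. (phi p x + u1 x) * phi p x \<partial>hl))
   + (n * (J_e u1 v1 - J_e u0 v0)) * ((\<integral>x. v0 x * phi p x \<partial>hl) + n * (\<integral>x. v1 x * phi p x \<partial>hl))
   + (n * ((\<integral>x. (phi p x + u1 x) * ph1 x \<partial>hl) - (\<integral>x. (phi p x + u0 x) * ph1 x \<partial>hl))) * (R_e u0 v0 + n * R_e u1 v1)
   + (n * ((\<integral>x. v1 x * ph1 x \<partial>hl) - (\<integral>x. v0 x * ph1 x \<partial>hl))) * (W_e u0 v0 + n * W_e u1 v1)"

text \<open>The factor n (n^2 - 1) is minus the sum of the cubes of the weights c_j; it is positive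
  exactly when n > 1, that is for N \<ge> 3.\<close>

definition kk1 :: "real \<Rightarrow> real" where "kk1 n = n * (p * (2 * p + 1)) * (n\<^sup>2 - 1) * tau3"

text \<open>The constant terms 2p \<integral> S \<phi> \<phi>' agree on the two edges and cancel in
  the difference. What remains is p (2p + 1) (X0 - X1), where the kernel parts of u0 and u1
  contribute n^2 c^2 and c^2 times \<open>tau3\<close>, and every other term contains a factor y or
  is cubic.\<close>

lemma a1_bound:
  fixes n c y z C1 :: real
  assumes n: "n \<ge> 1" and H: "H1r u0 u0'" "H1r v0 v0'" "H1r u1 u1'" "H1r v1 v1'"
    and y: "0 \<le> y" and z: "0 \<le> z" "z \<le> 1"
    and zb: "h2 u0 u0' + h2 v0 v0' \<le> z\<^sup>2" "h2 u1 u1' + h2 v1 v1' \<le> z\<^sup>2"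
    and r0: "H1r r0 r0'" "u0 = (\<lambda>x. - n * c * ph1 x + r0 x)" and r1: "H1r r1 r1'" "u1 = (\<lambda>x. c * ph1 x + r1 x)"
    and yb: "h2 r0 r0' \<le> y\<^sup>2" "h2 r1 r1' \<le> y\<^sup>2" "h2 v0 v0' \<le> y\<^sup>2" "h2 v1 v1' \<le> y\<^sup>2"
    and C1: "\<bar>c\<bar> \<le> C1 * z" "y \<le> C1 * z"
  shows "n * (I_e u1 v1 - I_e u0 v0) \<ge> kk1 n * c\<^sup>2 - (20 * n * (n + 1) * sqrt m0 * C1 + 24 * n * C1 + 2 * n * 10^6) * (z * y + z^3)"
proof -
  have z1: "z\<^sup>2 \<le> 1" using z power_mono[of z 1 2] by simp
  have small: "h2 u0 u0' + h2 v0 v0' \<le> 1" "h2 u1 u1' + h2 v1 v1' \<le> 1" using zb z1 by linarith+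
  have hz: "sqrt h * h \<le> z^3" if "0 \<le> h" "h \<le> z\<^sup>2" for h
  proof -
    have "sqrt h \<le> z" using that z real_le_lsqrt by simp
    then have "sqrt h * h \<le> z * z\<^sup>2" using that z by (intro mult_mono) auto
    then show ?thesis by (simp add: power2_eq_square power3_eq_cube)
  qed
  have vi: "(\<integral>x. (w x)\<^sup>2 \<partial>hl) \<le> y\<^sup>2" if "h2 w w' \<le> y\<^sup>2" for w w'
  proof -
    have "0 \<le> (\<integral>x. (w' x)\<^sup>2 \<partial>hl)" by simp
    then show ?thesis using that unfolding h2_def by linarith
  qed
  define X0 where "X0 = (\<integral>x. T x * S x * (u0 x)\<^sup>2 \<partial>hl)"
  define X1 where "X1 = (\<integral>x. T x * S x * (u1 x)\<^sup>2 \<partial>hl)"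
  define sp where "sp = (\<integral>x. S x * phi p x * ph1 x \<partial>hl)"
  have nn: "0 \<le> h2 w w'" for w w' by (rule h2_nonneg)
  have i0: "\<bar>I_e u0 v0 + 2 * p * sp + p * (2 * p + 1) * X0\<bar> \<le> 2 * y\<^sup>2 + 10^6 * z^3"
    using I_e_bound[OF H(1,2) small(1)] vi[OF yb(3)] hz[OF _ zb(1)] nn[of u0 u0'] nn[of v0 v0'] unfolding X0_def sp_def by auto
  have i1: "\<bar>I_e u1 v1 + 2 * p * sp + p * (2 * p + 1) * X1\<bar> \<le> 2 * y\<^sup>2 + 10^6 * z^3"
    using I_e_bound[OF H(3,4) small(2)] vi[OF yb(4)] hz[OF _ zb(2)] nn[of u1 u1'] nn[of v1 v1'] unfolding X1_def sp_def by auto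
  have TS: "\<bar>T x * S x\<bar> \<le> 1" for x using S_bounds[of x] T_bounds[of x] by (auto simp: abs_mult intro!: mult_le_one)
  have mTS: "(\<lambda>x. T x * S x) \<in> borel_measurable hl" by (intro hl_continuous_measurable continuous_intros cont)
  have ex: "(\<integral>x. T x * S x * (b * ph1 x + r x)\<^sup>2 \<partial>hl) = b\<^sup>2 * tau3 + 2 * b * (\<integral>x. r x * (T x * S x * ph1 x) \<partial>hl) + (\<integral>x. T x * S x * (r x)\<^sup>2 \<partial>hl)
      \<and> \<bar>\<integral>x. r x * (T x * S x * ph1 x) \<partial>hl\<bar> \<le> sqrt m0 * y \<and> \<bar>\<integral>x. T x * S x * (r x)\<^sup>2 \<partial>hl\<bar> \<le> y\<^sup>2"
    if r: "H1r r r'" and ry: "h2 r r' \<le> y\<^sup>2" for b r r'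
  proof -
    have L: "L2r r" using r by (simp add: H1r_def)
    note pb = integral_phi_bound[OF L phi_bounded_facts(2) Su_bound(3)]
    have j: "integrable hl (\<lambda>x. T x * S x * (r x)\<^sup>2)"
      using L2r_mult_integrable[OF L2r_bounded_mult[OF L mTS TS] L] by (simp add: power2_eq_square mult.assoc)
    have "(\<integral>x. T x * S x * (b * ph1 x + r x)\<^sup>2 \<partial>hl) = (\<integral>x. b\<^sup>2 * (T x * S x * (ph1 x)\<^sup>2) + 2 * b * (r x * (T x * S x * ph1 x)) + T x * S x * (r x)\<^sup>2 \<partial>hl)"
      by (rule Bochner_Integration.integral_cong) (auto simp: power2_eq_square algebra_simps)
    also have "\<dots> = b\<^sup>2 * tau3 + 2 * b * (\<integral>x. r x * (T x * S x * ph1 x) \<partial>hl) + (\<integral>x. T x * S x * (r x)\<^sup>2 \<partial>hl)"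
      unfolding tau3_def using tau3_int pb(2) j by simp
    finally have 1: "(\<integral>x. T x * S x * (b * ph1 x + r x)\<^sup>2 \<partial>hl) = b\<^sup>2 * tau3 + 2 * b * (\<integral>x. r x * (T x * S x * ph1 x) \<partial>hl) + (\<integral>x. T x * S x * (r x)\<^sup>2 \<partial>hl)" .
    have sq: "sqrt (\<integral>x. (r x)\<^sup>2 \<partial>hl) \<le> y" using vi[OF ry] y by (intro real_le_lsqrt) auto
    have "\<bar>\<integral>x. r x * (T x * S x * ph1 x) \<partial>hl\<bar> \<le> sqrt m0 * y"
      using order_trans[OF pb(1) mult_left_mono[OF sq]] m0_pos by simp
    moreover have "\<bar>\<integral>x. T x * S x * (r x)\<^sup>2 \<partial>hl\<bar> \<le> (\<integral>x. (r x)\<^sup>2 \<partial>hl)"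
    proof (rule abs_integral_le[OF j L2r_sq[OF L]])
      fix x show "\<bar>T x * S x * (r x)\<^sup>2\<bar> \<le> (r x)\<^sup>2"
        unfolding abs_mult[of "T x * S x"] using mult_right_mono[OF TS[of x], of "(r x)\<^sup>2"] by simp
    qed
    ultimately show ?thesis using 1 vi[OF ry] by auto
  qed
  obtain Y0 Z0 where X0: "X0 = (- n * c)\<^sup>2 * tau3 + 2 * (- n * c) * Y0 + Z0" "\<bar>Y0\<bar> \<le> sqrt m0 * y" "\<bar>Z0\<bar> \<le> y\<^sup>2"
    using ex[OF r0(1) yb(1), of "- n * c"] unfolding X0_def r0(2) by blast
  obtain Y1 Z1 where X1: "X1 = c\<^sup>2 * tau3 + 2 * c * Y1 + Z1" "\<bar>Y1\<bar> \<le> sqrt m0 * y" "\<bar>Z1\<bar> \<le> y\<^sup>2"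
    using ex[OF r1(1) yb(2), of c] unfolding X1_def r1(2) by blast
  have cY: "\<bar>c * Y\<bar> \<le> C1 * sqrt m0 * (z * y)" if "\<bar>Y\<bar> \<le> sqrt m0 * y" for Y
  proof -
    have "\<bar>c\<bar> * \<bar>Y\<bar> \<le> (C1 * z) * (sqrt m0 * y)" using C1(1) that by (intro mult_mono) (auto intro: order_trans[OF abs_ge_zero])
    then show ?thesis by (simp add: abs_mult mult_ac)
  qed
  have yy: "y\<^sup>2 \<le> C1 * (z * y)" using mult_right_mono[OF C1(2) y] by (simp add: power2_eq_square mult_ac)
  have D: "X0 - X1 = (n\<^sup>2 - 1) * tau3 * c\<^sup>2 - 2 * n * (c * Y0) - 2 * (c * Y1) + Z0 - Z1"
    unfolding X0(1) X1(1) by (simp add: power2_eq_square algebra_simps)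
  have nY: "n * (c * Y0) \<le> n * (C1 * sqrt m0 * (z * y))" using cY[OF X0(2)] n by (intro mult_left_mono) auto
  have DX: "(n\<^sup>2 - 1) * tau3 * c\<^sup>2 - (2 * (n + 1) * sqrt m0 * C1 * (z * y) + 2 * C1 * (z * y)) \<le> X0 - X1"
  proof -
    have "2 * (n + 1) * sqrt m0 * C1 * (z * y) = 2 * (n * (C1 * sqrt m0 * (z * y))) + 2 * (C1 * sqrt m0 * (z * y))" by (simp add: algebra_simps)
    then show ?thesis unfolding D using nY cY[OF X1(2)] X0(3) X1(3) yy by (simp add: abs_le_iff)
  qed
  define E where "E = 2 * (n + 1) * sqrt m0 * C1 * (z * y) + 2 * C1 * (z * y)"
  have E: "E \<ge> 0"
  proof -
    have "0 \<le> C1 * (z * y)" using yy zero_le_power2[of y] by linarith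
    then have "0 \<le> 2 * (n + 1) * sqrt m0 * (C1 * (z * y))" using n m0_pos by (intro mult_nonneg_nonneg[of "2 * (n + 1) * sqrt m0"]) auto
    then show ?thesis using \<open>0 \<le> C1 * (z * y)\<close> unfolding E_def by (simp add: mult.assoc)
  qed
  define pp where "pp = p * (2 * p + 1)"
  have pp: "0 < pp" "pp \<le> 10"
  proof -
    show "0 < pp" using p_ge by (simp add: pp_def)
    have "p * (2 * p + 1) \<le> 2 * 5" using p_ge p_lt by (intro mult_mono) auto
    then show "pp \<le> 10" by (simp add: pp_def)
  qed
  have "pp * ((n\<^sup>2 - 1) * tau3 * c\<^sup>2 - E) \<le> pp * (X0 - X1)" using DX pp unfolding E_def by (intro mult_left_mono) auto
  moreover have "pp * E \<le> 10 * E" using pp E by (intro mult_right_mono) auto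
  ultimately have "pp * ((n\<^sup>2 - 1) * tau3 * c\<^sup>2) - 10 * E \<le> pp * (X0 - X1)" by (simp add: algebra_simps)
  moreover have "I_e u1 v1 - I_e u0 v0 \<ge> pp * (X0 - X1) - 2 * (2 * y\<^sup>2 + 10^6 * z^3)"
    using i0 i1 unfolding pp_def[symmetric] by (simp add: right_diff_distrib abs_le_iff)
  ultimately have "I_e u1 v1 - I_e u0 v0 \<ge> pp * ((n\<^sup>2 - 1) * tau3 * c\<^sup>2) - (10 * E + 4 * C1 * (z * y) + 2 * 10^6 * z^3)"
    using mult_left_mono[OF yy, of 4] by (simp add: algebra_simps)
  then have "n * (pp * ((n\<^sup>2 - 1) * tau3 * c\<^sup>2) - (10 * E + 4 * C1 * (z * y) + 2 * 10^6 * z^3)) \<le> n * (I_e u1 v1 - I_e u0 v0)"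
    using n by (intro mult_left_mono) auto
  moreover have "n * (pp * ((n\<^sup>2 - 1) * tau3 * c\<^sup>2)) = kk1 n * c\<^sup>2" by (simp add: kk1_def pp_def)
  moreover have "n * (10 * E + 4 * C1 * (z * y) + 2 * 10^6 * z^3) \<le> (20 * n * (n + 1) * sqrt m0 * C1 + 24 * n * C1 + 2 * n * 10^6) * (z * y + z^3)"
  proof -
    have c1: "C1 \<ge> 0 \<or> z = 0" using C1(2) y z by (metis order_trans zero_le_mult_iff not_le le_less)
    have "(20 * n * (n + 1) * sqrt m0 * C1 + 24 * n * C1 + 2 * n * 10^6) * (z * y + z^3) - n * (10 * E + 4 * C1 * (z * y) + 2 * 10^6 * z^3)
        = (20 * n * (n + 1) * sqrt m0 + 24 * n) * (C1 * z^3) + 2 * n * 10^6 * (z * y)"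
      unfolding E_def by (simp add: algebra_simps)
    moreover have "0 \<le> C1 * z^3" using c1 z by auto
    then have "0 \<le> (20 * n * (n + 1) * sqrt m0 + 24 * n) * (C1 * z^3)"
      using n m0_pos by (intro mult_nonneg_nonneg[of "20 * n * (n + 1) * sqrt m0 + 24 * n"] add_nonneg_nonneg) auto
    moreover have "0 \<le> 2 * n * 10^6 * (z * y)" using n z y by simp
    ultimately show ?thesis by linarith
  qed
  ultimately show ?thesis by (simp add: right_diff_distrib)
qed

definition E_e :: "(real \<Rightarrow> real) \<Rightarrow> (real \<Rightarrow> real) \<Rightarrow> (real \<Rightarrow> real) \<Rightarrow> (real \<Rightarrow> real) \<Rightarrow> real" where
  "E_e u u' v v' = (\<integral>x. (ph1 x + u' x)\<^sup>2 + (v' x)\<^sup>2 - ((phi p x + u x)\<^sup>2 + (v x)\<^sup>2) powr (p + 1) \<partial>hl)"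
definition M_e :: "(real \<Rightarrow> real) \<Rightarrow> (real \<Rightarrow> real) \<Rightarrow> real" where
  "M_e u v = (\<integral>x. (phi p x + u x)\<^sup>2 + (v x)\<^sup>2 \<partial>hl)"
definition E0 :: real where "E0 = (\<integral>x. (ph1 x)\<^sup>2 - (phi p x)\<^sup>2 * S x \<partial>hl)"

lemma M_e_expand:
  assumes "L2r u" "L2r v"
  shows "M_e u v = m0 + 2 * (\<integral>x. phi p x * u x \<partial>hl) + (\<integral>x. (u x)\<^sup>2 \<partial>hl) + (\<integral>x. (v x)\<^sup>2 \<partial>hl)"
proof -
  have "M_e u v = (\<integral>x. (phi p x)\<^sup>2 + 2 * (phi p x * u x) + (u x)\<^sup>2 + (v x)\<^sup>2 \<partial>hl)"
    unfolding M_e_def by (rule Bochner_Integration.integral_cong) (auto simp: power2_eq_square algebra_simps)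
  also have "\<dots> = m0 + 2 * (\<integral>x. phi p x * u x \<partial>hl) + (\<integral>x. (u x)\<^sup>2 \<partial>hl) + (\<integral>x. (v x)\<^sup>2 \<partial>hl)"
    unfolding m0_def using assms L2r_mult_integrable[OF L2r_phis(1) assms(1)] L2r_phis(1) by (simp add: L2r_def)
  finally show ?thesis .
qed

lemma E_e_lower:
  assumes H: "H1r u u'" "H1r v v'" and small: "h2 u u' + h2 v v' \<le> 1"
  shows "E_e u u' v v' + M_e u v \<ge> E0 + m0 + qp u u' + qm v v' - 10^6 * (sqrt (h2 u u' + h2 v v') * (h2 u u' + h2 v v'))"
proof -
  have L: "L2r u" "L2r u'" "L2r v" "L2r v'" using H by (auto simp: H1r_def)
  note ee = edge_energy[OF H small]
  have i1: "integrable hl (\<lambda>x. (phi p x + u x)\<^sup>2 + (v x)\<^sup>2)" using L2r_add[OF L2r_phis(1) L(1)] L(3) by (auto simp: L2r_def)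
  have i2: "integrable hl (\<lambda>x. (ph1 x + u' x)\<^sup>2 + (v' x)\<^sup>2)" using L2r_add[OF L2r_phis(2) L(2)] L(4) by (auto simp: L2r_def)
  have i3: "integrable hl (\<lambda>x. (phi p x)\<^sup>2)" "integrable hl (\<lambda>x. (ph1 x)\<^sup>2)" using L2r_phis by (auto simp: L2r_def)
  have i4: "integrable hl (\<lambda>x. (phi p x)\<^sup>2 * S x)"
    using integral_phi_bound(2)[OF L2r_phis(1) phi_bounded_facts(1) Su_bound(1)] by (simp add: power2_eq_square mult_ac)
  have "E_e u u' v v' + M_e u v = (\<integral>x. (ph1 x + u' x)\<^sup>2 + (v' x)\<^sup>2 + ((phi p x + u x)\<^sup>2 + (v x)\<^sup>2) - ((phi p x + u x)\<^sup>2 + (v x)\<^sup>2) powr (p + 1) \<partial>hl)"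
  proof -
    have "E_e u u' v v' + M_e u v = (\<integral>x. ((ph1 x + u' x)\<^sup>2 + (v' x)\<^sup>2 - ((phi p x + u x)\<^sup>2 + (v x)\<^sup>2) powr (p + 1)) + ((phi p x + u x)\<^sup>2 + (v x)\<^sup>2) \<partial>hl)"
      unfolding E_e_def M_e_def by (rule Bochner_Integration.integral_add[symmetric]) (intro Bochner_Integration.integrable_diff i1 i2 ee(1))+
    then show ?thesis by (simp add: algebra_simps)
  qed
  moreover have "(\<integral>x. (ph1 x)\<^sup>2 + (phi p x)\<^sup>2 - (phi p x)\<^sup>2 * S x \<partial>hl) = E0 + m0"
    unfolding E0_def m0_def using i3 i4 by simp
  ultimately show ?thesis using ee(2) by linarith
qed

text \<open>The constraints on mass and energy give \<kappa> y^2 + \<eta> \<le> C z^3: coercivity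
  holds off the kernel, and the mass constraint disposes of the negative direction. In
  \<open>Bfun\<close> the first product yields K c^2 up to errors, the three others are errors of
  order z y + z^3. \<open>trapping_inequality\<close> then concludes.\<close>

lemma trap:
  fixes n :: real
  assumes n: "n \<ge> 2"
  obtains \<epsilon> k where "\<epsilon> > 0" "k > 0"
    "\<And>u0 u0' v0 v0' u1 u1' v1 v1' \<eta>. \<lbrakk>H1r u0 u0'; H1r v0 v0'; H1r u1 u1'; H1r v1 v1'; u0 0 = u1 0; v0 0 = 0; v1 0 = 0;
       h2 u0 u0' + h2 v0 v0' + n * (h2 u1 u1' + h2 v1 v1') \<le> \<epsilon>\<^sup>2;
       M_e u0 v0 + n * M_e u1 v1 = (n + 1) * m0;
       E_e u0 u0' v0 v0' + n * E_e u1 u1' v1 v1' = (n + 1) * E0 - \<eta>; 0 \<le> \<eta>\<rbrakk>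
      \<Longrightarrow> Bfun n u0 v0 u1 v1 \<ge> k * \<eta>"
proof -
  have n1: "n \<ge> 1" using n by simp
  obtain \<kappa>1 where \<kappa>1: "\<kappa>1 > 0" and coer: "\<And>u0 u0' u1 u1'. H1r u0 u0' \<Longrightarrow> H1r u1 u1' \<Longrightarrow> u0 0 = u1 0 \<Longrightarrow>
      (let c = ((u1 x0 - u0 x0) / (n + 1)) / ph1 x0 in
      \<kappa>1 * (h2 (\<lambda>x. u0 x + n * c * ph1 x) (\<lambda>x. u0' x + n * c * ph2 x) + n * h2 (\<lambda>x. u1 x - c * ph1 x) (\<lambda>x. u1' x - c * ph2 x))
       \<le> qp u0 u0' + n * qp u1 u1' + 2 / mchi * ((\<integral>x. phi p x * u0 x \<partial>hl) + n * (\<integral>x. phi p x * u1 x \<partial>hl))\<^sup>2)"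
    by (rule two_edge_coercive[OF n1]) (rule that)
  define \<kappa> where "\<kappa> = min \<kappa>1 (p\<^sup>2 / 16 / 32)"
  have \<kappa>: "\<kappa> > 0" "\<kappa> \<le> \<kappa>1" "\<kappa> \<le> p\<^sup>2 / 16 / 32" using \<kappa>1 by (auto simp: \<kappa>_def)
  define sm where "sm = sqrt m0"
  have sm: "sm > 0" "sm\<^sup>2 = m0" using m0_pos by (auto simp: sm_def)
  define Hp where "Hp = h2 ph1 ph2"
  have Hp: "Hp \<ge> 0" by (simp add: Hp_def h2_nonneg)
  \<comment> \<open>From the embedding at \<open>x0\<close>: c is (u1 - u0)/((n + 1) ph1) there, and
    |u1 - u0| \<le> 2 z.\<close>
  define C1 where "C1 = 2 / \<bar>ph1 x0\<bar> "
  have C1: "C1 > 0" using ph1_x0 by (simp add: C1_def)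
  \<comment> \<open>One constant for both comparisons y \<le> C2 z and z \<le> C2 (|c| + y). These
    are proved for squares, and C2 \<ge> 2 allows C2 to be replaced by its square.\<close>
  define C2 where "C2 = 2 + 2 * (n\<^sup>2 + n) * (C1 + 1)\<^sup>2 * (Hp + 1)"
  have n2: "0 \<le> n\<^sup>2 + n" using n by simp
  have C2: "C2 \<ge> 2" unfolding C2_def using n2 Hp C1 by (auto intro!: mult_nonneg_nonneg)
  define C3 where "C3 = C1 + C2"
  have C3: "C3 > 0" "C1 \<le> C3" "C2 \<le> C3" using C1 C2 by (auto simp: C3_def)
  define D1 where "D1 = 20 * n * (n + 1) * sm * C3 + 24 * n * C3 + 2 * n * 10^6"
  have D1: "D1 \<ge> 0" unfolding D1_def using n sm C3 by (intro add_nonneg_nonneg mult_nonneg_nonneg) auto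
  define D2 where "D2 = 2 * n * (4 * sm * C3 + 10^6) * ((1 + n) * sm)"
  define D3 where "D3 = 2 * n * sm * ((1 + n) * (4 * sm + 10^6))"
  define D4 where "D4 = 2 * n * sm * ((1 + n) * 10^6)"
  have D: "D2 \<ge> 0" "D3 \<ge> 0" "D4 \<ge> 0" unfolding D2_def D3_def D4_def using n sm C3 by (auto intro!: mult_nonneg_nonneg add_nonneg_nonneg)
  define D5 where "D5 = 10^6 * (1 + n) + 2 / mchi"
  have D5: "D5 \<ge> 0" using n mchi_pos by (simp add: D5_def)
  define C where "C = 1 + C2 + D5 + D1 * ((n + 1) * (2 * m0)) + D2 + D3 + D4"
  have DM: "0 \<le> D1 * ((n + 1) * (2 * m0))" using D1 n m0_pos by (intro mult_nonneg_nonneg) auto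
  have C: "C \<ge> 1" "C2 \<le> C" "D5 \<le> C" "D1 * ((n + 1) * (2 * m0)) + D2 + D3 + D4 \<le> C"
    unfolding C_def using C2 D5 D DM by linarith+
  have kk: "kk1 n > 0"
  proof -
    have "n\<^sup>2 > 1" using n power_strict_mono[of 1 n 2] by simp
    then show ?thesis unfolding kk1_def using n p_ge tau3_pos by (intro mult_pos_pos) auto
  qed
  \<comment> \<open>The pairing with \<Phi> that multiplies the leading term, called
    \<open>M\<close> below, equals (n + 1) m0 at \<Phi> and keeps at least half of this for z \<le>
    sm/2.\<close>
  define K where "K = kk1 n * ((n + 1) * m0 / 2)"
  have K: "K > 0" using kk n m0_pos by (simp add: K_def)
  obtain \<epsilon>0 k where ek: "\<epsilon>0 > 0" "k > 0" and trapi: "\<And>c y z \<eta> B. \<lbrakk>0 \<le> y; 0 \<le> z; z \<le> \<epsilon>0; z \<le> C * (\<bar>c\<bar> + y); 0 \<le> \<eta>; \<kappa> * y\<^sup>2 + \<eta> \<le> C * z^3;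
       B \<ge> K * c\<^sup>2 - C * (z * y + z^3)\<rbrakk> \<Longrightarrow> B \<ge> k * \<eta>"
    by (rule trapping_inequality[OF \<kappa>(1) C(1) K]) (rule that)
  define \<epsilon> where "\<epsilon> = min \<epsilon>0 (min 1 (sm / 2))"
  have e: "\<epsilon> > 0" "\<epsilon> \<le> \<epsilon>0" "\<epsilon> \<le> 1" "\<epsilon> \<le> sm / 2" using ek sm by (auto simp: \<epsilon>_def)
  show thesis
  proof (rule that[OF e(1) ek(2)])
    fix u0 u0' v0 v0' u1 u1' v1 v1' \<eta>
    assume H: "H1r u0 u0'" "H1r v0 v0'" "H1r u1 u1'" "H1r v1 v1'" and u00: "u0 0 = u1 0" and v00: "v0 0 = 0" "v1 0 = 0"
      and small: "h2 u0 u0' + h2 v0 v0' + n * (h2 u1 u1' + h2 v1 v1') \<le> \<epsilon>\<^sup>2"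
      and mass: "M_e u0 v0 + n * M_e u1 v1 = (n + 1) * m0"
      and energy: "E_e u0 u0' v0 v0' + n * E_e u1 u1' v1 v1' = (n + 1) * E0 - \<eta>" and \<eta>: "0 \<le> \<eta>"
    have L: "L2r u0" "L2r v0" "L2r u1" "L2r v1" using H by (auto simp: H1r_def)
    define Q where "Q = h2 u0 u0' + h2 v0 v0' + n * (h2 u1 u1' + h2 v1 v1')"
    define z where "z = sqrt Q"
    have nn: "0 \<le> h2 w w'" for w w' by (rule h2_nonneg)
    have nh: "h2 u1 u1' + h2 v1 v1' \<le> n * (h2 u1 u1' + h2 v1 v1')"
      using mult_right_mono[OF n1, of "h2 u1 u1' + h2 v1 v1'"] nn[of u1 u1'] nn[of v1 v1'] by simp
    have Q0: "Q \<ge> 0" unfolding Q_def using nh nn[of u1 u1'] nn[of v1 v1'] nn[of u0 u0'] nn[of v0 v0'] by linarith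
    have z2: "z\<^sup>2 = Q" and z0: "z \<ge> 0" using Q0 by (auto simp: z_def)
    have ze: "z \<le> \<epsilon>" unfolding z_def using small e(1) by (intro real_le_lsqrt) (auto simp: Q_def)
    have z1: "z \<le> 1" "z \<le> \<epsilon>0" "z \<le> sm / 2" using ze e by auto
    have zz: "z\<^sup>2 \<le> z" using mult_left_mono[OF z1(1) z0] by (simp add: power2_eq_square)
    have zb: "h2 u0 u0' + h2 v0 v0' \<le> z\<^sup>2" "h2 u1 u1' + h2 v1 v1' \<le> z\<^sup>2"
      unfolding z2 Q_def using nh nn[of u1 u1'] nn[of v1 v1'] nn[of u0 u0'] nn[of v0 v0'] by linarith+
    have zl1: "z\<^sup>2 \<le> 1" using zz z1 by linarith
    have sm1: "h2 u0 u0' + h2 v0 v0' \<le> 1" "h2 u1 u1' + h2 v1 v1' \<le> 1" using zb zl1 by linarith+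
    define c where "c = ((u1 x0 - u0 x0) / (n + 1)) / ph1 x0"
    define r0 where "r0 = (\<lambda>x. u0 x + n * c * ph1 x)"
    define r0' where "r0' = (\<lambda>x. u0' x + n * c * ph2 x)"
    define r1 where "r1 = (\<lambda>x. u1 x - c * ph1 x)"
    define r1' where "r1' = (\<lambda>x. u1' x - c * ph2 x)"
    have Hr: "H1r r0 r0'" "H1r r1 r1'" unfolding r0_def r0'_def r1_def r1'_def
      by (intro H1r_add H1r_diff H1r_cmult H H1r_phis)+
    define Y where "Y = h2 r0 r0' + n * h2 r1 r1' + h2 v0 v0' + n * h2 v1 v1'"
    define y where "y = sqrt Y"
    have nr: "h2 r1 r1' \<le> n * h2 r1 r1'" "h2 v1 v1' \<le> n * h2 v1 v1'" "h2 u1 u1' \<le> n * h2 u1 u1'"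
      using mult_right_mono[OF n1 nn] by auto
    have Y0: "Y \<ge> 0" unfolding Y_def using nr nn[of r0 r0'] nn[of r1 r1'] nn[of v0 v0'] nn[of v1 v1'] by linarith
    have y2: "y\<^sup>2 = Y" and y0: "y \<ge> 0" using Y0 by (auto simp: y_def)
    have yb: "h2 r0 r0' \<le> y\<^sup>2" "h2 r1 r1' \<le> y\<^sup>2" "h2 v0 v0' \<le> y\<^sup>2" "h2 v1 v1' \<le> y\<^sup>2"
      unfolding y2 Y_def using nr nn[of r0 r0'] nn[of r1 r1'] nn[of v0 v0'] nn[of v1 v1'] by linarith+
    have cz: "\<bar>c\<bar> \<le> C1 * z"
    proof -
      have x00: "x0 \<ge> 0" by (simp add: x0_def)
      have p0: "(u0 x0)\<^sup>2 \<le> z\<^sup>2" "(u1 x0)\<^sup>2 \<le> z\<^sup>2"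
        using H1r_sup_h2[OF H(1) x00] H1r_sup_h2[OF H(3) x00] zb nn[of v0 v0'] nn[of v1 v1'] by linarith+
      have a: "\<bar>u0 x0\<bar> \<le> z" "\<bar>u1 x0\<bar> \<le> z" using p0 z0 by (simp_all add: abs_le_square_iff[symmetric])
      have "\<bar>(u1 x0 - u0 x0) / (n + 1)\<bar> \<le> \<bar>u1 x0 - u0 x0\<bar>"
      proof -
        have "\<bar>u1 x0 - u0 x0\<bar> / (n + 1) \<le> \<bar>u1 x0 - u0 x0\<bar> / 1" using n by (intro divide_left_mono) auto
        then show ?thesis using n by simp
      qed
      also have "\<dots> \<le> 2 * z" using a by linarith
      finally have "\<bar>(u1 x0 - u0 x0) / (n + 1)\<bar> / \<bar>ph1 x0\<bar> \<le> 2 * z / \<bar>ph1 x0\<bar>" by (rule divide_right_mono) simp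
      then show ?thesis unfolding c_def C1_def by (simp add: abs_mult)
    qed
    have c2: "c\<^sup>2 * Hp \<le> C1\<^sup>2 * Hp * z\<^sup>2"
    proof -
      have "\<bar>c\<bar>\<^sup>2 \<le> (C1 * z)\<^sup>2" using cz by (intro power_mono) auto
      then have "c\<^sup>2 * Hp \<le> (C1 * z)\<^sup>2 * Hp" using Hp by (intro mult_right_mono) auto
      then show ?thesis by (simp add: power_mult_distrib mult_ac)
    qed
    have hr0: "h2 r0 r0' \<le> 2 * h2 u0 u0' + 2 * (n\<^sup>2 * (c\<^sup>2 * Hp))" 
      using h2_add_le[OF H(1) H1r_cmult[OF H1r_phis(2), of "n * c"]] unfolding h2_cmult r0_def r0'_def Hp_def by (simp add: power_mult_distrib)
    have hr1: "h2 r1 r1' \<le> 2 * h2 u1 u1' + 2 * (c\<^sup>2 * Hp)"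
      using h2_add_le[OF H(3) H1r_cmult[OF H1r_phis(2), of "- c"]] unfolding h2_cmult r1_def r1'_def Hp_def by simp
    have hu0: "h2 u0 u0' \<le> 2 * h2 r0 r0' + 2 * (n\<^sup>2 * (c\<^sup>2 * Hp))"
      using h2_add_le[OF Hr(1) H1r_cmult[OF H1r_phis(2), of "- (n * c)"]] unfolding h2_cmult unfolding r0_def r0'_def Hp_def by (simp add: power_mult_distrib)
    have hu1: "h2 u1 u1' \<le> 2 * h2 r1 r1' + 2 * (c\<^sup>2 * Hp)"
      using h2_add_le[OF Hr(2) H1r_cmult[OF H1r_phis(2), of "c"]] unfolding h2_cmult unfolding r1_def r1'_def Hp_def by simp
    have Yz: "Y \<le> 2 * Q + 2 * (n\<^sup>2 + n) * (c\<^sup>2 * Hp)"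
    proof -
      have "n * h2 r1 r1' \<le> n * (2 * h2 u1 u1' + 2 * (c\<^sup>2 * Hp))" using hr1 n by (intro mult_left_mono) auto
      then show ?thesis unfolding Y_def Q_def using hr0 nn[of v0 v0'] nr(2) nn[of v1 v1'] by (simp add: algebra_simps)
    qed
    have Qy: "Q \<le> 2 * Y + 2 * (n\<^sup>2 + n) * (c\<^sup>2 * Hp)"
    proof -
      have "n * h2 u1 u1' \<le> n * (2 * h2 r1 r1' + 2 * (c\<^sup>2 * Hp))" using hu1 n by (intro mult_left_mono) auto
      then show ?thesis unfolding Y_def Q_def using hu0 nn[of v0 v0'] nr(2) nn[of v1 v1'] by (simp add: algebra_simps)
    qed
    have C2sq: "2 + 2 * (n\<^sup>2 + n) * (C1\<^sup>2 * Hp) \<le> C2\<^sup>2" "2 \<le> C2\<^sup>2" "2 * (n\<^sup>2 + n) * Hp \<le> C2\<^sup>2"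
    proof -
      have C12: "C1\<^sup>2 \<le> (C1 + 1)\<^sup>2" "1 \<le> (C1 + 1)\<^sup>2" using C1 power_mono[of C1 "C1 + 1" 2] power_mono[of 1 "C1 + 1" 2] by auto
      have "C1\<^sup>2 * Hp \<le> (C1 + 1)\<^sup>2 * (Hp + 1)" using C12 Hp by (intro mult_mono) auto
      then have "2 * (n\<^sup>2 + n) * (C1\<^sup>2 * Hp) \<le> 2 * (n\<^sup>2 + n) * ((C1 + 1)\<^sup>2 * (Hp + 1))" using n2 by (intro mult_left_mono) auto
      then have a: "2 + 2 * (n\<^sup>2 + n) * (C1\<^sup>2 * Hp) \<le> C2" by (simp add: C2_def mult.assoc)
      have "1 * Hp \<le> (C1 + 1)\<^sup>2 * (Hp + 1)" using C12 Hp by (intro mult_mono) auto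
      then have "2 * (n\<^sup>2 + n) * Hp \<le> 2 * (n\<^sup>2 + n) * ((C1 + 1)\<^sup>2 * (Hp + 1))" using n2 by (intro mult_left_mono) auto
      then have b: "2 * (n\<^sup>2 + n) * Hp \<le> C2" by (simp add: C2_def mult.assoc)
      have "C2 * 1 \<le> C2 * C2" using C2 by (intro mult_left_mono) auto
      then have "C2 \<le> C2\<^sup>2" by (simp add: power2_eq_square)
      then show "2 + 2 * (n\<^sup>2 + n) * (C1\<^sup>2 * Hp) \<le> C2\<^sup>2" "2 \<le> C2\<^sup>2" "2 * (n\<^sup>2 + n) * Hp \<le> C2\<^sup>2" using a b C2 by linarith+
    qed
    have yz: "y \<le> C2 * z"
    proof (rule power2_le_imp_le)
      have "2 * (n\<^sup>2 + n) * (c\<^sup>2 * Hp) \<le> 2 * (n\<^sup>2 + n) * (C1\<^sup>2 * Hp * z\<^sup>2)" using c2 n2 by (intro mult_left_mono) auto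
      then have "y\<^sup>2 \<le> (2 + 2 * (n\<^sup>2 + n) * (C1\<^sup>2 * Hp)) * z\<^sup>2" using Yz unfolding y2 z2[symmetric] by (simp add: algebra_simps)
      also have "\<dots> \<le> C2\<^sup>2 * z\<^sup>2" using C2sq(1) by (intro mult_right_mono) auto
      finally show "y\<^sup>2 \<le> (C2 * z)\<^sup>2" by (simp add: power_mult_distrib)
    qed (use C2 z0 in simp)
    have zy: "z \<le> C * (\<bar>c\<bar> + y)"
    proof -
      have "z \<le> C2 * (\<bar>c\<bar> + y)"
      proof (rule power2_le_imp_le)
        have "2 * (n\<^sup>2 + n) * Hp * c\<^sup>2 \<le> C2\<^sup>2 * c\<^sup>2" "2 * y\<^sup>2 \<le> C2\<^sup>2 * y\<^sup>2" using C2sq by (auto intro!: mult_right_mono)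
        then have "z\<^sup>2 \<le> C2\<^sup>2 * (c\<^sup>2 + y\<^sup>2)" using Qy unfolding z2 y2[symmetric] by (simp add: algebra_simps)
        also have "\<dots> \<le> C2\<^sup>2 * (\<bar>c\<bar> + y)\<^sup>2" using y0 by (intro mult_left_mono) (auto simp: power2_sum)
        finally show "z\<^sup>2 \<le> (C2 * (\<bar>c\<bar> + y))\<^sup>2" by (simp add: power_mult_distrib)
      qed (use C2 y0 in simp)
      also have "\<dots> \<le> C * (\<bar>c\<bar> + y)" using C y0 by (intro mult_right_mono) auto
      finally show ?thesis .
    qed
    have hz: "sqrt h * h \<le> z^3" if "0 \<le> h" "h \<le> z\<^sup>2" for h
    proof -
      have "sqrt h \<le> z" using that z0 real_le_lsqrt by simp
      then have "sqrt h * h \<le> z * z\<^sup>2" using that z0 by (intro mult_mono) auto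
      then show ?thesis by (simp add: power2_eq_square power3_eq_cube)
    qed
    have z3: "0 \<le> z^3" using z0 by simp
    have en: "\<kappa> * y\<^sup>2 + \<eta> \<le> C * z^3"
    proof -
      define mm where "mm = (\<integral>x. phi p x * u0 x \<partial>hl) + n * (\<integral>x. phi p x * u1 x \<partial>hl)"
      define i2 where "i2 = (\<integral>x. (u0 x)\<^sup>2 \<partial>hl) + (\<integral>x. (v0 x)\<^sup>2 \<partial>hl) + n * ((\<integral>x. (u1 x)\<^sup>2 \<partial>hl) + (\<integral>x. (v1 x)\<^sup>2 \<partial>hl))"
      \<comment> \<open>The mass constraint makes the pairing with \<phi> equal to - i2/2, hence of
        second order; its square, the error term in \<open>two_edge_coercive\<close>, is then of
        order z^4 and below z^3.\<close>
      have "2 * mm + i2 = 0" using mass unfolding M_e_expand[OF L(1,2)] M_e_expand[OF L(3,4)] mm_def i2_def by (simp add: algebra_simps)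
      moreover have "0 \<le> i2" unfolding i2_def using n by (intro add_nonneg_nonneg mult_nonneg_nonneg) auto
      moreover have "i2 \<le> z\<^sup>2"
      proof -
        have le: "(\<integral>x. (w x)\<^sup>2 \<partial>hl) \<le> h2 w w'" for w w' by (simp add: h2_def)
        have "n * ((\<integral>x. (u1 x)\<^sup>2 \<partial>hl) + (\<integral>x. (v1 x)\<^sup>2 \<partial>hl)) \<le> n * (h2 u1 u1' + h2 v1 v1')"
          using n le[of u1 u1'] le[of v1 v1'] by (intro mult_left_mono) auto
        then show ?thesis unfolding i2_def z2 Q_def using le[of u0 u0'] le[of v0 v0'] by linarith
      qed
      ultimately have "\<bar>mm\<bar> \<le> z\<^sup>2" by linarith
      then have "\<bar>mm\<bar>\<^sup>2 \<le> (z\<^sup>2)\<^sup>2" by (intro power_mono) auto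
      moreover have "(z\<^sup>2)\<^sup>2 = z * z^3" by (simp add: power2_eq_square power3_eq_cube)
      moreover have "z * z^3 \<le> 1 * z^3" using z1 z3 by (intro mult_right_mono) auto
      ultimately have "mm\<^sup>2 \<le> z^3" by simp
      then have mm: "2 / mchi * mm\<^sup>2 \<le> 2 / mchi * z^3" using mchi_pos by (intro mult_left_mono) auto
      have q: "\<kappa>1 * (h2 r0 r0' + n * h2 r1 r1') \<le> qp u0 u0' + n * qp u1 u1' + 2 / mchi * mm\<^sup>2"
        using coer[OF H(1,3) u00] unfolding Let_def c_def[symmetric] r0_def r0'_def r1_def r1'_def mm_def .
      have qv: "p\<^sup>2/16/32 * h2 v0 v0' \<le> qm v0 v0'" "p\<^sup>2/16/32 * h2 v1 v1' \<le> qm v1 v1'"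
        using qm_coercive[OF H(2) v00(1)] qm_coercive[OF H(4) v00(2)] by auto
      have a1: "\<kappa> * (h2 r0 r0' + n * h2 r1 r1') \<le> \<kappa>1 * (h2 r0 r0' + n * h2 r1 r1')"
        using \<kappa>(2) nn n by (intro mult_right_mono add_nonneg_nonneg mult_nonneg_nonneg) auto
      have a2: "\<kappa> * h2 v0 v0' \<le> qm v0 v0'" "\<kappa> * h2 v1 v1' \<le> qm v1 v1'"
        using mult_right_mono[OF \<kappa>(3) nn] qv by (meson order_trans)+
      have a3: "n * (\<kappa> * h2 v1 v1') \<le> n * qm v1 v1'" using a2 n by (intro mult_left_mono) auto
      have el0: "E_e u0 u0' v0 v0' + M_e u0 v0 \<ge> E0 + m0 + qp u0 u0' + qm v0 v0' - 10^6 * z^3"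
        using E_e_lower[OF H(1,2) sm1(1)] hz[OF _ zb(1)] nn[of u0 u0'] nn[of v0 v0'] by auto
      have el1: "E_e u1 u1' v1 v1' + M_e u1 v1 \<ge> E0 + m0 + qp u1 u1' + qm v1 v1' - 10^6 * z^3"
        using E_e_lower[OF H(3,4) sm1(2)] hz[OF _ zb(2)] nn[of u1 u1'] nn[of v1 v1'] by auto
      have "n * (E0 + m0 + qp u1 u1' + qm v1 v1' - 10^6 * z^3) \<le> n * (E_e u1 u1' v1 v1' + M_e u1 v1)"
        using el1 n by (intro mult_left_mono) auto
      then have "qp u0 u0' + n * qp u1 u1' + qm v0 v0' + n * qm v1 v1' \<le> - \<eta> + 10^6 * (1 + n) * z^3"
        using el0 mass energy by (simp add: algebra_simps)
      then have "\<kappa> * y\<^sup>2 + \<eta> \<le> 10^6 * (1 + n) * z^3 + 2 / mchi * z^3"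
        using q a1 a2(1) a3 mm unfolding y2 Y_def by (simp add: algebra_simps)
      also have "\<dots> = D5 * z^3" by (simp add: D5_def algebra_simps)
      also have "\<dots> \<le> C * z^3" using C z3 by (intro mult_right_mono) auto
      finally show ?thesis .
    qed
    have B: "Bfun n u0 v0 u1 v1 \<ge> K * c\<^sup>2 - C * (z * y + z^3)"
    proof -
      have ub: "\<bar>\<integral>x. w x * f x \<partial>hl\<bar> \<le> sm * b" "integrable hl (\<lambda>x. w x * f x)"
        if w: "H1r w w'" and wb: "h2 w w' \<le> b\<^sup>2" and b: "b \<ge> 0" and f: "f \<in> borel_measurable hl" "\<And>x. \<bar>f x\<bar> \<le> phi p x" for w w' f b
      proof -
        have Lw: "L2r w" using w by (simp add: H1r_def)
        have "(\<integral>x. (w x)\<^sup>2 \<partial>hl) \<le> h2 w w'" by (simp add: h2_def)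
        then have "sqrt (\<integral>x. (w x)\<^sup>2 \<partial>hl) \<le> b" using wb b by (intro real_le_lsqrt) auto
        then have "sqrt m0 * sqrt (\<integral>x. (w x)\<^sup>2 \<partial>hl) \<le> sm * b" using sm by (intro mult_mono) (auto simp: sm_def)
        then show "\<bar>\<integral>x. w x * f x \<partial>hl\<bar> \<le> sm * b" using integral_phi_bound(1)[OF Lw f(1)] f(2) by (meson order_trans)
        show "integrable hl (\<lambda>x. w x * f x)" by (rule integral_phi_bound(2)[OF Lw f])
      qed
      have uz: "h2 u0 u0' \<le> z\<^sup>2" "h2 u1 u1' \<le> z\<^sup>2" using zb nn[of v0 v0'] nn[of v1 v1'] by linarith+
      note pf = phi_bounded_facts(3,5) and p1f = phi_bounded_facts(4) ph_abs(1) and spf = phi_bounded_facts(1) Su_bound(1)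
      define a1 where "a1 = n * (I_e u1 v1 - I_e u0 v0)"
      define M where "M = (\<integral>x. (phi p x + u0 x) * phi p x \<partial>hl) + n * (\<integral>x. (phi p x + u1 x) * phi p x \<partial>hl)"
      define b1 where "b1 = n * (J_e u1 v1 - J_e u0 v0)"
      define Yv where "Yv = (\<integral>x. v0 x * phi p x \<partial>hl) + n * (\<integral>x. v1 x * phi p x \<partial>hl)"
      define P where "P = n * ((\<integral>x. (phi p x + u1 x) * ph1 x \<partial>hl) - (\<integral>x. (phi p x + u0 x) * ph1 x \<partial>hl))"
      define R where "R = R_e u0 v0 + n * R_e u1 v1"
      define Qv where "Qv = n * ((\<integral>x. v1 x * ph1 x \<partial>hl) - (\<integral>x. v0 x * ph1 x \<partial>hl))"
      define W where "W = W_e u0 v0 + n * W_e u1 v1"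
      have nzy: "0 \<le> z * y" using z0 y0 by simp
      have C1C3: "\<bar>c\<bar> \<le> C3 * z" "y \<le> C3 * z"
        using cz yz mult_right_mono[OF C3(2) z0] mult_right_mono[OF C3(3) z0] by linarith+
      have A1: "a1 \<ge> kk1 n * c\<^sup>2 - D1 * (z * y + z^3)"
        unfolding a1_def D1_def sm_def
        by (rule a1_bound[OF n1 H y0 z0 z1(1) zb Hr(1) _ Hr(2) _ yb C1C3]) (auto simp: r0_def r1_def)
      have n0: "n \<ge> 0" using n by simp
      have Mb: "(n + 1) * m0 / 2 \<le> M" "M \<le> (n + 1) * (2 * m0)"
      proof -
        have e: "(\<integral>x. (phi p x + w x) * phi p x \<partial>hl) = m0 + (\<integral>x. w x * phi p x \<partial>hl)" if "integrable hl (\<lambda>x. w x * phi p x)" for w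
        proof -
          have "(\<integral>x. (phi p x + w x) * phi p x \<partial>hl) = (\<integral>x. (phi p x)\<^sup>2 + w x * phi p x \<partial>hl)"
            by (rule Bochner_Integration.integral_cong) (auto simp: power2_eq_square algebra_simps)
          then show ?thesis using that L2r_phis(1) by (simp add: m0_def L2r_def)
        qed
        note b0 = ub[OF H(1) uz(1) z0 pf] and b1 = ub[OF H(3) uz(2) z0 pf]
        \<comment> \<open>The third entry in the minimum defining \<epsilon> was chosen for this:
          the pairing of a perturbation with \<phi> stays below m0/2.\<close>
        have "sm * z \<le> sm * (sm / 2)" using sm by (intro mult_left_mono z1(3)) auto
        then have "sm * z \<le> m0 / 2" unfolding sm(2)[symmetric] by (simp add: power2_eq_square)
        then have bb: "\<bar>\<integral>x. u0 x * phi p x \<partial>hl\<bar> \<le> m0 / 2" "\<bar>\<integral>x. u1 x * phi p x \<partial>hl\<bar> \<le> m0 / 2" using b0 b1 by linarith+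
        have "n * (m0 / 2) \<le> n * (m0 + (\<integral>x. u1 x * phi p x \<partial>hl))" "n * (m0 + (\<integral>x. u1 x * phi p x \<partial>hl)) \<le> n * (2 * m0)"
          using bb(2) n0 m0_pos by (intro mult_left_mono; linarith)+
        then show "(n + 1) * m0 / 2 \<le> M" "M \<le> (n + 1) * (2 * m0)"
          unfolding M_def e[OF b0(2)] e[OF b1(2)] using bb(1) m0_pos by (simp_all add: distrib_right)
      qed
      have T1: "a1 * M \<ge> K * c\<^sup>2 - D1 * ((n + 1) * (2 * m0)) * (z * y + z^3)"
      proof -
        define err where "err = D1 * (z * y + z^3)"
        have err: "0 \<le> err" unfolding err_def using D1 nzy z3 by (intro mult_nonneg_nonneg) auto
        have M0: "0 \<le> M" using Mb(1) n m0_pos by (smt (verit) divide_nonneg_nonneg mult_nonneg_nonneg)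
        have "(kk1 n * c\<^sup>2) * ((n + 1) * m0 / 2) \<le> (kk1 n * c\<^sup>2) * M" using Mb(1) kk by (intro mult_left_mono) auto
        moreover have "(kk1 n * c\<^sup>2) * M \<le> (a1 + err) * M" using A1 M0 unfolding err_def by (intro mult_right_mono) auto
        moreover have "err * M \<le> err * ((n + 1) * (2 * m0))" using Mb(2) err by (rule mult_left_mono)
        ultimately have "K * c\<^sup>2 \<le> a1 * M + err * ((n + 1) * (2 * m0))" unfolding K_def by (simp add: algebra_simps)
        then show ?thesis unfolding err_def by (simp add: mult_ac)
      qed
      have T2: "\<bar>b1 * Yv\<bar> \<le> D2 * (z * y + z^3)"
      proof -
        have J: "\<bar>J_e u v\<bar> \<le> (4 * sm * C3 + 10^6) * z"
          if Hu: "H1r u u'" "H1r v v'" and s: "h2 u u' + h2 v v' \<le> 1" "h2 u u' + h2 v v' \<le> z\<^sup>2" and vy: "h2 v v' \<le> y\<^sup>2" for u u' v v'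
        proof -
          have "(\<integral>x. (v x)\<^sup>2 \<partial>hl) \<le> h2 v v'" by (simp add: h2_def)
          then have "sqrt (\<integral>x. (v x)\<^sup>2 \<partial>hl) \<le> y" using vy y0 by (intro real_le_lsqrt) auto
          then have "sqrt m0 * sqrt (\<integral>x. (v x)\<^sup>2 \<partial>hl) \<le> sm * (C3 * z)" using C1C3(2) sm by (intro mult_mono) (auto simp: sm_def)
          moreover have "10^6 * (h2 u u' + h2 v v') \<le> 10^6 * z" using s(2) zz by (intro mult_left_mono) auto
          ultimately have "\<bar>J_e u v\<bar> \<le> 4 * (sm * (C3 * z)) + 10^6 * z" using J_e_bound[OF Hu s(1)] by linarith
          then show ?thesis by (simp add: algebra_simps)
        qed
        have j0: "\<bar>J_e u0 v0\<bar> \<le> (4 * sm * C3 + 10^6) * z" by (rule J[OF H(1,2) sm1(1) zb(1) yb(3)])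
        have j1: "\<bar>J_e u1 v1\<bar> \<le> (4 * sm * C3 + 10^6) * z" by (rule J[OF H(3,4) sm1(2) zb(2) yb(4)])
        have "\<bar>J_e u1 v1 - J_e u0 v0\<bar> \<le> 2 * ((4 * sm * C3 + 10^6) * z)" using j0 j1 by linarith
        then have "\<bar>b1\<bar> \<le> n * (2 * ((4 * sm * C3 + 10^6) * z))" unfolding b1_def abs_mult using n0 by (intro mult_mono) auto
        moreover have "\<bar>Yv\<bar> \<le> (1 + n) * (sm * y)"
        proof -
          have "\<bar>n * (\<integral>x. v1 x * phi p x \<partial>hl)\<bar> \<le> n * (sm * y)" unfolding abs_mult using ub(1)[OF H(4) yb(4) y0 pf] n0 by (intro mult_mono) auto
          then show ?thesis unfolding Yv_def using ub(1)[OF H(2) yb(3) y0 pf] by (simp add: distrib_right)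
        qed
        ultimately have "\<bar>b1\<bar> * \<bar>Yv\<bar> \<le> (n * (2 * ((4 * sm * C3 + 10^6) * z))) * ((1 + n) * (sm * y))"
          using n0 sm C3 z0 by (intro mult_mono) auto
        also have "\<dots> = D2 * (z * y)" by (simp add: D2_def)
        also have "\<dots> \<le> D2 * (z * y + z^3)" using D(1) z3 by (intro mult_left_mono) auto
        finally show ?thesis by (simp add: abs_mult)
      qed
      have T3: "\<bar>P * R\<bar> \<le> D3 * (z * y + z^3)"
      proof -
        have e: "(\<integral>x. (phi p x + w x) * ph1 x \<partial>hl) = (\<integral>x. phi p x * ph1 x \<partial>hl) + (\<integral>x. w x * ph1 x \<partial>hl)" if "integrable hl (\<lambda>x. w x * ph1 x)" for w
          using that L2r_mult_integrable[OF L2r_phis(1,2)] by (simp add: distrib_right)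
        note b0 = ub[OF H(1) uz(1) z0 p1f] and b1 = ub[OF H(3) uz(2) z0 p1f]
        have "\<bar>(\<integral>x. u1 x * ph1 x \<partial>hl) - (\<integral>x. u0 x * ph1 x \<partial>hl)\<bar> \<le> 2 * (sm * z)" using b0(1) b1(1) by linarith
        then have Pb: "\<bar>P\<bar> \<le> n * (2 * (sm * z))" unfolding P_def e[OF b0(2)] e[OF b1(2)] abs_mult using n0 by (intro mult_mono) auto
        note s0 = ub[OF Hr(1) yb(1) y0 spf] and s1 = ub[OF Hr(2) yb(2) y0 spf]
        have iS: "integrable hl (\<lambda>x. ph1 x * (S x * phi p x))" by (rule integral_phi_bound(2)[OF L2r_phis(2) spf])
        have u0e: "(\<integral>x. u0 x * (S x * phi p x) \<partial>hl) = (\<integral>x. r0 x * (S x * phi p x) \<partial>hl) - n * c * (\<integral>x. ph1 x * (S x * phi p x) \<partial>hl)"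
        proof -
          have "(\<integral>x. u0 x * (S x * phi p x) \<partial>hl) = (\<integral>x. r0 x * (S x * phi p x) - n * c * (ph1 x * (S x * phi p x)) \<partial>hl)"
            by (rule Bochner_Integration.integral_cong) (auto simp: r0_def algebra_simps)
          then show ?thesis using s0(2) iS by simp
        qed
        have u1e: "(\<integral>x. u1 x * (S x * phi p x) \<partial>hl) = (\<integral>x. r1 x * (S x * phi p x) \<partial>hl) + c * (\<integral>x. ph1 x * (S x * phi p x) \<partial>hl)"
        proof -
          have "(\<integral>x. u1 x * (S x * phi p x) \<partial>hl) = (\<integral>x. r1 x * (S x * phi p x) + c * (ph1 x * (S x * phi p x)) \<partial>hl)"
            by (rule Bochner_Integration.integral_cong) (auto simp: r1_def algebra_simps)
          then show ?thesis using s1(2) iS by simp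
        qed
        define g0 where "g0 = (\<integral>x. r0 x * (S x * phi p x) \<partial>hl)"
        define g1 where "g1 = (\<integral>x. r1 x * (S x * phi p x) \<partial>hl)"
        have R0: "\<bar>R_e u0 v0 + 2 * p * (g0 - n * c * (\<integral>x. ph1 x * (S x * phi p x) \<partial>hl))\<bar> \<le> 10^6 * z\<^sup>2"
          using R_e_bound[OF H(1,2) sm1(1)] mult_left_mono[OF zb(1), of "10^6", OF zero_le_power[OF zero_le_numeral]] unfolding u0e g0_def by linarith
        have R1: "\<bar>R_e u1 v1 + 2 * p * (g1 + c * (\<integral>x. ph1 x * (S x * phi p x) \<partial>hl))\<bar> \<le> 10^6 * z\<^sup>2"
          using R_e_bound[OF H(3,4) sm1(2)] mult_left_mono[OF zb(2), of "10^6", OF zero_le_power[OF zero_le_numeral]] unfolding u1e g1_def by linarith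
        have "n * \<bar>R_e u1 v1 + 2 * p * (g1 + c * (\<integral>x. ph1 x * (S x * phi p x) \<partial>hl))\<bar> \<le> n * (10^6 * z\<^sup>2)" using R1 n0 by (rule mult_left_mono)
        then have R1n: "\<bar>n * (R_e u1 v1 + 2 * p * (g1 + c * (\<integral>x. ph1 x * (S x * phi p x) \<partial>hl)))\<bar> \<le> n * (10^6 * z\<^sup>2)" using n0 by (simp add: abs_mult)
        \<comment> \<open>The kernel parts - n c on edge 0 and n times c on the others cancel,
          because the weights c_j sum to zero. Thus R is of order y + z^2, although each edge alone
          is of order z.\<close>
        have Req: "R = (R_e u0 v0 + 2 * p * (g0 - n * c * (\<integral>x. ph1 x * (S x * phi p x) \<partial>hl)))
            + n * (R_e u1 v1 + 2 * p * (g1 + c * (\<integral>x. ph1 x * (S x * phi p x) \<partial>hl))) - 2 * p * (g0 + n * g1)"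
          unfolding R_def by (simp add: algebra_simps)
        have "\<bar>g0 + n * g1\<bar> \<le> (1 + n) * (sm * y)"
        proof -
          have "\<bar>n * g1\<bar> \<le> n * (sm * y)" unfolding abs_mult g1_def using s1(1) n0 by (intro mult_mono) auto
          then show ?thesis using s0(1) unfolding g0_def by (simp add: distrib_right)
        qed
        then have "\<bar>2 * p\<bar> * \<bar>g0 + n * g1\<bar> \<le> 4 * ((1 + n) * (sm * y))" using p_lt by (intro mult_mono) auto
        then have "\<bar>2 * p * (g0 + n * g1)\<bar> \<le> 4 * ((1 + n) * (sm * y))" by (simp only: abs_mult)
        then have "\<bar>R\<bar> \<le> 10^6 * z\<^sup>2 + n * (10^6 * z\<^sup>2) + 4 * ((1 + n) * (sm * y))" using R0 R1n unfolding Req by linarith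
        then have "\<bar>P\<bar> * \<bar>R\<bar> \<le> (n * (2 * (sm * z))) * (10^6 * z\<^sup>2 + n * (10^6 * z\<^sup>2) + 4 * ((1 + n) * (sm * y)))"
          using Pb n0 sm z0 by (intro mult_mono) auto
        also have "\<dots> = 2 * n * sm * (1 + n) * 10^6 * z^3 + 2 * n * sm * (1 + n) * (4 * sm) * (z * y)"
          by (simp add: power2_eq_square power3_eq_cube algebra_simps)
        also have "\<dots> \<le> D3 * (z * y + z^3)"
        proof -
          have "D3 * (z * y + z^3) - (2 * n * sm * (1 + n) * 10^6 * z^3 + 2 * n * sm * (1 + n) * (4 * sm) * (z * y))
             = 2 * n * sm * (1 + n) * (4 * sm) * z^3 + 2 * n * sm * (1 + n) * 10^6 * (z * y)" by (simp add: D3_def algebra_simps)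
          moreover have "0 \<le> 2 * n * sm * (1 + n) * (4 * sm) * z^3" using n0 sm z3 by (intro mult_nonneg_nonneg) auto
          moreover have "0 \<le> 2 * n * sm * (1 + n) * 10^6 * (z * y)" using n0 sm by (intro mult_nonneg_nonneg[OF _ nzy]) auto
          ultimately show ?thesis by linarith
        qed
        finally show ?thesis by (simp add: abs_mult)
      qed
      have T4: "\<bar>Qv * W\<bar> \<le> D4 * (z * y + z^3)"
      proof -
        have "\<bar>(\<integral>x. v1 x * ph1 x \<partial>hl) - (\<integral>x. v0 x * ph1 x \<partial>hl)\<bar> \<le> 2 * (sm * y)"
          using ub(1)[OF H(2) yb(3) y0 p1f] ub(1)[OF H(4) yb(4) y0 p1f] by linarith
        then have Qb: "\<bar>Qv\<bar> \<le> n * (2 * (sm * y))" unfolding Qv_def abs_mult using n0 by (intro mult_mono) auto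
        have w0: "\<bar>W_e u0 v0\<bar> \<le> 10^6 * z" and w1: "\<bar>W_e u1 v1\<bar> \<le> 10^6 * z"
        proof -
          have "10^6 * (h2 u0 u0' + h2 v0 v0') \<le> 10^6 * z" "10^6 * (h2 u1 u1' + h2 v1 v1') \<le> 10^6 * z"
            by (rule mult_left_mono[OF order_trans[OF zb(1) zz]], simp, rule mult_left_mono[OF order_trans[OF zb(2) zz]], simp)
          then show "\<bar>W_e u0 v0\<bar> \<le> 10^6 * z" "\<bar>W_e u1 v1\<bar> \<le> 10^6 * z"
            using W_e_bound[OF H(1,2) sm1(1)] W_e_bound[OF H(3,4) sm1(2)] by linarith+
        qed
        have "\<bar>n * W_e u1 v1\<bar> \<le> n * (10^6 * z)" unfolding abs_mult using w1 n0 by (intro mult_mono) auto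
        then have "\<bar>W\<bar> \<le> (1 + n) * (10^6 * z)" unfolding W_def using w0 by (simp add: distrib_right)
        then have "\<bar>Qv\<bar> * \<bar>W\<bar> \<le> (n * (2 * (sm * y))) * ((1 + n) * (10^6 * z))" using Qb n0 sm y0 by (intro mult_mono) auto
        also have "\<dots> = D4 * (z * y)" by (simp add: D4_def)
        also have "\<dots> \<le> D4 * (z * y + z^3)" using D(3) z3 by (intro mult_left_mono) auto
        finally show ?thesis by (simp add: abs_mult)
      qed
      have "Bfun n u0 v0 u1 v1 = a1 * M + b1 * Yv + P * R + Qv * W"
        unfolding Bfun_def a1_def M_def b1_def Yv_def P_def R_def Qv_def W_def ..
      then have "Bfun n u0 v0 u1 v1 \<ge> K * c\<^sup>2 - (D1 * ((n + 1) * (2 * m0)) + D2 + D3 + D4) * (z * y + z^3)"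
        using T1 T2 T3 T4 by (simp only: distrib_right)
      moreover have "(D1 * ((n + 1) * (2 * m0)) + D2 + D3 + D4) * (z * y + z^3) \<le> C * (z * y + z^3)"
        using C(4) nzy z3 by (intro mult_right_mono) auto
      ultimately show ?thesis by linarith
    qed
    show "Bfun n u0 v0 u1 v1 \<ge> k * \<eta>"
      by (rule trapi[OF y0 z0 z1(2) zy \<eta> en B])
  qed
qed

end

section \<open>Sobolev spaces on the star graph\<close>

lemma L2_hl_iff: "L2_hl f \<longleftrightarrow> f \<in> borel_measurable hl \<and> integrable hl (\<lambda>x. (cmod (f x))\<^sup>2)"
  unfolding L2_hl_def borel_measurable_hl_iff hl_integrable_iff ..

lemma L2_hl_cmod: "L2_hl f \<Longrightarrow> L2r (\<lambda>x. cmod (f x))"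
  by (auto simp: L2_hl_iff L2r_def)

lemma L2_hl_bound:
  assumes "L2r g" "f \<in> borel_measurable hl" "\<And>x. x \<ge> 0 \<Longrightarrow> cmod (f x) \<le> g x"
  shows "L2_hl f"
  unfolding L2_hl_iff
proof
  show "integrable hl (\<lambda>x. (cmod (f x))\<^sup>2)"
  proof (rule integrable_hl_bound[OF L2r_sq[OF assms(1)]])
    fix x :: real assume "x \<ge> 0"
    then show "norm ((cmod (f x))\<^sup>2) \<le> (g x)\<^sup>2" using assms(3)[of x] by (simp add: power_mono)
  qed (use assms(2) in measurable)
qed fact

lemma L2_hl_parts: "L2_hl f \<longleftrightarrow> L2r (\<lambda>x. Re (f x)) \<and> L2r (\<lambda>x. Im (f x))"
proof
  assume f: "L2_hl f"
  have m: "f \<in> borel_measurable hl" using f by (simp add: L2_hl_iff)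
  have "(\<lambda>x. Re (f x)) \<in> borel_measurable hl" "(\<lambda>x. Im (f x)) \<in> borel_measurable hl" using m by measurable
  then show "L2r (\<lambda>x. Re (f x)) \<and> L2r (\<lambda>x. Im (f x))"
    using L2r_bound[OF L2_hl_cmod[OF f]] abs_Re_le_cmod abs_Im_le_cmod by simp
next
  assume r: "L2r (\<lambda>x. Re (f x)) \<and> L2r (\<lambda>x. Im (f x))"
  then have m: "(\<lambda>x. Re (f x)) \<in> borel_measurable hl" "(\<lambda>x. Im (f x)) \<in> borel_measurable hl" by (auto simp: L2r_def)
  have "f \<in> borel_measurable hl" using m by (simp add: borel_measurable_complex_iff)
  then show "L2_hl f" using r by (auto simp: L2_hl_iff L2r_def cmod_power2)
qed

lemma L2_hl_lin:
  assumes "L2_hl f" "L2_hl g" shows "L2_hl (\<lambda>x. a * f x + b * g x)"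
proof (rule L2_hl_bound)
  show "L2r (\<lambda>x. cmod a * cmod (f x) + cmod b * cmod (g x))"
    by (intro L2r_add L2r_cmult L2_hl_cmod assms)
  show "(\<lambda>x. a * f x + b * g x) \<in> borel_measurable hl" using assms by (auto simp: L2_hl_iff)
  show "cmod (a * f x + b * g x) \<le> cmod a * cmod (f x) + cmod b * cmod (g x)" for x
    by (metis norm_mult norm_triangle_ineq)
qed

definition cn :: "(real \<Rightarrow> complex) \<Rightarrow> real" where "cn f = sqrt (\<integral>x. (cmod (f x))\<^sup>2 \<partial>hl)"

lemma cn_nonneg: "cn f \<ge> 0" by (simp add: cn_def)

lemma cn_sq: "(cn f)\<^sup>2 = (\<integral>x. (cmod (f x))\<^sup>2 \<partial>hl)" by (simp add: cn_def)

lemma L2_hl_prod: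
  assumes f: "L2_hl f" and g: "L2_hl g"
  shows "integrable hl (\<lambda>x. f x * cnj (g x))" "cmod (\<integral>x. f x * cnj (g x) \<partial>hl) \<le> cn f * cn g"
    "(\<integral>x. cmod (f x) * cmod (g x) \<partial>hl) \<le> cn f * cn g"
proof -
  have L: "L2r (\<lambda>x. cmod (f x))" "L2r (\<lambda>x. cmod (g x))" by (intro L2_hl_cmod f g)+
  have i: "integrable hl (\<lambda>x. cmod (f x) * cmod (g x))" by (rule L2r_mult_integrable[OF L])
  show j: "integrable hl (\<lambda>x. f x * cnj (g x))"
  proof (rule integrable_hl_bound[OF i])
    have "(\<lambda>x. cnj (g x)) \<in> borel_measurable hl" using g by (simp add: L2_hl_iff borel_measurable_complex_iff)
    then show "(\<lambda>x. f x * cnj (g x)) \<in> borel_measurable hl" using f by (auto simp: L2_hl_iff)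
  qed (simp add: norm_mult)
  have "(\<integral>x. cmod (f x) * cmod (g x) \<partial>hl)\<^sup>2 \<le> (cn f * cn g)\<^sup>2"
    using L2r_Cauchy_Schwarz[OF L] by (simp add: power_mult_distrib cn_sq)
  then show k: "(\<integral>x. cmod (f x) * cmod (g x) \<partial>hl) \<le> cn f * cn g"
    by (rule power2_le_imp_le) (simp add: cn_nonneg)
  have "cmod (\<integral>x. f x * cnj (g x) \<partial>hl) \<le> (\<integral>x. cmod (f x * cnj (g x)) \<partial>hl)" by (rule integral_norm_bound)
  also have "\<dots> = (\<integral>x. cmod (f x) * cmod (g x) \<partial>hl)" by (simp add: norm_mult)
  finally show "cmod (\<integral>x. f x * cnj (g x) \<partial>hl) \<le> cn f * cn g" using k by linarith
qed

text \<open>The bridge between the complex definitions and the real pairs. The integrability on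
  bounded intervals that \<open>prim\<close> asks for follows from |h| \<le> h^2 + 1.\<close>

lemma is_hl_deriv_parts:
  assumes f: "L2_hl f"
  shows "is_hl_deriv f g \<longleftrightarrow> H1r (\<lambda>x. Re (f x)) (\<lambda>x. Re (g x)) \<and> H1r (\<lambda>x. Im (f x)) (\<lambda>x. Im (g x))"
proof -
  have si: "set_integrable lborel {0..x} h" if "L2r h" for h x
  proof -
    have "set_integrable lborel {0..x} (\<lambda>x. (h x)\<^sup>2)"
      by (rule set_integrable_subset[of _ "{0..}"]) (use that in \<open>auto simp: L2r_def hl_integrable_iff\<close>)
    moreover have "set_integrable lborel {0..x} (\<lambda>x. 1 :: real)"
      by (rule borel_integrable_atLeastAtMost') simp
    ultimately have "set_integrable lborel {0..x} (\<lambda>x. (h x)\<^sup>2 + 1)" by simp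
    then show ?thesis
    proof (rule set_integrable_bound)
      have "set_borel_measurable lborel {0..} h" using that by (simp add: L2r_def borel_measurable_hl_iff)
      then show "set_borel_measurable lborel {0..x} h"
        by (rule set_borel_measurable_subset) auto
      have "\<bar>h y\<bar> \<le> (h y)\<^sup>2 + 1" for y using two_abs_mult_le[of "h y" 1] abs_ge_zero[of "h y"] by simp
      then show "AE y in lborel. y \<in> {0..x} \<longrightarrow> norm (h y) \<le> norm ((h y)\<^sup>2 + 1)" by (auto intro!: AE_I2)
    qed
  qed
  have sc: "set_integrable lborel {0..x} (\<lambda>x. complex_of_real (h x))" if "L2r h" for h x
  proof -
    have "integrable lborel (\<lambda>y. complex_of_real (indicat_real {0..x} y *\<^sub>R h y))"
      using si[OF that, of x] unfolding set_integrable_def by (rule integrable_of_real)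
    then show ?thesis by (simp add: set_integrable_def scaleR_conv_of_real)
  qed
  have c: "set_integrable lborel {0..x} g \<and> Re (LINT s:{0..x}|lborel. g s) = (LINT s:{0..x}|lborel. Re (g s))
      \<and> Im (LINT s:{0..x}|lborel. g s) = (LINT s:{0..x}|lborel. Im (g s))" if g: "L2_hl g" for x
  proof -
    have "set_integrable lborel {0..x} (\<lambda>x. complex_of_real (Re (g x)))" "set_integrable lborel {0..x} (\<lambda>x. complex_of_real (Im (g x)))"
      using sc g by (auto simp: L2_hl_parts)
    then have "set_integrable lborel {0..x} (\<lambda>x. complex_of_real (Re (g x)) + \<i> * complex_of_real (Im (g x)))"
      by simp
    then have i: "set_integrable lborel {0..x} g" by (simp flip: complex_eq)
    then have i': "complex_integrable lborel (\<lambda>s. indicat_real {0..x} s *\<^sub>R g s)" by (simp add: set_integrable_def)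
    show ?thesis using i integral_Re[OF i'] integral_Im[OF i'] by (simp add: set_lebesgue_integral_def)
  qed
  show ?thesis
  proof
    assume d: "is_hl_deriv f g"
    then have g: "L2_hl g" by (simp add: is_hl_deriv_def)
    have eq: "f x = f 0 + (LINT s:{0..x}|lborel. g s)" if "x \<ge> 0" for x
      using d that unfolding is_hl_deriv_def by blast
    have "Re (f x) = Re (f 0) + (LINT s:{0..x}|lborel. Re (g s))" "Im (f x) = Im (f 0) + (LINT s:{0..x}|lborel. Im (g s))" if "x \<ge> 0" for x
      using c[OF g, of x] arg_cong[OF eq[OF that], of Re] arg_cong[OF eq[OF that], of Im] by simp_all
    then show "H1r (\<lambda>x. Re (f x)) (\<lambda>x. Re (g x)) \<and> H1r (\<lambda>x. Im (f x)) (\<lambda>x. Im (g x))"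
      using f g si unfolding H1r_def prim_def L2_hl_parts by blast
  next
    assume h: "H1r (\<lambda>x. Re (f x)) (\<lambda>x. Re (g x)) \<and> H1r (\<lambda>x. Im (f x)) (\<lambda>x. Im (g x))"
    then have g: "L2_hl g" by (simp add: L2_hl_parts H1r_def)
    have "Re (f x) = Re (f 0) + (LINT s:{0..x}|lborel. Re (g s)) \<and> Im (f x) = Im (f 0) + (LINT s:{0..x}|lborel. Im (g s))" if "x \<ge> 0" for x
      using h that unfolding H1r_def prim_def by blast
    then have "f x = f 0 + (LINT s:{0..x}|lborel. g s)" if "x \<ge> 0" for x
      using c[OF g, of x] that unfolding complex_eq_iff plus_complex.simps by metis
    then show "is_hl_deriv f g" using g unfolding is_hl_deriv_def by blast
  qed
qed

lemma H1_hl_deriv: "H1_hl f \<Longrightarrow> is_hl_deriv f (hl_deriv f)"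
  unfolding H1_hl_def hl_deriv_def by (metis someI_ex)

lemma H1_hl_H1r:
  assumes "H1_hl f"
  shows "H1r (\<lambda>x. Re (f x)) (\<lambda>x. Re (hl_deriv f x))" "H1r (\<lambda>x. Im (f x)) (\<lambda>x. Im (hl_deriv f x))"
    "L2_hl f" "L2_hl (hl_deriv f)"
proof -
  show L: "L2_hl f" using assms by (simp add: H1_hl_def)
  note d = H1_hl_deriv[OF assms]
  show "L2_hl (hl_deriv f)" using d unfolding is_hl_deriv_def by blast
  show "H1r (\<lambda>x. Re (f x)) (\<lambda>x. Re (hl_deriv f x))" "H1r (\<lambda>x. Im (f x)) (\<lambda>x. Im (hl_deriv f x))"
    using d unfolding is_hl_deriv_parts[OF L] by auto
qed

text \<open>By \<open>prim_unique_AE\<close> any concrete weak derivative may replace the selected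
  \<open>hl_deriv\<close> under an integral.\<close>

lemma H1r_H1_hl:
  assumes "H1r (\<lambda>x. Re (f x)) (\<lambda>x. Re (g x))" "H1r (\<lambda>x. Im (f x)) (\<lambda>x. Im (g x))"
  shows "H1_hl f" "AE x in hl. hl_deriv f x = g x"
proof -
  have f: "L2_hl f" using assms by (simp add: L2_hl_parts H1r_def)
  show h: "H1_hl f" using f assms is_hl_deriv_parts[OF f] unfolding H1_hl_def by blast
  have "AE x in hl. Re (hl_deriv f x) = Re (g x)" "AE x in hl. Im (hl_deriv f x) = Im (g x)"
    using H1_hl_H1r(1,2)[OF h] assms by (auto simp: H1r_def intro!: prim_unique_AE)
  then show "AE x in hl. hl_deriv f x = g x" by eventually_elim (simp add: complex_eq_iff)
qed

lemma H1_hl_lin: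
  assumes f: "H1_hl f" and g: "H1_hl g"
  shows "H1_hl (\<lambda>x. a * f x + b * g x)" "AE x in hl. hl_deriv (\<lambda>x. a * f x + b * g x) x = a * hl_deriv f x + b * hl_deriv g x"
proof -
  note ff = H1_hl_H1r[OF f] and gg = H1_hl_H1r[OF g]
  have 1: "H1r (\<lambda>x. Re (a * f x + b * g x)) (\<lambda>x. Re (a * hl_deriv f x + b * hl_deriv g x))"
    using H1r_add[OF H1r_diff[OF H1r_cmult[OF ff(1), of "Re a"] H1r_cmult[OF ff(2), of "Im a"]]
       H1r_diff[OF H1r_cmult[OF gg(1), of "Re b"] H1r_cmult[OF gg(2), of "Im b"]]] by simp
  have 2: "H1r (\<lambda>x. Im (a * f x + b * g x)) (\<lambda>x. Im (a * hl_deriv f x + b * hl_deriv g x))"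
    using H1r_add[OF H1r_add[OF H1r_cmult[OF ff(2), of "Re a"] H1r_cmult[OF ff(1), of "Im a"]]
       H1r_add[OF H1r_cmult[OF gg(2), of "Re b"] H1r_cmult[OF gg(1), of "Im b"]]] by simp
  show "H1_hl (\<lambda>x. a * f x + b * g x)" "AE x in hl. hl_deriv (\<lambda>x. a * f x + b * g x) x = a * hl_deriv f x + b * hl_deriv g x"
    using H1r_H1_hl[OF 1 2] by auto
qed

definition L2G :: "nat \<Rightarrow> gfun \<Rightarrow> bool" where "L2G N U \<longleftrightarrow> (\<forall>j<N. L2_hl (U j))"

definition L2norm :: "nat \<Rightarrow> gfun \<Rightarrow> real" where "L2norm N U = sqrt (\<Sum>j<N. (cn (U j))\<^sup>2)"

lemma ipG_hl: "ipG N u v = (\<Sum>j<N. \<integral>x. u j x * cnj (v j x) \<partial>hl)"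
  unfolding ipG_def hl_integral_eq ..

lemma gradG_ip: "gradG N u v = ipG N (\<lambda>j. hl_deriv (u j)) (\<lambda>j. hl_deriv (v j))"
  unfolding gradG_def ipG_def ..

lemma H1norm_cn: "(H1norm N U)\<^sup>2 = (\<Sum>j<N. (cn (U j))\<^sup>2 + (cn (hl_deriv (U j)))\<^sup>2)"
  unfolding H1norm_def hl_integral_eq cn_sq by (subst real_sqrt_pow2) (auto intro!: sum_nonneg add_nonneg_nonneg)

lemma H1norm_nonneg: "H1norm N U \<ge> 0"
  unfolding H1norm_def by (auto intro!: sum_nonneg add_nonneg_nonneg simp: hl_integral_eq)

lemma L2norm_nonneg: "L2norm N U \<ge> 0" and L2norm_sq: "(L2norm N U)\<^sup>2 = (\<Sum>j<N. (cn (U j))\<^sup>2)"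
  by (simp_all add: L2norm_def sum_nonneg)

lemma H1norm_split: "(H1norm N U)\<^sup>2 = (L2norm N U)\<^sup>2 + (L2norm N (\<lambda>j. hl_deriv (U j)))\<^sup>2"
  unfolding H1norm_cn L2norm_sq by (simp add: sum.distrib)

lemma L2norm_le_H1norm: "L2norm N U \<le> H1norm N U" "L2norm N (\<lambda>j. hl_deriv (U j)) \<le> H1norm N U"
  by (rule power2_le_imp_le; simp add: H1norm_split H1norm_nonneg)+

lemma H1G_D: "H1G N U \<Longrightarrow> j < N \<Longrightarrow> H1_hl (U j)" "H1G N U \<Longrightarrow> j < N \<Longrightarrow> U j 0 = U 0 0"
  unfolding H1G_def by blast+

lemma H1G_L2G: "H1G N U \<Longrightarrow> L2G N U" "H1G N U \<Longrightarrow> L2G N (\<lambda>j. hl_deriv (U j))"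
  unfolding L2G_def using H1G_D(1) H1_hl_H1r(3,4) by blast+

lemma ipG_bound:
  assumes "L2G N U" "L2G N V" shows "cmod (ipG N U V) \<le> L2norm N U * L2norm N V"
    "(\<Sum>j<N. \<integral>x. cmod (U j x) * cmod (V j x) \<partial>hl) \<le> L2norm N U * L2norm N V"
proof -
  have s: "(\<Sum>j<N. cn (U j) * cn (V j)) \<le> L2norm N U * L2norm N V"
  proof (rule power2_le_imp_le)
    show "(\<Sum>j<N. cn (U j) * cn (V j))\<^sup>2 \<le> (L2norm N U * L2norm N V)\<^sup>2"
      unfolding power_mult_distrib L2norm_sq by (rule Cauchy_Schwarz_ineq_sum)
  qed (simp add: L2norm_nonneg)
  have "cmod (ipG N U V) \<le> (\<Sum>j<N. cmod (\<integral>x. U j x * cnj (V j x) \<partial>hl))" unfolding ipG_hl by (rule norm_sum)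
  also have "\<dots> \<le> (\<Sum>j<N. cn (U j) * cn (V j))"
    using assms by (intro sum_mono L2_hl_prod) (auto simp: L2G_def)
  finally show "cmod (ipG N U V) \<le> L2norm N U * L2norm N V" using s by linarith
  have "(\<Sum>j<N. \<integral>x. cmod (U j x) * cmod (V j x) \<partial>hl) \<le> (\<Sum>j<N. cn (U j) * cn (V j))"
    using assms by (intro sum_mono L2_hl_prod) (auto simp: L2G_def)
  then show "(\<Sum>j<N. \<integral>x. cmod (U j x) * cmod (V j x) \<partial>hl) \<le> L2norm N U * L2norm N V" using s by linarith
qed

lemma L2G_lin: "L2G N U \<Longrightarrow> L2G N V \<Longrightarrow> L2G N (\<lambda>j x. a * U j x + b * V j x)"
  by (auto simp: L2G_def intro!: L2_hl_lin)

lemma ipG_lin_left: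
  assumes "L2G N U" "L2G N V" "L2G N W"
  shows "ipG N (\<lambda>j x. a * U j x + b * V j x) W = a * ipG N U W + b * ipG N V W"
proof -
  have "(\<integral>x. (a * U j x + b * V j x) * cnj (W j x) \<partial>hl) = a * (\<integral>x. U j x * cnj (W j x) \<partial>hl) + b * (\<integral>x. V j x * cnj (W j x) \<partial>hl)" if "j < N" for j
  proof -
    have i: "integrable hl (\<lambda>x. U j x * cnj (W j x))" "integrable hl (\<lambda>x. V j x * cnj (W j x))"
      using assms that by (auto simp: L2G_def intro!: L2_hl_prod)
    have "(\<integral>x. (a * U j x + b * V j x) * cnj (W j x) \<partial>hl) = (\<integral>x. a * (U j x * cnj (W j x)) + b * (V j x * cnj (W j x)) \<partial>hl)"
      by (simp add: algebra_simps)
    then show ?thesis using i by simp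
  qed
  then show ?thesis unfolding ipG_hl by (simp add: sum.distrib sum_distrib_left)
qed

lemma ipG_cnj: "ipG N U V = cnj (ipG N V U)"
proof -
  have "(\<integral>x. U j x * cnj (V j x) \<partial>hl) = cnj (\<integral>x. V j x * cnj (U j x) \<partial>hl)" for j
    using Bochner_Integration.integral_cnj[of hl "\<lambda>x. V j x * cnj (U j x)"] by (simp add: mult.commute)
  then show ?thesis unfolding ipG_hl cnj_sum by simp
qed

lemma ipG_lin_right:
  assumes "L2G N U" "L2G N V" "L2G N W"
  shows "ipG N W (\<lambda>j x. a * U j x + b * V j x) = cnj a * ipG N W U + cnj b * ipG N W V"
  by (subst ipG_cnj, subst ipG_lin_left[OF assms]) (simp flip: ipG_cnj)

lemma ipG_self: "ipG N U U = complex_of_real ((L2norm N U)\<^sup>2)"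
proof -
  have "(\<integral>x. U j x * cnj (U j x) \<partial>hl) = complex_of_real (\<integral>x. (cmod (U j x))\<^sup>2 \<partial>hl)" for j
    by (subst integral_complex_of_real[symmetric]) (simp only: complex_norm_square)
  then show ?thesis unfolding ipG_hl L2norm_sq cn_sq of_real_sum by simp
qed

text \<open>For use with \<open>hl_deriv\<close>, which is known to respect linear combinations only
  almost everywhere.\<close>

lemma ipG_cong_AE:
  assumes "\<And>j. j < N \<Longrightarrow> AE x in hl. U j x = U' j x" "\<And>j. j < N \<Longrightarrow> AE x in hl. V j x = V' j x"
    "L2G N U" "L2G N U'" "L2G N V" "L2G N V'"
  shows "ipG N U V = ipG N U' V'"
  unfolding ipG_hl
proof (rule sum.cong[OF refl])
  fix j assume j: "j \<in> {..<N}"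
  have "AE x in hl. U j x = U' j x" "AE x in hl. V j x = V' j x" using assms(1,2) j by auto
  then have ae: "AE x in hl. U j x * cnj (V j x) = U' j x * cnj (V' j x)" by eventually_elim simp
  have "integrable hl (\<lambda>x. U j x * cnj (V j x))" "integrable hl (\<lambda>x. U' j x * cnj (V' j x))"
    using assms(3-6) j by (auto simp: L2G_def intro!: L2_hl_prod)
  then show "(\<integral>x. U j x * cnj (V j x) \<partial>hl) = (\<integral>x. U' j x * cnj (V' j x) \<partial>hl)"
    using ae by (intro integral_cong_AE) auto
qed

lemma H1G_lin:
  assumes "H1G N U" "H1G N V" shows "H1G N (\<lambda>j x. a * U j x + b * V j x)"
  unfolding H1G_def
proof (intro conjI allI impI)
  fix j assume j: "j < N"
  show "H1_hl (\<lambda>x. a * U j x + b * V j x)" by (intro H1_hl_lin(1) H1G_D(1)[OF assms(1) j] H1G_D(1)[OF assms(2) j])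
  show "a * U j 0 + b * V j 0 = a * U 0 0 + b * V 0 0"
    by (simp only: H1G_D(2)[OF assms(1) j] H1G_D(2)[OF assms(2) j])
qed

lemma gradG_lin_left:
  assumes "H1G N U" "H1G N V" "H1G N W"
  shows "gradG N (\<lambda>j x. a * U j x + b * V j x) W = a * gradG N U W + b * gradG N V W"
proof -
  have "gradG N (\<lambda>j x. a * U j x + b * V j x) W = ipG N (\<lambda>j x. a * hl_deriv (U j) x + b * hl_deriv (V j) x) (\<lambda>j. hl_deriv (W j))"
    unfolding gradG_ip
  proof (rule ipG_cong_AE)
    show "AE x in hl. hl_deriv (\<lambda>x. a * U j x + b * V j x) x = a * hl_deriv (U j) x + b * hl_deriv (V j) x" if "j < N" for j
      by (rule H1_hl_lin(2)) (use assms that H1G_D(1) in blast)+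
    show "L2G N (\<lambda>j. hl_deriv (\<lambda>x. a * U j x + b * V j x))" by (rule H1G_L2G(2)[OF H1G_lin[OF assms(1,2)]])
  qed (auto intro!: L2G_lin H1G_L2G(2) assms)
  then show ?thesis using ipG_lin_left[OF H1G_L2G(2)[OF assms(1)] H1G_L2G(2)[OF assms(2)] H1G_L2G(2)[OF assms(3)]]
    by (simp add: gradG_ip)
qed

lemma gradG_cnj: "gradG N U V = cnj (gradG N V U)"
  unfolding gradG_ip by (rule ipG_cnj)

lemma gradG_lin_right:
  assumes "H1G N U" "H1G N V" "H1G N W"
  shows "gradG N W (\<lambda>j x. a * U j x + b * V j x) = cnj a * gradG N W U + cnj b * gradG N W V"
  by (subst gradG_cnj, subst gradG_lin_left[OF assms]) (simp flip: gradG_cnj)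

lemma gradG_bound: "H1G N U \<Longrightarrow> H1G N V \<Longrightarrow> cmod (gradG N U V) \<le> H1norm N U * H1norm N V"
  unfolding gradG_ip
  by (rule order_trans[OF ipG_bound(1)[OF H1G_L2G(2) H1G_L2G(2)]])
     (auto intro!: mult_mono L2norm_le_H1norm L2norm_nonneg H1norm_nonneg)

lemma ipG_bound_H1: "L2G N U \<Longrightarrow> H1G N V \<Longrightarrow> cmod (ipG N U V) \<le> L2norm N U * H1norm N V"
  by (rule order_trans[OF ipG_bound(1)[OF _ H1G_L2G(1)]])
     (auto intro!: mult_left_mono L2norm_le_H1norm L2norm_nonneg)

lemma gradG_self: "gradG N U U = complex_of_real ((L2norm N (\<lambda>j. hl_deriv (U j)))\<^sup>2)"
  unfolding gradG_ip by (rule ipG_self)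

lemma H1norm_sq_ip: "(H1norm N U)\<^sup>2 = Re (ipG N U U + gradG N U U)"
  unfolding ipG_self gradG_self H1norm_split by simp

lemma H1norm_cmult:
  assumes "H1G N U" shows "H1norm N (\<lambda>j x. a * U j x) = cmod a * H1norm N U"
proof -
  have H: "H1G N (\<lambda>j x. a * U j x)" using H1G_lin[OF assms assms, of a 0] by simp
  have "ipG N (\<lambda>j x. a * U j x) (\<lambda>j x. a * U j x) = a * cnj a * ipG N U U"
    using ipG_lin_left[OF H1G_L2G(1)[OF assms] H1G_L2G(1)[OF assms] H1G_L2G(1)[OF H], of a 0]
      ipG_lin_right[OF H1G_L2G(1)[OF assms] H1G_L2G(1)[OF assms] H1G_L2G(1)[OF assms], of a 0] by simp
  moreover have "gradG N (\<lambda>j x. a * U j x) (\<lambda>j x. a * U j x) = a * cnj a * gradG N U U"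
    using gradG_lin_left[OF assms assms H, of a 0] gradG_lin_right[OF assms assms assms, of a 0] by simp
  moreover have "a * cnj a = complex_of_real ((cmod a)\<^sup>2)" by (rule complex_norm_square[symmetric])
  ultimately have "ipG N (\<lambda>j x. a * U j x) (\<lambda>j x. a * U j x) + gradG N (\<lambda>j x. a * U j x) (\<lambda>j x. a * U j x)
      = complex_of_real ((cmod a)\<^sup>2) * (ipG N U U + gradG N U U)" by (simp only: distrib_left)
  then have "(H1norm N (\<lambda>j x. a * U j x))\<^sup>2 = (cmod a * H1norm N U)\<^sup>2"
    unfolding H1norm_sq_ip power_mult_distrib by (simp del: of_real_power)
  then show ?thesis by (simp add: power2_eq_iff_nonneg H1norm_nonneg)
qed

lemma H1norm_add_le:
  assumes U: "H1G N U" and V: "H1G N V"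
  shows "H1norm N (\<lambda>j x. U j x + V j x) \<le> H1norm N U + H1norm N V"
proof (rule power2_le_imp_le)
  have H: "H1G N (\<lambda>j x. U j x + V j x)" using H1G_lin[OF U V, of 1 1] by simp
  note L = H1G_L2G(1)[OF U] H1G_L2G(1)[OF V] H1G_L2G(1)[OF H]
  note dL = H1G_L2G(2)[OF U] H1G_L2G(2)[OF V]
  have "ipG N (\<lambda>j x. U j x + V j x) (\<lambda>j x. U j x + V j x) = ipG N U U + ipG N U V + (ipG N V U + ipG N V V)"
    using ipG_lin_left[OF L(1,2,3), of 1 1] ipG_lin_right[OF L(1,2,1), of 1 1] ipG_lin_right[OF L(1,2,2), of 1 1] by simp
  moreover have "gradG N (\<lambda>j x. U j x + V j x) (\<lambda>j x. U j x + V j x) = gradG N U U + gradG N U V + (gradG N V U + gradG N V V)"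
    using gradG_lin_left[OF U V H, of 1 1] gradG_lin_right[OF U V U, of 1 1] gradG_lin_right[OF U V V, of 1 1] by simp
  ultimately have "(H1norm N (\<lambda>j x. U j x + V j x))\<^sup>2 = (H1norm N U)\<^sup>2 + (H1norm N V)\<^sup>2 + 2 * (Re (ipG N U V) + Re (gradG N U V))"
    unfolding H1norm_sq_ip ipG_cnj[of N V U] gradG_cnj[of N V U] by simp
  also have "Re (ipG N U V) + Re (gradG N U V) \<le> H1norm N U * H1norm N V"
  proof -
    define a where "a = L2norm N U"
    define b where "b = L2norm N (\<lambda>j. hl_deriv (U j))"
    define c where "c = L2norm N V"
    define d where "d = L2norm N (\<lambda>j. hl_deriv (V j))"
    have "Re (ipG N U V) + Re (gradG N U V) \<le> a * c + b * d"
      unfolding gradG_ip a_def b_def c_def d_def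
      using ipG_bound(1)[OF L(1,2)] ipG_bound(1)[OF dL] complex_Re_le_cmod by (meson add_mono order_trans)
    also have "\<dots> \<le> H1norm N U * H1norm N V"
    proof (rule power2_le_imp_le)
      \<comment> \<open>Lagrange's identity combines the Cauchy-Schwarz bounds for functions and
        derivatives into one for the H^1 norm.\<close>
      have "0 \<le> (a * d - b * c)\<^sup>2" by simp
      then have "(a * c + b * d)\<^sup>2 \<le> (a\<^sup>2 + b\<^sup>2) * (c\<^sup>2 + d\<^sup>2)" by (simp add: power2_eq_square algebra_simps)
      then show "(a * c + b * d)\<^sup>2 \<le> (H1norm N U * H1norm N V)\<^sup>2"
        unfolding power_mult_distrib H1norm_split a_def b_def c_def d_def .
    qed (simp add: H1norm_nonneg)
    finally show ?thesis .
  qed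
  finally show "(H1norm N (\<lambda>j x. U j x + V j x))\<^sup>2 \<le> (H1norm N U + H1norm N V)\<^sup>2"
    by (simp add: power2_eq_square algebra_simps)
qed (simp add: H1norm_nonneg)

lemma H1G_diff: "H1G N U \<Longrightarrow> H1G N V \<Longrightarrow> H1G N (\<lambda>j x. U j x - V j x)"
  using H1G_lin[of N U V 1 "-1"] by simp

lemma H1G_add: "H1G N U \<Longrightarrow> H1G N V \<Longrightarrow> H1G N (\<lambda>j x. U j x + V j x)"
  using H1G_lin[of N U V 1 1] by simp

lemma H1G_cmult: "H1G N U \<Longrightarrow> H1G N (\<lambda>j x. a * U j x)"
  using H1G_lin[of N U U a 0] by simp

lemma L2G_diff: "L2G N U \<Longrightarrow> L2G N V \<Longrightarrow> L2G N (\<lambda>j x. U j x - V j x)"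
  using L2G_lin[of N U V 1 "-1"] by simp

lemma ipG_diff_left: "L2G N U \<Longrightarrow> L2G N V \<Longrightarrow> L2G N W \<Longrightarrow> ipG N (\<lambda>j x. U j x - V j x) W = ipG N U W - ipG N V W"
  using ipG_lin_left[of N U V W 1 "-1"] by simp

lemma ipG_diff_right: "L2G N U \<Longrightarrow> L2G N V \<Longrightarrow> L2G N W \<Longrightarrow> ipG N W (\<lambda>j x. U j x - V j x) = ipG N W U - ipG N W V"
  using ipG_lin_right[of N U V W 1 "-1"] by simp

lemma H1norm_diff_commute: "H1norm N (\<lambda>j x. U j x - V j x) = H1norm N (\<lambda>j x. V j x - U j x)" if "H1G N U" "H1G N V"
  using H1norm_cmult[OF H1G_diff[OF that], of "-1"] by simp

lemma H1norm_diff_triangle: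
  assumes "H1G N U" "H1G N V" "H1G N W"
  shows "H1norm N (\<lambda>j x. U j x - W j x) \<le> H1norm N (\<lambda>j x. U j x - V j x) + H1norm N (\<lambda>j x. V j x - W j x)"
  using H1norm_add_le[OF H1G_diff[OF assms(1,2)] H1G_diff[OF assms(2,3)]] by simp

lemma H1norm_diff_abs:
  assumes "H1G N U" "H1G N V"
  shows "\<bar>H1norm N U - H1norm N V\<bar> \<le> H1norm N (\<lambda>j x. U j x - V j x)"
  using H1norm_add_le[OF assms(2) H1G_diff[OF assms]] H1norm_add_le[OF assms(1) H1G_diff[OF assms(2,1)]]
    H1norm_diff_commute[OF assms] by simp

lemma cn_sq_parts:
  assumes "L2_hl f" shows "(cn f)\<^sup>2 = (\<integral>x. (Re (f x))\<^sup>2 \<partial>hl) + (\<integral>x. (Im (f x))\<^sup>2 \<partial>hl)"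
  using assms unfolding cn_sq L2_hl_parts by (simp add: cmod_power2 L2r_def)

lemma H1norm_h2:
  assumes "H1G N U"
  shows "(H1norm N U)\<^sup>2 = (\<Sum>j<N. h2 (\<lambda>x. Re (U j x)) (\<lambda>x. Re (hl_deriv (U j) x)) + h2 (\<lambda>x. Im (U j x)) (\<lambda>x. Im (hl_deriv (U j) x)))"
  unfolding H1norm_cn h2_def
  by (intro sum.cong refl) (simp add: cn_sq_parts[OF H1_hl_H1r(3)[OF H1G_D(1)[OF assms]]] cn_sq_parts[OF H1_hl_H1r(4)[OF H1G_D(1)[OF assms]]])

lemma H1norm_sup:
  assumes U: "H1G N U" and j: "j < N" and x: "x \<ge> 0"
  shows "cmod (U j x) \<le> H1norm N U"
proof (rule power2_le_imp_le)
  have Hj: "H1_hl (U j)" by (rule H1G_D(1)[OF U j])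
  have "(cmod (U j x))\<^sup>2 = (Re (U j x))\<^sup>2 + (Im (U j x))\<^sup>2" by (rule cmod_power2)
  also have "\<dots> \<le> h2 (\<lambda>x. Re (U j x)) (\<lambda>x. Re (hl_deriv (U j) x)) + h2 (\<lambda>x. Im (U j x)) (\<lambda>x. Im (hl_deriv (U j) x))"
    using H1r_sup_h2[OF H1_hl_H1r(1)[OF Hj] x] H1r_sup_h2[OF H1_hl_H1r(2)[OF Hj] x] by simp
  also have "\<dots> \<le> (H1norm N U)\<^sup>2" unfolding H1norm_h2[OF U]
    using j by (intro member_le_sum[of j "{..<N}" "\<lambda>j. h2 (\<lambda>x. Re (U j x)) (\<lambda>x. Re (hl_deriv (U j) x)) + h2 (\<lambda>x. Im (U j x)) (\<lambda>x. Im (hl_deriv (U j) x))"])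
       (auto simp: h2_nonneg)
  finally show "(cmod (U j x))\<^sup>2 \<le> (H1norm N U)\<^sup>2" .
qed (rule H1norm_nonneg)

text \<open>The embedding bounds |U|^(2p) by a constant, so the nonlinearity lies in L^2 and acts on
  H^1 through \<open>ipG\<close>.\<close>

lemma nonlin_L2:
  assumes U: "H1G N U" and R: "H1norm N U \<le> R" and p: "p > 0"
  shows "L2G N (nonlin p U)" "L2norm N (nonlin p U) \<le> R powr (2 * p) * L2norm N U"
proof -
  have c: "cmod (nonlin p U j x) \<le> R powr (2 * p) * cmod (U j x)" if "j < N" "x \<ge> 0" for j x
  proof -
    have "cmod (U j x) powr (2 * p) \<le> R powr (2 * p)"
      using H1norm_sup[OF U that] R p by (intro powr_mono2) auto
    then show ?thesis by (simp add: nonlin_def norm_mult mult_right_mono)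
  qed
  have L: "L2G N U" by (rule H1G_L2G(1)[OF U])
  have Lj: "L2_hl (nonlin p U j)" if j: "j < N" for j
  proof (rule L2_hl_bound)
    show "L2r (\<lambda>x. R powr (2 * p) * cmod (U j x))" using L j by (intro L2r_cmult L2_hl_cmod) (simp add: L2G_def)
    have [measurable]: "U j \<in> borel_measurable hl" using L j by (simp add: L2G_def L2_hl_iff)
    show "nonlin p U j \<in> borel_measurable hl" unfolding nonlin_def by measurable
  qed (rule c[OF j])
  show "L2G N (nonlin p U)" using Lj by (simp add: L2G_def)
  have cj: "(cn (nonlin p U j))\<^sup>2 \<le> (R powr (2 * p))\<^sup>2 * (cn (U j))\<^sup>2" if j: "j < N" for j
  proof -
    have "(\<integral>x. (cmod (nonlin p U j x))\<^sup>2 \<partial>hl) \<le> (\<integral>x. (R powr (2 * p))\<^sup>2 * (cmod (U j x))\<^sup>2 \<partial>hl)"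
    proof (rule hl_integral_mono)
      show "integrable hl (\<lambda>x. (cmod (nonlin p U j x))\<^sup>2)" using Lj[OF j] by (simp add: L2_hl_iff)
      show "integrable hl (\<lambda>x. (R powr (2 * p))\<^sup>2 * (cmod (U j x))\<^sup>2)" using L j by (simp add: L2G_def L2_hl_iff)
      show "(cmod (nonlin p U j x))\<^sup>2 \<le> (R powr (2 * p))\<^sup>2 * (cmod (U j x))\<^sup>2" if "x \<ge> 0" for x
        using power_mono[OF c[OF j that], of 2] by (simp add: power_mult_distrib)
    qed
    then show ?thesis by (simp add: cn_sq)
  qed
  show "L2norm N (nonlin p U) \<le> R powr (2 * p) * L2norm N U"
  proof (rule power2_le_imp_le)
    show "(L2norm N (nonlin p U))\<^sup>2 \<le> (R powr (2 * p) * L2norm N U)\<^sup>2"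
      unfolding power_mult_distrib L2norm_sq sum_distrib_left using cj by (intro sum_mono) auto
  qed (simp add: L2norm_nonneg)
qed

section \<open>Conservation laws and symmetry of the flow\<close>

text \<open>Bound for the H^{-1} norm of the time derivative of a solution whose H^1 norm is at most
  R; see \<open>DF_bound\<close>.\<close>

definition BB :: "real \<Rightarrow> real \<Rightarrow> real" where "BB p R = R + (p + 1) * (R powr (2 * p) * R)"

definition Pot :: "nat \<Rightarrow> real \<Rightarrow> gfun \<Rightarrow> real" where
  "Pot N p U = (\<Sum>j<N. \<integral>x. cmod (U j x) powr (2 * p + 2) \<partial>hl)"

lemma ipG_nonlin_self: "ipG N (nonlin p U) U = complex_of_real (Pot N p U)"
proof -
  have "nonlin p U j x * cnj (U j x) = complex_of_real (cmod (U j x) powr (2 * p + 2))" for j x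
  proof (cases "U j x = 0")
    case False
    have "nonlin p U j x * cnj (U j x) = complex_of_real (cmod (U j x) powr (2 * p)) * (U j x * cnj (U j x))"
      by (simp add: nonlin_def)
    also have "U j x * cnj (U j x) = complex_of_real ((cmod (U j x))\<^sup>2)" by (rule complex_norm_square[symmetric])
    finally show ?thesis using False by (simp add: powr_add)
  qed (simp add: nonlin_def)
  then show ?thesis by (simp add: ipG_hl Pot_def)
qed

text \<open>Since 2p - 1 \<ge> 0, the derivative of the power is monotone and bounded on (0, R] by
  its value at R; continuity covers the end point 0.\<close>

lemma powr_lipschitz:
  fixes a b R p :: real
  assumes p: "1/2 \<le> p" and a: "0 \<le> a" "a \<le> R" and b: "0 \<le> b" "b \<le> R"
  shows "\<bar>b powr (2 * p) - a powr (2 * p)\<bar> \<le> 2 * p * R powr (2 * p - 1) * \<bar>b - a\<bar>"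
proof -
  have main: "b powr (2 * p) - a powr (2 * p) \<le> 2 * p * R powr (2 * p - 1) * (b - a)" if ab: "0 \<le> a" "a < b" "b \<le> R" for a b :: real
  proof -
    have "\<exists>l z. a < z \<and> z < b \<and> ((\<lambda>x. x powr (2 * p)) has_real_derivative l) (at z) \<and> b powr (2 * p) - a powr (2 * p) = (b - a) * l"
    proof (rule MVT[OF ab(2)])
      show "continuous_on {a..b} (\<lambda>x. x powr (2 * p))"
        by (rule continuous_on_powr') (use ab p in \<open>auto intro!: continuous_intros\<close>)
      show "(\<lambda>x. x powr (2 * p)) differentiable (at x)" if "a < x" "x < b" for x
        using has_real_derivative_powr[of x "2 * p"] that ab by (auto simp: real_differentiable_def)
    qed
    then obtain l z where z: "a < z" "z < b" and l: "((\<lambda>x. x powr (2 * p)) has_real_derivative l) (at z)"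
      and e: "b powr (2 * p) - a powr (2 * p) = (b - a) * l" by blast
    have "l = 2 * p * z powr (2 * p - 1)"
      using DERIV_unique[OF l has_real_derivative_powr] z ab by simp
    moreover have "2 * p * z powr (2 * p - 1) \<le> 2 * p * R powr (2 * p - 1)"
      using z ab p by (intro mult_left_mono powr_mono2) auto
    ultimately have "l \<le> 2 * p * R powr (2 * p - 1)" by simp
    then show ?thesis unfolding e using ab by (subst mult.commute[of "b - a"]) (intro mult_right_mono, auto)
  qed
  have mono: "x powr (2 * p) \<le> y powr (2 * p)" if "0 \<le> x" "x \<le> y" for x y :: real
    using that p by (intro powr_mono2) auto
  consider "a < b" | "a = b" | "b < a" by linarith
  then show ?thesis
  proof cases
    case 1 then show ?thesis using main[OF a(1) 1 b(2)] mono[OF a(1), of b] by simp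
  next
    case 3 then show ?thesis using main[OF b(1) 3 a(2)] mono[OF b(1), of a] by simp
  qed simp
qed

text \<open>The two terms agree to first order in b - a, so their difference is quadratic. In the
  proof of energy conservation the increment is divided by the time step h, and a first-order error
  would not vanish there.\<close>

lemma trapezoid_bound:
  fixes a b R p :: real
  assumes p: "1/2 \<le> p" and a: "0 \<le> a" "a \<le> R" and b: "0 \<le> b" "b \<le> R"
  shows "\<bar>(p + 1) * (b powr (2 * p) - a powr (2 * p)) * ((a\<^sup>2 + b\<^sup>2) / 2) - p * (b powr (2 * p + 2) - a powr (2 * p + 2))\<bar>
     \<le> 4 * p * (p + 1) * (R * R powr (2 * p - 1)) * (b - a)\<^sup>2"
proof -
  have main: "\<bar>(p + 1) * (b powr (2 * p) - a powr (2 * p)) * ((a\<^sup>2 + b\<^sup>2) / 2) - p * (b powr (2 * p + 2) - a powr (2 * p + 2))\<bar>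
     \<le> 4 * p * (p + 1) * (R * R powr (2 * p - 1)) * (b - a)\<^sup>2" if ab: "0 \<le> a" "a < b" "b \<le> R" for a b :: real
  proof -
    \<comment> \<open>As a function of the upper end point, F vanishes at a and its derivative is
      itself of order x - a, because the two first-order terms cancel; the mean value theorem
      supplies the second factor b - a.\<close>
    define F where "F x = (p + 1) * (x powr (2 * p) - a powr (2 * p)) * ((a\<^sup>2 + x\<^sup>2) / 2) - p * (x powr (2 * p + 2) - a powr (2 * p + 2))" for x
    have dF: "(F has_real_derivative p * (p + 1) * x powr (2 * p - 1) * (a\<^sup>2 - x\<^sup>2) + (p + 1) * x * (x powr (2 * p) - a powr (2 * p))) (at x)" if x: "0 < x" for x
    proof -
      have d: "(F has_real_derivative (p + 1) * (2 * p * x powr (2 * p - 1)) * ((a\<^sup>2 + x\<^sup>2) / 2)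
         + (p + 1) * (x powr (2 * p) - a powr (2 * p)) * x - p * ((2 * p + 2) * x powr (2 * p + 2 - 1))) (at x)"
        unfolding F_def[abs_def] using x
        by (auto intro!: derivative_eq_intros simp: mult_ac) (simp add: algebra_simps)
      have pe: "x powr (2 * p + 2 - 1) = x powr (2 * p - 1) * x\<^sup>2"
        using x powr_add[of x "2 * p - 1" 2] by (simp add: algebra_simps)
      have alg: "(p + 1) * (2 * p * Y) * ((a\<^sup>2 + x\<^sup>2) / 2) + (p + 1) * (X - B) * x - p * ((2 * p + 2) * (Y * x\<^sup>2))
         = p * (p + 1) * Y * (a\<^sup>2 - x\<^sup>2) + (p + 1) * x * (X - B)" for X Y B by (simp add: field_simps)
      show ?thesis by (rule DERIV_cong[OF d[unfolded pe] alg])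
    qed
    have "\<exists>l z. a < z \<and> z < b \<and> (F has_real_derivative l) (at z) \<and> F b - F a = (b - a) * l"
    proof (rule MVT[OF ab(2)])
      have c: "continuous_on {a..b} (\<lambda>x. x powr (2 * p))" "continuous_on {a..b} (\<lambda>x. x powr (2 * p + 2))"
        by (rule continuous_on_powr'; use ab p in \<open>auto intro!: continuous_intros\<close>)+
      show "continuous_on {a..b} F" unfolding F_def[abs_def] divide_inverse
        by (intro c continuous_on_diff continuous_on_mult continuous_on_add continuous_on_power continuous_on_const continuous_on_id)
      show "F differentiable (at x)" if "a < x" "x < b" for x
        using dF[of x] that ab by (auto simp: real_differentiable_def)
    qed
    then obtain l z where z: "a < z" "z < b" and l: "(F has_real_derivative l) (at z)" and e: "F b - F a = (b - a) * l" by blast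
    have le: "l = p * (p + 1) * z powr (2 * p - 1) * (a\<^sup>2 - z\<^sup>2) + (p + 1) * z * (z powr (2 * p) - a powr (2 * p))"
      using DERIV_unique[OF l dF] z ab by simp
    define Q where "Q = R * R powr (2 * p - 1)"
    have zR: "0 \<le> z" "z \<le> R" "0 \<le> R" using z ab by auto
    have t1: "\<bar>p * (p + 1) * z powr (2 * p - 1) * (a\<^sup>2 - z\<^sup>2)\<bar> \<le> p * (p + 1) * (2 * Q * (b - a))"
    proof -
      have "\<bar>a\<^sup>2 - z\<^sup>2\<bar> = (a + z) * (z - a)"
      proof -
        have "a\<^sup>2 \<le> z\<^sup>2" using z ab by (intro power_mono) auto
        then show ?thesis by (simp add: power2_eq_square algebra_simps)
      qed
      also have "\<dots> \<le> (2 * R) * (b - a)" using z ab by (intro mult_mono) auto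
      finally have "z powr (2 * p - 1) * \<bar>a\<^sup>2 - z\<^sup>2\<bar> \<le> R powr (2 * p - 1) * ((2 * R) * (b - a))"
        using zR p by (intro mult_mono powr_mono2) auto
      also have "\<dots> = 2 * Q * (b - a)" by (simp add: Q_def)
      finally have "p * (p + 1) * (z powr (2 * p - 1) * \<bar>a\<^sup>2 - z\<^sup>2\<bar>) \<le> p * (p + 1) * (2 * Q * (b - a))"
        using p by (intro mult_left_mono) auto
      then show ?thesis using p by (simp add: abs_mult mult.assoc)
    qed
    have t2: "\<bar>(p + 1) * z * (z powr (2 * p) - a powr (2 * p))\<bar> \<le> (p + 1) * (2 * p * Q * (b - a))"
    proof -
      have "\<bar>z powr (2 * p) - a powr (2 * p)\<bar> \<le> 2 * p * R powr (2 * p - 1) * \<bar>z - a\<bar>"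
        using ab z zR p by (intro powr_lipschitz) auto
      also have "\<dots> \<le> 2 * p * R powr (2 * p - 1) * (b - a)" using z p by (intro mult_left_mono) auto
      finally have "z * \<bar>z powr (2 * p) - a powr (2 * p)\<bar> \<le> R * (2 * p * R powr (2 * p - 1) * (b - a))"
        using zR by (intro mult_mono) auto
      also have "\<dots> = 2 * p * Q * (b - a)" by (simp add: Q_def)
      finally have "(p + 1) * (z * \<bar>z powr (2 * p) - a powr (2 * p)\<bar>) \<le> (p + 1) * (2 * p * Q * (b - a))"
        using p by (intro mult_left_mono) auto
      then show ?thesis using p zR by (simp add: abs_mult mult.assoc)
    qed
    have "\<bar>l\<bar> \<le> p * (p + 1) * (2 * Q * (b - a)) + (p + 1) * (2 * p * Q * (b - a))" unfolding le using t1 t2 by linarith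
    also have "\<dots> = 4 * p * (p + 1) * Q * (b - a)" by (simp add: algebra_simps)
    finally have "(b - a) * \<bar>l\<bar> \<le> (b - a) * (4 * p * (p + 1) * Q * (b - a))" using ab by (intro mult_left_mono) auto
    moreover have "F a = 0" by (simp add: F_def)
    ultimately have "\<bar>F b\<bar> \<le> 4 * p * (p + 1) * Q * (b - a)\<^sup>2" using e ab by (simp add: abs_mult power2_eq_square mult_ac)
    then show ?thesis by (simp add: F_def Q_def)
  qed
  consider "a < b" | "a = b" | "b < a" by linarith
  then show ?thesis
  proof cases
    case 1 then show ?thesis using main[OF a(1) 1 b(2)] by simp
  next
    case 3
    have "\<bar>(p + 1) * (b powr (2 * p) - a powr (2 * p)) * ((a\<^sup>2 + b\<^sup>2) / 2) - p * (b powr (2 * p + 2) - a powr (2 * p + 2))\<bar>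
      = \<bar>(p + 1) * (a powr (2 * p) - b powr (2 * p)) * ((b\<^sup>2 + a\<^sup>2) / 2) - p * (a powr (2 * p + 2) - b powr (2 * p + 2))\<bar>"
      by (subst abs_minus_cancel[symmetric]) (simp add: algebra_simps add_divide_distrib)
    then show ?thesis using main[OF b(1) 3 a(2)] by (simp add: power2_commute[of b a])
  qed simp
qed

text \<open>Re (b cnj a) is the mean of |a|^2 and |b|^2 up to |b - a|^2/2, which reduces the claim
  to the moduli.\<close>

lemma complex_trapezoid_bound:
  fixes a b :: complex
  assumes p: "1/2 \<le> p" and a: "cmod a \<le> R" and b: "cmod b \<le> R"
  shows "\<bar>(p + 1) * ((cmod b powr (2 * p) - cmod a powr (2 * p)) * Re (b * cnj a)) - p * (cmod b powr (2 * p + 2) - cmod a powr (2 * p + 2))\<bar>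
    \<le> (4 * p * (p + 1) * (R * R powr (2 * p - 1)) + (p + 1) * R powr (2 * p)) * (cmod (b - a))\<^sup>2"
proof -
  define D where "D = cmod b powr (2 * p) - cmod a powr (2 * p)"
  have "(cmod (b - a))\<^sup>2 = (cmod a)\<^sup>2 + (cmod b)\<^sup>2 - 2 * Re (b * cnj a)"
    unfolding cmod_power2 by (simp add: power2_eq_square algebra_simps)
  then have re: "Re (b * cnj a) = ((cmod a)\<^sup>2 + (cmod b)\<^sup>2) / 2 - (cmod (b - a))\<^sup>2 / 2"
  proof -
    have "C = A + B - 2 * q \<Longrightarrow> q = (A + B) / 2 - C / 2" for A B C q :: real by (simp add: field_simps)
    then show "(cmod (b - a))\<^sup>2 = (cmod a)\<^sup>2 + (cmod b)\<^sup>2 - 2 * Re (b * cnj a) \<Longrightarrow> ?thesis" .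
  qed
  have R: "0 \<le> R" using a norm_ge_zero order_trans by blast
  have "(cmod b - cmod a)\<^sup>2 \<le> (cmod (b - a))\<^sup>2"
    using norm_triangle_ineq3[of b a] by (simp add: abs_le_square_iff[symmetric])
  moreover have "0 \<le> 4 * p * (p + 1) * (R * R powr (2 * p - 1))" using p R by (intro mult_nonneg_nonneg) auto
  ultimately have m: "4 * p * (p + 1) * (R * R powr (2 * p - 1)) * (cmod b - cmod a)\<^sup>2 \<le> 4 * p * (p + 1) * (R * R powr (2 * p - 1)) * (cmod (b - a))\<^sup>2"
    by (rule mult_left_mono)
  have t: "\<bar>(p + 1) * D * (((cmod a)\<^sup>2 + (cmod b)\<^sup>2) / 2) - p * (cmod b powr (2 * p + 2) - cmod a powr (2 * p + 2))\<bar>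
     \<le> 4 * p * (p + 1) * (R * R powr (2 * p - 1)) * (cmod b - cmod a)\<^sup>2"
    unfolding D_def using p a b by (intro trapezoid_bound) auto
  have D: "\<bar>D\<bar> \<le> R powr (2 * p)"
  proof -
    have "cmod b powr (2 * p) \<le> R powr (2 * p)" "cmod a powr (2 * p) \<le> R powr (2 * p)" using p a b by (auto intro!: powr_mono2)
    then show ?thesis unfolding D_def using powr_ge_zero[of "cmod a" "2 * p"] powr_ge_zero[of "cmod b" "2 * p"] by linarith
  qed
  have "\<bar>(p + 1) * D * ((cmod (b - a))\<^sup>2 / 2)\<bar> \<le> (p + 1) * R powr (2 * p) * ((cmod (b - a))\<^sup>2 / 1)"
    unfolding abs_mult using p D by (intro mult_mono) auto
  moreover have "(p + 1) * (D * Re (b * cnj a)) - p * (cmod b powr (2 * p + 2) - cmod a powr (2 * p + 2))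
    = ((p + 1) * D * (((cmod a)\<^sup>2 + (cmod b)\<^sup>2) / 2) - p * (cmod b powr (2 * p + 2) - cmod a powr (2 * p + 2))) - (p + 1) * D * ((cmod (b - a))\<^sup>2 / 2)"
    unfolding re by (simp add: algebra_simps)
  ultimately show ?thesis using t m unfolding D_def[symmetric] distrib_right[of "4 * p * (p + 1) * (R * R powr (2 * p - 1))"] by linarith
qed

section \<open>Edge permutations\<close>

definition permG :: "(nat \<Rightarrow> nat) \<Rightarrow> gfun \<Rightarrow> gfun" where "permG \<pi> U = (\<lambda>j. U (\<pi> j))"

text \<open>Transpositions are all that is needed, and for an involution \<open>permG\<close> is its
  own inverse and its own adjoint for both pairings.\<close>

locale involution =
  fixes N :: nat and \<pi> :: "nat \<Rightarrow> nat"
  assumes invol: "\<And>j. \<pi> (\<pi> j) = j" and range: "\<And>j. j < N \<Longrightarrow> \<pi> j < N"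
begin

lemma sum_perm: "(\<Sum>j<N. f (\<pi> j)) = (\<Sum>j<N. f j)"
  by (rule sum.reindex_bij_witness[of _ \<pi> \<pi>]) (auto simp: invol range)

lemma ipG_perm: "ipG N (permG \<pi> U) (permG \<pi> V) = ipG N U V"
  unfolding ipG_hl permG_def by (rule sum_perm)

lemma gradG_perm: "gradG N (permG \<pi> U) (permG \<pi> V) = gradG N U V"
  unfolding gradG_ip ipG_hl permG_def by (rule sum_perm)

lemma permG_permG: "permG \<pi> (permG \<pi> U) = U" by (simp add: permG_def invol)

lemma ipG_perm_swap: "ipG N (permG \<pi> U) V = ipG N U (permG \<pi> V)"
  using ipG_perm[of U "permG \<pi> V"] by (simp add: permG_permG)

lemma gradG_perm_swap: "gradG N (permG \<pi> U) V = gradG N U (permG \<pi> V)"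
  using gradG_perm[of U "permG \<pi> V"] by (simp add: permG_permG)

lemma H1norm_perm: "H1norm N (permG \<pi> U) = H1norm N U"
proof -
  have "(H1norm N (permG \<pi> U))\<^sup>2 = (H1norm N U)\<^sup>2" unfolding H1norm_sq_ip by (simp add: ipG_perm gradG_perm)
  then show ?thesis by (simp add: power2_eq_iff_nonneg H1norm_nonneg)
qed

lemma H1G_perm:
  assumes "H1G N U" shows "H1G N (permG \<pi> U)"
  unfolding H1G_def permG_def
proof (intro conjI allI impI)
  fix j assume j: "j < N"
  show "H1_hl (U (\<pi> j))" by (rule H1G_D(1)[OF assms range[OF j]])
  have "0 < N" using j by simp
  then show "U (\<pi> j) 0 = U (\<pi> 0) 0" using H1G_D(2)[OF assms range[OF j]] H1G_D(2)[OF assms range, of 0] by simp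
qed

lemma nonlin_perm: "nonlin p (permG \<pi> U) = permG \<pi> (nonlin p U)"
  by (simp add: nonlin_def permG_def)

lemma permG_diff: "permG \<pi> (\<lambda>j x. U j x - V j x) = (\<lambda>j x. permG \<pi> U j x - permG \<pi> V j x)"
  by (simp add: permG_def)

end

section \<open>Weak solutions and their conservation laws\<close>

locale nls_solution =
  fixes N :: nat and p :: real and \<Psi> :: "real \<Rightarrow> gfun"
  assumes p_half: "1/2 \<le> p" and sol: "nls_sol N p \<Psi>"
begin

lemma p0: "p > 0" using p_half by simp

text \<open>The time derivative as a functional, solved for in the weak equation. On
  \<open>H1G\<close> it agrees with the derivative whose existence \<open>nls_sol\<close>
  asserts.\<close>

definition DF :: "real \<Rightarrow> gfun \<Rightarrow> complex" where
  "DF t \<Theta> = - \<i> * (gradG N (\<Psi> t) \<Theta> - complex_of_real (p + 1) * ipG N (nonlin p (\<Psi> t)) \<Theta>)"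

lemma HG: "H1G N (\<Psi> t)" using sol by (simp add: nls_sol_def)

lemmas LG = H1G_L2G(1)[OF HG]

lemma nlL: "L2G N (nonlin p (\<Psi> t))" by (rule nonlin_L2(1)[OF HG order_refl p0])

lemma cont_shift: "((\<lambda>h. H1norm N (\<lambda>j x. \<Psi> (t + h) j x - \<Psi> t j x)) \<longlongrightarrow> 0) (at 0)"
proof -
  have "((\<lambda>s. H1norm N (\<lambda>j x. \<Psi> s j x - \<Psi> t j x)) \<longlongrightarrow> 0) (at t)" using sol by (simp add: nls_sol_def)
  from LIM_offset_zero[OF this] show ?thesis .
qed

lemma DF_bound:
  assumes R: "H1norm N (\<Psi> t) \<le> R" and \<Theta>: "H1G N \<Theta>"
  shows "cmod (DF t \<Theta>) \<le> BB p R * H1norm N \<Theta>"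
proof -
  have "cmod (DF t \<Theta>) = cmod (gradG N (\<Psi> t) \<Theta> - complex_of_real (p + 1) * ipG N (nonlin p (\<Psi> t)) \<Theta>)"
    by (simp add: DF_def norm_mult)
  also have "\<dots> \<le> cmod (gradG N (\<Psi> t) \<Theta>) + (p + 1) * cmod (ipG N (nonlin p (\<Psi> t)) \<Theta>)"
    using norm_triangle_ineq4[of "gradG N (\<Psi> t) \<Theta>" "complex_of_real (p + 1) * ipG N (nonlin p (\<Psi> t)) \<Theta>"] p0
    by (simp add: norm_mult del: of_real_add)
  also have "\<dots> \<le> R * H1norm N \<Theta> + (p + 1) * ((R powr (2 * p) * R) * H1norm N \<Theta>)"
  proof (intro add_mono mult_left_mono)
    show "cmod (gradG N (\<Psi> t) \<Theta>) \<le> R * H1norm N \<Theta>"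
      using gradG_bound[OF HG \<Theta>, of t] mult_right_mono[OF R H1norm_nonneg, of N \<Theta>] by linarith
    have "L2norm N (nonlin p (\<Psi> t)) \<le> R powr (2 * p) * L2norm N (\<Psi> t)" by (rule nonlin_L2(2)[OF HG R p0])
    also have "\<dots> \<le> R powr (2 * p) * R" using L2norm_le_H1norm(1)[of N "\<Psi> t"] R by (intro mult_left_mono) auto
    finally have "L2norm N (nonlin p (\<Psi> t)) * H1norm N \<Theta> \<le> (R powr (2 * p) * R) * H1norm N \<Theta>"
      by (rule mult_right_mono) (rule H1norm_nonneg)
    then show "cmod (ipG N (nonlin p (\<Psi> t)) \<Theta>) \<le> (R powr (2 * p) * R) * H1norm N \<Theta>"
      using ipG_bound_H1[OF nlL \<Theta>, of t] by linarith
  qed (use p0 in auto)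
  also have "\<dots> = BB p R * H1norm N \<Theta>" by (simp add: BB_def algebra_simps)
  finally show ?thesis .
qed

lemma BB_nonneg: "0 \<le> R \<Longrightarrow> 0 \<le> BB p R" using p0 by (simp add: BB_def)

lemma DF_lin:
  assumes "H1G N U" "H1G N V"
  shows "DF t (\<lambda>j x. a * U j x + b * V j x) = cnj a * DF t U + cnj b * DF t V"
  unfolding DF_def gradG_lin_right[OF assms HG] ipG_lin_right[OF H1G_L2G(1)[OF assms(1)] H1G_L2G(1)[OF assms(2)] nlL]
  by (simp add: algebra_simps)

text \<open>Rescaling the test function removes the restriction to the unit ball in
  \<open>dual_le\<close>, uniformly in \<Theta>. The 1 added to the norm covers test functions of
  norm zero.\<close>

lemma dq:
  assumes "e > 0"
  shows "\<exists>d>0. \<forall>h. h \<noteq> 0 \<and> \<bar>h\<bar> < d \<longrightarrow> (\<forall>\<Theta>. H1G N \<Theta> \<longrightarrow>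
     cmod ((ipG N (\<Psi> (t + h)) \<Theta> - ipG N (\<Psi> t) \<Theta>) / complex_of_real h - DF t \<Theta>) \<le> e * (H1norm N \<Theta> + 1))"
proof -
  obtain D :: "real \<Rightarrow> gfun \<Rightarrow> complex" where D1: "\<forall>t. \<forall>e>0. \<exists>d>0. \<forall>h. h \<noteq> 0 \<and> \<bar>h\<bar> < d \<longrightarrow>
            dual_le N (\<lambda>\<Theta>. ipG N (\<lambda>j x. (\<Psi> (t + h) j x - \<Psi> t j x) / complex_of_real h) \<Theta> - D t \<Theta>) e"
     and D2: "\<forall>t \<Theta>. H1G N \<Theta> \<longrightarrow> \<i> * D t \<Theta> = gradG N (\<Psi> t) \<Theta> - complex_of_real (p + 1) * ipG N (nonlin p (\<Psi> t)) \<Theta>"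
    using sol unfolding nls_sol_def by blast
  have DD: "D t \<Theta> = DF t \<Theta>" if "H1G N \<Theta>" for \<Theta>
  proof -
    have "- \<i> * (\<i> * D t \<Theta>) = DF t \<Theta>" using D2 that unfolding DF_def by simp
    then show ?thesis by simp
  qed
  obtain d where d: "d > 0" and dd: "\<forall>h. h \<noteq> 0 \<and> \<bar>h\<bar> < d \<longrightarrow>
            dual_le N (\<lambda>\<Theta>. ipG N (\<lambda>j x. (\<Psi> (t + h) j x - \<Psi> t j x) / complex_of_real h) \<Theta> - D t \<Theta>) e"
    using D1 assms by blast
  show ?thesis
  proof (intro exI[of _ d] conjI allI impI d)
    fix h \<Theta> assume h: "h \<noteq> 0 \<and> \<bar>h\<bar> < d" and \<Theta>: "H1G N \<Theta>"
    define k where "k = 1 / (H1norm N \<Theta> + 1)"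
    have k: "k > 0" "k * (H1norm N \<Theta> + 1) = 1" using H1norm_nonneg[of N \<Theta>] by (auto simp: k_def)
    define \<Theta>' where "\<Theta>' = (\<lambda>j x. complex_of_real k * \<Theta> j x)"
    have H': "H1G N \<Theta>'" unfolding \<Theta>'_def by (rule H1G_cmult[OF \<Theta>])
    have "H1norm N \<Theta>' = k * H1norm N \<Theta>" unfolding \<Theta>'_def using H1norm_cmult[OF \<Theta>, of "complex_of_real k"] k by simp
    also have "\<dots> \<le> 1" using k by (simp add: distrib_left)
    finally have n': "H1norm N \<Theta>' \<le> 1" .
    have dif: "ipG N (\<lambda>j x. (\<Psi> (t + h) j x - \<Psi> t j x) / complex_of_real h) \<Theta>' = (ipG N (\<Psi> (t + h)) \<Theta>' - ipG N (\<Psi> t) \<Theta>') / complex_of_real h"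
      using ipG_lin_left[OF LG LG H1G_L2G(1)[OF H'], of "1 / complex_of_real h" "t + h" "- (1 / complex_of_real h)" t]
      by (simp add: diff_divide_distrib)
    have ipk: "ipG N W \<Theta>' = complex_of_real k * ipG N W \<Theta>" if "L2G N W" for W
      using ipG_lin_right[OF H1G_L2G(1)[OF \<Theta>] H1G_L2G(1)[OF \<Theta>] that, of "complex_of_real k" 0] by (simp add: \<Theta>'_def)
    have DFk: "DF t \<Theta>' = complex_of_real k * DF t \<Theta>"
      using DF_lin[OF \<Theta> \<Theta>, of t "complex_of_real k" 0] by (simp add: \<Theta>'_def)
    have "cmod (ipG N (\<lambda>j x. (\<Psi> (t + h) j x - \<Psi> t j x) / complex_of_real h) \<Theta>' - D t \<Theta>') \<le> e"
      using dd h H' n' unfolding dual_le_def by blast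
    then have "cmod (complex_of_real k * ((ipG N (\<Psi> (t + h)) \<Theta> - ipG N (\<Psi> t) \<Theta>) / complex_of_real h - DF t \<Theta>)) \<le> e"
      unfolding dif DD[OF H'] DFk ipk[OF LG] by (simp add: algebra_simps diff_divide_distrib)
    then have "k * cmod ((ipG N (\<Psi> (t + h)) \<Theta> - ipG N (\<Psi> t) \<Theta>) / complex_of_real h - DF t \<Theta>) \<le> e"
      using k by (simp add: norm_mult)
    also have "e = k * (e * (H1norm N \<Theta> + 1))" using k(2) by (metis mult.left_commute mult.right_neutral)
    finally show "cmod ((ipG N (\<Psi> (t + h)) \<Theta> - ipG N (\<Psi> t) \<Theta>) / complex_of_real h - DF t \<Theta>) \<le> e * (H1norm N \<Theta> + 1)"
      using k(1) by simp
  qed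
qed

text \<open>The test function may move with h, as long as it converges in H^1. Because the
  difference quotients converge uniformly on bounded sets of H^1, the limit is not affected; this is
  what a product rule for the H^{-1}-H^1 pairing requires.\<close>

lemma dq_tendsto:
  assumes Th: "\<And>h. H1G N (\<Theta> h)" and T0: "H1G N \<Theta>0"
    and lim: "((\<lambda>h. H1norm N (\<lambda>j x. \<Theta> h j x - \<Theta>0 j x)) \<longlongrightarrow> 0) (at 0)"
  shows "((\<lambda>h. (ipG N (\<Psi> (t + h)) (\<Theta> h) - ipG N (\<Psi> t) (\<Theta> h)) / complex_of_real h) \<longlongrightarrow> DF t \<Theta>0) (at 0)"
proof (rule tendstoI)
  fix e :: real assume e: "e > 0"
  define n0 where "n0 = H1norm N \<Theta>0"
  define B where "B = BB p (H1norm N (\<Psi> t))"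
  have n0: "n0 \<ge> 0" and B: "B \<ge> 0" by (auto simp: n0_def B_def H1norm_nonneg intro!: BB_nonneg)
  define e1 where "e1 = (e / 4) / (n0 + 2)"
  have e1: "e1 > 0" using e n0 by (simp add: e1_def)
  have e1': "e1 * (n0 + 2) = e / 4"
  proof -
    have "n0 + 2 \<noteq> 0" using n0 by simp
    then show ?thesis unfolding e1_def by (rule nonzero_divide_eq_eq[THEN iffD1, OF _ refl, symmetric])
  qed
  obtain d where d: "d > 0" and dd: "\<forall>h. h \<noteq> 0 \<and> \<bar>h\<bar> < d \<longrightarrow> (\<forall>\<Theta>. H1G N \<Theta> \<longrightarrow>
     cmod ((ipG N (\<Psi> (t + h)) \<Theta> - ipG N (\<Psi> t) \<Theta>) / complex_of_real h - DF t \<Theta>) \<le> e1 * (H1norm N \<Theta> + 1))"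
    using dq[OF e1] by blast
  define e2 where "e2 = min 1 (e / (4 * (B + 1)))"
  have e2: "e2 > 0" "e2 \<le> 1" "e2 * (B + 1) \<le> e / 4"
  proof -
    show "e2 > 0" "e2 \<le> 1" using e B by (auto simp: e2_def)
    have "e2 \<le> e / (4 * (B + 1))" by (simp add: e2_def)
    then show "e2 * (B + 1) \<le> e / 4" using B by (simp add: field_simps)
  qed
  have "eventually (\<lambda>h. dist (H1norm N (\<lambda>j x. \<Theta> h j x - \<Theta>0 j x)) 0 < e2) (at 0)" by (rule tendstoD[OF lim e2(1)])
  moreover have "eventually (\<lambda>h. h \<noteq> 0 \<and> \<bar>h\<bar> < d) (at 0)"
    unfolding eventually_at using d by (auto simp: dist_real_def)
  ultimately show "eventually (\<lambda>h. dist ((ipG N (\<Psi> (t + h)) (\<Theta> h) - ipG N (\<Psi> t) (\<Theta> h)) / complex_of_real h) (DF t \<Theta>0) < e) (at 0)"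
  proof eventually_elim
    case (elim h)
    define r where "r = H1norm N (\<lambda>j x. \<Theta> h j x - \<Theta>0 j x)"
    have r: "0 \<le> r" "r < e2" using elim(1) by (auto simp: r_def H1norm_nonneg)
    have "H1norm N (\<Theta> h) \<le> n0 + 1" using H1norm_diff_abs[OF Th T0, of h] r e2 by (simp add: r_def n0_def)
    then have "e1 * (H1norm N (\<Theta> h) + 1) \<le> e1 * (n0 + 2)" using e1 by (intro mult_left_mono) auto
    then have 1: "cmod ((ipG N (\<Psi> (t + h)) (\<Theta> h) - ipG N (\<Psi> t) (\<Theta> h)) / complex_of_real h - DF t (\<Theta> h)) \<le> e / 4"
      using dd elim(2) Th e1' by (smt (verit))
    have "DF t (\<Theta> h) - DF t \<Theta>0 = DF t (\<lambda>j x. \<Theta> h j x - \<Theta>0 j x)" using DF_lin[OF Th T0, of t 1 h "-1"] by simp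
    then have "cmod (DF t (\<Theta> h) - DF t \<Theta>0) \<le> B * r"
      using DF_bound[OF order_refl H1G_diff[OF Th T0], of t h] by (simp add: B_def r_def)
    also have "\<dots> \<le> (B + 1) * e2" using r B by (intro mult_mono) auto
    also have "\<dots> \<le> e / 4" using e2(3) by (simp add: mult.commute)
    finally have 2: "cmod (DF t (\<Theta> h) - DF t \<Theta>0) \<le> e / 4" .
    show ?case unfolding dist_norm
      using norm_triangle_ineq[of "(ipG N (\<Psi> (t + h)) (\<Theta> h) - ipG N (\<Psi> t) (\<Theta> h)) / complex_of_real h - DF t (\<Theta> h)" "DF t (\<Theta> h) - DF t \<Theta>0"] 1 2 e
      by simp
  qed
qed

lemma ip_deriv: "H1G N \<Theta> \<Longrightarrow> ((\<lambda>h. (ipG N (\<Psi> (t + h)) \<Theta> - ipG N (\<Psi> t) \<Theta>) / complex_of_real h) \<longlongrightarrow> DF t \<Theta>) (at 0)"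
proof -
  assume \<Theta>: "H1G N \<Theta>"
  have "H1norm N (\<lambda>j x. \<Theta> j x - \<Theta> j x) = 0" using H1norm_cmult[OF \<Theta>, of 0] by simp
  then show ?thesis using dq_tendsto[of "\<lambda>h. \<Theta>" \<Theta> t] \<Theta> by simp
qed

text \<open>The product rule for a pairing of the solution with a permuted copy of itself at another
  time. Equal times without permutation give the mass, two times the energy, and equal times with a
  transposition the symmetry.\<close>

lemma two_time:
  assumes "involution N \<pi>"
  shows "((\<lambda>k. (ipG N (\<Psi> (a + k)) (permG \<pi> (\<Psi> (b + k))) - ipG N (\<Psi> a) (permG \<pi> (\<Psi> b))) / complex_of_real k)
     \<longlongrightarrow> DF a (permG \<pi> (\<Psi> b)) + cnj (DF b (permG \<pi> (\<Psi> a)))) (at 0)"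
proof -
  interpret involution N \<pi> by fact
  have 1: "((\<lambda>k. (ipG N (\<Psi> (a + k)) (permG \<pi> (\<Psi> (b + k))) - ipG N (\<Psi> a) (permG \<pi> (\<Psi> (b + k)))) / complex_of_real k) \<longlongrightarrow> DF a (permG \<pi> (\<Psi> b))) (at 0)"
  proof (rule dq_tendsto[OF H1G_perm[OF HG] H1G_perm[OF HG]])
    show "((\<lambda>h. H1norm N (\<lambda>j x. permG \<pi> (\<Psi> (b + h)) j x - permG \<pi> (\<Psi> b) j x)) \<longlongrightarrow> 0) (at 0)"
      using cont_shift[of b] by (simp flip: permG_diff add: H1norm_perm)
  qed
  have 2: "((\<lambda>k. (ipG N (\<Psi> (b + k)) (permG \<pi> (\<Psi> a)) - ipG N (\<Psi> b) (permG \<pi> (\<Psi> a))) / complex_of_real k) \<longlongrightarrow> DF b (permG \<pi> (\<Psi> a))) (at 0)"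
    by (rule ip_deriv[OF H1G_perm[OF HG]])
  have c: "ipG N (\<Psi> a) (permG \<pi> (\<Psi> s)) = cnj (ipG N (\<Psi> s) (permG \<pi> (\<Psi> a)))" for s
    by (subst ipG_cnj) (simp add: ipG_perm_swap)
  have "((\<lambda>k. (ipG N (\<Psi> (a + k)) (permG \<pi> (\<Psi> (b + k))) - ipG N (\<Psi> a) (permG \<pi> (\<Psi> (b + k)))) / complex_of_real k
      + cnj ((ipG N (\<Psi> (b + k)) (permG \<pi> (\<Psi> a)) - ipG N (\<Psi> b) (permG \<pi> (\<Psi> a))) / complex_of_real k))
     \<longlongrightarrow> DF a (permG \<pi> (\<Psi> b)) + cnj (DF b (permG \<pi> (\<Psi> a)))) (at 0)"
    by (intro tendsto_intros 1 2)
  then show ?thesis by (simp add: c[symmetric] diff_divide_distrib)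
qed

lemma involution_id: "involution N (\<lambda>j. j)" by unfold_locales auto

lemma two_time_id: "((\<lambda>k. (ipG N (\<Psi> (a + k)) (\<Psi> (b + k)) - ipG N (\<Psi> a) (\<Psi> b)) / complex_of_real k)
     \<longlongrightarrow> DF a (\<Psi> b) + cnj (DF b (\<Psi> a))) (at 0)"
  using two_time[OF involution_id, of a b] by (simp add: permG_def)

lemma DERIV_of_complex:
  fixes f :: "real \<Rightarrow> complex"
  assumes "((\<lambda>h. (f (t + h) - f t) / complex_of_real h) \<longlongrightarrow> D) (at 0)"
  shows "((\<lambda>t. Re (f t)) has_real_derivative Re D) (at t)" "((\<lambda>t. Im (f t)) has_real_derivative Im D) (at t)"
  unfolding DERIV_def using tendsto_Re[OF assms] tendsto_Im[OF assms] by simp_all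

lemma DF_self: "DF t (\<Psi> t) = - \<i> * complex_of_real ((L2norm N (\<lambda>j. hl_deriv (\<Psi> t j)))\<^sup>2 - (p + 1) * Pot N p (\<Psi> t))"
  unfolding DF_def gradG_self ipG_nonlin_self by simp

text \<open>By \<open>DF_self\<close> the pairing of the derivative with the solution is purely
  imaginary.\<close>

theorem mass_conserved: "(L2norm N (\<Psi> t))\<^sup>2 = (L2norm N (\<Psi> 0))\<^sup>2"
proof -
  have "((\<lambda>t. Re (ipG N (\<Psi> t) (\<Psi> t))) has_real_derivative 0) (at t)" for t
    using DERIV_of_complex(1)[of "\<lambda>t. ipG N (\<Psi> t) (\<Psi> t)", OF two_time_id] by (simp add: DF_self)
  then have "Re (ipG N (\<Psi> t) (\<Psi> t)) = Re (ipG N (\<Psi> 0) (\<Psi> 0))" by (rule DERIV_isconst_all[rule_format])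
  then show ?thesis by (simp add: ipG_self)
qed

text \<open>The distance F of two states of the trajectory is a continuous function of the two
  times, so compactness of the square of \<open>{0..T}\<close> gives boundedness and uniform
  continuity without a topology on the space of states.\<close>

lemma H1_unif:
  "\<exists>R>0. \<forall>t\<in>{0..T}. H1norm N (\<Psi> t) \<le> R"
  "e > 0 \<Longrightarrow> \<exists>d>0. \<forall>s\<in>{0..T}. \<forall>t\<in>{0..T}. \<bar>s - t\<bar> < d \<longrightarrow> H1norm N (\<lambda>j x. \<Psi> s j x - \<Psi> t j x) < e"
proof -
  define F where "F = (\<lambda>(s, t). H1norm N (\<lambda>j x. \<Psi> s j x - \<Psi> t j x))"
  have g0: "((\<lambda>s. H1norm N (\<lambda>j x. \<Psi> s j x - \<Psi> t j x)) \<longlongrightarrow> 0) (nhds t)" for t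
  proof -
    have z: "H1norm N (\<lambda>j x. \<Psi> t j x - \<Psi> t j x) = 0" using H1norm_cmult[OF HG, of 0 t] by simp
    have "((\<lambda>s. H1norm N (\<lambda>j x. \<Psi> s j x - \<Psi> t j x)) \<longlongrightarrow> 0) (at t)" using sol by (simp add: nls_sol_def)
    then show ?thesis 
      using tendsto_at_iff_tendsto_nhds[of "\<lambda>s. H1norm N (\<lambda>j x. \<Psi> s j x - \<Psi> t j x)" t] z by simp
  qed
  have lip: "\<bar>F (s, t) - F (s', t')\<bar> \<le> H1norm N (\<lambda>j x. \<Psi> s j x - \<Psi> s' j x) + H1norm N (\<lambda>j x. \<Psi> t j x - \<Psi> t' j x)" for s t s' t'
    unfolding F_def prod.case
    using H1norm_diff_triangle[OF HG HG HG, of s t s'] H1norm_diff_triangle[OF HG HG HG, of s' t t']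
      H1norm_diff_triangle[OF HG HG HG, of s' t' s] H1norm_diff_triangle[OF HG HG HG, of s t' t]
      H1norm_diff_commute[OF HG HG, of s s'] H1norm_diff_commute[OF HG HG, of t t'] by linarith
  have "continuous_on UNIV F"
    unfolding continuous_on_def
  proof (intro ballI)
    fix x :: "real \<times> real"
    obtain s t where x: "x = (s, t)" by (cases x)
    have "((\<lambda>y. H1norm N (\<lambda>j x. \<Psi> (fst y) j x - \<Psi> s j x) + H1norm N (\<lambda>j x. \<Psi> (snd y) j x - \<Psi> t j x)) \<longlongrightarrow> 0 + 0) (at x)"
      by (intro tendsto_add filterlim_compose[OF g0]) (auto simp: x intro!: tendsto_eq_intros)
    then have l: "((\<lambda>y. H1norm N (\<lambda>j x. \<Psi> (fst y) j x - \<Psi> s j x) + H1norm N (\<lambda>j x. \<Psi> (snd y) j x - \<Psi> t j x)) \<longlongrightarrow> 0) (at x)"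
      by simp
    have "((\<lambda>y. F y - F x) \<longlongrightarrow> 0) (at x)"
    proof (rule Lim_null_comparison[OF _ l], rule always_eventually, rule allI)
      fix y :: "real \<times> real"
      show "norm (F y - F x) \<le> H1norm N (\<lambda>j x. \<Psi> (fst y) j x - \<Psi> s j x) + H1norm N (\<lambda>j x. \<Psi> (snd y) j x - \<Psi> t j x)"
        unfolding x real_norm_def using lip[of "fst y" "snd y" s t] by simp
    qed
    then show "(F \<longlongrightarrow> F x) (at x within UNIV)" by (simp add: LIM_zero_iff)
  qed
  then have cF: "continuous_on ({0..T} \<times> {0..T}) F" by (rule continuous_on_subset) simp
  have comp: "compact ({0..T} \<times> {0..T})" by (intro compact_Times) auto
  show "\<exists>R>0. \<forall>t\<in>{0..T}. H1norm N (\<Psi> t) \<le> R"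
  proof (cases "T \<ge> 0")
    case True
    have "compact (F ` ({0..T} \<times> {0..T}))" by (rule compact_continuous_image[OF cF comp])
    then obtain B where B: "\<forall>y\<in>F ` ({0..T} \<times> {0..T}). norm y \<le> B" using compact_imp_bounded bounded_iff by metis
    have "H1norm N (\<Psi> t) \<le> \<bar>B\<bar> + H1norm N (\<Psi> 0) + 1" if t: "t \<in> {0..T}" for t
    proof -
      have "norm (F (t, 0)) \<le> B" using B t True by (metis SigmaI atLeastAtMost_iff image_eqI order_refl)
      then show ?thesis using H1norm_diff_abs[OF HG HG, of t 0] by (simp add: F_def)
    qed
    then show ?thesis using H1norm_nonneg[of N "\<Psi> 0"] by (intro exI[of _ "\<bar>B\<bar> + H1norm N (\<Psi> 0) + 1"]) auto
  qed (auto intro!: exI[of _ 1])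
  assume e: "e > 0"
  have "uniformly_continuous_on ({0..T} \<times> {0..T}) F" by (rule compact_uniformly_continuous[OF cF comp])
  then obtain d where d: "d > 0" and dd: "\<forall>x\<in>{0..T} \<times> {0..T}. \<forall>x'\<in>{0..T} \<times> {0..T}. dist x' x < d \<longrightarrow> dist (F x') (F x) < e"
    using e unfolding uniformly_continuous_on_def by blast
  show "\<exists>d>0. \<forall>s\<in>{0..T}. \<forall>t\<in>{0..T}. \<bar>s - t\<bar> < d \<longrightarrow> H1norm N (\<lambda>j x. \<Psi> s j x - \<Psi> t j x) < e"
  proof (intro exI[of _ d] conjI ballI impI d)
    fix s t assume st: "s \<in> {0..T}" "t \<in> {0..T}" "\<bar>s - t\<bar> < d"
    have z: "H1norm N (\<lambda>j x. \<Psi> t j x - \<Psi> t j x) = 0" using H1norm_cmult[OF HG, of 0 t] by simp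
    have "dist (s, t) (t, t) < d" using st by (simp add: dist_prod_def dist_real_def)
    then have "dist (F (s, t)) (F (t, t)) < e" using dd st by (metis SigmaI)
    then show "H1norm N (\<lambda>j x. \<Psi> s j x - \<Psi> t j x) < e" using z by (simp add: F_def dist_real_def)
  qed
qed

text \<open>Interpolation between H^{-1}, where the solution is Lipschitz in time, and H^1, where it
  is continuous. The squared L^2 increment is therefore o(h), which survives the division by h in
  \<open>energy_conserved\<close>.\<close>

lemma L2_increment:
  assumes h: "h > 0" and R: "\<And>s. t \<le> s \<Longrightarrow> s \<le> t + h \<Longrightarrow> H1norm N (\<Psi> s) \<le> R"
  shows "(L2norm N (\<lambda>j x. \<Psi> (t + h) j x - \<Psi> t j x))\<^sup>2 \<le> h * (BB p R * H1norm N (\<lambda>j x. \<Psi> (t + h) j x - \<Psi> t j x))"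
proof -
  define w where "w = (\<lambda>j x. \<Psi> (t + h) j x - \<Psi> t j x)"
  have w: "H1G N w" unfolding w_def by (rule H1G_diff[OF HG HG])
  have d: "((\<lambda>s. Re (ipG N (\<Psi> s) w)) has_real_derivative Re (DF s w)) (at s)" for s
    by (rule DERIV_of_complex(1)[OF ip_deriv[OF w]])
  obtain z where z: "t < z" "z < t + h" and e: "Re (ipG N (\<Psi> (t + h)) w) - Re (ipG N (\<Psi> t) w) = (t + h - t) * Re (DF z w)"
    using MVT2[of t "t + h" "\<lambda>s. Re (ipG N (\<Psi> s) w)" "\<lambda>s. Re (DF s w)"] h d by auto
  have "Re (ipG N w w) = Re (ipG N (\<Psi> (t + h)) w) - Re (ipG N (\<Psi> t) w)"
    using ipG_diff_left[OF LG LG H1G_L2G(1)[OF w], of "t + h" t] by (simp add: w_def)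
  then have "(L2norm N w)\<^sup>2 = h * Re (DF z w)" using e by (simp add: ipG_self)
  also have "\<dots> \<le> h * (BB p R * H1norm N w)"
  proof -
    have "Re (DF z w) \<le> cmod (DF z w)" by (rule complex_Re_le_cmod)
    also have "\<dots> \<le> BB p R * H1norm N w" using R[of z] z w by (intro DF_bound) auto
    finally show ?thesis using h by (intro mult_left_mono) auto
  qed
  finally show ?thesis unfolding w_def .
qed

text \<open>The gradient terms are conjugate to each other and cancel, so only the nonlinearity,
  which is continuous on H^1, remains.\<close>

lemma Im_two_time: "Im (DF a (\<Psi> b) + cnj (DF b (\<Psi> a))) = (p + 1) * (Re (ipG N (nonlin p (\<Psi> a)) (\<Psi> b)) - Re (ipG N (nonlin p (\<Psi> b)) (\<Psi> a)))"
proof -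
  have g: "gradG N (\<Psi> b) (\<Psi> a) = cnj (gradG N (\<Psi> a) (\<Psi> b))" by (rule gradG_cnj)
  show ?thesis unfolding DF_def g by (simp add: algebra_simps)
qed

lemma int_powr:
  "j < N \<Longrightarrow> integrable hl (\<lambda>x. cmod (\<Psi> t j x) powr (2 * p + 2))"
  "j < N \<Longrightarrow> integrable hl (\<lambda>x. cmod (\<Psi> t j x) powr (2 * p) * Re (\<Psi> t j x * cnj (\<Psi> s j x)))"
proof -
  assume j: "j < N"
  have i: "integrable hl (\<lambda>x. nonlin p (\<Psi> t) j x * cnj (\<Psi> s j x))" for s
    using nlL[of t] LG[of s] j by (auto simp: L2G_def intro!: L2_hl_prod)
  have "(\<lambda>x. Re (nonlin p (\<Psi> t) j x * cnj (\<Psi> s j x))) = (\<lambda>x. cmod (\<Psi> t j x) powr (2 * p) * Re (\<Psi> t j x * cnj (\<Psi> s j x)))" for s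
    by (simp add: nonlin_def mult.assoc)
  then show a: "integrable hl (\<lambda>x. cmod (\<Psi> t j x) powr (2 * p) * Re (\<Psi> t j x * cnj (\<Psi> s j x)))" for s
    using integrable_Re[OF i[of s]] by simp
  have "cmod (\<Psi> t j x) powr (2 * p) * Re (\<Psi> t j x * cnj (\<Psi> t j x)) = cmod (\<Psi> t j x) powr (2 * p + 2)" for x
  proof -
    have "Re (\<Psi> t j x * cnj (\<Psi> t j x)) = (cmod (\<Psi> t j x))\<^sup>2" by (simp flip: complex_norm_square)
    then show ?thesis by (cases "\<Psi> t j x = 0") (simp_all add: powr_add)
  qed
  then show "integrable hl (\<lambda>x. cmod (\<Psi> t j x) powr (2 * p + 2))" using a[of t] by simp
qed

text \<open>\<open>complex_trapezoid_bound\<close> integrated over the graph: to first order the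
  two-time derivative equals p times the increment of the potential energy, and the error is the
  squared L^2 increment.\<close>

lemma Pot_increment:
  assumes R: "H1norm N (\<Psi> a) \<le> R" "H1norm N (\<Psi> b) \<le> R"
  shows "\<bar>Im (DF b (\<Psi> a) + cnj (DF a (\<Psi> b))) - p * (Pot N p (\<Psi> b) - Pot N p (\<Psi> a))\<bar>
    \<le> (4 * p * (p + 1) * (R * R powr (2 * p - 1)) + (p + 1) * R powr (2 * p)) * (L2norm N (\<lambda>j x. \<Psi> b j x - \<Psi> a j x))\<^sup>2"
proof -
  let ?K = "4 * p * (p + 1) * (R * R powr (2 * p - 1)) + (p + 1) * R powr (2 * p)"
  let ?G = "\<lambda>j x. (p + 1) * ((cmod (\<Psi> b j x) powr (2 * p) - cmod (\<Psi> a j x) powr (2 * p)) * Re (\<Psi> b j x * cnj (\<Psi> a j x)))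
      - p * (cmod (\<Psi> b j x) powr (2 * p + 2) - cmod (\<Psi> a j x) powr (2 * p + 2))"
  have Re_ip: "Re (ipG N (nonlin p (\<Psi> t)) (\<Psi> s)) = (\<Sum>j<N. \<integral>x. cmod (\<Psi> t j x) powr (2 * p) * Re (\<Psi> t j x * cnj (\<Psi> s j x)) \<partial>hl)" for t s
  proof -
    have i: "integrable hl (\<lambda>x. nonlin p (\<Psi> t) j x * cnj (\<Psi> s j x))" if "j < N" for j
      using nlL[of t] LG[of s] that by (auto simp: L2G_def intro!: L2_hl_prod)
    have "Re (\<integral>x. nonlin p (\<Psi> t) j x * cnj (\<Psi> s j x) \<partial>hl) = (\<integral>x. cmod (\<Psi> t j x) powr (2 * p) * Re (\<Psi> t j x * cnj (\<Psi> s j x)) \<partial>hl)" if "j < N" for j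
      using integral_Re[OF i[OF that]] by (simp add: nonlin_def mult.assoc)
    then show ?thesis by (simp add: ipG_hl)
  qed
  have sym: "Re (\<Psi> a j x * cnj (\<Psi> b j x)) = Re (\<Psi> b j x * cnj (\<Psi> a j x))" for j x by (simp add: mult.commute)
  have i2: "integrable hl (\<lambda>x. cmod (\<Psi> a j x) powr (2 * p) * Re (\<Psi> b j x * cnj (\<Psi> a j x)))" if "j < N" for j
    using int_powr(2)[OF that, of a b] unfolding sym .
  have e: "Im (DF b (\<Psi> a) + cnj (DF a (\<Psi> b))) - p * (Pot N p (\<Psi> b) - Pot N p (\<Psi> a)) = (\<Sum>j<N. \<integral>x. ?G j x \<partial>hl)"
  proof -
    have "(\<integral>x. ?G j x \<partial>hl) = (p + 1) * ((\<integral>x. cmod (\<Psi> b j x) powr (2 * p) * Re (\<Psi> b j x * cnj (\<Psi> a j x)) \<partial>hl) - (\<integral>x. cmod (\<Psi> a j x) powr (2 * p) * Re (\<Psi> b j x * cnj (\<Psi> a j x)) \<partial>hl))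
       - p * ((\<integral>x. cmod (\<Psi> b j x) powr (2 * p + 2) \<partial>hl) - (\<integral>x. cmod (\<Psi> a j x) powr (2 * p + 2) \<partial>hl))" if "j < N" for j
      using int_powr[OF that] i2[OF that] by (simp add: left_diff_distrib)
    then show ?thesis unfolding Im_two_time Re_ip Pot_def sym
      by (simp add: sum_subtractf sum_distrib_left right_diff_distrib)
  qed
  have "\<bar>\<Sum>j<N. \<integral>x. ?G j x \<partial>hl\<bar> \<le> (\<Sum>j<N. \<bar>\<integral>x. ?G j x \<partial>hl\<bar>)" by (rule sum_abs)
  also have "\<dots> \<le> (\<Sum>j<N. ?K * (cn (\<lambda>x. \<Psi> b j x - \<Psi> a j x))\<^sup>2)"
  proof (rule sum_mono)
    fix j assume "j \<in> {..<N}"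
    then have j: "j < N" by simp
    have iG: "integrable hl (?G j)" using int_powr[OF j] i2[OF j] by (simp add: left_diff_distrib)
    have iw: "integrable hl (\<lambda>x. ?K * (cmod (\<Psi> b j x - \<Psi> a j x))\<^sup>2)"
      using L2G_diff[OF LG LG, of b a] j by (simp add: L2G_def L2_hl_iff)
    have "\<bar>\<integral>x. ?G j x \<partial>hl\<bar> \<le> (\<integral>x. \<bar>?G j x\<bar> \<partial>hl)" using integral_norm_bound[of hl "?G j"] by simp
    also have "\<dots> \<le> (\<integral>x. ?K * (cmod (\<Psi> b j x - \<Psi> a j x))\<^sup>2 \<partial>hl)"
    proof (rule hl_integral_mono[OF _ iw])
      show "integrable hl (\<lambda>x. \<bar>?G j x\<bar>)" using iG by simp
      show "\<bar>?G j x\<bar> \<le> ?K * (cmod (\<Psi> b j x - \<Psi> a j x))\<^sup>2" if "x \<ge> 0" for x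
        using H1norm_sup[OF HG j that, of a] H1norm_sup[OF HG j that, of b] R
        by (intro complex_trapezoid_bound[OF p_half]) linarith+
    qed
    also have "\<dots> = ?K * (cn (\<lambda>x. \<Psi> b j x - \<Psi> a j x))\<^sup>2" by (simp add: cn_sq)
    finally show "\<bar>\<integral>x. ?G j x \<partial>hl\<bar> \<le> ?K * (cn (\<lambda>x. \<Psi> b j x - \<Psi> a j x))\<^sup>2" .
  qed
  also have "\<dots> = ?K * (L2norm N (\<lambda>j x. \<Psi> b j x - \<Psi> a j x))\<^sup>2" by (simp add: L2norm_sq sum_distrib_left)
  finally show ?thesis unfolding e .
qed

definition Energy :: "real \<Rightarrow> real" where
  "Energy t = (L2norm N (\<lambda>j. hl_deriv (\<Psi> t j)))\<^sup>2 - Pot N p (\<Psi> t)"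

lemma Pot_continuous: "isCont (\<lambda>t. Pot N p (\<Psi> t)) t"
proof -
  define R where "R = H1norm N (\<Psi> t) + 1"
  define K where "K = 4 * p * (p + 1) * (R * R powr (2 * p - 1)) + (p + 1) * R powr (2 * p)"
  have R0: "R > 0" using H1norm_nonneg[of N "\<Psi> t"] by (simp add: R_def)
  have K0: "0 \<le> K" using R0 p0 by (simp add: K_def)
  let ?d = "\<lambda>s. H1norm N (\<lambda>j x. \<Psi> s j x - \<Psi> t j x)"
  have lim: "(?d \<longlongrightarrow> 0) (at t)" using sol by (simp add: nls_sol_def)
  have Im0: "Im (DF s (\<Psi> t) + cnj (DF t (\<Psi> s))) = (p + 1) * (Re (ipG N (nonlin p (\<Psi> s)) (\<lambda>j x. \<Psi> t j x - \<Psi> s j x)) - Re (ipG N (nonlin p (\<Psi> t)) (\<lambda>j x. \<Psi> s j x - \<Psi> t j x)) + (Pot N p (\<Psi> s) - Pot N p (\<Psi> t)))" for s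
    unfolding Im_two_time ipG_diff_right[OF LG LG nlL] ipG_nonlin_self by simp
  have ev: "eventually (\<lambda>s. norm (Pot N p (\<Psi> s) - Pot N p (\<Psi> t)) \<le> (K + 2 * (p + 1) * (R powr (2 * p) * R)) * ?d s) (at t)"
    using tendstoD[OF lim, of 1, OF zero_less_one]
  proof eventually_elim
    case (elim s)
    have d1: "?d s < 1" "0 \<le> ?d s" using elim by (auto simp: H1norm_nonneg)
    have Rs: "H1norm N (\<Psi> s) \<le> R" "H1norm N (\<Psi> t) \<le> R" using H1norm_diff_abs[OF HG HG, of s t] d1 by (auto simp: R_def)
    have w: "H1G N (\<lambda>j x. \<Psi> s j x - \<Psi> t j x)" by (rule H1G_diff[OF HG HG])
    have "L2norm N (\<lambda>j x. \<Psi> s j x - \<Psi> t j x) \<le> ?d s" by (rule L2norm_le_H1norm)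
    then have "(L2norm N (\<lambda>j x. \<Psi> s j x - \<Psi> t j x))\<^sup>2 \<le> ?d s * ?d s"
      unfolding power2_eq_square using d1 by (intro mult_mono) (auto simp: L2norm_nonneg)
    also have "\<dots> \<le> ?d s * 1" using d1 by (intro mult_left_mono) auto
    finally have sq: "K * (L2norm N (\<lambda>j x. \<Psi> s j x - \<Psi> t j x))\<^sup>2 \<le> K * ?d s" using K0 by (intro mult_left_mono) auto
    have nb: "cmod (ipG N (nonlin p (\<Psi> r)) W) \<le> R powr (2 * p) * R * H1norm N W" if "H1norm N (\<Psi> r) \<le> R" "H1G N W" for r W
    proof -
      have "L2norm N (nonlin p (\<Psi> r)) \<le> R powr (2 * p) * L2norm N (\<Psi> r)" by (rule nonlin_L2(2)[OF HG that(1) p0])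
      also have "\<dots> \<le> R powr (2 * p) * R" using L2norm_le_H1norm(1)[of N "\<Psi> r"] that(1) by (intro mult_left_mono) auto
      finally have "L2norm N (nonlin p (\<Psi> r)) * H1norm N W \<le> R powr (2 * p) * R * H1norm N W"
        by (rule mult_right_mono) (rule H1norm_nonneg)
      then show ?thesis using ipG_bound_H1[OF nlL that(2), of r] by linarith
    qed
    have a: "\<bar>Re (ipG N (nonlin p (\<Psi> t)) (\<lambda>j x. \<Psi> s j x - \<Psi> t j x))\<bar> \<le> R powr (2 * p) * R * ?d s"
      using nb[OF Rs(2) w] abs_Re_le_cmod order_trans by blast
    have b: "\<bar>Re (ipG N (nonlin p (\<Psi> s)) (\<lambda>j x. \<Psi> t j x - \<Psi> s j x))\<bar> \<le> R powr (2 * p) * R * ?d s"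
    proof -
      have w': "H1G N (\<lambda>j x. \<Psi> t j x - \<Psi> s j x)" by (rule H1G_diff[OF HG HG])
      have c: "H1norm N (\<lambda>j x. \<Psi> t j x - \<Psi> s j x) = ?d s" by (rule H1norm_diff_commute[OF HG HG])
      show ?thesis using order_trans[OF abs_Re_le_cmod nb[OF Rs(1) w']] unfolding c .
    qed
    define x where "x = Re (ipG N (nonlin p (\<Psi> s)) (\<lambda>j x. \<Psi> t j x - \<Psi> s j x)) - Re (ipG N (nonlin p (\<Psi> t)) (\<lambda>j x. \<Psi> s j x - \<Psi> t j x))"
    define P where "P = Pot N p (\<Psi> s) - Pot N p (\<Psi> t)"
    have "\<bar>x\<bar> \<le> 2 * (R powr (2 * p) * R * ?d s)" unfolding x_def using a b by linarith
    then have "\<bar>(p + 1) * x\<bar> \<le> (p + 1) * (2 * (R powr (2 * p) * R * ?d s))" using p0 by (simp add: abs_mult)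
    moreover have "\<bar>(p + 1) * (x + P) - p * P\<bar> \<le> K * (L2norm N (\<lambda>j x. \<Psi> s j x - \<Psi> t j x))\<^sup>2"
      using Pot_increment[OF Rs(2,1)] unfolding Im0 K_def x_def P_def .
    \<comment> \<open>The coefficients p + 1 and p leave P itself with coefficient 1, so the
      increment of the potential energy is bounded by terms known to be small.\<close>
    moreover have "(p + 1) * (x + P) - p * P = (p + 1) * x + P" by (simp add: algebra_simps)
    ultimately have "\<bar>P\<bar> \<le> K * ?d s + (p + 1) * (2 * (R powr (2 * p) * R * ?d s))" using sq by linarith
    then show ?case unfolding P_def by (simp add: algebra_simps)
  qed
  have "((\<lambda>s. (K + 2 * (p + 1) * (R powr (2 * p) * R)) * ?d s) \<longlongrightarrow> (K + 2 * (p + 1) * (R powr (2 * p) * R)) * 0) (at t)"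
    by (intro tendsto_intros lim)
  then have l: "((\<lambda>s. (K + 2 * (p + 1) * (R powr (2 * p) * R)) * ?d s) \<longlongrightarrow> 0) (at t)" by simp
  have "((\<lambda>s. Pot N p (\<Psi> s) - Pot N p (\<Psi> t)) \<longlongrightarrow> 0) (at t)"
    by (rule Lim_null_comparison[OF ev l])
  then show ?thesis unfolding isCont_def by (simp add: LIM_zero_iff)
qed

text \<open>A solution is not differentiable in \<open>H\<^sup>1\<close>, so the energy cannot be differentiated directly. Instead
  \<open>Im \<langle>\<Psi>(t+h), \<Psi>(t)\<rangle> / h\<close> tends to the quadratic part of the energy, and in its time derivative the
  Laplacians cancel.\<close>

theorem energy_conserved:
  assumes T: "T \<ge> 0" shows "Energy T = Energy 0"
proof -
  obtain R where R: "R > 0" "\<And>t. t \<in> {0..T+1} \<Longrightarrow> H1norm N (\<Psi> t) \<le> R" using H1_unif(1)[of "T + 1"] by blast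
  define K where "K = 4 * p * (p + 1) * (R * R powr (2 * p - 1)) + (p + 1) * R powr (2 * p)"
  have K0: "0 \<le> K" using R p0 by (simp add: K_def)
  define B where "B = BB p R"
  have B0: "0 \<le> B" unfolding B_def using R by (intro BB_nonneg) auto
  define P where "P t = Pot N p (\<Psi> t)" for t
  \<comment> \<open>The lower limit - 1 makes every t \<ge> 0 an interior point, so that
    \<open>IP\<close> has a two-sided derivative also at 0.\<close>
  define IP where "IP t = integral {-1..t} P" for t
  have cP: "continuous_on A P" for A unfolding P_def[abs_def] using Pot_continuous by (intro continuous_at_imp_continuous_on) auto
  have dIP: "(IP has_real_derivative P t) (at t)" if "t > -1" for t
  proof -
    have "(IP has_vector_derivative P t) (at t within {-1..t+1})"
      unfolding IP_def[abs_def] by (rule integral_has_vector_derivative[OF cP]) (use that in auto)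
    then have "(IP has_vector_derivative P t) (at t)"
      using that by (simp add: at_within_interior[of t "{-1..t+1}"])
    then show ?thesis by (simp add: has_real_derivative_iff_has_vector_derivative)
  qed
  \<comment> \<open>The time average of p P over [t, t + h] is subtracted because its derivative, p
    times the increment of P over h, matches the derivative of the pairing up to o(1). As h tends to
    0, J tends to - \<open>Energy\<close> t, the coefficient p + 1 of the potential energy being
    reduced to 1.\<close>
  define J where "J h t = Im (ipG N (\<Psi> (t + h)) (\<Psi> t)) / h - p * ((IP (t + h) - IP t) / h)" for h t
  have dJ: "(J h has_real_derivative Im (DF (t + h) (\<Psi> t) + cnj (DF t (\<Psi> (t + h)))) / h - p * ((P (t + h) - P t) / h)) (at t)"
    if "h > 0" "t \<ge> 0" for h t
  proof -
    have "((\<lambda>k. (ipG N (\<Psi> ((t + k) + h)) (\<Psi> (t + k)) - ipG N (\<Psi> (t + h)) (\<Psi> t)) / complex_of_real k)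
     \<longlongrightarrow> DF (t + h) (\<Psi> t) + cnj (DF t (\<Psi> (t + h)))) (at 0)"
      using two_time_id[of "t + h" t] by (simp add: algebra_simps)
    from DERIV_of_complex(2)[of "\<lambda>t. ipG N (\<Psi> (t + h)) (\<Psi> t)", OF this]
    have 1: "((\<lambda>t. Im (ipG N (\<Psi> (t + h)) (\<Psi> t))) has_real_derivative Im (DF (t + h) (\<Psi> t) + cnj (DF t (\<Psi> (t + h))))) (at t)" .
    have 2: "((\<lambda>t. IP (t + h)) has_real_derivative P (t + h)) (at t)"
      using DERIV_shift[of IP "P (t + h)" t h] dIP[of "t + h"] that by simp
    have 3: "(IP has_real_derivative P t) (at t)" using that by (intro dIP) auto
    show ?thesis unfolding J_def[abs_def] by (intro DERIV_diff DERIV_cdivide DERIV_cmult 1 2 3)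
  qed
  have limJ: "((\<lambda>h. J h t) \<longlongrightarrow> - Energy t) (at_right 0)" if "t \<ge> 0" for t
  proof -
    have "((\<lambda>h. (ipG N (\<Psi> (t + h)) (\<Psi> t) - ipG N (\<Psi> t) (\<Psi> t)) / complex_of_real h) \<longlongrightarrow> DF t (\<Psi> t)) (at 0)"
      by (rule ip_deriv[OF HG])
    from tendsto_Im[OF this] have 1: "((\<lambda>h. Im (ipG N (\<Psi> (t + h)) (\<Psi> t)) / h) \<longlongrightarrow> Im (DF t (\<Psi> t))) (at 0)"
      by (simp add: ipG_self)
    have 2: "((\<lambda>h. (IP (t + h) - IP t) / h) \<longlongrightarrow> P t) (at 0)" using dIP[of t] that by (simp add: DERIV_def)
    have "((\<lambda>h. J h t) \<longlongrightarrow> Im (DF t (\<Psi> t)) - p * P t) (at 0)" unfolding J_def by (intro tendsto_intros 1 2)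
    moreover have "Im (DF t (\<Psi> t)) - p * P t = - Energy t" by (simp add: DF_self Energy_def P_def algebra_simps)
    ultimately show ?thesis by (simp add: filterlim_at_split)
  qed
  have "((\<lambda>h. J h T - J h 0) \<longlongrightarrow> - Energy T - (- Energy 0)) (at_right 0)" by (intro tendsto_diff limJ T order_refl)
  moreover have "((\<lambda>h. J h T - J h 0) \<longlongrightarrow> 0) (at_right 0)"
  proof (rule tendstoI)
    fix e :: real assume e: "e > 0"
    define e1 where "e1 = e / (T * (K * B) + 1)"
    have pos: "T * (K * B) + 1 > 0" using T K0 B0 by (simp add: add_nonneg_pos)
    have e1: "e1 > 0" using e pos by (simp add: e1_def)
    obtain d where d: "d > 0" and dd: "\<And>s t. s \<in> {0..T+1} \<Longrightarrow> t \<in> {0..T+1} \<Longrightarrow> \<bar>s - t\<bar> < d \<Longrightarrow> H1norm N (\<lambda>j x. \<Psi> s j x - \<Psi> t j x) < e1"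
      using H1_unif(2)[OF e1, of "T + 1"] by blast
    have "eventually (\<lambda>h. h \<in> {0<..<min d 1}) (at_right 0)" by (rule eventually_at_right_real) (use d in simp)
    then show "eventually (\<lambda>h. dist (J h T - J h 0) 0 < e) (at_right 0)"
    proof eventually_elim
      case (elim h)
      then have h: "h > 0" "h < d" "h < 1" by auto
      have db: "\<bar>Im (DF (t + h) (\<Psi> t) + cnj (DF t (\<Psi> (t + h)))) / h - p * ((P (t + h) - P t) / h)\<bar> \<le> K * B * e1" if t: "0 \<le> t" "t \<le> T" for t
      proof -
        have "(L2norm N (\<lambda>j x. \<Psi> (t + h) j x - \<Psi> t j x))\<^sup>2 \<le> h * (B * H1norm N (\<lambda>j x. \<Psi> (t + h) j x - \<Psi> t j x))"
          unfolding B_def using h t by (intro L2_increment R(2)) auto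
        also have "\<dots> \<le> h * (B * e1)"
        proof -
          have "H1norm N (\<lambda>j x. \<Psi> (t + h) j x - \<Psi> t j x) \<le> e1" using dd[of "t + h" t] h t by simp
          then show ?thesis using B0 h by (intro mult_left_mono) auto
        qed
        finally have "K * (L2norm N (\<lambda>j x. \<Psi> (t + h) j x - \<Psi> t j x))\<^sup>2 \<le> K * (h * (B * e1))" using K0 by (rule mult_left_mono)
        moreover have "\<bar>Im (DF (t + h) (\<Psi> t) + cnj (DF t (\<Psi> (t + h)))) - p * (P (t + h) - P t)\<bar> \<le> K * (L2norm N (\<lambda>j x. \<Psi> (t + h) j x - \<Psi> t j x))\<^sup>2"
          unfolding K_def P_def using h t by (intro Pot_increment R(2)) auto
        ultimately have "\<bar>Im (DF (t + h) (\<Psi> t) + cnj (DF t (\<Psi> (t + h)))) - p * (P (t + h) - P t)\<bar> \<le> h * (K * B * e1)" by (simp add: mult_ac)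
        moreover have "Im (DF (t + h) (\<Psi> t) + cnj (DF t (\<Psi> (t + h)))) / h - p * ((P (t + h) - P t) / h) = (Im (DF (t + h) (\<Psi> t) + cnj (DF t (\<Psi> (t + h)))) - p * (P (t + h) - P t)) / h"
          by (simp add: diff_divide_distrib right_diff_distrib)
        ultimately show ?thesis using h by (simp add: abs_divide pos_divide_le_eq mult.commute)
      qed
      have "\<bar>J h T - J h 0\<bar> \<le> T * (K * B * e1)"
      proof (cases "T = 0")
        case False
        then have T0: "0 < T" using T by simp
        obtain z where z: "0 < z" "z < T" and e: "J h T - J h 0 = (T - 0) * (Im (DF (z + h) (\<Psi> z) + cnj (DF z (\<Psi> (z + h)))) / h - p * ((P (z + h) - P z) / h))"
          using MVT2[OF T0, of "J h" "\<lambda>t. Im (DF (t + h) (\<Psi> t) + cnj (DF t (\<Psi> (t + h)))) / h - p * ((P (t + h) - P t) / h)"] dJ h by blast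
        show ?thesis unfolding e abs_mult using db[of z] z T by (intro mult_mono) auto
      qed simp
      also have "\<dots> = (T * (K * B)) * e1" by simp
      also have "\<dots> < (T * (K * B) + 1) * e1" using e1 by (intro mult_strict_right_mono) auto
      also have "\<dots> = e" unfolding e1_def using pos by simp
      finally show ?case by (simp add: dist_real_def)
    qed
  qed
  ultimately have "- Energy T - (- Energy 0) = 0" by (rule tendsto_unique[OF trivial_limit_at_right_real])
  then show ?thesis by simp
qed

end

section \<open>Preservation of the edge symmetry\<close>

text \<open>Continuity of primitives turns the almost everywhere conclusion of an L^2 estimate into
  a pointwise one.\<close>

lemma prim_AE_zero:
  assumes u: "prim u u'" and ae: "AE x in hl. u x = 0" and x: "x \<ge> 0"
  shows "u x = 0"
proof (rule ccontr)
  assume nz: "u x \<noteq> 0"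
  have "continuous (at x within {0..}) u" using prim_continuous[OF u] x by (simp add: continuous_on_eq_continuous_within)
  then obtain d where d: "d > 0" and dd: "\<And>y. y \<in> {0..} \<Longrightarrow> dist y x < d \<Longrightarrow> dist (u y) (u x) < \<bar>u x\<bar>"
    using nz unfolding continuous_within_eps_delta by (meson zero_less_abs_iff)
  have "AE y in lborel. y \<in> {0..} \<longrightarrow> u y = 0" using ae by (subst (asm) AE_restrict_space_iff) auto
  then have "AE y in lborel. y \<notin> {x<..<x+d}"
  proof eventually_elim
    case (elim y)
    show ?case
    proof
      assume y: "y \<in> {x<..<x+d}"
      then have "dist (u y) (u x) < \<bar>u x\<bar>" using x by (intro dd) (auto simp: dist_real_def)
      moreover have "u y = 0" using elim y x by simp
      ultimately show False by (simp add: dist_real_def)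
    qed
  qed
  then have "emeasure lborel {x<..<x+d} = 0" by (subst (asm) AE_iff_measurable[where N="{x<..<x+d}"]) auto
  then show False using d by simp
qed

lemma cn_zero:
  assumes f: "H1_hl f" and z: "cn f = 0" and x: "x \<ge> 0"
  shows "f x = 0"
proof -
  note h = H1_hl_H1r[OF f]
  have i: "integrable hl (\<lambda>x. (cmod (f x))\<^sup>2)" using h(3) by (simp add: L2_hl_iff)
  have "(\<integral>x. (cmod (f x))\<^sup>2 \<partial>hl) = 0" using z by (simp add: cn_def)
  then have "AE x in hl. (cmod (f x))\<^sup>2 = 0" using integral_nonneg_eq_0_iff_AE[OF i] by simp
  then have "AE x in hl. Re (f x) = 0" "AE x in hl. Im (f x) = 0" by (auto elim!: eventually_mono)
  then have "Re (f x) = 0" "Im (f x) = 0" using h(1,2) x by (auto simp: H1r_def intro: prim_AE_zero)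
  then show ?thesis by (simp add: complex_eq_iff)
qed

context nls_solution begin

text \<open>A uniqueness argument by Gronwall's inequality for the solution and its permuted copy.
  Since both have the same conserved mass, the squared L^2 distance is a constant minus 2 Re of a
  single pairing, and \<open>two_time\<close> differentiates it.\<close>

theorem symmetry_preserved:
  assumes inv: "involution N \<pi>" and init: "\<And>j x. j < N \<Longrightarrow> x \<ge> 0 \<Longrightarrow> \<Psi> 0 (\<pi> j) x = \<Psi> 0 j x"
    and T: "T \<ge> 0" and j: "j < N" and x: "x \<ge> 0"
  shows "\<Psi> T (\<pi> j) x = \<Psi> T j x"
proof -
  interpret involution N \<pi> by fact
  define W where "W t = permG \<pi> (\<Psi> t)" for t
  have HW: "H1G N (W t)" for t unfolding W_def by (rule H1G_perm[OF HG])
  note LW = H1G_L2G(1)[OF HW]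
  define f where "f t = (L2norm N (\<lambda>j x. \<Psi> t j x - W t j x))\<^sup>2" for t
  obtain R where R: "R > 0" "\<And>t. t \<in> {0..T} \<Longrightarrow> H1norm N (\<Psi> t) \<le> R" using H1_unif(1)[of T] by blast
  define C where "C = 4 * (p + 1) * (p * (R * R powr (2 * p - 1)))"
  have f_eq: "f t = 2 * (L2norm N (\<Psi> 0))\<^sup>2 - 2 * Re (ipG N (\<Psi> t) (W t))" for t
  proof -
    have L: "L2G N (\<lambda>j x. \<Psi> t j x - W t j x)" by (rule L2G_diff[OF LG LW])
    have a: "ipG N (W t) (\<Psi> t) = ipG N (\<Psi> t) (W t)" unfolding W_def by (rule ipG_perm_swap)
    have b: "ipG N (W t) (W t) = ipG N (\<Psi> t) (\<Psi> t)" unfolding W_def by (rule ipG_perm)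
    have "complex_of_real (f t) = ipG N (\<lambda>j x. \<Psi> t j x - W t j x) (\<lambda>j x. \<Psi> t j x - W t j x)"
      unfolding f_def by (rule ipG_self[symmetric])
    also have "\<dots> = 2 * ipG N (\<Psi> t) (\<Psi> t) - 2 * ipG N (\<Psi> t) (W t)"
      unfolding ipG_diff_left[OF LG LW L] ipG_diff_right[OF LG LW LG] ipG_diff_right[OF LG LW LW] a b by simp
    finally have "Re (complex_of_real (f t)) = Re (2 * ipG N (\<Psi> t) (\<Psi> t) - 2 * ipG N (\<Psi> t) (W t))" by (rule arg_cong)
    then show ?thesis using mass_conserved[of t] by (simp add: ipG_self)
  qed
  have dG: "((\<lambda>t. Re (ipG N (\<Psi> t) (W t))) has_real_derivative Re (DF t (W t) + cnj (DF t (W t)))) (at t)" for t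
    using DERIV_of_complex(1)[of "\<lambda>t. ipG N (\<Psi> t) (W t)", OF two_time[OF inv, of t t, folded W_def]] .
  have df: "(f has_real_derivative - 4 * Re (DF t (W t))) (at t)" for t
  proof -
    have "((\<lambda>t. 2 * (L2norm N (\<Psi> 0))\<^sup>2 - 2 * Re (ipG N (\<Psi> t) (W t))) has_real_derivative 0 - 2 * Re (DF t (W t) + cnj (DF t (W t)))) (at t)"
      by (intro DERIV_diff DERIV_const DERIV_cmult dG)
    then show ?thesis unfolding f_eq[abs_def, symmetric] by simp
  qed
  have bound: "- 4 * Re (DF t (W t)) \<le> C * f t" if t: "t \<in> {0..T}" for t
  proof -
    \<comment> \<open>The permutation is symmetric for the gradient form, so this pairing is real
      and the Laplacian does not contribute to the derivative of the distance.\<close>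
    have grad: "Im (gradG N (\<Psi> t) (W t)) = 0"
    proof -
      have "gradG N (W t) (\<Psi> t) = gradG N (\<Psi> t) (W t)" unfolding W_def by (rule gradG_perm_swap)
      then have "gradG N (\<Psi> t) (W t) = cnj (gradG N (\<Psi> t) (W t))" by (subst gradG_cnj) simp
      then show ?thesis by (metis cnj.simps(2) neg_equal_zero)
    qed
    have swap: "ipG N (nonlin p (W t)) (\<Psi> t) = ipG N (nonlin p (\<Psi> t)) (W t)"
      unfolding W_def nonlin_perm by (rule ipG_perm_swap)
    have nW: "L2G N (nonlin p (W t))" by (rule nonlin_L2(1)[OF HW order_refl p0])
    \<comment> \<open>Adding the swapped pairing leaves (|a|^(2p) - |b|^(2p)) Im (a cnj b) at each
      point. Both factors are of size |a - b|, as Im (a cnj b) = Im ((a - b) cnj b), which gives the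
      quadratic bound that Gronwall's inequality needs.\<close>
    let ?I = "\<lambda>j x. Im (nonlin p (\<Psi> t) j x * cnj (W t j x)) + Im (nonlin p (W t) j x * cnj (\<Psi> t j x))"
    have i: "integrable hl (\<lambda>x. nonlin p (\<Psi> t) j x * cnj (W t j x))" "integrable hl (\<lambda>x. nonlin p (W t) j x * cnj (\<Psi> t j x))" if "j < N" for j
      using nlL[of t] LG[of t] LW[of t] nW that by (auto simp: L2G_def intro!: L2_hl_prod)
    have "2 * Im (ipG N (nonlin p (\<Psi> t)) (W t)) = Im (ipG N (nonlin p (\<Psi> t)) (W t)) + Im (ipG N (nonlin p (W t)) (\<Psi> t))"
      by (simp add: swap)
    also have "\<dots> = (\<Sum>j<N. \<integral>x. ?I j x \<partial>hl)"
      unfolding ipG_hl Im_sum sum.distrib[symmetric]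
    proof (rule sum.cong[OF refl])
      fix j assume "j \<in> {..<N}"
      then have j: "j < N" by simp
      show "Im (\<integral>x. nonlin p (\<Psi> t) j x * cnj (W t j x) \<partial>hl) + Im (\<integral>x. nonlin p (W t) j x * cnj (\<Psi> t j x) \<partial>hl) = (\<integral>x. ?I j x \<partial>hl)"
        using integral_Im[OF i(1)[OF j]] integral_Im[OF i(2)[OF j]] integrable_Im[OF i(1)[OF j]] integrable_Im[OF i(2)[OF j]] by simp
    qed
    finally have two: "2 * Im (ipG N (nonlin p (\<Psi> t)) (W t)) = (\<Sum>j<N. \<integral>x. ?I j x \<partial>hl)" .
    have "(\<Sum>j<N. \<integral>x. ?I j x \<partial>hl) \<le> (\<Sum>j<N. (2 * p * (R * R powr (2 * p - 1))) * (cn (\<lambda>x. \<Psi> t j x - W t j x))\<^sup>2)"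
    proof (rule sum_mono)
      fix j assume "j \<in> {..<N}"
      then have j: "j < N" by simp
      have "(\<integral>x. ?I j x \<partial>hl) \<le> (\<integral>x. (2 * p * (R * R powr (2 * p - 1))) * (cmod (\<Psi> t j x - W t j x))\<^sup>2 \<partial>hl)"
      proof (rule hl_integral_mono)
        show "integrable hl (\<lambda>x. ?I j x)" using integrable_Im[OF i(1)[OF j]] integrable_Im[OF i(2)[OF j]] by simp
        show "integrable hl (\<lambda>x. (2 * p * (R * R powr (2 * p - 1))) * (cmod (\<Psi> t j x - W t j x))\<^sup>2)"
          using L2G_diff[OF LG[of t] LW[of t]] j by (simp add: L2G_def L2_hl_iff)
        fix x :: real assume x: "x \<ge> 0"
        define a where "a = \<Psi> t j x"
        define b where "b = W t j x"
        have aR: "cmod a \<le> R" "cmod b \<le> R"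
          using H1norm_sup[OF HG j x, of t] H1norm_sup[OF HW j x, of t] R(2)[OF t] H1norm_perm[of "\<Psi> t"] by (auto simp: a_def b_def W_def)
        have "?I j x = (cmod a powr (2 * p) - cmod b powr (2 * p)) * Im (a * cnj b)"
          unfolding nonlin_def a_def[symmetric] b_def[symmetric] by (simp add: algebra_simps)
        also have "\<dots> \<le> \<bar>cmod a powr (2 * p) - cmod b powr (2 * p)\<bar> * \<bar>Im (a * cnj b)\<bar>" by (metis abs_ge_self abs_mult)
        also have "\<dots> \<le> (2 * p * R powr (2 * p - 1) * cmod (a - b)) * (cmod (a - b) * R)"
        proof (rule mult_mono)
          have "\<bar>cmod a powr (2 * p) - cmod b powr (2 * p)\<bar> \<le> 2 * p * R powr (2 * p - 1) * \<bar>cmod a - cmod b\<bar>"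
            using aR by (intro powr_lipschitz p_half) auto
          also have "\<dots> \<le> 2 * p * R powr (2 * p - 1) * cmod (a - b)"
            using p0 norm_triangle_ineq3[of a b] by (intro mult_left_mono) auto
          finally show "\<bar>cmod a powr (2 * p) - cmod b powr (2 * p)\<bar> \<le> 2 * p * R powr (2 * p - 1) * cmod (a - b)" .
          have "Im (a * cnj b) = Im ((a - b) * cnj b)" by (simp add: algebra_simps)
          also have "\<bar>\<dots>\<bar> \<le> cmod ((a - b) * cnj b)" by (rule abs_Im_le_cmod)
          also have "\<dots> \<le> cmod (a - b) * R" unfolding norm_mult using aR(2) by (intro mult_left_mono) auto
          finally show "\<bar>Im (a * cnj b)\<bar> \<le> cmod (a - b) * R" .
        qed (use p0 in auto)
        also have "\<dots> = (2 * p * (R * R powr (2 * p - 1))) * (cmod (a - b))\<^sup>2" by (simp add: power2_eq_square)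
        finally show "?I j x \<le> (2 * p * (R * R powr (2 * p - 1))) * (cmod (\<Psi> t j x - W t j x))\<^sup>2" unfolding a_def b_def .
      qed
      then show "(\<integral>x. ?I j x \<partial>hl) \<le> (2 * p * (R * R powr (2 * p - 1))) * (cn (\<lambda>x. \<Psi> t j x - W t j x))\<^sup>2" by (simp add: cn_sq)
    qed
    also have "\<dots> = (2 * p * (R * R powr (2 * p - 1))) * f t" by (simp add: f_def L2norm_sq sum_distrib_left)
    finally have "Im (ipG N (nonlin p (\<Psi> t)) (W t)) \<le> (p * (R * R powr (2 * p - 1))) * f t" using two by simp
    then have "4 * (p + 1) * Im (ipG N (nonlin p (\<Psi> t)) (W t)) \<le> 4 * (p + 1) * ((p * (R * R powr (2 * p - 1))) * f t)"
      using p0 by (intro mult_left_mono) auto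
    moreover have "- 4 * Re (DF t (W t)) = 4 * (p + 1) * Im (ipG N (nonlin p (\<Psi> t)) (W t))"
      unfolding DF_def using grad by (simp add: algebra_simps)
    ultimately show ?thesis by (simp add: C_def mult_ac)
  qed
  have "f T * exp (- C * T) \<le> f 0 * exp (- C * 0)"
  proof (rule DERIV_nonpos_imp_nonincreasing[OF T, of "\<lambda>t. f t * exp (- C * t)"])
    fix t assume t: "0 \<le> t" "t \<le> T"
    have "((\<lambda>t. f t * exp (- C * t)) has_real_derivative (- 4 * Re (DF t (W t)) - C * f t) * exp (- C * t)) (at t)"
      by (rule derivative_eq_intros df refl)+ (simp add: algebra_simps)
    moreover have "(- 4 * Re (DF t (W t)) - C * f t) * exp (- C * t) \<le> 0"
      using bound[of t] t by (intro mult_nonpos_nonneg) auto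
    ultimately show "\<exists>y. ((\<lambda>t. f t * exp (- C * t)) has_real_derivative y) (at t) \<and> y \<le> 0" by blast
  qed
  moreover have "f 0 = 0"
  proof -
    have "cn (\<lambda>x. \<Psi> 0 j x - W 0 j x) = 0" if "j < N" for j
    proof -
      have "(\<integral>x. (cmod (\<Psi> 0 j x - W 0 j x))\<^sup>2 \<partial>hl) = (\<integral>x. 0 \<partial>hl)"
        using init[OF that] by (intro Bochner_Integration.integral_cong) (auto simp: W_def permG_def)
      then show ?thesis by (simp add: cn_def)
    qed
    then show ?thesis by (simp add: f_def L2norm_sq)
  qed
  ultimately have "f T \<le> 0" by (simp add: mult_le_0_iff)
  then have "(\<Sum>j<N. (cn (\<lambda>x. \<Psi> T j x - W T j x))\<^sup>2) = 0"
    unfolding f_def L2norm_sq by (intro antisym sum_nonneg) auto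
  then have "\<forall>i\<in>{..<N}. (cn (\<lambda>x. \<Psi> T i x - W T i x))\<^sup>2 = 0"
    by (subst (asm) sum_nonneg_eq_0_iff) auto
  then have "cn (\<lambda>x. \<Psi> T j x - W T j x) = 0" using j by simp
  then have "\<Psi> T j x - W T j x = 0" using H1G_D(1)[OF H1G_diff[OF HG HW] j] x by (intro cn_zero[of "\<lambda>x. \<Psi> T j x - W T j x"])
  then show ?thesis by (simp add: W_def permG_def)
qed

end

section \<open>Initial data of smaller energy\<close>

text \<open>The fourth derivative of the power is a positive multiple of q (q - 1) (q - 2) (q - 3)
  \<ge> 0, so the cubic Taylor polynomial is a lower bound. It is applied with q = 2p + 2, which is
  at least 3 because 1/2 \<le> p.\<close>

lemma one_minus_powr_ge:
  fixes q y :: real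
  assumes q: "q \<ge> 3" and y: "y < 1"
  shows "(1 - y) powr q \<ge> 1 - q * y + q * (q - 1) / 2 * y\<^sup>2 - q * (q - 1) * (q - 2) / 6 * y ^ 3"
proof (cases "y = 0")
  case False
  define D where "D m t = (\<Prod>i<m. (q - real i)) * t powr (q - real m)" for m :: nat and t :: real
  have "\<exists>t. (if 1 - y < 1 then 1 - y < t \<and> t < 1 else 1 < t \<and> t < 1 - y) \<and>
     (1 - y) powr q = (\<Sum>m<4. D m 1 / fact m * (1 - y - 1) ^ m) + D 4 t / fact 4 * (1 - y - 1) ^ 4"
  proof (rule Taylor[where a="min 1 (1 - y)" and b="max 1 (1 - y)"])
    show "D 0 = (\<lambda>x. x powr q)" by (auto simp: D_def)
    show "\<forall>m t. m < 4 \<and> min 1 (1 - y) \<le> t \<and> t \<le> max 1 (1 - y) \<longrightarrow> (D m has_real_derivative D (Suc m) t) (at t)"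
    proof (intro allI impI)
      fix m :: nat and t :: real assume "m < 4 \<and> min 1 (1 - y) \<le> t \<and> t \<le> max 1 (1 - y)"
      then have t: "t > 0" using y by (auto simp: min_def split: if_splits)
      have "((\<lambda>t. (\<Prod>i<m. (q - real i)) * t powr (q - real m)) has_real_derivative
         (\<Prod>i<m. (q - real i)) * ((q - real m) * t powr (q - real m - 1))) (at t)"
        by (intro DERIV_cmult has_real_derivative_powr t)
      then show "(D m has_real_derivative D (Suc m) t) (at t)"
        by (simp add: D_def[abs_def] algebra_simps)
    qed
  qed (use False in auto)
  then obtain t where tt: "if 1 - y < 1 then 1 - y < t \<and> t < 1 else 1 < t \<and> t < 1 - y"
    and e: "(1 - y) powr q = (\<Sum>m<4. D m 1 / fact m * (1 - y - 1) ^ m) + D 4 t / fact 4 * (1 - y - 1) ^ 4" by blast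
  have t: "t > 0" using tt y by (auto split: if_splits)
  have "D 4 t = q * (q - 1) * (q - 2) * (q - 3) * t powr (q - 4)" by (simp add: D_def eval_nat_numeral)
  moreover have "0 \<le> q * (q - 1) * (q - 2) * (q - 3)" using q by (intro mult_nonneg_nonneg) auto
  ultimately have "0 \<le> D 4 t" by simp
  then have "0 \<le> D 4 t / fact 4 * (1 - y - 1) ^ 4" by (intro mult_nonneg_nonneg) auto
  moreover have "(\<Sum>m<4. D m 1 / fact m * (1 - y - 1) ^ m) = 1 - q * y + q * (q - 1) / 2 * y\<^sup>2 - q * (q - 1) * (q - 2) / 6 * y ^ 3"
    by (simp add: D_def eval_nat_numeral field_simps)
  ultimately show ?thesis using e by linarith
qed simp

lemma powr_bernoulli:
  fixes x r :: real
  assumes x: "0 < x" "x \<le> 1" and r: "1 \<le> r"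
  shows "1 + r * (x - 1) \<le> x powr r"
proof (cases "x = 1")
  case False
  have "\<exists>z>x. z < 1 \<and> 1 powr r - x powr r = (1 - x) * (r * z powr (r - 1))"
    by (rule MVT2) (use False x in \<open>auto intro!: has_real_derivative_powr\<close>)
  then obtain z where z: "x < z" "z < 1" and e: "1 powr r - x powr r = (1 - x) * (r * z powr (r - 1))" by blast
  have "z powr (r - 1) \<le> 1" using z x r by (intro powr_le1) auto
  then have "(1 - x) * (r * z powr (r - 1)) \<le> (1 - x) * (r * 1)" using x r by (intro mult_left_mono) auto
  then show ?thesis using e by (simp add: algebra_simps)
qed simp

section \<open>The family of data and its energy\<close>

definition cc :: "nat \<Rightarrow> nat \<Rightarrow> real" where "cc N j = (if j = 0 then - (real N - 1) else 1)"

lemma sum_edges: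
  fixes F :: "nat \<Rightarrow> 'a::real_vector"
  assumes N: "N \<ge> 2" and F: "\<And>j. 1 \<le> j \<Longrightarrow> j < N \<Longrightarrow> F j = F 1"
  shows "(\<Sum>j<N. F j) = F 0 + (real N - 1) *\<^sub>R F 1"
proof -
  have "{..<N} = insert 0 {1..<N}" using N by auto
  then have "(\<Sum>j<N. F j) = F 0 + (\<Sum>j\<in>{1..<N}. F j)" by simp
  also have "(\<Sum>j\<in>{1..<N}. F j) = (\<Sum>j\<in>{1..<N}. F 1)" by (rule sum.cong[OF refl]) (rule F; simp)
  also have "\<dots> = (real N - 1) *\<^sub>R F 1" using N by (simp add: sum_constant_scaleR of_nat_diff)
  finally show ?thesis .
qed

context half_soliton begin

definition mu where "mu = (\<integral>x. (ph1 x)\<^sup>2 \<partial>hl)"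
definition mu2 where "mu2 = (\<integral>x. (ph2 x)\<^sup>2 \<partial>hl)"
definition P0 where "P0 = (\<integral>x. (phi p x)\<^sup>2 * S x \<partial>hl)"
definition s2 where "s2 = (\<integral>x. (phi p x)\<^sup>2 * S x * (T x)\<^sup>2 \<partial>hl)"
text \<open>The same number as \<open>tau3\<close>, since \<phi>' = - \<phi> T: one cubic
  coefficient lowers the energy of the data and drives the growth.\<close>

definition sig3 where "sig3 = (\<integral>x. (phi p x)\<^sup>2 * S x * T x ^ 3 \<partial>hl)"

lemma S_phi_int: "integrable hl (\<lambda>x. (phi p x)\<^sup>2 * S x * T x ^ k)"
proof -
  have "integrable hl (\<lambda>x. (S x * T x ^ k * phi p x) * phi p x)"
  proof (intro L2r_mult_integrable L2r_bounded_mult[where B=1] L2r_phis)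
    show "(\<lambda>x. S x * T x ^ k) \<in> borel_measurable hl" by (intro hl_continuous_measurable continuous_intros cont)
    fix x
    have "\<bar>T x\<bar> ^ k \<le> 1" using T_bounds[of x] by (intro power_le_one) auto
    then show "\<bar>S x * T x ^ k\<bar> \<le> 1" using S_bounds[of x] by (simp add: abs_mult power_abs mult_le_one)
  qed
  then show ?thesis by (simp add: power2_eq_square mult_ac)
qed

lemma sq_ints: "integrable hl (\<lambda>x. (phi p x)\<^sup>2)" "integrable hl (\<lambda>x. (ph1 x)\<^sup>2)" "integrable hl (\<lambda>x. (ph2 x)\<^sup>2)"
  "integrable hl (\<lambda>x. (phi p x)\<^sup>2 * S x)"
  using L2r_phis S_phi_int[of 0] by (auto simp: L2r_def)

lemma sig3_pos: "sig3 > 0"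
  unfolding sig3_def
proof (rule integral_pos_hl[OF S_phi_int])
  fix x :: real
  show "0 \<le> (phi p x)\<^sup>2 * S x * T x ^ 3" if "0 \<le> x" using that T_bounds(3)[of x] S_bounds[of x] by simp
  show "0 < (phi p x)\<^sup>2 * S x * T x ^ 3" if "0 < x" using that T_bounds(4)[of x] S_bounds[of x] phi_pos[of x] by simp
qed

lemma E0_eq: "E0 = mu - P0"
  unfolding E0_def mu_def P0_def using sq_ints by simp

text \<open>The stationary equations of \<phi> and of \<phi>' tested with themselves. They are
  responsible for the cancellation of all terms of order c^2 in the energy of the data.\<close>

lemma identities: "mu + m0 = (p + 1) * P0" "mu2 + mu = (p + 1) * (2 * p + 1) * s2"
proof -
  have "0 = (\<integral>x. ph1 x * ph1 x + Vm x * phi p x * phi p x \<partial>hl)" using phi_form[OF H1r_phis(1)] by simp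
  also have "\<dots> = (\<integral>x. (ph1 x)\<^sup>2 + (phi p x)\<^sup>2 - (p + 1) * ((phi p x)\<^sup>2 * S x) \<partial>hl)"
    by (rule Bochner_Integration.integral_cong) (auto simp: Vm_def power2_eq_square algebra_simps)
  also have "\<dots> = mu + m0 - (p + 1) * P0" unfolding mu_def m0_def P0_def using sq_ints by simp
  finally show "mu + m0 = (p + 1) * P0" by simp
  have p0: "ph1 0 = 0" by (simp add: ph1_def T_def)
  have "0 = (\<integral>x. ph2 x * ph2 x + Vp x * ph1 x * ph1 x \<partial>hl)" using ph1_form[OF H1r_phis(2) p0] by simp
  also have "\<dots> = (\<integral>x. (ph2 x)\<^sup>2 + (ph1 x)\<^sup>2 - (p + 1) * (2 * p + 1) * ((phi p x)\<^sup>2 * S x * (T x)\<^sup>2) \<partial>hl)"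
    by (rule Bochner_Integration.integral_cong) (auto simp: Vp_def ph1_def power2_eq_square algebra_simps)
  also have "\<dots> = mu2 + mu - (p + 1) * (2 * p + 1) * s2" unfolding mu_def mu2_def s2_def using sq_ints S_phi_int[of 2] by simp
  finally show "mu2 + mu = (p + 1) * (2 * p + 1) * s2" by simp
qed

text \<open>The scaling that restores the mass of \<Phi>. Per edge, the mean mass before scaling is
  m0 + n c^2 mu: the cross terms cancel because the weights sum to zero, and n is the mean of their
  squares.\<close>

definition lam :: "real \<Rightarrow> real \<Rightarrow> real" where "lam n c = sqrt (m0 / (m0 + n * c\<^sup>2 * mu))"

lemma mu_nonneg: "mu \<ge> 0" "mu2 \<ge> 0" "s2 \<ge> 0" by (auto simp: mu_def mu2_def s2_def S_bounds less_imp_le intro!: integral_nonneg_AE AE_hl_I)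

lemma lam_bounds:
  assumes n: "n \<ge> 0"
  shows "0 < lam n c" "lam n c \<le> 1" "(lam n c)\<^sup>2 * (m0 + n * c\<^sup>2 * mu) = m0" "1 - (lam n c)\<^sup>2 \<le> n * c\<^sup>2 * mu / m0" "\<bar>lam n c - 1\<bar> \<le> n * c\<^sup>2 * mu / m0"
proof -
  define d where "d = n * c\<^sup>2 * mu"
  have d: "d \<ge> 0" using n mu_nonneg by (simp add: d_def)
  have sq: "(lam n c)\<^sup>2 = m0 / (m0 + d)" unfolding lam_def d_def[symmetric] using m0_pos d by simp
  show l0: "0 < lam n c" unfolding lam_def d_def[symmetric] using m0_pos d by simp
  show l1: "lam n c \<le> 1" unfolding lam_def d_def[symmetric] using m0_pos d by simp
  show "(lam n c)\<^sup>2 * (m0 + n * c\<^sup>2 * mu) = m0" unfolding d_def[symmetric] sq using m0_pos d by simp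
  have "1 - (lam n c)\<^sup>2 = d / (m0 + d)" unfolding sq using m0_pos d by (simp add: field_simps)
  also have "\<dots> \<le> d / m0" using m0_pos d by (intro divide_left_mono) auto
  finally show a: "1 - (lam n c)\<^sup>2 \<le> n * c\<^sup>2 * mu / m0" unfolding d_def .
  have "(lam n c)\<^sup>2 \<le> lam n c" using l0 l1 by (simp add: power2_eq_square mult_left_le)
  then show "\<bar>lam n c - 1\<bar> \<le> n * c\<^sup>2 * mu / m0" using a l1 by linarith
qed

text \<open>This is the mean energy per edge. With \<nu> = 1 - \<lambda>^2 of order c^2,
  \<open>identities\<close> and the mass relation cancel everything of order c^2. The cubic gain k3
  keeps at least the factor w \<ge> 1/2 from the scaling, and the loss is of order c^4.\<close>

lemma initial_energy_real:
  fixes n c :: real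
  assumes n: "n \<ge> 1"
  defines "lc \<equiv> lam n c"
  defines "k3 \<equiv> (2 * p + 2) * (2 * p + 1) * (2 * p) / 6 * (n * (n - 1)) * sig3"
  assumes nu: "(p + 1) * (n * c\<^sup>2 * mu / m0) \<le> 1/2" and c: "c \<ge> 0"
    and Pc: "Pc \<ge> P0 + (p + 1) * (2 * p + 1) * n * c\<^sup>2 * s2 + k3 * c ^ 3"
  shows "lc\<^sup>2 * (mu + n * c\<^sup>2 * mu2) - (lc\<^sup>2) powr (p + 1) * Pc
     \<le> E0 - (k3 / 2 * c ^ 3 - (p + 1) * (n * (mu2 + mu)) * (n * mu / m0) * c ^ 4)"
proof -
  define \<nu> where "\<nu> = 1 - lc\<^sup>2"
  have n0: "n \<ge> 0" using n by simp
  note lb = lam_bounds[OF n0, of c, folded lc_def]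
  have lc2: "lc\<^sup>2 = 1 - \<nu>" by (simp add: \<nu>_def)
  have lle: "lc\<^sup>2 \<le> 1" using lb by (simp add: power_le_one)
  have \<nu>0: "\<nu> \<ge> 0" using lle by (simp add: \<nu>_def)
  have \<nu>le: "\<nu> \<le> n * c\<^sup>2 * mu / m0" using lb(4) by (simp add: \<nu>_def)
  have \<nu>h: "(p + 1) * \<nu> \<le> 1/2" by (rule order_trans[OF mult_left_mono[OF \<nu>le] nu]) simp
  have \<nu>m: "\<nu> * m0 = n * c\<^sup>2 * mu - \<nu> * (n * c\<^sup>2 * mu)"
    using lb(3) unfolding lc2 by (simp add: algebra_simps)
  have pw: "(lc\<^sup>2) powr (p + 1) \<ge> 1 - (p + 1) * \<nu>"
  proof -
    have "0 < lc\<^sup>2" using lb(1) by simp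
    from powr_bernoulli[OF this lle, of "p + 1"] have "1 + (p + 1) * (lc\<^sup>2 - 1) \<le> (lc\<^sup>2) powr (p + 1)" using p_pos by simp
    then show ?thesis unfolding \<nu>_def by (simp add: algebra_simps)
  qed
  have k3: "0 \<le> k3" unfolding k3_def using n sig3_pos p_pos by simp
  define d where "d = n * c\<^sup>2"
  have d: "d \<ge> 0" using n by (simp add: d_def)
  define w where "w = 1 - (p + 1) * \<nu>"
  have w: "w \<ge> 1/2" using \<nu>h by (simp add: w_def)
  have P0n: "P0 \<ge> 0" unfolding P0_def by (auto simp: S_bounds less_imp_le intro!: integral_nonneg_AE AE_hl_I)
  have kc: "0 \<le> k3 * c ^ 3" using k3 c by simp
  have Pc': "P0 + d * (mu2 + mu) + k3 * c ^ 3 \<le> Pc"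
    using Pc unfolding identities(2) d_def by (simp add: mult_ac)
  have "0 \<le> d * (mu2 + mu)" using d mu_nonneg by simp
  then have Pn: "0 \<le> P0 + d * (mu2 + mu) + k3 * c ^ 3" using P0n kc by simp
  have "w * (P0 + d * (mu2 + mu) + k3 * c ^ 3) \<le> (lc\<^sup>2) powr (p + 1) * Pc"
    using pw w Pn Pc' by (intro mult_mono) (auto simp: w_def)
  moreover have "w * (P0 + d * (mu2 + mu) + k3 * c ^ 3) = P0 - \<nu> * ((p + 1) * P0) + d * (mu2 + mu) - (p + 1) * \<nu> * (d * (mu2 + mu)) + w * (k3 * c ^ 3)"
    by (simp add: w_def algebra_simps)
  moreover have "w * (k3 * c ^ 3) \<ge> 1/2 * (k3 * c ^ 3)" using w kc by (intro mult_right_mono)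
  moreover have "\<nu> * (mu + m0) = \<nu> * ((p + 1) * P0)" unfolding identities ..
  moreover have "(p + 1) * \<nu> * (d * (mu2 + mu)) \<le> (p + 1) * (d * mu / m0) * (d * (mu2 + mu))"
    using \<nu>le p_pos d mu_nonneg by (intro mult_right_mono mult_left_mono) (auto simp: d_def)
  moreover have "(p + 1) * (d * mu / m0) * (d * (mu2 + mu)) = (p + 1) * (n * (mu2 + mu)) * (n * mu / m0) * c ^ 4"
    by (simp add: d_def power2_eq_square power4_eq_xxxx)
  moreover have "0 \<le> \<nu> * (d * mu2)" using \<nu>0 d mu_nonneg by simp
  moreover have "0 \<le> \<nu> * (d * mu)" using \<nu>0 d mu_nonneg by simp
  moreover have "lc\<^sup>2 * (mu + n * c\<^sup>2 * mu2) = mu + d * mu2 - \<nu> * mu - \<nu> * (d * mu2)"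
    unfolding lc2 d_def by (simp add: algebra_simps)
  moreover have "\<nu> * m0 = d * mu - \<nu> * (d * mu)" using \<nu>m by (simp add: d_def)
  moreover have "\<nu> * (mu + m0) = \<nu> * mu + \<nu> * m0" "d * (mu2 + mu) = d * mu2 + d * mu" by (simp_all add: distrib_left)
  moreover have "k3 / 2 * c ^ 3 = 1/2 * (k3 * c ^ 3)" by simp
  ultimately show ?thesis unfolding E0_eq by linarith
qed

end

lemma H1_of_real:
  assumes u: "H1r u u'"
  shows "H1_hl (\<lambda>x. complex_of_real (u x))" "AE x in hl. hl_deriv (\<lambda>x. complex_of_real (u x)) x = complex_of_real (u' x)"
    "(cn (\<lambda>x. complex_of_real (u x)))\<^sup>2 = (\<integral>x. (u x)\<^sup>2 \<partial>hl)"
    "(cn (hl_deriv (\<lambda>x. complex_of_real (u x))))\<^sup>2 = (\<integral>x. (u' x)\<^sup>2 \<partial>hl)"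
proof -
  have 0: "H1r (\<lambda>x. 0) (\<lambda>x. 0)" using H1r_cmult[OF u, of 0] by simp
  show H: "H1_hl (\<lambda>x. complex_of_real (u x))" by (rule H1r_H1_hl(1)[of _ "\<lambda>x. complex_of_real (u' x)"]) (use u 0 in simp_all)
  show d: "AE x in hl. hl_deriv (\<lambda>x. complex_of_real (u x)) x = complex_of_real (u' x)"
    by (rule H1r_H1_hl(2)) (use u 0 in simp_all)
  show "(cn (\<lambda>x. complex_of_real (u x)))\<^sup>2 = (\<integral>x. (u x)\<^sup>2 \<partial>hl)" by (simp add: cn_sq)
  have m: "u' \<in> borel_measurable hl" using u by (simp add: H1r_def L2r_def)
  have "(\<integral>x. (cmod (hl_deriv (\<lambda>x. complex_of_real (u x)) x))\<^sup>2 \<partial>hl) = (\<integral>x. (u' x)\<^sup>2 \<partial>hl)"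
  proof (rule integral_cong_AE)
    show "(\<lambda>x. (cmod (hl_deriv (\<lambda>x. complex_of_real (u x)) x))\<^sup>2) \<in> borel_measurable hl"
      using H1_hl_H1r(4)[OF H] by (auto simp: L2_hl_iff)
    show "AE x in hl. (cmod (hl_deriv (\<lambda>x. complex_of_real (u x)) x))\<^sup>2 = (u' x)\<^sup>2" using d by eventually_elim simp
  qed (use m in simp)
  then show "(cn (hl_deriv (\<lambda>x. complex_of_real (u x))))\<^sup>2 = (\<integral>x. (u' x)\<^sup>2 \<partial>hl)" by (simp add: cn_sq)
qed

context half_soliton begin

definition wdat :: "real \<Rightarrow> nat \<Rightarrow> real \<Rightarrow> nat \<Rightarrow> real \<Rightarrow> real" where
  "wdat l N c j x = l * (phi p x + c * cc N j * ph1 x)"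
definition wdat' :: "real \<Rightarrow> nat \<Rightarrow> real \<Rightarrow> nat \<Rightarrow> real \<Rightarrow> real" where
  "wdat' l N c j x = l * (ph1 x + c * cc N j * ph2 x)"

lemma ph1_0: "ph1 0 = 0" by (simp add: ph1_def T_def)

lemma wdat_H1r: "H1r (wdat l N c j) (wdat' l N c j)"
  unfolding wdat_def wdat'_def by (intro H1r_cmult H1r_add H1r_phis)

lemma wdat_H1G: "N \<ge> 1 \<Longrightarrow> H1G N (\<lambda>j x. complex_of_real (wdat l N c j x))"
  unfolding H1G_def using H1_of_real(1)[OF wdat_H1r] by (simp add: wdat_def ph1_0)

lemma square_expand:
  assumes "L2r f" "L2r g"
  shows "(\<integral>x. (f x + a * g x)\<^sup>2 \<partial>hl) = (\<integral>x. (f x)\<^sup>2 \<partial>hl) + 2 * a * (\<integral>x. f x * g x \<partial>hl) + a\<^sup>2 * (\<integral>x. (g x)\<^sup>2 \<partial>hl)"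
proof -
  have i: "integrable hl (\<lambda>x. f x * g x)" "integrable hl (\<lambda>x. (f x)\<^sup>2)" "integrable hl (\<lambda>x. (g x)\<^sup>2)"
    using assms L2r_mult_integrable by (auto simp: L2r_def)
  have "(\<integral>x. (f x + a * g x)\<^sup>2 \<partial>hl) = (\<integral>x. (f x)\<^sup>2 + 2 * a * (f x * g x) + a\<^sup>2 * (g x)\<^sup>2 \<partial>hl)"
    by (rule Bochner_Integration.integral_cong) (auto simp: power2_eq_square algebra_simps)
  then show ?thesis using i by simp
qed

lemma wdat_norms:
  assumes N: "N \<ge> 2"
  shows "(L2norm N (\<lambda>j x. complex_of_real (wdat l N c j x)))\<^sup>2 = real N * (l\<^sup>2 * (m0 + (real N - 1) * c\<^sup>2 * mu))"
    "(L2norm N (\<lambda>j. hl_deriv (\<lambda>x. complex_of_real (wdat l N c j x))))\<^sup>2 = real N * (l\<^sup>2 * (mu + (real N - 1) * c\<^sup>2 * mu2))"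
proof -
  have s: "(\<Sum>j<N. l\<^sup>2 * (A + 2 * (c * cc N j) * B + (c * cc N j)\<^sup>2 * D)) = real N * (l\<^sup>2 * (A + (real N - 1) * c\<^sup>2 * D))" for A B D :: real
    by (subst sum_edges[OF N]) (simp_all add: cc_def power2_eq_square algebra_simps)
  have 1: "(\<integral>x. (wdat l N c j x)\<^sup>2 \<partial>hl) = l\<^sup>2 * (m0 + 2 * (c * cc N j) * (\<integral>x. phi p x * ph1 x \<partial>hl) + (c * cc N j)\<^sup>2 * mu)" for j
    unfolding wdat_def power_mult_distrib[of l] integral_mult_right_zero square_expand[OF L2r_phis(1,2)] m0_def mu_def ..
  have 2: "(\<integral>x. (wdat' l N c j x)\<^sup>2 \<partial>hl) = l\<^sup>2 * (mu + 2 * (c * cc N j) * (\<integral>x. ph1 x * ph2 x \<partial>hl) + (c * cc N j)\<^sup>2 * mu2)" for j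
    unfolding wdat'_def power_mult_distrib[of l] integral_mult_right_zero square_expand[OF L2r_phis(2,3)] mu_def mu2_def ..
  show "(L2norm N (\<lambda>j x. complex_of_real (wdat l N c j x)))\<^sup>2 = real N * (l\<^sup>2 * (m0 + (real N - 1) * c\<^sup>2 * mu))"
    unfolding L2norm_sq H1_of_real(3)[OF wdat_H1r] 1 by (rule s)
  show "(L2norm N (\<lambda>j. hl_deriv (\<lambda>x. complex_of_real (wdat l N c j x))))\<^sup>2 = real N * (l\<^sup>2 * (mu + (real N - 1) * c\<^sup>2 * mu2))"
    unfolding L2norm_sq H1_of_real(4)[OF wdat_H1r] 2 by (rule s)
qed

text \<open>Since \<phi>' = - \<phi> T, the datum on an edge is \<phi> (1 - a T) up to scaling, and
  the power factorises into \<phi>^2 S and a power of 1 - a T that stays positive for |a| <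
  1.\<close>

lemma power_integral_lower:
  assumes a: "\<bar>a\<bar> < 1"
  shows "(\<integral>x. (phi p x)\<^sup>2 * S x * (1 - a * T x) powr (2 * p + 2) \<partial>hl) \<ge>
    P0 - (2 * p + 2) * a * (\<integral>x. (phi p x)\<^sup>2 * S x * T x \<partial>hl) + (2 * p + 2) * (2 * p + 1) / 2 * a\<^sup>2 * s2
      - (2 * p + 2) * (2 * p + 1) * (2 * p) / 6 * a ^ 3 * sig3"
proof -
  let ?q = "2 * p + 2"
  let ?w = "\<lambda>x. (phi p x)\<^sup>2 * S x"
  have aT: "\<bar>a * T x\<bar> < 1" for x
  proof -
    have "\<bar>a\<bar> * \<bar>T x\<bar> \<le> \<bar>a\<bar> * 1" using T_bounds[of x] by (intro mult_left_mono) auto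
    then show ?thesis using a by (simp add: abs_mult)
  qed
  have i: "integrable hl ?w" "integrable hl (\<lambda>x. ?w x * T x)" "integrable hl (\<lambda>x. ?w x * (T x)\<^sup>2)" "integrable hl (\<lambda>x. ?w x * T x ^ 3)"
    using S_phi_int[of 0] S_phi_int[of 1] S_phi_int[of 2] S_phi_int[of 3] by simp_all
  have pos: "1 - a * T x > 0" for x using aT[of x] by (simp add: abs_less_iff)
  have ip: "integrable hl (\<lambda>x. ?w x * (1 - a * T x) powr ?q)"
  proof (rule Bochner_Integration.integrable_bound[of hl "\<lambda>x. 2 powr ?q * ?w x"])
    show "(\<lambda>x. ?w x * (1 - a * T x) powr ?q) \<in> borel_measurable hl"
      by (intro hl_continuous_measurable continuous_on_mult continuous_on_power continuous_on_powr' continuous_on_diff continuous_on_const cont)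
         (use pos p_pos in \<open>auto intro: less_imp_le add_pos_pos simp del: p_pos\<close>)
    show "AE x in hl. norm (?w x * (1 - a * T x) powr ?q) \<le> norm (2 powr ?q * ?w x)"
    proof (rule AE_hl_I)
      fix x :: real
      have "(1 - a * T x) powr ?q \<le> 2 powr ?q" using pos[of x] aT[of x] p_pos by (intro powr_mono2) (auto simp: abs_less_iff)
      then have "?w x * (1 - a * T x) powr ?q \<le> ?w x * 2 powr ?q" using S_bounds[of x] by (intro mult_left_mono) (auto intro: less_imp_le)
      then show "norm (?w x * (1 - a * T x) powr ?q) \<le> norm (2 powr ?q * ?w x)"
        using S_bounds[of x] by (simp add: abs_mult mult_ac less_imp_le abs_of_pos)
    qed
  qed (use i in simp)
  let ?r = "\<lambda>x. ?w x - ?q * a * (?w x * T x) + ?q * (2 * p + 1) / 2 * a\<^sup>2 * (?w x * (T x)\<^sup>2) - ?q * (2 * p + 1) * (2 * p) / 6 * a ^ 3 * (?w x * T x ^ 3)"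
  have "(\<integral>x. ?r x \<partial>hl) \<le> (\<integral>x. ?w x * (1 - a * T x) powr ?q \<partial>hl)"
  proof (rule hl_integral_mono[OF _ ip])
    show "integrable hl ?r" using i by simp
    fix x :: real
    have "1 - ?q * (a * T x) + ?q * (?q - 1) / 2 * (a * T x)\<^sup>2 - ?q * (?q - 1) * (?q - 2) / 6 * (a * T x) ^ 3 \<le> (1 - a * T x) powr ?q"
      using p_ge pos[of x] by (intro one_minus_powr_ge) auto
    then have "?w x * (1 - ?q * (a * T x) + ?q * (?q - 1) / 2 * (a * T x)\<^sup>2 - ?q * (?q - 1) * (?q - 2) / 6 * (a * T x) ^ 3) \<le> ?w x * (1 - a * T x) powr ?q"
      using S_bounds[of x] by (intro mult_left_mono) (auto intro: less_imp_le)
    then show "?r x \<le> ?w x * (1 - a * T x) powr ?q"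
      by (simp add: power_mult_distrib algebra_simps add_divide_distrib diff_divide_distrib)
  qed
  moreover have "(\<integral>x. ?r x \<partial>hl) = P0 - ?q * a * (\<integral>x. ?w x * T x \<partial>hl) + ?q * (2 * p + 1) / 2 * a\<^sup>2 * s2 - ?q * (2 * p + 1) * (2 * p) / 6 * a ^ 3 * sig3"
    using i unfolding P0_def s2_def sig3_def by simp
  ultimately show ?thesis by linarith
qed

text \<open>\<open>Pc\<close> is the mean over the edges. The weights - n, once, and 1, n times,
  have moments 0, n (n + 1) and - n (n^2 - 1); after division by N = n + 1 the cubic term carries n
  (n - 1), which does not vanish for N \<ge> 3.\<close>

lemma wdat_Pot:
  assumes N: "N \<ge> 2" and l: "l > 0" and c: "0 \<le> c" "c * (real N - 1) < 1"
  obtains Pc where "Pot N p (\<lambda>j x. complex_of_real (wdat l N c j x)) = real N * ((l\<^sup>2) powr (p + 1) * Pc)"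
    "Pc \<ge> P0 + (p + 1) * (2 * p + 1) * (real N - 1) * c\<^sup>2 * s2
      + (2 * p + 2) * (2 * p + 1) * (2 * p) / 6 * ((real N - 1) * (real N - 1 - 1)) * sig3 * c ^ 3"
proof
  define n where "n = real N - 1"
  have n: "n \<ge> 1" using N by (simp add: n_def)
  define Q where "Q a = (\<integral>x. (phi p x)\<^sup>2 * S x * (1 - a * T x) powr (2 * p + 2) \<partial>hl)" for a
  define R where "R a = P0 - (2 * p + 2) * a * (\<integral>x. (phi p x)\<^sup>2 * S x * T x \<partial>hl) + (2 * p + 2) * (2 * p + 1) / 2 * a\<^sup>2 * s2
      - (2 * p + 2) * (2 * p + 1) * (2 * p) / 6 * a ^ 3 * sig3" for a
  define a where "a j = c * cc N j" for j
  have "c * 1 \<le> c * n" using c n by (intro mult_left_mono) auto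
  then have ab: "\<bar>a j\<bar> < 1" for j using c n by (auto simp: a_def cc_def n_def abs_mult)
  have QR: "Q (a j) \<ge> R (a j)" for j unfolding Q_def R_def by (rule power_integral_lower[OF ab])
  have pt: "cmod (complex_of_real (wdat l N c j x)) powr (2 * p + 2) = (l\<^sup>2) powr (p + 1) * ((phi p x)\<^sup>2 * S x * (1 - a j * T x) powr (2 * p + 2))" for j x
  proof -
    have "\<bar>a j\<bar> * \<bar>T x\<bar> \<le> \<bar>a j\<bar> * 1" using T_bounds[of x] by (intro mult_left_mono) auto
    then have "\<bar>a j * T x\<bar> < 1" using ab[of j] by (simp add: abs_mult)
    then have pos: "1 - a j * T x > 0" by (simp add: abs_less_iff)
    have w: "wdat l N c j x = l * (phi p x * (1 - a j * T x))" by (simp add: wdat_def ph1_def a_def algebra_simps)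
    have "cmod (complex_of_real (wdat l N c j x)) = l * (phi p x * (1 - a j * T x))"
      unfolding w norm_of_real using l phi_pos[of x] pos by (simp only: abs_mult abs_of_pos)
    then have "cmod (complex_of_real (wdat l N c j x)) powr (2 * p + 2) = l powr (2 * p + 2) * (phi p x powr (2 * p + 2) * (1 - a j * T x) powr (2 * p + 2))"
      using l phi_pos[of x] pos by (simp add: powr_mult)
    also have "l powr (2 * p + 2) = (l\<^sup>2) powr (p + 1)" using l by (simp add: powr_powr powr_numeral[symmetric] algebra_simps del: powr_numeral)
    also have "phi p x powr (2 * p + 2) = (phi p x)\<^sup>2 * S x" using phi_pos[of x] by (simp add: powr_add phi_powr)
    finally show ?thesis by simp
  qed
  have "Pot N p (\<lambda>j x. complex_of_real (wdat l N c j x)) = (\<Sum>j<N. (l\<^sup>2) powr (p + 1) * Q (a j))"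
    unfolding Pot_def pt Q_def by simp
  also have "\<dots> = (l\<^sup>2) powr (p + 1) * (\<Sum>j<N. Q (a j))" by (simp add: sum_distrib_left)
  finally show "Pot N p (\<lambda>j x. complex_of_real (wdat l N c j x)) = real N * ((l\<^sup>2) powr (p + 1) * ((\<Sum>j<N. Q (a j)) / real N))"
    using N by simp
  have "(\<Sum>j<N. R (a j)) \<le> (\<Sum>j<N. Q (a j))" by (intro sum_mono QR)
  moreover have "(\<Sum>j<N. R (a j)) = R (a 0) + n *\<^sub>R R (a 1)"
    unfolding n_def by (rule sum_edges[OF N]) (simp add: a_def cc_def)
  moreover have "R (a 0) + n *\<^sub>R R (a 1) = (n + 1) * (P0 + (p + 1) * (2 * p + 1) * n * c\<^sup>2 * s2
      + (2 * p + 2) * (2 * p + 1) * (2 * p) / 6 * (n * (n - 1)) * sig3 * c ^ 3)"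
  proof -
    have a: "a 0 = - (n * c)" "a 1 = c" by (simp_all add: a_def cc_def n_def algebra_simps)
    define K1 K2 K3 where "K1 = (2 * p + 2) * (\<integral>x. (phi p x)\<^sup>2 * S x * T x \<partial>hl)" and "K2 = (p + 1) * (2 * p + 1) * s2" and "K3 = (2 * p + 2) * (2 * p + 1) * (2 * p) / 6 * sig3"
    have r: "R a = P0 - K1 * a + K2 * a\<^sup>2 - K3 * a ^ 3" for a by (simp add: R_def K1_def K2_def K3_def field_simps)
    have "R (a 0) + n *\<^sub>R R (a 1) = (n + 1) * (P0 + K2 * (n * c\<^sup>2) + K3 * (n * (n - 1) * c ^ 3))"
      unfolding r a by (simp add: power2_eq_square power3_eq_cube algebra_simps)
    then show ?thesis by (simp add: K2_def K3_def mult_ac)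
  qed
  ultimately have "(n + 1) * (P0 + (p + 1) * (2 * p + 1) * n * c\<^sup>2 * s2
      + (2 * p + 2) * (2 * p + 1) * (2 * p) / 6 * (n * (n - 1)) * sig3 * c ^ 3) \<le> (\<Sum>j<N. Q (a j))" by linarith
  then show "P0 + (p + 1) * (2 * p + 1) * (real N - 1) * c\<^sup>2 * s2
      + (2 * p + 2) * (2 * p + 1) * (2 * p) / 6 * ((real N - 1) * (real N - 1 - 1)) * sig3 * c ^ 3 \<le> (\<Sum>j<N. Q (a j)) / real N"
    unfolding n_def[symmetric] using n by (subst pos_le_divide_eq) (auto simp: n_def mult.commute)
qed

lemma wdat_close:
  assumes N: "N \<ge> 2" and c: "0 \<le> c" "c \<le> 1"
  defines "n \<equiv> real N - 1"
  shows "(H1norm N (\<lambda>j x. complex_of_real (wdat (lam n c) N c j x) - halfsol p j x))\<^sup>2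
    \<le> c\<^sup>2 * (real N * (2 * (n * mu / m0)\<^sup>2 * h2 (phi p) ph1 + 2 * n\<^sup>2 * h2 ph1 ph2))"
proof -
  define l where "l = lam n c"
  have n: "n \<ge> 1" using N by (simp add: n_def)
  have lb: "0 < l" "l \<le> 1" "\<bar>l - 1\<bar> \<le> n * c\<^sup>2 * mu / m0" unfolding l_def using lam_bounds[of n c] n by auto
  have cc: "c * c \<le> c" using c by (simp add: mult_left_le)
  have "n * c\<^sup>2 * mu / m0 \<le> n * c * mu / m0" using cc n mu_nonneg m0_pos by (intro divide_right_mono mult_right_mono mult_left_mono) (auto simp: power2_eq_square)
  then have "\<bar>l - 1\<bar> \<le> c * (n * mu / m0)" using lb(3) by (simp add: mult_ac)
  then have l2: "(l - 1)\<^sup>2 \<le> (c * (n * mu / m0))\<^sup>2" using power_mono[of "\<bar>l - 1\<bar>" _ 2] by fastforce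
  have l3: "l\<^sup>2 \<le> 1" using lb by (simp add: power_le_one)
  let ?u = "\<lambda>j x. (l - 1) * phi p x + (l * c * cc N j) * ph1 x"
  let ?u' = "\<lambda>j x. (l - 1) * ph1 x + (l * c * cc N j) * ph2 x"
  have H: "H1r (?u j) (?u' j)" for j by (intro H1r_add H1r_cmult H1r_phis)
  have e: "(\<lambda>j x. complex_of_real (wdat (lam n c) N c j x) - halfsol p j x) = (\<lambda>j x. complex_of_real (?u j x))"
    by (auto simp: wdat_def halfsol_def l_def algebra_simps)
  have "(H1norm N (\<lambda>j x. complex_of_real (?u j x)))\<^sup>2 = (\<Sum>j<N. h2 (?u j) (?u' j))"
    unfolding H1norm_cn H1_of_real(3,4)[OF H] h2_def ..
  also have "\<dots> \<le> (\<Sum>j<N. c\<^sup>2 * (2 * (n * mu / m0)\<^sup>2 * h2 (phi p) ph1 + 2 * n\<^sup>2 * h2 ph1 ph2))"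
  proof (rule sum_mono)
    fix j
    have "h2 (?u j) (?u' j) \<le> 2 * h2 (\<lambda>x. (l - 1) * phi p x) (\<lambda>x. (l - 1) * ph1 x) + 2 * h2 (\<lambda>x. (l * c * cc N j) * ph1 x) (\<lambda>x. (l * c * cc N j) * ph2 x)"
      by (intro h2_add_le H1r_cmult H1r_phis)
    also have "\<dots> = 2 * ((l - 1)\<^sup>2 * h2 (phi p) ph1) + 2 * ((l * c * cc N j)\<^sup>2 * h2 ph1 ph2)" unfolding h2_cmult ..
    also have "\<dots> \<le> 2 * ((c * (n * mu / m0))\<^sup>2 * h2 (phi p) ph1) + 2 * ((c * n)\<^sup>2 * h2 ph1 ph2)"
    proof -
      have "(cc N j)\<^sup>2 \<le> n\<^sup>2" proof -
        have "\<bar>cc N j\<bar> \<le> \<bar>n\<bar>" using n by (auto simp: cc_def n_def)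
        then show ?thesis by (simp add: abs_le_square_iff)
      qed
      then have "l\<^sup>2 * (c\<^sup>2 * (cc N j)\<^sup>2) \<le> 1 * (c\<^sup>2 * n\<^sup>2)" using l3 by (intro mult_mono) auto
      then have "(l * c * cc N j)\<^sup>2 \<le> (c * n)\<^sup>2" by (simp add: power_mult_distrib mult_ac)
      then show ?thesis using l2 by (intro add_mono mult_left_mono mult_right_mono h2_nonneg) auto
    qed
    also have "\<dots> = c\<^sup>2 * (2 * (n * mu / m0)\<^sup>2 * h2 (phi p) ph1 + 2 * n\<^sup>2 * h2 ph1 ph2)"
      unfolding power_mult_distrib[of c] by (simp add: algebra_simps)
    finally show "h2 (?u j) (?u' j) \<le> c\<^sup>2 * (2 * (n * mu / m0)\<^sup>2 * h2 (phi p) ph1 + 2 * n\<^sup>2 * h2 ph1 ph2)" .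
  qed
  also have "\<dots> = c\<^sup>2 * (real N * (2 * (n * mu / m0)\<^sup>2 * h2 (phi p) ph1 + 2 * n\<^sup>2 * h2 ph1 ph2))" by simp
  finally show ?thesis unfolding e .
qed

lemma halfsol_H1G: "N \<ge> 1 \<Longrightarrow> H1G N (halfsol p)"
  using wdat_H1G[of N 1 0] by (simp add: wdat_def halfsol_def)

text \<open>The sign of c matters: for c > 0 the cubic term lowers the energy. The distance to
  \<Phi> is of order c, and for small c the gain k3/2 * c^3 exceeds the loss B c^4.\<close>

lemma initial_data:
  assumes N: "N \<ge> 3" and \<delta>: "\<delta> > 0"
  obtains V where "H1G N V" "H1norm N V \<le> \<delta>" "\<And>j. 1 \<le> j \<Longrightarrow> V j = V 1"
    "(L2norm N (\<lambda>j x. halfsol p j x + V j x))\<^sup>2 = real N * m0"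
    "(L2norm N (\<lambda>j. hl_deriv (\<lambda>x. halfsol p j x + V j x)))\<^sup>2 - Pot N p (\<lambda>j x. halfsol p j x + V j x) < real N * E0"
proof -
  define n where "n = real N - 1"
  have n: "n \<ge> 2" using N by (simp add: n_def)
  have N2: "N \<ge> 2" using N by simp
  define K where "K = real N * (2 * (n * mu / m0)\<^sup>2 * h2 (phi p) ph1 + 2 * n\<^sup>2 * h2 ph1 ph2)"
  define k3 where "k3 = (2 * p + 2) * (2 * p + 1) * (2 * p) / 6 * (n * (n - 1)) * sig3"
  define B where "B = (p + 1) * (n * (mu2 + mu)) * (n * mu / m0)"
  have k3: "k3 > 0" unfolding k3_def using n sig3_pos p_pos by (intro mult_pos_pos divide_pos_pos add_pos_pos) auto
  have L: "((\<lambda>c. c * n) \<longlongrightarrow> 0 * n) (at_right 0)" "((\<lambda>c. (p + 1) * (n * c\<^sup>2 * mu / m0)) \<longlongrightarrow> (p + 1) * (n * 0\<^sup>2 * mu / m0)) (at_right 0)"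
    "((\<lambda>c. c\<^sup>2 * K) \<longlongrightarrow> 0\<^sup>2 * K) (at_right 0)" "((\<lambda>c. B * c) \<longlongrightarrow> B * 0) (at_right 0)"
    by (intro tendsto_intros; use m0_pos in simp)+
  have "\<forall>\<^sub>F c in at_right 0. c * n < 1" "\<forall>\<^sub>F c in at_right 0. (p + 1) * (n * c\<^sup>2 * mu / m0) < 1/2"
    "\<forall>\<^sub>F c in at_right 0. c\<^sup>2 * K < \<delta>\<^sup>2" "\<forall>\<^sub>F c in at_right 0. B * c < k3 / 2"
    by (rule order_tendstoD(2)[OF L(1)] order_tendstoD(2)[OF L(2)] order_tendstoD(2)[OF L(3)] order_tendstoD(2)[OF L(4)]; use \<delta> k3 in simp)+
  moreover have "\<forall>\<^sub>F c in at_right 0. c > (0::real)" by (rule eventually_at_right_less)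
  moreover have "\<forall>\<^sub>F c in at_right 0. c < (1::real)" using eventually_at_right_real[of 0 1] by (auto elim: eventually_mono)
  ultimately have "\<forall>\<^sub>F c in at_right (0::real). c * n < 1 \<and> (p + 1) * (n * c\<^sup>2 * mu / m0) < 1/2 \<and> c\<^sup>2 * K < \<delta>\<^sup>2 \<and> B * c < k3 / 2 \<and> c > 0 \<and> c < 1"
    by eventually_elim blast
  then obtain c where c: "c * n < 1" "(p + 1) * (n * c\<^sup>2 * mu / m0) < 1/2" "c\<^sup>2 * K < \<delta>\<^sup>2" "B * c < k3 / 2" "c > 0" "c < 1"
    using eventually_happens'[OF trivial_limit_at_right_real[of 0]] by blast
  define l where "l = lam n c"
  have lb: "l > 0" "l\<^sup>2 * (m0 + n * c\<^sup>2 * mu) = m0" unfolding l_def using lam_bounds[of n c] n by auto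
  define G where "G = (\<lambda>j x. complex_of_real (wdat l N c j x))"
  define V where "V = (\<lambda>j x. G j x - halfsol p j x)"
  have GV: "(\<lambda>j x. halfsol p j x + V j x) = G" "\<And>j. (\<lambda>x. halfsol p j x + V j x) = G j" by (auto simp: V_def)
  show thesis
  proof (rule that[of V])
    have G: "H1G N G" unfolding G_def using N by (intro wdat_H1G) simp
    show "H1G N V" unfolding V_def using G halfsol_H1G N by (intro H1G_diff) auto
    have "(H1norm N V)\<^sup>2 \<le> c\<^sup>2 * K"
      unfolding V_def G_def K_def l_def n_def using c N2 by (intro wdat_close) auto
    then have "(H1norm N V)\<^sup>2 \<le> \<delta>\<^sup>2" using c(3) by linarith
    then show "H1norm N V \<le> \<delta>" by (rule power2_le_imp_le) (use \<delta> in linarith)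
    show "V j = V 1" if "1 \<le> j" for j using that by (simp add: V_def G_def wdat_def cc_def halfsol_def)
    show "(L2norm N (\<lambda>j x. halfsol p j x + V j x))\<^sup>2 = real N * m0"
      unfolding GV unfolding G_def wdat_norms(1)[OF N2] n_def[symmetric] lb(2) ..
    obtain Pc where P: "Pot N p G = real N * ((l\<^sup>2) powr (p + 1) * Pc)"
      and Pc: "Pc \<ge> P0 + (p + 1) * (2 * p + 1) * n * c\<^sup>2 * s2 + k3 * c ^ 3"
      unfolding G_def n_def k3_def by (rule wdat_Pot[OF N2 lb(1), of c]) (use c in \<open>auto simp: n_def\<close>)
    have "l\<^sup>2 * (mu + n * c\<^sup>2 * mu2) - (l\<^sup>2) powr (p + 1) * Pc \<le> E0 - (k3 / 2 * c ^ 3 - B * c ^ 4)"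
      unfolding l_def B_def k3_def by (rule initial_energy_real) (use n c Pc[unfolded k3_def] in linarith)+
    also have "\<dots> < E0"
    proof -
      have "c ^ 3 * (B * c) < c ^ 3 * (k3 / 2)" using c by (intro mult_strict_left_mono) auto
      then show ?thesis by (simp add: algebra_simps power3_eq_cube power4_eq_xxxx)
    qed
    finally have "real N * (l\<^sup>2 * (mu + n * c\<^sup>2 * mu2) - (l\<^sup>2) powr (p + 1) * Pc) < real N * E0" using N by simp
    moreover have "(L2norm N (\<lambda>j. hl_deriv (G j)))\<^sup>2 = real N * (l\<^sup>2 * (mu + n * c\<^sup>2 * mu2))"
      unfolding G_def wdat_norms(2)[OF N2] n_def ..
    ultimately show "(L2norm N (\<lambda>j. hl_deriv (\<lambda>x. halfsol p j x + V j x)))\<^sup>2 - Pot N p (\<lambda>j x. halfsol p j x + V j x) < real N * E0"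
      unfolding GV P by (simp add: algebra_simps)
  qed
qed

end

section \<open>Instability\<close>

lemma cmod_powr_double: "cmod z powr (2 * q) = ((Re z)\<^sup>2 + (Im z)\<^sup>2) powr q"
proof (cases "z = 0")
  case False
  then have "cmod z > 0" by simp
  then have "cmod z powr (2 * q) = (cmod z powr 2) powr q" by (simp only: powr_powr)
  also have "cmod z powr 2 = (cmod z)\<^sup>2" using powr_numeral[of "cmod z"] by simp
  finally show ?thesis by (simp only: cmod_power2)
qed simp

lemma L2_hl_of_real: "L2r w \<Longrightarrow> L2_hl (\<lambda>x. complex_of_real (w x))"
  unfolding L2_hl_parts by (simp add: L2r_def)

lemma complex_real_pairing:
  assumes f: "L2_hl f" and w: "L2r w"
  shows "Re (\<integral>x. f x * complex_of_real (w x) \<partial>hl) = (\<integral>x. Re (f x) * w x \<partial>hl)"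
    "Im (\<integral>x. f x * complex_of_real (w x) \<partial>hl) = (\<integral>x. Im (f x) * w x \<partial>hl)"
proof -
  have "integrable hl (\<lambda>x. f x * cnj (complex_of_real (w x)))" by (rule L2_hl_prod(1)[OF f L2_hl_of_real[OF w]])
  then have i: "integrable hl (\<lambda>x. f x * complex_of_real (w x))" by simp
  show "Re (\<integral>x. f x * complex_of_real (w x) \<partial>hl) = (\<integral>x. Re (f x) * w x \<partial>hl)"
    using integral_Re[OF i] by simp
  show "Im (\<integral>x. f x * complex_of_real (w x) \<partial>hl) = (\<integral>x. Im (f x) * w x \<partial>hl)"
    using integral_Im[OF i] by simp
qed

lemma H1_hl_by_parts:
  assumes f: "H1_hl f" and w: "H1r w w'"
  shows "(\<integral>x. hl_deriv f x * complex_of_real (w x) \<partial>hl) = - (\<integral>x. f x * complex_of_real (w' x) \<partial>hl) - f 0 * complex_of_real (w 0)"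
proof -
  note h = H1_hl_H1r[OF f]
  have L: "L2r w" "L2r w'" using w by (auto simp: H1r_def)
  show ?thesis
    using H1r_by_parts[OF h(1) w] H1r_by_parts[OF h(2) w]
    by (intro complex_eqI) (simp_all add: complex_real_pairing[OF h(4) L(1)] complex_real_pairing[OF h(3) L(2)])
qed

text \<open>\<open>hl_deriv\<close> is a choice, but the predicate chosen from sees only x \<ge> 0,
  so the very same function is selected. This matters because initial values are prescribed only
  there.\<close>

lemma hl_deriv_cong:
  assumes "\<And>x. x \<ge> 0 \<Longrightarrow> f x = g x" shows "hl_deriv f = hl_deriv g"
proof -
  have "is_hl_deriv f h \<longleftrightarrow> is_hl_deriv g h" for h
    unfolding is_hl_deriv_def using assms by (intro conj_cong refl all_cong) (metis order_refl)
  then show ?thesis by (simp add: hl_deriv_def)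
qed

lemma L2norm_cong:
  assumes "\<And>j x. j < N \<Longrightarrow> x \<ge> 0 \<Longrightarrow> U j x = V j x" shows "L2norm N U = L2norm N V"
proof -
  have "(cn (U j))\<^sup>2 = (cn (V j))\<^sup>2" if "j < N" for j
    unfolding cn_sq by (rule Bochner_Integration.integral_cong) (use assms that in auto)
  then show ?thesis by (simp add: L2norm_def)
qed

lemma Pot_cong:
  assumes "\<And>j x. j < N \<Longrightarrow> x \<ge> 0 \<Longrightarrow> U j x = V j x" shows "Pot N p U = Pot N p V"
  unfolding Pot_def by (intro sum.cong refl Bochner_Integration.integral_cong) (use assms in auto)

lemma integrable_cmod_powr:
  assumes U: "H1G N U" and p: "p > 0" and j: "j < N"
  shows "integrable hl (\<lambda>x. cmod (U j x) powr (2 * p + 2))"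
proof -
  have "integrable hl (\<lambda>x. nonlin p U j x * cnj (U j x))"
    using nonlin_L2(1)[OF U order_refl p] H1G_L2G(1)[OF U] j by (auto simp: L2G_def intro!: L2_hl_prod)
  then have "integrable hl (\<lambda>x. Re (nonlin p U j x * cnj (U j x)))" by (rule integrable_Re)
  moreover have "Re (nonlin p U j x * cnj (U j x)) = cmod (U j x) powr (2 * p + 2)" for x
  proof -
    have "nonlin p U j x * cnj (U j x) = complex_of_real (cmod (U j x) powr (2 * p)) * (U j x * cnj (U j x))"
      by (simp add: nonlin_def)
    also have "U j x * cnj (U j x) = complex_of_real ((cmod (U j x))\<^sup>2)" by (rule complex_norm_square[symmetric])
    finally show ?thesis by (cases "U j x = 0") (simp_all add: powr_add)
  qed
  ultimately show ?thesis by simp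
qed

lemma ipG_cmult_left: "ipG N (\<lambda>j x. a * U j x) V = a * ipG N U V"
  by (simp add: ipG_hl mult.assoc sum_distrib_left)

section \<open>The virial rate on symmetric states\<close>

context half_soliton begin

definition UU :: "nat \<Rightarrow> gfun" where "UU N j x = complex_of_real (cc N j * ph1 x)"
text \<open>\<open>YA\<close> and \<open>YB\<close> are what is left of the nonlinearity after the
  linear terms absorbed by L_+ \<phi>' = 0 and L_- \<phi> = 0, up to sign; see \<open>DF_UU\<close>
  and \<open>DF_halfsol\<close>. The explicit factors 1 and - 1 keep the shape in which
  \<open>L2G_lin\<close> and \<open>ipG_lin_left\<close> apply.\<close>

definition YA :: "gfun \<Rightarrow> gfun" where
  "YA Z j x = 1 * nonlin p Z j x + (- complex_of_real (2 * p + 1)) * (complex_of_real (S x) * Z j x)"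
definition YB :: "gfun \<Rightarrow> gfun" where
  "YB Z j x = 1 * (complex_of_real (S x) * Z j x) + (- 1) * nonlin p Z j x"
definition Rate :: "nat \<Rightarrow> gfun \<Rightarrow> real" where
  "Rate N Z = Re (ipG N (YA Z) (UU N) * cnj (ipG N Z (halfsol p)) + ipG N Z (UU N) * cnj (ipG N (YB Z) (halfsol p)))"

lemma UU_H1G: "N \<ge> 1 \<Longrightarrow> H1G N (UU N)"
  unfolding H1G_def UU_def[abs_def] using H1_of_real(1)[OF H1r_cmult[OF H1r_phis(2)]] by (simp add: ph1_0)

lemma S_mult_L2G: "L2G N Z \<Longrightarrow> L2G N (\<lambda>j x. complex_of_real (S x) * Z j x)"
  unfolding L2G_def
proof (intro allI impI)
  fix j assume Z: "\<forall>j<N. L2_hl (Z j)" and j: "j < N"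
  have f: "L2_hl (Z j)" using Z j by blast
  have mS: "S \<in> borel_measurable hl" by (intro hl_continuous_measurable cont)
  show "L2_hl (\<lambda>x. complex_of_real (S x) * Z j x)"
  proof (rule L2_hl_bound[OF L2_hl_cmod[OF f]])
    show "(\<lambda>x. complex_of_real (S x) * Z j x) \<in> borel_measurable hl" using f mS by (auto simp: L2_hl_iff)
    show "cmod (complex_of_real (S x) * Z j x) \<le> cmod (Z j x)" for x
      using S_bounds[of x] by (simp add: norm_mult mult_left_le_one_le)
  qed
qed

lemma YA_YB_L2G:
  assumes Z: "H1G N Z" shows "L2G N (YA Z)" "L2G N (YB Z)"
proof -
  have L: "L2G N (nonlin p Z)" by (rule nonlin_L2(1)[OF Z order_refl p_pos(1)])
  note S = S_mult_L2G[OF H1G_L2G(1)[OF Z]]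
  show "L2G N (YA Z)" unfolding YA_def[abs_def] by (rule L2G_lin[OF L S])
  show "L2G N (YB Z)" unfolding YB_def[abs_def] by (rule L2G_lin[OF S L])
qed

text \<open>Every product pairs one factor with the conjugate of another, so a common phase cancels.
  The state may therefore be rotated before it is compared with \<Phi>.\<close>

lemma Rate_phase:
  assumes g: "cmod \<gamma> = 1"
  shows "Rate N (\<lambda>j x. \<gamma> * Z j x) = Rate N Z"
proof -
  have nl: "nonlin p (\<lambda>j x. \<gamma> * Z j x) j x = \<gamma> * nonlin p Z j x" for j x
    using g by (simp add: nonlin_def norm_mult)
  have YA: "YA (\<lambda>j x. \<gamma> * Z j x) = (\<lambda>j x. \<gamma> * YA Z j x)"
    by (intro ext) (simp add: YA_def nl algebra_simps)
  have YB: "YB (\<lambda>j x. \<gamma> * Z j x) = (\<lambda>j x. \<gamma> * YB Z j x)"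
    by (intro ext) (simp add: YB_def nl algebra_simps)
  have gg: "\<gamma> * cnj \<gamma> = 1" using g complex_norm_square[of \<gamma>] by simp
  have e: "(\<gamma> * a) * cnj (\<gamma> * b) = a * cnj b" for a b
  proof -
    have "(\<gamma> * a) * cnj (\<gamma> * b) = (\<gamma> * cnj \<gamma>) * (a * cnj b)" by simp
    then show ?thesis by (simp only: gg mult_1)
  qed
  show ?thesis unfolding Rate_def YA YB ipG_cmult_left e ..
qed

lemma ipG_edges:
  assumes N: "N \<ge> 2" and sym: "\<forall>j x. 1 \<le> j \<and> j < N \<and> 0 \<le> x \<longrightarrow> F j x = F 1 x"
  shows "ipG N F (UU N) = complex_of_real (real N - 1) * ((\<integral>x. F 1 x * complex_of_real (ph1 x) \<partial>hl) - (\<integral>x. F 0 x * complex_of_real (ph1 x) \<partial>hl))"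
    "ipG N F (halfsol p) = (\<integral>x. F 0 x * complex_of_real (phi p x) \<partial>hl) + complex_of_real (real N - 1) * (\<integral>x. F 1 x * complex_of_real (phi p x) \<partial>hl)"
proof -
  have c: "(\<integral>x. F j x * w x \<partial>hl) = (\<integral>x. F 1 x * w x \<partial>hl)" if "1 \<le> j" "j < N" for j and w :: "real \<Rightarrow> complex"
  proof (rule Bochner_Integration.integral_cong)
    fix x assume "x \<in> space hl"
    then have "F j x = F 1 x" using sym that by (metis atLeast_iff space_hl)
    then show "F j x * w x = F 1 x * w x" by (rule arg_cong)
  qed simp
  have "ipG N F (UU N) = (\<Sum>j<N. complex_of_real (cc N j) * (\<integral>x. F j x * complex_of_real (ph1 x) \<partial>hl))"
    unfolding ipG_hl UU_def
    by (intro sum.cong refl, subst integral_mult_right_zero[symmetric]) (simp add: mult_ac)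
  also have "\<dots> = complex_of_real (cc N 0) * (\<integral>x. F 0 x * complex_of_real (ph1 x) \<partial>hl) + (real N - 1) *\<^sub>R (complex_of_real (cc N 1) * (\<integral>x. F 1 x * complex_of_real (ph1 x) \<partial>hl))"
  proof (rule sum_edges[OF N])
    fix j :: nat assume a: "1 \<le> j" "j < N"
    show "complex_of_real (cc N j) * (\<integral>x. F j x * complex_of_real (ph1 x) \<partial>hl) = complex_of_real (cc N 1) * (\<integral>x. F 1 x * complex_of_real (ph1 x) \<partial>hl)"
      unfolding c[OF a] using a by (simp add: cc_def)
  qed
  also have "\<dots> = complex_of_real (real N - 1) * ((\<integral>x. F 1 x * complex_of_real (ph1 x) \<partial>hl) - (\<integral>x. F 0 x * complex_of_real (ph1 x) \<partial>hl))"
    by (simp add: cc_def scaleR_conv_of_real algebra_simps)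
  finally show "ipG N F (UU N) = \<dots>" .
  have "ipG N F (halfsol p) = (\<Sum>j<N. \<integral>x. F j x * complex_of_real (phi p x) \<partial>hl)"
    by (simp add: ipG_hl halfsol_def)
  also have "\<dots> = (\<integral>x. F 0 x * complex_of_real (phi p x) \<partial>hl) + (real N - 1) *\<^sub>R (\<integral>x. F 1 x * complex_of_real (phi p x) \<partial>hl)"
    by (rule sum_edges[OF N]) (rule c)
  finally show "ipG N F (halfsol p) = (\<integral>x. F 0 x * complex_of_real (phi p x) \<partial>hl) + complex_of_real (real N - 1) * (\<integral>x. F 1 x * complex_of_real (phi p x) \<partial>hl)"
    by (simp add: scaleR_conv_of_real)
qed

definition Zf :: "gfun \<Rightarrow> gfun" where "Zf W = (\<lambda>j x. halfsol p j x + W j x)"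

context
  fixes N :: nat and W :: gfun
  assumes N3: "N \<ge> 3" and W: "H1G N W"
    and sym: "\<forall>j x. 1 \<le> j \<and> j < N \<and> 0 \<le> x \<longrightarrow> W j x = W 1 x"
begin

lemma Zf_H1G: "H1G N (Zf W)" unfolding Zf_def using H1G_add[OF halfsol_H1G W] N3 by simp

lemma Zf_sym: "\<forall>j x. 1 \<le> j \<and> j < N \<and> 0 \<le> x \<longrightarrow> (Zf W) j x = (Zf W) 1 x"
  unfolding Zf_def halfsol_def using sym by metis

lemma Zf_parts: "Re ((Zf W) j x) = phi p x + Re (W j x)" "Im ((Zf W) j x) = Im (W j x)"
  by (simp_all add: Zf_def halfsol_def)

lemma cmod_Zf: "cmod ((Zf W) j x) powr (2 * q) = ((phi p x + Re (W j x))\<^sup>2 + (Im (W j x))\<^sup>2) powr q"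
  unfolding cmod_powr_double Zf_parts ..

lemma YA_parts:
  "Re (YA (Zf W) j x) = A_of (\<lambda>x. Re (W j x)) (\<lambda>x. Im (W j x)) x * (phi p x + Re (W j x)) - (2 * p + 1) * (S x * (phi p x + Re (W j x)))"
  "Im (YA (Zf W) j x) = A_of (\<lambda>x. Re (W j x)) (\<lambda>x. Im (W j x)) x * Im (W j x) - (2 * p + 1) * (S x * Im (W j x))"
  "Re (YB (Zf W) j x) = S x * (phi p x + Re (W j x)) - A_of (\<lambda>x. Re (W j x)) (\<lambda>x. Im (W j x)) x * (phi p x + Re (W j x))"
  "Im (YB (Zf W) j x) = S x * Im (W j x) - A_of (\<lambda>x. Re (W j x)) (\<lambda>x. Im (W j x)) x * Im (W j x)"
  unfolding YA_def YB_def nonlin_def A_of_def cmod_Zf by (simp_all add: Zf_parts algebra_simps)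

lemma Rate_Bfun:
  "Rate N (Zf W) = Bfun (real N - 1) (\<lambda>x. Re (W 0 x)) (\<lambda>x. Im (W 0 x)) (\<lambda>x. Re (W 1 x)) (\<lambda>x. Im (W 1 x))"
proof -
  have N2: "N \<ge> 2" and lt: "0 < N" "1 < N" using N3 by auto
  have L: "L2_hl (YA (Zf W) j)" "L2_hl (YB (Zf W) j)" "L2_hl ((Zf W) j)" if "j < N" for j
    using YA_YB_L2G[OF Zf_H1G] H1G_L2G(1)[OF Zf_H1G] that by (auto simp: L2G_def)
  have s1: "\<forall>j x. 1 \<le> j \<and> j < N \<and> 0 \<le> x \<longrightarrow> YA (Zf W) j x = YA (Zf W) 1 x" "\<forall>j x. 1 \<le> j \<and> j < N \<and> 0 \<le> x \<longrightarrow> YB (Zf W) j x = YB (Zf W) 1 x"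
    unfolding YA_def YB_def nonlin_def using Zf_sym by metis+
  note e = ipG_edges[OF N2, of "Zf W", OF Zf_sym] ipG_edges[OF N2, of "YA (Zf W)", OF s1(1)] ipG_edges[OF N2, of "YB (Zf W)", OF s1(2)]
  note cp = complex_real_pairing[OF L(1)[OF lt(1)] L2r_phis(2)] complex_real_pairing[OF L(1)[OF lt(2)] L2r_phis(2)]
    complex_real_pairing[OF L(2)[OF lt(1)] L2r_phis(1)] complex_real_pairing[OF L(2)[OF lt(2)] L2r_phis(1)]
    complex_real_pairing[OF L(3)[OF lt(1)] L2r_phis(1)] complex_real_pairing[OF L(3)[OF lt(2)] L2r_phis(1)]
    complex_real_pairing[OF L(3)[OF lt(1)] L2r_phis(2)] complex_real_pairing[OF L(3)[OF lt(2)] L2r_phis(2)]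
  have rm: "Re (complex_of_real r * (a - b) * cnj (c + complex_of_real r * d) + complex_of_real r * (e - f) * cnj (g + complex_of_real r * h))
    = r * (Re a - Re b) * (Re c + r * Re d) + r * (Im a - Im b) * (Im c + r * Im d)
    + r * (Re e - Re f) * (Re g + r * Re h) + r * (Im e - Im f) * (Im g + r * Im h)" for r a b c d e f g h
    by (simp add: algebra_simps)
  show ?thesis
    unfolding Rate_def e rm cp YA_parts Zf_parts Bfun_def I_e_def J_e_def R_e_def W_e_def ..
qed

lemma energy_edge:
  assumes j: "j < N"
  shows "(cn (hl_deriv ((Zf W) j)))\<^sup>2 - (\<integral>x. cmod ((Zf W) j x) powr (2 * p + 2) \<partial>hl)
     = E_e (\<lambda>x. Re (W j x)) (\<lambda>x. Re (hl_deriv (W j) x)) (\<lambda>x. Im (W j x)) (\<lambda>x. Im (hl_deriv (W j) x))"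
proof -
  note h = H1_hl_H1r[OF H1G_D(1)[OF W j]]
  have ae: "AE x in hl. hl_deriv ((Zf W) j) x = complex_of_real (ph1 x) + hl_deriv (W j) x"
  proof (rule H1r_H1_hl(2))
    show "H1r (\<lambda>x. Re ((Zf W) j x)) (\<lambda>x. Re (complex_of_real (ph1 x) + hl_deriv (W j) x))"
      unfolding Zf_parts using H1r_add[OF H1r_phis(1) h(1)] by simp
    show "H1r (\<lambda>x. Im ((Zf W) j x)) (\<lambda>x. Im (complex_of_real (ph1 x) + hl_deriv (W j) x))"
      unfolding Zf_parts using h(2) by simp
  qed
  have L: "L2_hl (hl_deriv ((Zf W) j))" by (rule H1_hl_H1r(4)[OF H1G_D(1)[OF Zf_H1G j]])
  have Lr: "L2r (\<lambda>x. ph1 x + Re (hl_deriv (W j) x))" "L2r (\<lambda>x. Im (hl_deriv (W j) x))"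
    using L2r_add[OF L2r_phis(2)] h(1,2) by (auto simp: H1r_def)
  have i: "integrable hl (\<lambda>x. (ph1 x + Re (hl_deriv (W j) x))\<^sup>2 + (Im (hl_deriv (W j) x))\<^sup>2)"
    by (intro Bochner_Integration.integrable_add L2r_sq Lr)
  have "(cn (hl_deriv ((Zf W) j)))\<^sup>2 = (\<integral>x. (ph1 x + Re (hl_deriv (W j) x))\<^sup>2 + (Im (hl_deriv (W j) x))\<^sup>2 \<partial>hl)"
    unfolding cn_sq
  proof (rule integral_cong_AE)
    show "(\<lambda>x. (cmod (hl_deriv ((Zf W) j) x))\<^sup>2) \<in> borel_measurable hl" using L by (auto simp: L2_hl_iff)
    show "AE x in hl. (cmod (hl_deriv ((Zf W) j) x))\<^sup>2 = (ph1 x + Re (hl_deriv (W j) x))\<^sup>2 + (Im (hl_deriv (W j) x))\<^sup>2"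
      using ae by eventually_elim (simp add: cmod_power2)
  qed (use i in blast)
  moreover have "cmod ((Zf W) j x) powr (2 * p + 2) = ((phi p x + Re (W j x))\<^sup>2 + (Im (W j x))\<^sup>2) powr (p + 1)" for x
    using cmod_Zf[of j x "p + 1"] by (simp add: algebra_simps)
  moreover have "integrable hl (\<lambda>x. cmod ((Zf W) j x) powr (2 * p + 2))" by (rule integrable_cmod_powr[OF Zf_H1G p_pos(1) j])
  ultimately show ?thesis unfolding E_e_def using i by simp
qed

lemma mass_edge:
  assumes j: "j < N"
  shows "(cn ((Zf W) j))\<^sup>2 = M_e (\<lambda>x. Re (W j x)) (\<lambda>x. Im (W j x))"
  unfolding cn_sq M_e_def cmod_power2 Zf_parts ..

lemma edge_cong:
  assumes "1 \<le> j" "j < N"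
  shows "hl_deriv (W j) = hl_deriv (W 1)" "M_e (\<lambda>x. Re (W j x)) (\<lambda>x. Im (W j x)) = M_e (\<lambda>x. Re (W 1 x)) (\<lambda>x. Im (W 1 x))"
    "E_e (\<lambda>x. Re (W j x)) u' (\<lambda>x. Im (W j x)) v' = E_e (\<lambda>x. Re (W 1 x)) u' (\<lambda>x. Im (W 1 x)) v'"
    "h2 (\<lambda>x. Re (W j x)) u' = h2 (\<lambda>x. Re (W 1 x)) u'" "h2 (\<lambda>x. Im (W j x)) u' = h2 (\<lambda>x. Im (W 1 x)) u'"
proof -
  have Wj: "W j x = W 1 x" if "x \<ge> 0" for x using sym assms that by blast
  show "hl_deriv (W j) = hl_deriv (W 1)" by (rule hl_deriv_cong) (use sym assms in blast)
  have c: "(\<integral>x. g x (W j x) \<partial>hl) = (\<integral>x. g x (W 1 x) \<partial>hl)" for g :: "real \<Rightarrow> complex \<Rightarrow> real"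
    by (rule Bochner_Integration.integral_cong) (simp_all add: Wj)
  show "M_e (\<lambda>x. Re (W j x)) (\<lambda>x. Im (W j x)) = M_e (\<lambda>x. Re (W 1 x)) (\<lambda>x. Im (W 1 x))"
    unfolding M_e_def by (rule c)
  show "E_e (\<lambda>x. Re (W j x)) u' (\<lambda>x. Im (W j x)) v' = E_e (\<lambda>x. Re (W 1 x)) u' (\<lambda>x. Im (W 1 x)) v'"
    unfolding E_e_def by (rule c)
  show "h2 (\<lambda>x. Re (W j x)) u' = h2 (\<lambda>x. Re (W 1 x)) u'" unfolding h2_def by (subst c) (rule refl)
  show "h2 (\<lambda>x. Im (W j x)) u' = h2 (\<lambda>x. Im (W 1 x)) u'" unfolding h2_def by (subst c) (rule refl)
qed

lemma edge_sums:
  defines "u \<equiv> \<lambda>j x. Re (W j x)" and "u' \<equiv> \<lambda>j x. Re (hl_deriv (W j) x)" and "v \<equiv> \<lambda>j x. Im (W j x)" and "v' \<equiv> \<lambda>j x. Im (hl_deriv (W j) x)"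
  shows "(H1norm N W)\<^sup>2 = h2 (u 0) (u' 0) + h2 (v 0) (v' 0) + (real N - 1) * (h2 (u 1) (u' 1) + h2 (v 1) (v' 1))"
    "(L2norm N (Zf W))\<^sup>2 = M_e (u 0) (v 0) + (real N - 1) * M_e (u 1) (v 1)"
    "(L2norm N (\<lambda>j. hl_deriv ((Zf W) j)))\<^sup>2 - Pot N p (Zf W) = E_e (u 0) (u' 0) (v 0) (v' 0) + (real N - 1) * E_e (u 1) (u' 1) (v 1) (v' 1)"
proof -
  have N2: "N \<ge> 2" using N3 by simp
  have ec: "h2 (u j) (u' j) + h2 (v j) (v' j) = h2 (u 1) (u' 1) + h2 (v 1) (v' 1)" "M_e (u j) (v j) = M_e (u 1) (v 1)"
    "E_e (u j) (u' j) (v j) (v' j) = E_e (u 1) (u' 1) (v 1) (v' 1)" if "1 \<le> j" "j < N" for j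
    unfolding u_def u'_def v_def v'_def by (simp_all only: edge_cong[OF that])
  have "(H1norm N W)\<^sup>2 = (\<Sum>j<N. h2 (u j) (u' j) + h2 (v j) (v' j))" unfolding H1norm_h2[OF W] u_def u'_def v_def v'_def ..
  also have "\<dots> = (h2 (u 0) (u' 0) + h2 (v 0) (v' 0)) + (real N - 1) *\<^sub>R (h2 (u 1) (u' 1) + h2 (v 1) (v' 1))"
    by (rule sum_edges[OF N2]) (rule ec(1))
  finally show "(H1norm N W)\<^sup>2 = h2 (u 0) (u' 0) + h2 (v 0) (v' 0) + (real N - 1) * (h2 (u 1) (u' 1) + h2 (v 1) (v' 1))" by simp
  have "(L2norm N (Zf W))\<^sup>2 = (\<Sum>j<N. M_e (u j) (v j))" unfolding L2norm_sq u_def v_def by (intro sum.cong refl mass_edge) simp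
  also have "\<dots> = M_e (u 0) (v 0) + (real N - 1) *\<^sub>R M_e (u 1) (v 1)"
    by (rule sum_edges[OF N2]) (rule ec(2))
  finally show "(L2norm N (Zf W))\<^sup>2 = M_e (u 0) (v 0) + (real N - 1) * M_e (u 1) (v 1)" by simp
  have "(L2norm N (\<lambda>j. hl_deriv ((Zf W) j)))\<^sup>2 - Pot N p (Zf W) = (\<Sum>j<N. (cn (hl_deriv ((Zf W) j)))\<^sup>2 - (\<integral>x. cmod ((Zf W) j x) powr (2 * p + 2) \<partial>hl))"
    unfolding L2norm_sq Pot_def sum_subtractf ..
  also have "\<dots> = (\<Sum>j<N. E_e (u j) (u' j) (v j) (v' j))" unfolding u_def u'_def v_def v'_def by (intro sum.cong refl energy_edge) simp
  also have "\<dots> = E_e (u 0) (u' 0) (v 0) (v' 0) + (real N - 1) *\<^sub>R E_e (u 1) (u' 1) (v 1) (v' 1)"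
    by (rule sum_edges[OF N2]) (rule ec(3))
  finally show "(L2norm N (\<lambda>j. hl_deriv ((Zf W) j)))\<^sup>2 - Pot N p (Zf W) = E_e (u 0) (u' 0) (v 0) (v' 0) + (real N - 1) * E_e (u 1) (u' 1) (v 1) (v' 1)" by simp
qed

end

text \<open>\<open>trap\<close> carried over to functions on the graph. The gauge condition on W at
  edge 0 and continuity at the vertex make both imaginary parts vanish there, as
  \<open>qm_coercive\<close> requires.\<close>

lemma trap_field:
  assumes N: "N \<ge> 3"
  obtains \<epsilon> k where "\<epsilon> > 0" "k > 0"
    "\<And>W \<eta>. \<lbrakk>H1G N W; \<forall>j x. 1 \<le> j \<and> j < N \<and> 0 \<le> x \<longrightarrow> W j x = W 1 x; Im (W 0 0) = 0; H1norm N W \<le> \<epsilon>;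
       (L2norm N (\<lambda>j x. halfsol p j x + W j x))\<^sup>2 = real N * m0;
       (L2norm N (\<lambda>j. hl_deriv (\<lambda>x. halfsol p j x + W j x)))\<^sup>2 - Pot N p (\<lambda>j x. halfsol p j x + W j x) = real N * E0 - \<eta>; 0 \<le> \<eta>\<rbrakk>
      \<Longrightarrow> Rate N (\<lambda>j x. halfsol p j x + W j x) \<ge> k * \<eta>"
proof -
  define n where "n = real N - 1"
  have n: "n \<ge> 2" using N by (simp add: n_def)
  have nN: "real N = n + 1" by (simp add: n_def)
  obtain \<epsilon> k where ek: "\<epsilon> > 0" "k > 0" and tr:
    "\<And>u0 u0' v0 v0' u1 u1' v1 v1' \<eta>. \<lbrakk>H1r u0 u0'; H1r v0 v0'; H1r u1 u1'; H1r v1 v1'; u0 0 = u1 0; v0 0 = 0; v1 0 = 0;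
       h2 u0 u0' + h2 v0 v0' + n * (h2 u1 u1' + h2 v1 v1') \<le> \<epsilon>\<^sup>2;
       M_e u0 v0 + n * M_e u1 v1 = (n + 1) * m0;
       E_e u0 u0' v0 v0' + n * E_e u1 u1' v1 v1' = (n + 1) * E0 - \<eta>; 0 \<le> \<eta>\<rbrakk>
      \<Longrightarrow> Bfun n u0 v0 u1 v1 \<ge> k * \<eta>"
    by (rule trap[OF n]) (rule that)
  show thesis
  proof (rule that[OF ek])
    fix W \<eta>
    assume W: "H1G N W" and sym: "\<forall>j x. 1 \<le> j \<and> j < N \<and> 0 \<le> x \<longrightarrow> W j x = W 1 x" and im: "Im (W 0 0) = 0" and small: "H1norm N W \<le> \<epsilon>"
      and mass: "(L2norm N (\<lambda>j x. halfsol p j x + W j x))\<^sup>2 = real N * m0"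
      and en: "(L2norm N (\<lambda>j. hl_deriv (\<lambda>x. halfsol p j x + W j x)))\<^sup>2 - Pot N p (\<lambda>j x. halfsol p j x + W j x) = real N * E0 - \<eta>" and \<eta>: "0 \<le> \<eta>"
    have Z: "(\<lambda>j x. halfsol p j x + W j x) = Zf W" "\<And>j. (\<lambda>x. halfsol p j x + W j x) = Zf W j"
      by (simp_all add: Zf_def)
    note es = edge_sums[OF N W sym, folded n_def]
    have lt: "0 < N" "1 < N" using N by auto
    have w1: "W 1 0 = W 0 0" by (rule H1G_D(2)[OF W lt(2)])
    note h0 = H1_hl_H1r[OF H1G_D(1)[OF W lt(1)]] and h1 = H1_hl_H1r[OF H1G_D(1)[OF W lt(2)]]
    have "(H1norm N W)\<^sup>2 \<le> \<epsilon>\<^sup>2" using small H1norm_nonneg by (intro power_mono)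
    note sm = this[unfolded es(1)]
    have v0: "Re (W 0 0) = Re (W 1 0)" "Im (W 1 0) = 0" using w1 im by simp_all
    note M = mass[unfolded Z nN es(2)] and E = en[unfolded Z nN es(3)]
    show "k * \<eta> \<le> Rate N (\<lambda>j x. halfsol p j x + W j x)"
      unfolding Z Rate_Bfun[OF N W sym] n_def[symmetric]
      by (rule tr[OF h0(1,2) h1(1,2) v0(1) im v0(2) sm M E \<eta>])
  qed
qed

end

section \<open>The virial identity\<close>

text \<open>Integration by parts leaves the common vertex value of Z times the sum of the outgoing
  derivatives of w, so the last hypothesis is the Kirchhoff condition for w. It holds for
  \<open>UU\<close> because the weights sum to zero, and for \<Phi> because \<phi>' vanishes at the
  vertex.\<close>

lemma gradG_real:
  assumes Z: "H1G N Z" and w: "\<And>j x. w j x = complex_of_real (a j * g x)" and g: "H1r g g'" and H: "H1r g' g''"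
    and bd: "(\<Sum>j<N. a j) * g' 0 = 0"
  shows "gradG N Z w = - (\<Sum>j<N. complex_of_real (a j) * (\<integral>x. Z j x * complex_of_real (g'' x) \<partial>hl))"
proof -
  have e: "(\<integral>x. hl_deriv (Z j) x * cnj (hl_deriv (w j) x) \<partial>hl)
     = - (complex_of_real (a j) * (\<integral>x. Z j x * complex_of_real (g'' x) \<partial>hl)) - Z 0 0 * complex_of_real (a j * g' 0)" if j: "j < N" for j
  proof -
    have wj: "w j = (\<lambda>x. complex_of_real (a j * g x))" by (rule ext) (rule w)
    have hw: "H1r (\<lambda>x. a j * g x) (\<lambda>x. a j * g' x)" by (rule H1r_cmult[OF g])
    note d = H1_of_real(2)[OF hw] and Hw = H1_of_real(1)[OF hw]
    have "L2r (\<lambda>x. a j * g' x)" using hw by (simp add: H1r_def)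
    note L = H1_hl_H1r(4)[OF H1G_D(1)[OF Z j]] H1_hl_H1r(4)[OF Hw, folded wj] L2_hl_of_real[OF this]
    have "(\<integral>x. hl_deriv (Z j) x * cnj (hl_deriv (w j) x) \<partial>hl) = (\<integral>x. hl_deriv (Z j) x * complex_of_real (a j * g' x) \<partial>hl)"
    proof (rule integral_cong_AE)
      show "(\<lambda>x. hl_deriv (Z j) x * cnj (hl_deriv (w j) x)) \<in> borel_measurable hl"
        using L2_hl_prod(1)[OF L(1,2)] by (rule borel_measurable_integrable)
      show "(\<lambda>x. hl_deriv (Z j) x * complex_of_real (a j * g' x)) \<in> borel_measurable hl"
        using L2_hl_prod(1)[OF L(1,3)] by (simp add: borel_measurable_integrable)
      show "AE x in hl. hl_deriv (Z j) x * cnj (hl_deriv (w j) x) = hl_deriv (Z j) x * complex_of_real (a j * g' x)"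
        using d unfolding wj by eventually_elim simp
    qed
    also have "\<dots> = - (\<integral>x. Z j x * complex_of_real (a j * g'' x) \<partial>hl) - Z j 0 * complex_of_real (a j * g' 0)"
      by (rule H1_hl_by_parts[OF H1G_D(1)[OF Z j] H1r_cmult[OF H]])
    also have "(\<integral>x. Z j x * complex_of_real (a j * g'' x) \<partial>hl) = complex_of_real (a j) * (\<integral>x. Z j x * complex_of_real (g'' x) \<partial>hl)"
      by (subst integral_mult_right_zero[symmetric]) (simp add: mult_ac)
    also have "Z j 0 = Z 0 0" by (rule H1G_D(2)[OF Z j])
    finally show ?thesis .
  qed
  have "gradG N Z w = (\<Sum>j<N. \<integral>x. hl_deriv (Z j) x * cnj (hl_deriv (w j) x) \<partial>hl)"
    unfolding gradG_def hl_integral_eq ..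
  also have "\<dots> = (\<Sum>j<N. - (complex_of_real (a j) * (\<integral>x. Z j x * complex_of_real (g'' x) \<partial>hl)) - Z 0 0 * complex_of_real (a j * g' 0))"
    by (rule sum.cong[OF refl]) (rule e, simp)
  also have "\<dots> = - (\<Sum>j<N. complex_of_real (a j) * (\<integral>x. Z j x * complex_of_real (g'' x) \<partial>hl)) - Z 0 0 * complex_of_real ((\<Sum>j<N. a j) * g' 0)"
    by (simp add: sum_subtractf sum_negf sum_distrib_left sum_distrib_right)
  finally show ?thesis using bd by simp
qed

context half_soliton begin

lemma ipG_S_split:
  assumes Z: "L2G N Z" and w: "\<And>j x. w j x = complex_of_real (a j * g x)" and L: "L2r g"
  shows "(\<Sum>j<N. complex_of_real (a j) * (\<integral>x. Z j x * complex_of_real ((1 - b * S x) * g x) \<partial>hl))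
     = ipG N Z w - complex_of_real b * ipG N (\<lambda>j x. complex_of_real (S x) * Z j x) w"
proof -
  have SZ: "L2G N (\<lambda>j x. complex_of_real (S x) * Z j x)" by (rule S_mult_L2G[OF Z])
  have "complex_of_real (a j) * (\<integral>x. Z j x * complex_of_real ((1 - b * S x) * g x) \<partial>hl)
     = (\<integral>x. Z j x * cnj (w j x) \<partial>hl) - complex_of_real b * (\<integral>x. (complex_of_real (S x) * Z j x) * cnj (w j x) \<partial>hl)" if j: "j < N" for j
  proof -
    have wL: "L2_hl (w j)"
    proof -
      have "L2r (\<lambda>x. a j * g x)" by (rule L2r_cmult[OF L])
      then have "L2_hl (\<lambda>x. complex_of_real (a j * g x))" by (rule L2_hl_of_real)
      then show ?thesis by (simp only: w[symmetric])
    qed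
    have i: "integrable hl (\<lambda>x. Z j x * cnj (w j x))" "integrable hl (\<lambda>x. (complex_of_real (S x) * Z j x) * cnj (w j x))"
      using Z SZ j wL by (auto simp: L2G_def intro!: L2_hl_prod(1))
    have "complex_of_real (a j) * (\<integral>x. Z j x * complex_of_real ((1 - b * S x) * g x) \<partial>hl)
       = (\<integral>x. complex_of_real (a j) * (Z j x * complex_of_real ((1 - b * S x) * g x)) \<partial>hl)" by simp
    also have "\<dots> = (\<integral>x. Z j x * cnj (w j x) - complex_of_real b * ((complex_of_real (S x) * Z j x) * cnj (w j x)) \<partial>hl)"
      by (rule Bochner_Integration.integral_cong) (simp_all add: w algebra_simps)
    also have "\<dots> = (\<integral>x. Z j x * cnj (w j x) \<partial>hl) - complex_of_real b * (\<integral>x. (complex_of_real (S x) * Z j x) * cnj (w j x) \<partial>hl)"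
      by (simp only: Bochner_Integration.integral_diff[OF i(1) integrable_mult_right[OF i(2)]] integral_mult_right_zero)
    finally show ?thesis .
  qed
  then show ?thesis unfolding ipG_hl by (simp add: sum_subtractf sum_distrib_left)
qed

end

locale half_soliton_flow = half_soliton p + nls_solution N p \<Psi>
  for p :: real and N :: nat and \<Psi> :: "real \<Rightarrow> gfun" +
  assumes N3: "N \<ge> 3"
begin

lemma N1: "N \<ge> 1" using N3 by simp

lemmas UH = UU_H1G[OF N1] and PH = halfsol_H1G[OF N1]

lemma SL: "L2G N (\<lambda>j x. complex_of_real (S x) * \<Psi> t j x)" by (rule S_mult_L2G[OF LG])

lemma sum_cc: "(\<Sum>j<N. cc N j) = 0"
  using sum_edges[of N "cc N"] N3 by (simp add: cc_def)

lemma ipG_YA: "ipG N (YA (\<Psi> t)) W = ipG N (nonlin p (\<Psi> t)) W - complex_of_real (2 * p + 1) * ipG N (\<lambda>j x. complex_of_real (S x) * \<Psi> t j x) W"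
  if "L2G N W"
  unfolding YA_def[abs_def] ipG_lin_left[OF nlL SL that] by (simp add: algebra_simps)

lemma ipG_YB: "ipG N (YB (\<Psi> t)) W = ipG N (\<lambda>j x. complex_of_real (S x) * \<Psi> t j x) W - ipG N (nonlin p (\<Psi> t)) W"
  if "L2G N W"
  unfolding YB_def[abs_def] ipG_lin_left[OF SL nlL that] by simp

lemma DF_UU: "DF t (UU N) = \<i> * ipG N (\<Psi> t) (UU N) + \<i> * complex_of_real (p + 1) * ipG N (YA (\<Psi> t)) (UU N)"
proof -
  have "gradG N (\<Psi> t) (UU N) = - (\<Sum>j<N. complex_of_real (cc N j) * (\<integral>x. \<Psi> t j x * complex_of_real (ph3 x) \<partial>hl))"
    by (rule gradG_real[OF HG _ H1r_phis(2,3)]) (simp_all add: UU_def sum_cc)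
  also have "\<dots> = - (ipG N (\<Psi> t) (UU N) - complex_of_real ((p + 1) * (2 * p + 1)) * ipG N (\<lambda>j x. complex_of_real (S x) * \<Psi> t j x) (UU N))"
    unfolding ph3_def Vp_def by (subst ipG_S_split[OF LG, of "UU N"]) (auto simp: UU_def L2r_phis)
  finally have g: "gradG N (\<Psi> t) (UU N) = \<dots>" .
  show ?thesis
    unfolding DF_def ipG_YA[OF H1G_L2G(1)[OF UH]] g by (simp add: algebra_simps)
qed

lemma DF_halfsol: "DF t (halfsol p) = \<i> * ipG N (\<Psi> t) (halfsol p) - \<i> * complex_of_real (p + 1) * ipG N (YB (\<Psi> t)) (halfsol p)"
proof -
  have "gradG N (\<Psi> t) (halfsol p) = - (\<Sum>j<N. complex_of_real 1 * (\<integral>x. \<Psi> t j x * complex_of_real (ph2 x) \<partial>hl))"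
    by (rule gradG_real[OF HG _ H1r_phis(1,2)]) (simp_all add: halfsol_def ph1_0)
  also have "\<dots> = - (\<Sum>j<N. complex_of_real 1 * (\<integral>x. \<Psi> t j x * complex_of_real ((1 - (p + 1) * S x) * phi p x) \<partial>hl))"
    unfolding ph2_def by (simp only: mult.commute[of "phi p _"])
  also have "\<dots> = - (ipG N (\<Psi> t) (halfsol p) - complex_of_real (p + 1) * ipG N (\<lambda>j x. complex_of_real (S x) * \<Psi> t j x) (halfsol p))"
    by (subst ipG_S_split[OF LG, of "halfsol p"]) (auto simp: halfsol_def L2r_phis)
  finally have g: "gradG N (\<Psi> t) (halfsol p) = \<dots>" .
  show ?thesis
    unfolding DF_def ipG_YB[OF H1G_L2G(1)[OF PH]] g by (simp add: algebra_simps)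
qed

text \<open>The functional A of the overview. A common phase rotation leaves it unchanged, so the
  first terms of \<open>DF_UU\<close> and \<open>DF_halfsol\<close>, which rotate both pairings
  alike, drop out of its derivative.\<close>

definition virial :: "real \<Rightarrow> real" where
  "virial t = Im (ipG N (\<Psi> t) (UU N) * cnj (ipG N (\<Psi> t) (halfsol p)))"

lemma virial_deriv: "(virial has_real_derivative (p + 1) * Rate N (\<Psi> t)) (at t)"
proof -
  let ?X = "\<lambda>t. ipG N (\<Psi> t) (UU N)" and ?Y = "\<lambda>t. ipG N (\<Psi> t) (halfsol p)"
  note dX = DERIV_of_complex[OF ip_deriv[OF UH, of t]] and dY = DERIV_of_complex[OF ip_deriv[OF PH, of t]]
  have v: "virial = (\<lambda>t. Im (?X t) * Re (?Y t) - Re (?X t) * Im (?Y t))"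
    by (rule ext) (simp add: virial_def)
  have "((\<lambda>t. Im (?X t) * Re (?Y t) - Re (?X t) * Im (?Y t)) has_real_derivative
     (Im (DF t (UU N)) * Re (?Y t) + Re (DF t (halfsol p)) * Im (?X t)) - (Re (DF t (UU N)) * Im (?Y t) + Im (DF t (halfsol p)) * Re (?X t))) (at t)"
    by (intro DERIV_diff DERIV_mult dX dY)
  then show ?thesis unfolding v
    by (rule back_subst[where P="\<lambda>D. (_ has_real_derivative D) (at t)"])
       (simp add: DF_UU DF_halfsol Rate_def algebra_simps)
qed

lemma virial_bounded: "\<bar>virial t\<bar> \<le> (L2norm N (\<Psi> 0))\<^sup>2 * (L2norm N (UU N) * L2norm N (halfsol p))"
proof -
  have "\<bar>virial t\<bar> \<le> cmod (ipG N (\<Psi> t) (UU N)) * cmod (ipG N (\<Psi> t) (halfsol p))"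
    unfolding virial_def by (rule order_trans[OF abs_Im_le_cmod]) (simp add: norm_mult)
  also have "\<dots> \<le> (L2norm N (\<Psi> t) * L2norm N (UU N)) * (L2norm N (\<Psi> t) * L2norm N (halfsol p))"
    by (intro mult_mono ipG_bound(1) LG H1G_L2G(1)[OF UH] H1G_L2G(1)[OF PH] mult_nonneg_nonneg L2norm_nonneg norm_ge_zero)
  also have "\<dots> = (L2norm N (\<Psi> t))\<^sup>2 * (L2norm N (UU N) * L2norm N (halfsol p))" by (simp add: power2_eq_square mult_ac)
  finally show ?thesis unfolding mass_conserved[of t] .
qed

lemma not_trapped:
  assumes r: "r > 0" shows "\<not> (\<forall>t>0. Rate N (\<Psi> t) \<ge> r)"
proof
  assume R: "\<forall>t>0. Rate N (\<Psi> t) \<ge> r"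
  define B where "B = (L2norm N (\<Psi> 0))\<^sup>2 * (L2norm N (UU N) * L2norm N (halfsol p))"
  have B: "\<bar>virial t\<bar> \<le> B" for t unfolding B_def by (rule virial_bounded)
  define q where "q = (p + 1) * r"
  have q: "q > 0" unfolding q_def using r by (simp add: add_pos_pos)
  \<comment> \<open>Long enough for growth at the rate q to exceed 2 B, the largest possible
    variation of the bounded functional.\<close>
  define s where "s = (2 * B + 1) / q"
  have B0: "B \<ge> 0" using B[of 0] by linarith
  have s: "s > 0" unfolding s_def using q B0 by (intro divide_pos_pos) auto
  have "\<exists>z>0. z < s \<and> virial s - virial 0 = (s - 0) * ((p + 1) * Rate N (\<Psi> z))"
    by (rule MVT2[OF s]) (rule virial_deriv)
  then obtain z where z: "z > 0" and e: "virial s - virial 0 = s * ((p + 1) * Rate N (\<Psi> z))" by auto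
  have "s * ((p + 1) * r) \<le> s * ((p + 1) * Rate N (\<Psi> z))"
    using s R z p_pos by (intro mult_left_mono) auto
  moreover have "s * ((p + 1) * r) = 2 * B + 1" unfolding q_def[symmetric] using q by (simp add: s_def)
  ultimately show False using e B[of s] B[of 0] by linarith
qed

text \<open>The transposition of the edges 1 and j fixes all other edges, and the data are invariant
  under it.\<close>

lemma edges_equal:
  assumes init: "\<And>j x. 1 \<le> j \<Longrightarrow> j < N \<Longrightarrow> x \<ge> 0 \<Longrightarrow> \<Psi> 0 j x = \<Psi> 0 1 x" and t: "t \<ge> 0"
    and j: "1 \<le> j" "j < N" and x: "x \<ge> 0"
  shows "\<Psi> t j x = \<Psi> t 1 x"
proof -
  define \<pi> where "\<pi> = Transposition.transpose 1 j"
  have inv: "involution N \<pi>" using N3 j by unfold_locales (auto simp: \<pi>_def Transposition.transpose_def)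
  have i0: "\<Psi> 0 (\<pi> i) y = \<Psi> 0 i y" if "i < N" "y \<ge> 0" for i y
    using init[OF j \<open>y \<ge> 0\<close>] by (auto simp: \<pi>_def Transposition.transpose_def)
  have "\<Psi> t (\<pi> 1) x = \<Psi> t 1 x" using N3 by (intro symmetry_preserved[OF inv i0 t _ x]) auto
  then show ?thesis by (simp add: \<pi>_def)
qed

end

section \<open>Choice of the phase and conclusion\<close>

context half_soliton begin

text \<open>The vertex value of Z lies within d of \<phi> 0 = 1, so rotating it to the positive real
  axis costs little: its modulus is at least 3/4, and the rotation differs from 1 by at most 2
  d/(3/4) \<le> 4 d. The vertex value takes the place of an orthogonality condition for the
  phase.\<close>

lemma gauge:
  assumes N: "N \<ge> 1" and Z: "H1G N Z" and d: "H1norm N (\<lambda>j x. Z j x - halfsol p j x) \<le> d" and d4: "d \<le> 1/4"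
  obtains \<omega> where "cmod \<omega> = 1" "Im (\<omega> * Z 0 0 - halfsol p 0 0) = 0"
    "H1norm N (\<lambda>j x. \<omega> * Z j x - halfsol p j x) \<le> (1 + 4 * H1norm N (halfsol p)) * d"
proof -
  note PH = halfsol_H1G[OF N]
  define X where "X = (\<lambda>j x. Z j x - halfsol p j x)"
  have X: "H1G N X" unfolding X_def by (rule H1G_diff[OF Z PH])
  define \<zeta> where "\<zeta> = Z 0 0"
  have "cmod (X 0 0) \<le> H1norm N X" using N by (intro H1norm_sup[OF X]) auto
  then have z1: "cmod (\<zeta> - 1) \<le> d" using d by (simp add: X_def \<zeta>_def halfsol_def phi_0)
  have zn: "\<bar>cmod \<zeta> - 1\<bar> \<le> d" using norm_triangle_ineq3[of \<zeta> 1] z1 by simp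
  then have z34: "cmod \<zeta> \<ge> 3/4" using d4 by linarith
  define \<omega> where "\<omega> = cnj \<zeta> / complex_of_real (cmod \<zeta>)"
  have "\<zeta> \<noteq> 0" using z34 by auto
  then have w: "cmod \<omega> = 1" by (simp add: \<omega>_def norm_divide)
  have wz: "\<omega> * \<zeta> = complex_of_real (cmod \<zeta>)"
  proof -
    have "cmod \<zeta> \<noteq> 0" using z34 by linarith
    moreover have "cnj \<zeta> * \<zeta> = complex_of_real (cmod \<zeta>) * complex_of_real (cmod \<zeta>)"
      using complex_norm_square[of \<zeta>] by (simp add: power2_eq_square mult.commute)
    ultimately show ?thesis by (simp add: \<omega>_def)
  qed
  have w1: "cmod (\<omega> - 1) \<le> 4 * d"
  proof -
    have nz: "cmod \<zeta> \<noteq> 0" using z34 by linarith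
    have "\<omega> - 1 = (cnj (\<zeta> - 1) + complex_of_real (1 - cmod \<zeta>)) / complex_of_real (cmod \<zeta>)"
      using nz by (simp add: \<omega>_def field_simps)
    then have "cmod (\<omega> - 1) = cmod (cnj (\<zeta> - 1) + complex_of_real (1 - cmod \<zeta>)) / cmod \<zeta>" by (simp only: norm_divide norm_of_real abs_norm_cancel)
    also have "\<dots> \<le> (2 * d) / (3/4)"
    proof (rule frac_le)
      have "cmod (cnj (\<zeta> - 1) + complex_of_real (1 - cmod \<zeta>)) \<le> cmod (\<zeta> - 1) + \<bar>1 - cmod \<zeta>\<bar>"
        using norm_triangle_ineq[of "cnj (\<zeta> - 1)" "complex_of_real (1 - cmod \<zeta>)"] by (simp only: complex_mod_cnj norm_of_real)
      then show "cmod (cnj (\<zeta> - 1) + complex_of_real (1 - cmod \<zeta>)) \<le> 2 * d" using z1 zn by linarith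
    qed (use z34 z1 norm_ge_zero[of "\<zeta> - 1"] in linarith)+
    also have "\<dots> \<le> 4 * d" using z1 order_trans[OF norm_ge_zero z1] by simp
    finally show ?thesis .
  qed
  show thesis
  proof (rule that[OF w])
    show "Im (\<omega> * Z 0 0 - halfsol p 0 0) = 0" using wz by (simp add: \<zeta>_def halfsol_def)
    have e: "(\<lambda>j x. \<omega> * Z j x - halfsol p j x) = (\<lambda>j x. \<omega> * X j x + (\<omega> - 1) * halfsol p j x)"
      by (intro ext) (simp add: X_def algebra_simps)
    have "H1norm N (\<lambda>j x. \<omega> * X j x + (\<omega> - 1) * halfsol p j x) \<le> H1norm N (\<lambda>j x. \<omega> * X j x) + H1norm N (\<lambda>j x. (\<omega> - 1) * halfsol p j x)"
      by (intro H1norm_add_le H1G_cmult X PH)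
    also have "\<dots> = H1norm N X + cmod (\<omega> - 1) * H1norm N (halfsol p)"
      unfolding H1norm_cmult[OF X] H1norm_cmult[OF PH] w by simp
    also have "\<dots> \<le> d + 4 * d * H1norm N (halfsol p)"
      using d w1 by (intro add_mono mult_right_mono H1norm_nonneg) (simp_all add: X_def)
    also have "\<dots> = (1 + 4 * H1norm N (halfsol p)) * d" by (simp add: algebra_simps)
    finally show "H1norm N (\<lambda>j x. \<omega> * Z j x - halfsol p j x) \<le> (1 + 4 * H1norm N (halfsol p)) * d" unfolding e .
  qed
qed

end

lemma phase_invariance:
  assumes Z: "H1G N Z" and g: "cmod \<gamma> = 1"
  shows "L2norm N (\<lambda>j x. \<gamma> * Z j x) = L2norm N Z" "Pot N p (\<lambda>j x. \<gamma> * Z j x) = Pot N p Z"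
    "(L2norm N (\<lambda>j. hl_deriv (\<lambda>x. \<gamma> * Z j x)))\<^sup>2 = (L2norm N (\<lambda>j. hl_deriv (Z j)))\<^sup>2"
proof -
  show l: "L2norm N (\<lambda>j x. \<gamma> * Z j x) = L2norm N Z" unfolding L2norm_def cn_sq using g by (simp add: norm_mult)
  show "Pot N p (\<lambda>j x. \<gamma> * Z j x) = Pot N p Z" unfolding Pot_def using g by (simp add: norm_mult)
  have "(H1norm N (\<lambda>j x. \<gamma> * Z j x))\<^sup>2 = (H1norm N Z)\<^sup>2" unfolding H1norm_cmult[OF Z] g by simp
  then show "(L2norm N (\<lambda>j. hl_deriv (\<lambda>x. \<gamma> * Z j x)))\<^sup>2 = (L2norm N (\<lambda>j. hl_deriv (Z j)))\<^sup>2"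
    unfolding H1norm_split l by simp
qed

theorem theorem2p3:
  fixes N :: nat and p :: real
  assumes "N \<ge> 3" and "1/2 \<le> p" and "p < 2"
  shows "\<exists>\<epsilon>>0. \<exists>\<delta>0>0. \<forall>\<delta>. 0 < \<delta> \<and> \<delta> < \<delta>0 \<longrightarrow>
           (\<exists>V. H1G N V \<and> H1norm N V \<le> \<delta> \<and>
              (\<forall>\<Psi>. nls_sol N p \<Psi> \<and>
                    (\<forall>j<N. \<forall>x\<ge>0. \<Psi> 0 j x = halfsol p j x + V j x) \<longrightarrow>
                 (\<exists>t0>0. (INF \<theta>::real. H1norm N (\<lambda>j x. exp (- \<i> * complex_of_real \<theta>) * \<Psi> t0 j x
                                                     - halfsol p j x)) > \<epsilon>)))"
proof -
  interpret half_soliton p using assms by unfold_locales auto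
  have N1: "N \<ge> 1" using assms(1) by simp
  obtain \<epsilon>0 k where \<epsilon>0: "\<epsilon>0 > 0" and k: "k > 0" and trap:
    "\<And>W \<eta>. \<lbrakk>H1G N W; \<forall>j x. 1 \<le> j \<and> j < N \<and> 0 \<le> x \<longrightarrow> W j x = W 1 x; Im (W 0 0) = 0; H1norm N W \<le> \<epsilon>0;
       (L2norm N (\<lambda>j x. halfsol p j x + W j x))\<^sup>2 = real N * m0;
       (L2norm N (\<lambda>j. hl_deriv (\<lambda>x. halfsol p j x + W j x)))\<^sup>2 - Pot N p (\<lambda>j x. halfsol p j x + W j x) = real N * E0 - \<eta>; 0 \<le> \<eta>\<rbrakk>
      \<Longrightarrow> Rate N (\<lambda>j x. halfsol p j x + W j x) \<ge> k * \<eta>"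
    by (rule trap_field[OF assms(1)]) (rule that)
  define C where "C = 1 + 4 * H1norm N (halfsol p)"
  have C: "C \<ge> 1" unfolding C_def using H1norm_nonneg[of N "halfsol p"] by simp
  \<comment> \<open>The infimum over \<theta> is only approached, so distances up to 2 \<epsilon>
    are allowed for. These must stay below the bound 1/4 of \<open>gauge\<close> and, after its loss
    C, below \<epsilon>0.\<close>
  define \<epsilon> where "\<epsilon> = min (1/8) (\<epsilon>0 / (2 * C))"
  have \<epsilon>: "\<epsilon> > 0" "2 * \<epsilon> \<le> 1/4" using \<epsilon>0 C by (auto simp: \<epsilon>_def)
  have "\<epsilon> \<le> \<epsilon>0 / (2 * C)" by (simp add: \<epsilon>_def)
  then have C\<epsilon>: "C * (2 * \<epsilon>) \<le> \<epsilon>0" using C by (simp add: field_simps)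
  show ?thesis
  proof (rule exI[of _ \<epsilon>], rule conjI[OF \<epsilon>(1)], rule exI[of _ 1], rule conjI[OF zero_less_one], intro allI impI)
    fix \<delta> :: real assume \<delta>: "0 < \<delta> \<and> \<delta> < 1"
    then have \<delta>0: "\<delta> > 0" by simp
    obtain V where V: "H1G N V" "H1norm N V \<le> \<delta>" and Vs: "\<And>j. 1 \<le> j \<Longrightarrow> V j = V 1"
      and Vm: "(L2norm N (\<lambda>j x. halfsol p j x + V j x))\<^sup>2 = real N * m0"
      and Ve: "(L2norm N (\<lambda>j. hl_deriv (\<lambda>x. halfsol p j x + V j x)))\<^sup>2 - Pot N p (\<lambda>j x. halfsol p j x + V j x) < real N * E0"
      by (rule initial_data[OF assms(1) \<delta>0]) (rule that)
    show "\<exists>V. H1G N V \<and> H1norm N V \<le> \<delta> \<and>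
              (\<forall>\<Psi>. nls_sol N p \<Psi> \<and> (\<forall>j<N. \<forall>x\<ge>0. \<Psi> 0 j x = halfsol p j x + V j x) \<longrightarrow>
                 (\<exists>t0>0. (INF \<theta>::real. H1norm N (\<lambda>j x. exp (- \<i> * complex_of_real \<theta>) * \<Psi> t0 j x - halfsol p j x)) > \<epsilon>))"
    proof (intro exI[of _ V] conjI V allI impI)
      fix \<Psi> assume a: "nls_sol N p \<Psi> \<and> (\<forall>j<N. \<forall>x\<ge>0. \<Psi> 0 j x = halfsol p j x + V j x)"
      then have init: "\<And>j x. j < N \<Longrightarrow> x \<ge> 0 \<Longrightarrow> \<Psi> 0 j x = halfsol p j x + V j x" by blast
      interpret half_soliton_flow p N \<Psi> by unfold_locales (use assms a in auto)
      \<comment> \<open>The energy defect of the data. It is positive and conserved, so k \<eta> is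
        a lower bound for the rate at all positive times while the solution stays near the
        orbit.\<close>
      define \<eta> where "\<eta> = real N * E0 - Energy 0"
      have dc: "hl_deriv (\<Psi> 0 j) = hl_deriv (\<lambda>x. halfsol p j x + V j x)" if "j < N" for j
        by (rule hl_deriv_cong) (rule init[OF that])
      have PC: "Pot N p (\<Psi> 0) = Pot N p (\<lambda>j x. halfsol p j x + V j x)" by (rule Pot_cong) (rule init)
      have LC: "L2norm N (\<Psi> 0) = L2norm N (\<lambda>j x. halfsol p j x + V j x)" by (rule L2norm_cong) (rule init)
      have "(\<Sum>j<N. (cn (hl_deriv (\<Psi> 0 j)))\<^sup>2) = (\<Sum>j<N. (cn (hl_deriv (\<lambda>x. halfsol p j x + V j x)))\<^sup>2)"
        by (rule sum.cong[OF refl]) (simp only: dc lessThan_iff)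
      then have \<eta>: "\<eta> > 0" unfolding \<eta>_def Energy_def PC using Ve unfolding L2norm_sq by simp
      have mass: "(L2norm N (\<Psi> t))\<^sup>2 = real N * m0" for t
        unfolding mass_conserved[of t] LC by (rule Vm)
      have sym0: "\<Psi> 0 j x = \<Psi> 0 1 x" if "1 \<le> j" "j < N" "x \<ge> 0" for j x
        using init[OF that(2,3)] init[of 1 x] Vs[OF that(1)] that assms(1) by (simp add: halfsol_def)
      show "\<exists>t0>0. (INF \<theta>::real. H1norm N (\<lambda>j x. exp (- \<i> * complex_of_real \<theta>) * \<Psi> t0 j x - halfsol p j x)) > \<epsilon>"
      proof (rule ccontr)
        assume far: "\<not> ?thesis"
        have near: "(INF \<theta>::real. H1norm N (\<lambda>j x. exp (- \<i> * complex_of_real \<theta>) * \<Psi> t j x - halfsol p j x)) < 2 * \<epsilon>" if "t > 0" for t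
        proof -
          have "\<not> \<epsilon> < (INF \<theta>::real. H1norm N (\<lambda>j x. exp (- \<i> * complex_of_real \<theta>) * \<Psi> t j x - halfsol p j x))"
            using far that by blast
          then show ?thesis using \<epsilon>(1) by linarith
        qed
        have "Rate N (\<Psi> t) \<ge> k * \<eta>" if t: "t > 0" for t
        proof -
          obtain \<theta> :: real where \<theta>: "H1norm N (\<lambda>j x. exp (- \<i> * complex_of_real \<theta>) * \<Psi> t j x - halfsol p j x) < 2 * \<epsilon>"
            using cInf_lessD[OF _ near[OF t]] by blast
          define e where "e = exp (- \<i> * complex_of_real \<theta>)"
          have e: "cmod e = 1" by (simp add: e_def norm_exp_eq_Re)
          obtain \<omega> where w: "cmod \<omega> = 1" and im: "Im (\<omega> * (e * \<Psi> t 0 0) - halfsol p 0 0) = 0"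
            and sm: "H1norm N (\<lambda>j x. \<omega> * (e * \<Psi> t j x) - halfsol p j x) \<le> C * (2 * \<epsilon>)"
            unfolding C_def by (rule gauge[OF N1 H1G_cmult[OF HG[of t], of e], of "2 * \<epsilon>"]) (use \<theta> \<epsilon>(2) in \<open>auto simp: e_def intro: less_imp_le\<close>)
          define \<gamma> where "\<gamma> = \<omega> * e"
          have g: "cmod \<gamma> = 1" by (simp add: \<gamma>_def norm_mult w e)
          define W where "W = (\<lambda>j x. \<gamma> * \<Psi> t j x - halfsol p j x)"
          have PW: "(\<lambda>j x. halfsol p j x + W j x) = (\<lambda>j x. \<gamma> * \<Psi> t j x)" "\<And>j. (\<lambda>x. halfsol p j x + W j x) = (\<lambda>x. \<gamma> * \<Psi> t j x)"
            by (simp_all add: W_def)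
          have Wsym: "\<forall>j x. 1 \<le> j \<and> j < N \<and> 0 \<le> x \<longrightarrow> W j x = W 1 x"
          proof (intro allI impI)
            fix j :: nat and x :: real assume "1 \<le> j \<and> j < N \<and> 0 \<le> x"
            then have "\<Psi> t j x = \<Psi> t 1 x" using t by (intro edges_equal[OF sym0]) auto
            then show "W j x = W 1 x" by (simp add: W_def halfsol_def)
          qed
          have En: "(L2norm N (\<lambda>j. hl_deriv (\<Psi> t j)))\<^sup>2 - Pot N p (\<Psi> t) = real N * E0 - \<eta>"
            using energy_conserved[of t] t by (simp add: \<eta>_def Energy_def)
          have "Rate N (\<lambda>j x. halfsol p j x + W j x) \<ge> k * \<eta>"
          proof (rule trap)
            show "H1G N W" unfolding W_def by (intro H1G_diff H1G_cmult HG PH)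
            show "Im (W 0 0) = 0" using im by (simp add: W_def \<gamma>_def mult.assoc)
            show "H1norm N W \<le> \<epsilon>0" using sm C\<epsilon> by (simp add: W_def \<gamma>_def mult.assoc)
            show "(L2norm N (\<lambda>j x. halfsol p j x + W j x))\<^sup>2 = real N * m0"
              unfolding PW phase_invariance(1)[OF HG g] by (rule mass)
            show "(L2norm N (\<lambda>j. hl_deriv (\<lambda>x. halfsol p j x + W j x)))\<^sup>2 - Pot N p (\<lambda>j x. halfsol p j x + W j x) = real N * E0 - \<eta>"
              unfolding PW phase_invariance(2,3)[OF HG g] by (rule En)
            show "0 \<le> \<eta>" using \<eta> by simp
          qed (rule Wsym)
          then show ?thesis unfolding PW Rate_phase[OF g] .
        qed
        then show False using not_trapped[of "k * \<eta>"] k \<eta> by simp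
      qed
    qed
  qed
qed

end
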